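(* Let $m>0$ and let $W=\int_{\mathbb R^2}dy\,g(y)\,\alpha^{(m)}_y(W(f))$ be such that $f\in\mathcal D(\mathbb R)$, $\int_{\mathbb R}\mathrm{Re}f=0$, $\int_{\mathbb R}\mathrm{Im}f\ne0$, and $g\in C_c(\mathbb R^2)$ is non-negative and not identically zero. Then $W\ne0$ and $\pi^\bullet_{0,\iota}\boldsymbol\phi^\bullet(W)=0$.
   Context: **Weyl algebra and net.** $\mathcal D(\mathbb R)$ is the space of complex-valued compactly supported smooth functions on $\mathbb R$ (as a real vector space); $\hat f(p)=(2\pi)^{-1/2}\int_{\mathbb R}e^{-ipx}f(x)\,dx$. $\mathfrak W$ is the Weyl C*-algebra generated by unitaries $W(f)$, $f\in\mathcal D(\mathbb R)$, with $W(f)W(g)=e^{-\frac i2\sigma(f,g)}W(f+g)$, $\sigma(f,g)=\mathrm{Im}\int_{\mathbb R}\overline fg$. For $m\ge0$ put $\omega_m(p)=\sqrt{p^2+m^2}$. The proper orthochronous Poincaré group of $\mathbb R^2$ acts on $\mathcal D(\mathbb R)$ by real-linear maps $\tau^{(m)}_{(\Lambda,x)}$ determined by: with $\tilde f(p)=\widehat{\mathrm{Re}f}(p)+i\omega_m(p)\widehat{\mathrm{Im}f}(p)$ and $x=(t,\boldsymbol x)$, $(\tau^{(m)}_{(\Lambda,x)}f)^{\sim}(p)=e^{i(t\omega_m(p)-\boldsymbol xp)}\tilde f(\Lambda^{-1}p)$, where $\Lambda^{-1}p$ is the spatial component of $\Lambda^{-1}(\omega_m(p),p)$. So space translations act by $f\mapsto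 f(\cdot-\boldsymbol x)$ and time translations by $(\tau^{(m)}_tf)\hat{\ }=[\cos(t\omega_m)+i\omega_m^{-1}\sin(t\omega_m)]\widehat{\mathrm{Re}f}+i[\cos(t\omega_m)+i\omega_m\sin(t\omega_m)]\widehat{\mathrm{Im}f}$. $\alpha^{(m)}_{(\Lambda,x)}(W(f))=W(\tau^{(m)}_{(\Lambda,x)}f)$; $\alpha^{(m)}_x$ denotes translations. For $m>0$ the vacuum state is $\omega^{(m)}(W(f))=e^{-\frac12\|f\|_m^2}$, $\|f\|_m^2=\frac12\int_{\mathbb R}dp\,|\omega_m^{-1/2}\widehat{\mathrm{Re}f}+i\omega_m^{1/2}\widehat{\mathrm{Im}f}|^2$, with GNS triple $(\pi^{(m)},\mathcal H^{(m)},\Omega^{(m)})$; $\pi^{(m)}$ is omitted in the notation. $O_I$ is the open double cone with base the bounded open interval $I$ of the time-zero line, and $\mathcal A^{(m)}(\Lambda O_I+x)=\{\pi^{(m)}(\alpha^{(m)}_{(\Lambda,x)}(W(f))):\mathrm{supp}f\subset I\}''$; $\mathcal A^{(m)}$ also denotes the norm closure of $\bigcup_O\mathcal A^{(m)}(O)$. $\alpha^{(m)}$ extends to $\mathcal A^{(m)}$. Dilations: $(\delta_\lambda f)(x)=\lambda^{-1}\mathrm{Re}f(\lambda^{-1}x)+i\,\mathrm{Im}f(\lambda^{-1}x)$; $\phi_\lambda$, $\lambda>0$, is the automorphism of $\mathcal A^{(m)}$, normal on local algebras, with $\phi_\lambda(W(f))=W(\delta_\lambda f)$, and $\boldsymbol\phi^\bullet(A)=(\lambda\mapsto\phi_\lambda(A))$.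 Integrals of operator functions are strong integrals. **Scaling limit.** $\underline{\mathcal A}^{(m)}(O)$ is the C*-algebra (pointwise operations, sup norm) of bounded functions $\lambda\in(0,\infty)\mapsto\underline A_\lambda\in\mathcal A^{(m)}(\lambda O)$ with $\sup_{\lambda>0}\|\alpha^{(m)}_{\lambda x}(\underline A_\lambda)-\underline A_\lambda\|\to0$ as $x\to0$; $\underline{\mathcal A}^{(m)}=\overline{\bigcup_O\underline{\mathcal A}^{(m)}(O)}$. For bounded $\lambda\mapsto A_\lambda\in\mathcal A^{(m)}(\lambda O)$, $h\in C_c(\mathbb R^2)$, $(\underline\alpha^{(m)}_hA)_\lambda=\int dx\,h(x)\alpha^{(m)}_{\lambda x}(A_\lambda)$. A scaling limit state $\underline\omega_{0,\iota}=\lim_\kappa\underline\omega_{\lambda_\kappa}$ is fixed, i.e. a weak* limit point as $\lambda\to0$, along a fixed net $\lambda_\kappa\to0$, of $\underline\omega_\lambda(\underline A)=\omega^{(m)}(\underline A_\lambda)$; with GNS triple $(\pi_{0,\iota},\mathcal H^{(m)}_{0,\iota},\Omega_{0,\iota})$, $\mathcal A^{(m)}_{0,\iota}(O)=\pi_{0,\iota}(\underline{\mathcal A}^{(m)}(O))''$. $\underline{\mathcal A}^{(m)\bullet}(O)$ is the C*-algebra of bounded functions $\lambda\mapsto A_\lambda\in\mathcal A^{(m)}(\lambda O)$ such that for all $\hat O\supset\overline O$, $\varepsilon>0$ there are $\underline A,\underline A'\in\underline{\mathcal A}^{(m)}(\hat O)$ with $\limsup_\kappa\|(A_{\lambda_\kappa}-\underline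 A_{\lambda_\kappa})\Omega^{(m)}\|+\|(A^*_{\lambda_\kappa}-\underline A'_{\lambda_\kappa})\Omega^{(m)}\|<\varepsilon$; $\underline{\mathcal A}^{(m)\bullet}=\overline{\bigcup_O\underline{\mathcal A}^{(m)\bullet}(O)}$. $\pi_{0,\iota}$ extends to a morphism $\pi^\bullet_{0,\iota}:\underline{\mathcal A}^{(m)\bullet}\to\mathcal A^{(m)}_{0,\iota}$, on local elements $\pi^\bullet_{0,\iota}(A)=\lim_{h\to\delta}\pi_{0,\iota}(\underline\alpha^{(m)}_hA)$ strongly ($h\ge0$ continuous, $\int h=1$, supports shrinking to $0$). For $W$ as in the claim one has $\boldsymbol\phi^\bullet(W)\in\underline{\mathcal A}^{(m)\bullet}$, so $\pi^\bullet_{0,\iota}\boldsymbol\phi^\bullet(W)$ is defined. *)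

theory Defs
  imports "HOL-Analysis.Analysis" "HOL-Library.Function_Algebras"
begin

section \<open>Complex Hilbert spaces and C*-algebras\<close>

class scaleC =
  fixes scaleC :: "complex \<Rightarrow> 'a \<Rightarrow> 'a" (infixr \<open>*\<^sub>C\<close> 75)

class star =
  fixes star :: "'a \<Rightarrow> 'a"

class complex_vector = real_vector + scaleC +
  assumes scaleC_add_right: "c *\<^sub>C (x + y) = c *\<^sub>C x + c *\<^sub>C y"
    and scaleC_add_left: "(c + d) *\<^sub>C x = c *\<^sub>C x + d *\<^sub>C x"
    and scaleC_scaleC: "c *\<^sub>C d *\<^sub>C x = (c * d) *\<^sub>C x"
    and scaleC_of_real: "complex_of_real r *\<^sub>C x = r *\<^sub>R x"

text \<open>The inner product is antilinear in its first argument.  Hilbert spaces are non-zero, so that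
  their bounded operators form a unital algebra with \<open>0 \<noteq> 1\<close>.\<close>

class complex_hilbert = banach + complex_vector +
  fixes cinner :: "'a \<Rightarrow> 'a \<Rightarrow> complex"
  assumes cinner_commute: "cinner x y = cnj (cinner y x)"
    and cinner_add_right: "cinner x (y + z) = cinner x y + cinner x z"
    and cinner_scaleC_right: "cinner x (c *\<^sub>C y) = c * cinner x y"
    and cinner_self: "cinner x x = complex_of_real ((norm x)\<^sup>2)"
    and ex_nonzero: "\<exists>x. x \<noteq> 0"

class cstar_algebra = real_normed_algebra_1 + banach + complex_vector + star +
  assumes mult_scaleC_left: "(c *\<^sub>C a) * b = c *\<^sub>C (a * b)"
    and mult_scaleC_right: "a * (c *\<^sub>C b) = c *\<^sub>C (a * b)"
    and norm_scaleC: "norm (c *\<^sub>C a) = cmod c * norm a"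
    and star_add: "star (a + b) = star a + star b"
    and star_scaleC: "star (c *\<^sub>C a) = cnj c *\<^sub>C star a"
    and star_mult: "star (a * b) = star b * star a"
    and star_star: "star (star a) = a"
    and norm_star_mult: "norm (star a * a) = (norm a)\<^sup>2"

text \<open>Together with \<^theory>\<open>HOL-Library.Function_Algebras\<close>, pointwise operations on functions.\<close>

instantiation "fun" :: (type, scaleC) scaleC
begin
definition scaleC_fun :: "complex \<Rightarrow> ('a \<Rightarrow> 'b) \<Rightarrow> 'a \<Rightarrow> 'b"
  where "c *\<^sub>C f = (\<lambda>x. c *\<^sub>C f x)"
instance ..
end

instantiation "fun" :: (type, star) star
begin
definition star_fun :: "('a \<Rightarrow> 'b) \<Rightarrow> 'a \<Rightarrow> 'b"
  where "star f = (\<lambda>x. star (f x))"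
instance ..
end

lemma cinner_add_left:
  fixes x y z :: "'a::complex_hilbert"
  shows "cinner (x + y) z = cinner x z + cinner y z"
  by (metis cinner_add_right cinner_commute complex_cnj_add)

lemma cinner_scaleC_left:
  fixes x y :: "'a::complex_hilbert"
  shows "cinner (c *\<^sub>C x) y = cnj c * cinner x y"
  by (metis cinner_commute cinner_scaleC_right complex_cnj_mult)

lemma cinner_scaleR:
  fixes x y :: "'a::complex_hilbert"
  shows "cinner x (r *\<^sub>R y) = of_real r * cinner x y"
    and "cinner (r *\<^sub>R x) y = of_real r * cinner x y"
  by (metis cinner_scaleC_right scaleC_of_real,
      metis cinner_scaleC_left scaleC_of_real complex_cnj_complex_of_real)

lemma cinner_minus:
  fixes x y :: "'a::complex_hilbert"
  shows "cinner x (- y) = - cinner x y" and "cinner (- x) y = - cinner x y"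
  using cinner_scaleR(1)[of x "-1" y] cinner_scaleR(2)[of "-1" x y] by auto

lemma cinner_diff:
  fixes x y z :: "'a::complex_hilbert"
  shows "cinner x (y - z) = cinner x y - cinner x z" and "cinner (x - y) z = cinner x z - cinner y z"
  using cinner_add_right[of x y "- z"] cinner_add_left[of x "- y" z] by (auto simp: cinner_minus)

lemma cinner_eqI:
  fixes u v :: "'a::complex_hilbert"
  assumes "\<And>y. cinner u y = cinner v y"
  shows "u = v"
proof -
  have "cinner (u - v) (u - v) = 0" by (simp add: cinner_diff assms)
  then show ?thesis by (simp add: cinner_self)
qed

lemma norm_add_sq:
  fixes x y :: "'a::complex_hilbert"
  shows "(norm (x + y))\<^sup>2 = (norm x)\<^sup>2 + 2 * Re (cinner x y) + (norm y)\<^sup>2"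
proof -
  have "complex_of_real ((norm (x + y))\<^sup>2) = cinner x x + (cinner x y + cinner y x) + cinner y y"
    unfolding cinner_self[symmetric] by (simp add: cinner_add_left cinner_add_right)
  also have "cinner x y + cinner y x = complex_of_real (2 * Re (cinner x y))"
    using cinner_commute[of y x] by (simp add: complex_add_cnj)
  finally have "complex_of_real ((norm (x + y))\<^sup>2) =
      complex_of_real ((norm x)\<^sup>2 + 2 * Re (cinner x y) + (norm y)\<^sup>2)"
    by (simp add: cinner_self)
  then show ?thesis using of_real_eq_iff by blast
qed

lemma linear_quadratic_zero:
  fixes a b :: real
  assumes "\<And>t. 0 \<le> t\<^sup>2 * a + t * b" "0 \<le> a"
  shows "b = 0"
proof (rule ccontr)
  assume b: "b \<noteq> 0"
  define s where "s = 1 / (a + 1)"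
  have s: "s > 0" "s * a < 1" using assms(2) by (auto simp: s_def field_simps)
  have "(- s * b)\<^sup>2 * a + (- s * b) * b = s * b\<^sup>2 * (s * a - 1)"
    by (simp add: power2_eq_square algebra_simps)
  moreover have "s * b\<^sup>2 * (s * a - 1) < 0"
    using s b by (simp add: mult_pos_neg)
  ultimately show False using assms(1)[of "- s * b"] by linarith
qed

lemma norm_scaleC_hilbert:
  fixes x :: "'a::complex_hilbert"
  shows "norm (c *\<^sub>C x) = cmod c * norm x"
proof -
  have "complex_of_real ((norm (c *\<^sub>C x))\<^sup>2) = complex_of_real ((cmod c * norm x)\<^sup>2)"
    unfolding cinner_self[symmetric] cinner_scaleC_left cinner_scaleC_right
    unfolding cinner_self power_mult_distrib of_real_mult complex_norm_square by simp
  then have "(norm (c *\<^sub>C x))\<^sup>2 = (cmod c * norm x)\<^sup>2" using of_real_eq_iff by blast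
  then show ?thesis by (simp add: power2_eq_iff_nonneg)
qed

lemma cinner_cauchy_schwarz:
  fixes x y :: "'a::complex_hilbert"
  shows "cmod (cinner x y) \<le> norm x * norm y"
proof (cases "y = 0")
  case True
  then show ?thesis using cinner_scaleR(1)[of x 0 0] by simp
next
  case False
  define d where "d = (norm y)\<^sup>2"
  have d: "d > 0" using False by (simp add: d_def)
  define c where "c = - cinner y x / of_real d"
  have "0 \<le> (norm (x + c *\<^sub>C y))\<^sup>2" by simp
  also have "\<dots> = (norm x)\<^sup>2 + 2 * Re (c * cinner x y) + (cmod c)\<^sup>2 * d"
    by (simp add: norm_add_sq cinner_scaleC_right norm_scaleC_hilbert power_mult_distrib d_def)
  also have "c * cinner x y = of_real (- (cmod (cinner x y))\<^sup>2 / d)"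
    using cinner_commute[of y x] complex_norm_square[of "cinner x y"]
    by (simp add: c_def mult.commute)
  also have "cmod c = cmod (cinner x y) / d"
    using cinner_commute[of y x] d by (simp add: c_def norm_divide)
  finally have "0 \<le> (norm x)\<^sup>2 - (cmod (cinner x y))\<^sup>2 / d"
    using d by (simp add: power_divide power2_eq_square)
  then have "(cmod (cinner x y))\<^sup>2 \<le> (norm x)\<^sup>2 * d"
    using d by (simp add: field_simps)
  then have "(cmod (cinner x y))\<^sup>2 \<le> (norm x * norm y)\<^sup>2"
    by (simp add: d_def power_mult_distrib)
  then show ?thesis by (rule power2_le_imp_le) simp
qed

lemma riesz_representation:
  fixes r :: "'a::complex_hilbert \<Rightarrow> complex"
  assumes add: "\<And>x y. r (x + y) = r x + r y"
    and scale: "\<And>c x. r (c *\<^sub>C x) = c * r x"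
    and bound: "\<And>x. cmod (r x) \<le> K * norm x"
  shows "\<exists>z. \<forall>x. r x = cinner z x"
proof -
  define J where "J x = (norm x)\<^sup>2 - 2 * Re (r x)" for x
  have rR: "r (t *\<^sub>R x) = of_real t * r x" for t x using scale[of "of_real t" x]
    by (simp add: scaleC_of_real)
  have r_diff: "r (x - y) = r x - r y" for x y
    using add[of "x - y" y] by simp
  have J_lower: "J x \<ge> - K\<^sup>2" for x
  proof -
    have "Re (r x) \<le> K * norm x" using bound[of x] complex_Re_le_cmod[of "r x"] by linarith
    moreover have "0 \<le> (norm x - K)\<^sup>2" by simp
    ultimately show ?thesis by (simp add: J_def power2_eq_square algebra_simps)
  qed
  define d where "d = Inf (range J)"
  have bdd: "bdd_below (range J)" using J_lower by (auto intro!: bdd_belowI)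
  have d_le: "d \<le> J x" for x unfolding d_def by (rule cInf_lower[OF _ bdd]) simp
  have "\<exists>x. J x < d + 1 / (real n + 1)" for n
  proof -
    have "Inf (range J) < d + 1 / (real n + 1)" by (simp add: d_def add_pos_pos)
    from cInf_lessD[OF _ this] show ?thesis by auto
  qed
  then obtain s where s: "\<And>n. J (s n) < d + 1 / (real n + 1)" by metis
  have par: "(norm (x - y))\<^sup>2 \<le> 2 * (J x - d) + 2 * (J y - d)" for x y
  proof -
    have "(norm (x + y))\<^sup>2 + (norm (x - y))\<^sup>2 = 2 * (norm x)\<^sup>2 + 2 * (norm y)\<^sup>2"
      using norm_add_sq[of x y] norm_add_sq[of x "- y"] by (simp add: cinner_minus)
    moreover have "J ((1/2) *\<^sub>R (x + y)) = (norm (x + y))\<^sup>2 / 4 - Re (r x) - Re (r y)"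
      unfolding J_def rR norm_scaleR add power_mult_distrib by (simp add: power_divide field_simps)
    moreover have "d \<le> J ((1/2) *\<^sub>R (x + y))" by (rule d_le)
    ultimately show ?thesis by (simp add: J_def)
  qed
  have "Cauchy s"
  proof (rule metric_CauchyI)
    fix e :: real assume e: "e > 0"
    obtain N where N: "4 / e\<^sup>2 < real N" using reals_Archimedean2 by blast
    have "dist (s m) (s n) < e" if "m \<ge> N" "n \<ge> N" for m n
    proof -
      define u where "u = 1 / (real N + 1)"
      have *: "J (s k) - d < u" if "k \<ge> N" for k
      proof -
        have "1 / (real k + 1) \<le> u" using that by (simp add: u_def frac_le)
        then show ?thesis using s[of k] by linarith
      qed
      have "(norm (s m - s n))\<^sup>2 < 4 * u"
        using par[of "s m" "s n"] *[OF that(1)] *[OF that(2)] by argo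
      also have "\<dots> \<le> e\<^sup>2"
      proof -
        have "4 < real N * e\<^sup>2" using N e by (simp add: divide_less_eq)
        moreover have "e\<^sup>2 * (real N + 1) = real N * e\<^sup>2 + e\<^sup>2" by (simp add: algebra_simps)
        ultimately have "4 \<le> e\<^sup>2 * (real N + 1)" using zero_le_power2[of e] by linarith
        then show ?thesis by (simp add: u_def divide_le_eq)
      qed
      finally have "norm (s m - s n) < e" using e by (simp add: power2_less_imp_less)
      then show ?thesis by (simp add: dist_norm)
    qed
    then show "\<exists>M. \<forall>m\<ge>M. \<forall>n\<ge>M. dist (s m) (s n) < e" by blast
  qed
  then obtain z where z: "s \<longlonglongrightarrow> z" using Cauchy_convergent convergent_def by blast
  have rlim: "(\<lambda>n. r (s n)) \<longlonglongrightarrow> r z"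
  proof (rule Lim_null_comparison[THEN LIM_zero_cancel])
    show "\<forall>\<^sub>F n in sequentially. norm (r (s n) - r z) \<le> K * norm (s n - z)"
      using bound by (auto simp: r_diff[symmetric])
    show "(\<lambda>n. K * norm (s n - z)) \<longlonglongrightarrow> 0"
      using z by (intro tendsto_mult_right_zero) (simp add: LIM_zero tendsto_norm_zero)
  qed
  have "(\<lambda>n. J (s n)) \<longlonglongrightarrow> J z" unfolding J_def
    by (intro tendsto_intros z rlim)
  moreover have "(\<lambda>n. d + 1 / (real n + 1)) \<longlonglongrightarrow> d + 0"
    using LIMSEQ_inverse_real_of_nat
    by (intro tendsto_add tendsto_const) (simp add: inverse_eq_divide add.commute)
  moreover have "\<exists>N. \<forall>n\<ge>N. J (s n) \<le> d + 1 / (real n + 1)" using s less_imp_le by blast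
  ultimately have "J z \<le> d + 0" by (rule LIMSEQ_le)
  then have Jz: "J z \<le> J x" for x using d_le[of x] by linarith
  have re: "Re (cinner z x) = Re (r x)" for x
  proof -
    have "0 \<le> t\<^sup>2 * (norm x)\<^sup>2 + t * (2 * (Re (cinner z x) - Re (r x)))" for t
      using Jz[of "z + t *\<^sub>R x"]
      by (simp add: J_def norm_add_sq cinner_scaleR add rR power_mult_distrib algebra_simps)
    from linear_quadratic_zero[OF this] show ?thesis by simp
  qed
  have "r x = cinner z x" for x
    using re[of x] re[of "\<i> *\<^sub>C x"] by (simp add: scale cinner_scaleC_right complex_eq_iff)
  then show ?thesis by blast
qed

section \<open>The C*-algebra of bounded operators on a complex Hilbert space\<close>

lemma scaleC_zero_right: "c *\<^sub>C (0::'a::complex_vector) = 0"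
  using scaleC_add_right[of c 0 "0::'a"] by simp

typedef (overloaded) 'a bdd_op =
  "{A :: 'a::complex_hilbert \<Rightarrow>\<^sub>L 'a. \<forall>c x. blinfun_apply A (c *\<^sub>C x) = c *\<^sub>C blinfun_apply A x}"
  morphisms bl_of Bdd_op
  by (rule exI[of _ 0]) (simp add: scaleC_zero_right)

setup_lifting type_definition_bdd_op

lift_definition op_app :: "'a::complex_hilbert bdd_op \<Rightarrow> 'a \<Rightarrow> 'a" (infixl \<open>\<cdot>\<close> 75)
  is blinfun_apply .

lemma scaleC_minus_right: "c *\<^sub>C (- x) = - (c *\<^sub>C (x::'a::complex_vector))"
  using scaleC_add_right[of c x "- x"] by (simp add: scaleC_zero_right eq_neg_iff_add_eq_0 add.commute)

lemma scaleC_scaleR_commute: "c *\<^sub>C r *\<^sub>R x = r *\<^sub>R c *\<^sub>C (x::'a::complex_vector)"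
  by (simp add: scaleC_of_real[symmetric] scaleC_scaleC mult.commute)

lemma bounded_linear_scaleC: "bounded_linear (\<lambda>x::'a::complex_hilbert. c *\<^sub>C x)"
  by (rule bounded_linear_intro[of _ "cmod c"])
    (auto simp: scaleC_add_right scaleC_scaleR_commute norm_scaleC_hilbert mult.commute)

lemma op_eqI: "(\<And>x. A \<cdot> x = B \<cdot> x) \<Longrightarrow> A = B"
  by transfer (rule blinfun_eqI)

lemma op_scaleC_right: "A \<cdot> (c *\<^sub>C x) = c *\<^sub>C (A \<cdot> x)"
  by transfer simp

instantiation bdd_op :: (complex_hilbert) real_normed_vector
begin

lift_definition zero_bdd_op :: "'a bdd_op" is 0
  by (simp add: scaleC_zero_right)
lift_definition plus_bdd_op :: "'a bdd_op \<Rightarrow> 'a bdd_op \<Rightarrow> 'a bdd_op" is "(+)"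
  by (simp add: blinfun.bilinear_simps scaleC_add_right)
lift_definition uminus_bdd_op :: "'a bdd_op \<Rightarrow> 'a bdd_op" is uminus
  by (simp add: blinfun.bilinear_simps scaleC_minus_right)
lift_definition minus_bdd_op :: "'a bdd_op \<Rightarrow> 'a bdd_op \<Rightarrow> 'a bdd_op" is "(-)"
  by (metis (no_types, lifting) add_uminus_conv_diff blinfun.minus_left plus_blinfun.rep_eq
      scaleC_add_right scaleC_minus_right)
lift_definition scaleR_bdd_op :: "real \<Rightarrow> 'a bdd_op \<Rightarrow> 'a bdd_op" is "(*\<^sub>R)"
  by (simp add: blinfun.bilinear_simps scaleC_scaleR_commute)
lift_definition norm_bdd_op :: "'a bdd_op \<Rightarrow> real" is norm .

definition "dist A B = norm (A - B)" for A B :: "'a bdd_op"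
definition "sgn A = scaleR (inverse (norm A)) A" for A :: "'a bdd_op"
definition [code del]:
  "(uniformity :: ('a bdd_op \<times> 'a bdd_op) filter) = (INF e\<in>{0<..}. principal {(x, y). dist x y < e})"
definition [code del]:
  "open (S :: 'a bdd_op set) = (\<forall>x\<in>S. \<forall>\<^sub>F (x', y) in uniformity. x' = x \<longrightarrow> y \<in> S)"

instance
proof
  show "dist A B = norm (A - B)" for A B :: "'a bdd_op" by (rule dist_bdd_op_def)
  show "sgn A = scaleR (inverse (norm A)) A" for A :: "'a bdd_op" by (rule sgn_bdd_op_def)
  show "(uniformity :: ('a bdd_op \<times> 'a bdd_op) filter) =
      (INF e\<in>{0<..}. principal {(x, y). dist x y < e})" by (rule uniformity_bdd_op_def)
  show "open S = (\<forall>x\<in>S. \<forall>\<^sub>F (x', y) in uniformity. x' = x \<longrightarrow> y \<in> S)" for S :: "'a bdd_op set"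
    by (rule open_bdd_op_def)
  show "norm A = 0 \<longleftrightarrow> A = 0" for A :: "'a bdd_op" by transfer simp
  show "norm (A + B) \<le> norm A + norm B" for A B :: "'a bdd_op"
    by transfer (rule norm_triangle_ineq)
  show "norm (r *\<^sub>R A) = \<bar>r\<bar> * norm A" for r and A :: "'a bdd_op" by transfer simp
qed (transfer, simp add: algebra_simps)+

end

lemma op_app_simps:
  "0 \<cdot> x = 0" "(A + B) \<cdot> x = A \<cdot> x + B \<cdot> x" "(- A) \<cdot> x = - (A \<cdot> x)" "(A - B) \<cdot> x = A \<cdot> x - B \<cdot> x"
  "(r *\<^sub>R A) \<cdot> x = r *\<^sub>R (A \<cdot> x)" "A \<cdot> (x + y) = A \<cdot> x + A \<cdot> y" "A \<cdot> (x - y) = A \<cdot> x - A \<cdot> y"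
  "A \<cdot> (r *\<^sub>R x) = r *\<^sub>R (A \<cdot> x)"
  by (transfer, simp add: blinfun.bilinear_simps)+

lemma norm_op_app: "norm (A \<cdot> x) \<le> norm A * norm x"
  by transfer (rule norm_blinfun)

lemma norm_op_bound: "0 \<le> b \<Longrightarrow> (\<And>x. norm (A \<cdot> x) \<le> b * norm x) \<Longrightarrow> norm A \<le> b"
  by transfer (rule norm_blinfun_bound)

instance bdd_op :: (complex_hilbert) banach
proof
  fix X :: "nat \<Rightarrow> 'a bdd_op"
  assume X: "Cauchy X"
  have d: "dist (bl_of A) (bl_of B) = dist A B" for A B :: "'a bdd_op"
    by (simp add: dist_norm norm_bdd_op.rep_eq minus_bdd_op.rep_eq)
  have "Cauchy (\<lambda>n. bl_of (X n))" using X by (simp add: Cauchy_def d)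
  then obtain L where L: "(\<lambda>n. bl_of (X n)) \<longlonglongrightarrow> L"
    using Cauchy_convergent convergent_def by blast
  have "blinfun_apply L (c *\<^sub>C x) = c *\<^sub>C blinfun_apply L x" for c x
  proof (rule LIMSEQ_unique)
    have Lx: "(\<lambda>n. blinfun_apply (bl_of (X n)) y) \<longlonglongrightarrow> blinfun_apply L y" for y
      by (intro tendsto_intros L)
    show "(\<lambda>n. blinfun_apply (bl_of (X n)) (c *\<^sub>C x)) \<longlonglongrightarrow> blinfun_apply L (c *\<^sub>C x)" by (rule Lx)
    have "(\<lambda>n. c *\<^sub>C blinfun_apply (bl_of (X n)) x) \<longlonglongrightarrow> c *\<^sub>C blinfun_apply L x"
      by (rule bounded_linear.tendsto[OF bounded_linear_scaleC Lx])
    then show "(\<lambda>n. blinfun_apply (bl_of (X n)) (c *\<^sub>C x)) \<longlonglongrightarrow> c *\<^sub>C blinfun_apply L x"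
      using bl_of[of "X _"] by simp
  qed
  then have "bl_of (Bdd_op L) = L" by (intro Bdd_op_inverse) simp
  then obtain A where "L = bl_of A" by metis
  with L have "X \<longlonglongrightarrow> A" by (simp add: tendsto_iff d)
  then show "convergent X" by (auto simp: convergent_def)
qed

lemma ex_adjoint:
  fixes A :: "'a::complex_hilbert bdd_op"
  shows "\<exists>B :: 'a bdd_op. \<forall>x y. cinner (B \<cdot> x) y = cinner x (A \<cdot> y)"
proof -
  have "\<exists>z. \<forall>y. cinner x (A \<cdot> y) = cinner z y" for x
  proof (rule riesz_representation)
    show "cmod (cinner x (A \<cdot> y)) \<le> (norm x * norm A) * norm y" for y
      by (metis cinner_cauchy_schwarz mult.assoc mult_left_mono norm_ge_zero norm_op_app order_trans)
  qed (auto simp: op_app_simps cinner_add_right op_scaleC_right cinner_scaleC_right)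
  then obtain b where b: "\<And>x y. cinner x (A \<cdot> y) = cinner (b x) y" by metis
  have b_add: "b (x + y) = b x + b y" for x y
    by (rule cinner_eqI) (simp add: b[symmetric] cinner_add_left)
  have b_scale: "b (c *\<^sub>C x) = c *\<^sub>C b x" for c x
    by (rule cinner_eqI) (simp add: b[symmetric] cinner_scaleC_left)
  have "norm (b x) \<le> norm x * norm A" for x
  proof (cases "b x = 0")
    case False
    have "(norm (b x))\<^sup>2 = cmod (cinner (b x) (b x))" unfolding cinner_self norm_of_real by simp
    also have "\<dots> = cmod (cinner x (A \<cdot> b x))" by (simp add: b)
    also have "\<dots> \<le> norm x * (norm A * norm (b x))"
      by (meson cinner_cauchy_schwarz mult_left_mono norm_ge_zero norm_op_app order_trans)
    finally show ?thesis using False by (simp add: power2_eq_square mult.assoc[symmetric])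
  qed simp
  then have "bounded_linear b"
    using b_add b_scale[of "of_real _"]
    by (intro bounded_linear_intro[of b "norm A"]) (auto simp: scaleC_of_real)
  then have "b = blinfun_apply (Blinfun b)" by (simp add: bounded_linear_Blinfun_apply)
  then have "\<exists>L. b = blinfun_apply L" ..
  then obtain L where L: "b = blinfun_apply L" ..
  have "bl_of (Bdd_op L) = L" using b_scale by (intro Bdd_op_inverse) (simp add: L)
  then obtain B :: "'a bdd_op" where "b = op_app B" using L by (metis op_app.rep_eq)
  then show ?thesis using b by metis
qed

instantiation bdd_op :: (complex_hilbert) cstar_algebra
begin

lift_definition times_bdd_op :: "'a bdd_op \<Rightarrow> 'a bdd_op \<Rightarrow> 'a bdd_op" is "(o\<^sub>L)"
  by simp
lift_definition one_bdd_op :: "'a bdd_op" is id_blinfun by simp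
lift_definition scaleC_bdd_op :: "complex \<Rightarrow> 'a bdd_op \<Rightarrow> 'a bdd_op"
  is "\<lambda>c A. blinfun_compose (Blinfun (\<lambda>x. c *\<^sub>C x)) A"
  by (simp add: bounded_linear_Blinfun_apply[OF bounded_linear_scaleC] scaleC_scaleC mult.commute)
definition star_bdd_op :: "'a bdd_op \<Rightarrow> 'a bdd_op"
  where "star A = (THE B. \<forall>x y. cinner (B \<cdot> x) y = cinner x (A \<cdot> y))"

lemma op_app_times: "(A * B) \<cdot> x = A \<cdot> (B \<cdot> x)" by transfer simp
lemma op_app_one: "1 \<cdot> x = x" by transfer simp
lemma op_app_scaleC: "(c *\<^sub>C A) \<cdot> x = c *\<^sub>C (A \<cdot> x)"
  by transfer (simp add: bounded_linear_Blinfun_apply[OF bounded_linear_scaleC])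

lemma star_adjoint: "cinner (star A \<cdot> x) y = cinner x (A \<cdot> y)"
proof -
  have "\<exists>!B. \<forall>x y. cinner (B \<cdot> x) y = cinner x (A \<cdot> y)"
    using ex_adjoint[of A] by (metis cinner_eqI op_eqI)
  from theI'[OF this] show ?thesis unfolding star_bdd_op_def by blast
qed

lemma star_adjoint': "cinner x (star A \<cdot> y) = cinner (A \<cdot> x) y"
  by (metis cinner_commute star_adjoint)

lemma norm_op_mult: "norm (A * B) \<le> norm A * norm (B :: 'a bdd_op)"
  by transfer (rule norm_blinfun_compose)

lemma norm_le_star_mult: "(norm A)\<^sup>2 \<le> norm (star A * A)" for A :: "'a bdd_op"
proof -
  have "norm (A \<cdot> x) \<le> sqrt (norm (star A * A)) * norm x" for x
  proof (rule power2_le_imp_le)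
    have "(norm (A \<cdot> x))\<^sup>2 = cmod (cinner (A \<cdot> x) (A \<cdot> x))" unfolding cinner_self norm_of_real by simp
    also have "\<dots> = cmod (cinner x ((star A * A) \<cdot> x))" by (simp add: op_app_times star_adjoint')
    also have "\<dots> \<le> norm x * (norm (star A * A) * norm x)"
      by (meson cinner_cauchy_schwarz mult_left_mono norm_ge_zero norm_op_app order_trans)
    finally show "(norm (A \<cdot> x))\<^sup>2 \<le> (sqrt (norm (star A * A)) * norm x)\<^sup>2"
      by (simp add: power_mult_distrib power2_eq_square mult_ac)
  qed simp
  then have "norm A \<le> sqrt (norm (star A * A))" by (intro norm_op_bound) auto
  then show ?thesis by (metis norm_ge_zero power_mono real_sqrt_pow2)
qed

lemma norm_star_le: "norm A \<le> norm (star A)" for A :: "'a bdd_op"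
proof (cases "norm A = 0")
  case False
  have "norm A * norm A \<le> norm (star A) * norm A"
    using norm_le_star_mult[of A] norm_op_mult[of "star A" A] by (simp add: power2_eq_square)
  then show ?thesis using False by simp
qed simp

instance
proof
  fix A B C :: "'a bdd_op" and c d :: complex and r :: real
  show "A * B * C = A * (B * C)" by (rule op_eqI) (simp add: op_app_times)
  show "(A + B) * C = A * C + B * C" by (rule op_eqI) (simp add: op_app_times op_app_simps)
  show "A * (B + C) = A * B + A * C" by (rule op_eqI) (simp add: op_app_times op_app_simps)
  show "1 * A = A" by (rule op_eqI) (simp add: op_app_times op_app_one)
  show "A * 1 = A" by (rule op_eqI) (simp add: op_app_times op_app_one)
  show "(0 :: 'a bdd_op) \<noteq> 1"
  proof -
    obtain x :: 'a where "x \<noteq> 0" using ex_nonzero by blast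
    then show ?thesis using op_app_one[of x] op_app_simps(1)[of x] by auto
  qed
  show "r *\<^sub>R A * B = r *\<^sub>R (A * B)" by (rule op_eqI) (simp add: op_app_times op_app_simps)
  show "A * r *\<^sub>R B = r *\<^sub>R (A * B)" by (rule op_eqI) (simp add: op_app_times op_app_simps)
  show "norm (A * B) \<le> norm A * norm B" by (rule norm_op_mult)
  show "norm (1 :: 'a bdd_op) = 1"
  proof (rule antisym)
    show "norm (1 :: 'a bdd_op) \<le> 1" by (rule norm_op_bound) (auto simp: op_app_one)
    obtain x :: 'a where "x \<noteq> 0" using ex_nonzero by blast
    then show "1 \<le> norm (1 :: 'a bdd_op)" using norm_op_app[of 1 x] by (simp add: op_app_one)
  qed
  show "c *\<^sub>C (A + B) = c *\<^sub>C A + c *\<^sub>C B"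
    by (rule op_eqI) (simp add: op_app_scaleC op_app_simps scaleC_add_right)
  show "(c + d) *\<^sub>C A = c *\<^sub>C A + d *\<^sub>C A"
    by (rule op_eqI) (simp add: op_app_scaleC op_app_simps scaleC_add_left)
  show "c *\<^sub>C d *\<^sub>C A = (c * d) *\<^sub>C A"
    by (rule op_eqI) (simp add: op_app_scaleC scaleC_scaleC)
  show "complex_of_real r *\<^sub>C A = r *\<^sub>R A"
    by (rule op_eqI) (simp add: op_app_scaleC op_app_simps scaleC_of_real)
  show "(c *\<^sub>C A) * B = c *\<^sub>C (A * B)"
    by (rule op_eqI) (simp add: op_app_scaleC op_app_times)
  show "A * (c *\<^sub>C B) = c *\<^sub>C (A * B)"
    by (rule op_eqI) (simp add: op_app_scaleC op_app_times op_scaleC_right)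
  show "norm (c *\<^sub>C A) = cmod c * norm A"
  proof (rule antisym)
    show le: "norm (c *\<^sub>C A) \<le> cmod c * norm A" for c and A :: "'a bdd_op"
      by (rule norm_op_bound)
        (auto simp: op_app_scaleC norm_scaleC_hilbert mult.assoc norm_op_app mult_left_mono)
    show "cmod c * norm A \<le> norm (c *\<^sub>C A)"
    proof (cases "c = 0")
      case False
      have "(inverse c) *\<^sub>C c *\<^sub>C A = A"
        using False scaleC_of_real[of 1]
        by (intro op_eqI) (simp add: op_app_scaleC scaleC_scaleC)
      then have "norm A \<le> cmod (inverse c) * norm (c *\<^sub>C A)"
        using le[of "inverse c" "c *\<^sub>C A"] by simp
      then show ?thesis using False by (simp add: norm_inverse inverse_eq_divide norm_divide field_simps)
    qed simp
  qed
  show "star (A + B) = star A + star B"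
    by (intro op_eqI cinner_eqI)
      (simp add: op_app_simps star_adjoint cinner_add_left cinner_add_right)
  show "star (c *\<^sub>C A) = cnj c *\<^sub>C star A"
    by (intro op_eqI cinner_eqI)
      (simp add: op_app_scaleC star_adjoint cinner_scaleC_left cinner_scaleC_right)
  show "star (A * B) = star B * star A"
    by (intro op_eqI cinner_eqI) (simp add: op_app_times star_adjoint)
  show ss: "star (star A) = A" for A :: "'a bdd_op"
    by (intro op_eqI cinner_eqI) (simp add: star_adjoint star_adjoint')
  show "norm (star A * A) = (norm A)\<^sup>2"
  proof (rule antisym)
    have "norm (star A) = norm A" using norm_star_le[of A] norm_star_le[of "star A"] by (simp add: ss)
    then show "norm (star A * A) \<le> (norm A)\<^sup>2"
      using norm_op_mult[of "star A" A] by (simp add: power2_eq_square)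
  qed (rule norm_le_star_mult)
qed

end

section \<open>Operator-algebraic notions\<close>

definition star_hom_on ::
  "'a::{plus,times,scaleC,star} set \<Rightarrow> ('a \<Rightarrow> 'b::{plus,times,scaleC,star}) \<Rightarrow> bool"
  where "star_hom_on S \<phi> \<longleftrightarrow>
    (\<forall>a\<in>S. \<forall>b\<in>S. \<phi> (a + b) = \<phi> a + \<phi> b \<and> \<phi> (a * b) = \<phi> a * \<phi> b) \<and>
    (\<forall>a\<in>S. \<forall>c. \<phi> (c *\<^sub>C a) = c *\<^sub>C \<phi> a) \<and>
    (\<forall>a\<in>S. \<phi> (star a) = star (\<phi> a))"

definition star_automorphism :: "'a::{plus,times,scaleC,star} set \<Rightarrow> ('a \<Rightarrow> 'a) \<Rightarrow> bool"
  where "star_automorphism S \<phi> \<longleftrightarrow> star_hom_on S \<phi> \<and> bij_betw \<phi> S S"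

definition star_subalgebra :: "'a::cstar_algebra set \<Rightarrow> bool"
  where "star_subalgebra S \<longleftrightarrow>
    (\<forall>a\<in>S. \<forall>b\<in>S. a + b \<in> S \<and> a * b \<in> S) \<and> (\<forall>a\<in>S. \<forall>c. c *\<^sub>C a \<in> S) \<and> (\<forall>a\<in>S. star a \<in> S)"

definition cstar_generated :: "'a::cstar_algebra set \<Rightarrow> 'a set"
  where "cstar_generated X = \<Inter>{S. star_subalgebra S \<and> closed S \<and> X \<subseteq> S}"

definition unitary :: "'a::cstar_algebra \<Rightarrow> bool"
  where "unitary u \<longleftrightarrow> star u * u = 1 \<and> u * star u = 1"

definition state :: "('a::cstar_algebra \<Rightarrow> complex) \<Rightarrow> bool"
  where "state \<omega> \<longleftrightarrow>
    (\<forall>a b. \<omega> (a + b) = \<omega> a + \<omega> b) \<and> (\<forall>c a. \<omega> (c *\<^sub>C a) = c * \<omega> a) \<and>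
    (\<forall>a. \<omega> (star a * a) \<in> \<real> \<and> 0 \<le> Re (\<omega> (star a * a))) \<and> \<omega> 1 = 1"

text \<open>\<open>S\<close> is a *-algebra given as a set, which also covers algebras of operator-valued functions.\<close>

definition gns_triple ::
  "'a::{plus,times,scaleC,star} set \<Rightarrow> ('a \<Rightarrow> complex) \<Rightarrow> ('a \<Rightarrow> 'h::complex_hilbert bdd_op) \<Rightarrow> 'h \<Rightarrow> bool"
  where "gns_triple S \<omega> \<pi> \<Omega> \<longleftrightarrow>
    star_hom_on S \<pi> \<and> (\<forall>a\<in>S. \<omega> a = cinner \<Omega> (\<pi> a \<cdot> \<Omega>)) \<and> closure ((\<lambda>a. \<pi> a \<cdot> \<Omega>) ` S) = UNIV"

definition commutant :: "'h::complex_hilbert bdd_op set \<Rightarrow> 'h bdd_op set"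
  where "commutant X = {T. \<forall>A\<in>X. T * A = A * T}"

definition bicommutant :: "'h::complex_hilbert bdd_op set \<Rightarrow> 'h bdd_op set"
  where "bicommutant X = commutant (commutant X)"

definition ultraweak_functional :: "('h::complex_hilbert bdd_op \<Rightarrow> complex) \<Rightarrow> bool"
  where "ultraweak_functional \<psi> \<longleftrightarrow> (\<exists>u v :: nat \<Rightarrow> 'h.
    summable (\<lambda>n. (norm (u n))\<^sup>2) \<and> summable (\<lambda>n. (norm (v n))\<^sup>2) \<and>
    (\<forall>A. \<psi> A = (\<Sum>n. cinner (u n) (A \<cdot> v n))))"

text \<open>Ultraweak continuity on \<open>M\<close>, for linear \<open>\<phi>\<close>: pulling back an ultraweakly continuous functional
  gives an ultraweakly continuous functional on \<open>M\<close>, and the latter are exactly the restrictions of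
  those on all bounded operators.\<close>

definition normal_on ::
  "'h::complex_hilbert bdd_op set \<Rightarrow> ('h bdd_op \<Rightarrow> 'k::complex_hilbert bdd_op) \<Rightarrow> bool"
  where "normal_on M \<phi> \<longleftrightarrow> (\<forall>\<psi>. ultraweak_functional \<psi> \<longrightarrow>
    (\<exists>\<psi>'. ultraweak_functional \<psi>' \<and> (\<forall>A\<in>M. \<psi>' A = \<psi> (\<phi> A))))"


section \<open>Test functions and the action of the Poincare group\<close>

text \<open>Points \<open>(t, x)\<close> of two-dimensional Minkowski space.\<close>

type_synonym spacetime = "real \<times> real"

definition supp :: "('a::topological_space \<Rightarrow> 'b::zero) \<Rightarrow> 'a set"
  where "supp f = closure {x. f x \<noteq> 0}"

definition test_functions :: "(real \<Rightarrow> complex) set"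
  where "test_functions = {f.
    (\<forall>n. ((\<lambda>h x. vector_derivative h (at x)) ^^ n) f differentiable_on UNIV) \<and> compact (supp f)}"

definition re_part :: "(real \<Rightarrow> complex) \<Rightarrow> real \<Rightarrow> complex"
  where "re_part f = (\<lambda>x. complex_of_real (Re (f x)))"

definition im_part :: "(real \<Rightarrow> complex) \<Rightarrow> real \<Rightarrow> complex"
  where "im_part f = (\<lambda>x. complex_of_real (Im (f x)))"

definition fourier :: "(real \<Rightarrow> complex) \<Rightarrow> real \<Rightarrow> complex"
  where "fourier f p = (2 * pi) powr (-1/2) *\<^sub>R (LINT x|lborel. exp (- (\<i> * p * x)) * f x)"

definition symplectic :: "(real \<Rightarrow> complex) \<Rightarrow> (real \<Rightarrow> complex) \<Rightarrow> real"
  where "symplectic f g = Im (LINT x|lborel. cnj (f x) * g x)"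

definition energy :: "real \<Rightarrow> real \<Rightarrow> real"
  where "energy m p = sqrt (p\<^sup>2 + m\<^sup>2)"

definition mass_shell_transform :: "real \<Rightarrow> (real \<Rightarrow> complex) \<Rightarrow> real \<Rightarrow> complex"
  where "mass_shell_transform m f p = fourier (re_part f) p + \<i> * energy m p * fourier (im_part f) p"

definition vacuum_norm_sq :: "real \<Rightarrow> (real \<Rightarrow> complex) \<Rightarrow> real"
  where "vacuum_norm_sq m f = 1/2 * (LINT p|lborel.
    (cmod (energy m p powr (-1/2) * fourier (re_part f) p
         + \<i> * energy m p powr (1/2) * fourier (im_part f) p))\<^sup>2)"

definition minkowski_form :: "spacetime \<Rightarrow> spacetime \<Rightarrow> real"
  where "minkowski_form x y = fst x * fst y - snd x * snd y"

text \<open>The last two conditions are unit determinant and preservation of the time direction.\<close>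

definition lorentz :: "(spacetime \<Rightarrow> spacetime) \<Rightarrow> bool"
  where "lorentz \<Lambda> \<longleftrightarrow> linear \<Lambda> \<and>
    (\<forall>x y. minkowski_form (\<Lambda> x) (\<Lambda> y) = minkowski_form x y) \<and>
    fst (\<Lambda> (1, 0)) * snd (\<Lambda> (0, 1)) - fst (\<Lambda> (0, 1)) * snd (\<Lambda> (1, 0)) = 1 \<and>
    fst (\<Lambda> (1, 0)) > 0"

definition double_cone_over :: "real \<Rightarrow> real \<Rightarrow> spacetime set"
  where "double_cone_over a b = {(t, x). a + \<bar>t\<bar> < x \<and> x < b - \<bar>t\<bar>}"

definition poincare_image :: "(spacetime \<Rightarrow> spacetime) \<Rightarrow> spacetime \<Rightarrow> spacetime set \<Rightarrow> spacetime set"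
  where "poincare_image \<Lambda> x R = (\<lambda>y. \<Lambda> y + x) ` R"

definition double_cones :: "spacetime set set"
  where "double_cones = {poincare_image \<Lambda> x (double_cone_over a b) | \<Lambda> x a b. lorentz \<Lambda> \<and> a < b}"

definition scale_region :: "real \<Rightarrow> spacetime set \<Rightarrow> spacetime set"
  where "scale_region l R = (\<lambda>y. l *\<^sub>R y) ` R"

definition dilate :: "real \<Rightarrow> (real \<Rightarrow> complex) \<Rightarrow> real \<Rightarrow> complex"
  where "dilate l f x = complex_of_real (Re (f (x / l)) / l) + \<i> * Im (f (x / l))"

text \<open>A test function is determined by its mass shell transform, so the following determines \<open>\<tau>\<close> on
  test functions, and real linearity and the group law are consequences.\<close>

locale poincare_test_action =
  fixes m :: real
    and \<tau> :: "(spacetime \<Rightarrow> spacetime) \<Rightarrow> spacetime \<Rightarrow> (real \<Rightarrow> complex) \<Rightarrow> real \<Rightarrow> complex"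
  assumes \<tau>_test: "lorentz \<Lambda> \<Longrightarrow> f \<in> test_functions \<Longrightarrow> \<tau> \<Lambda> x f \<in> test_functions"
    and \<tau>_transform: "lorentz \<Lambda> \<Longrightarrow> f \<in> test_functions \<Longrightarrow>
      mass_shell_transform m (\<tau> \<Lambda> x f) p =
        exp (\<i> * (fst x * energy m p - snd x * p)) *
        mass_shell_transform m f (snd (inv \<Lambda> (energy m p, p)))"


section \<open>The Weyl algebra, the vacuum and the local algebras\<close>

locale weyl_algebra =
  fixes W :: "(real \<Rightarrow> complex) \<Rightarrow> 'w::cstar_algebra"
  assumes W_unitary: "f \<in> test_functions \<Longrightarrow> unitary (W f)"
    and W_mult: "f \<in> test_functions \<Longrightarrow> g \<in> test_functions \<Longrightarrow>
      W f * W g = exp (- (\<i> / 2 * symplectic f g)) *\<^sub>C W (f + g)"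
    and W_generate: "cstar_generated (W ` test_functions) = UNIV"

locale weyl_poincare_action = poincare_test_action m \<tau> + weyl_algebra W
  for m \<tau> and W :: "(real \<Rightarrow> complex) \<Rightarrow> 'w::cstar_algebra" +
  fixes \<alpha>\<^sub>W :: "(spacetime \<Rightarrow> spacetime) \<Rightarrow> spacetime \<Rightarrow> 'w \<Rightarrow> 'w"
  assumes \<alpha>\<^sub>W_automorphism: "lorentz \<Lambda> \<Longrightarrow> star_automorphism UNIV (\<alpha>\<^sub>W \<Lambda> x)"
    and \<alpha>\<^sub>W_W: "lorentz \<Lambda> \<Longrightarrow> f \<in> test_functions \<Longrightarrow> \<alpha>\<^sub>W \<Lambda> x (W f) = W (\<tau> \<Lambda> x f)"

locale vacuum_representation = weyl_poincare_action m \<tau> W \<alpha>\<^sub>W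
  for m \<tau> and W :: "(real \<Rightarrow> complex) \<Rightarrow> 'w::cstar_algebra" and \<alpha>\<^sub>W +
  fixes \<omega> :: "'w \<Rightarrow> complex"
    and \<pi> :: "'w \<Rightarrow> 'h::complex_hilbert bdd_op"
    and \<Omega> :: 'h
  assumes \<omega>_state: "state \<omega>"
    and \<omega>_W: "f \<in> test_functions \<Longrightarrow> \<omega> (W f) = exp (- vacuum_norm_sq m f / 2)"
    and vacuum_gns: "gns_triple UNIV \<omega> \<pi> \<Omega>"
begin

definition local_algebra :: "spacetime set \<Rightarrow> 'h bdd_op set"
  where "local_algebra R = bicommutant {\<pi> (\<alpha>\<^sub>W \<Lambda> x (W f)) | \<Lambda> x a b f.
    lorentz \<Lambda> \<and> a < b \<and> R = poincare_image \<Lambda> x (double_cone_over a b) \<and>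
    f \<in> test_functions \<and> supp f \<subseteq> {a<..<b}}"

definition quasilocal_algebra :: "'h bdd_op set"
  where "quasilocal_algebra = closure (\<Union>R\<in>double_cones. local_algebra R)"

end

text \<open>The vacuum state is invariant under \<open>\<alpha>\<^sub>W\<close>; the extension \<open>\<alpha>\<close> of \<open>\<alpha>\<^sub>W\<close> to the quasilocal algebra is
  the one induced by the unitaries that implement \<open>\<alpha>\<^sub>W\<close> in the GNS representation.  The automorphisms
  \<open>\<phi> l\<close> are determined by normality and their values on Weyl operators.\<close>

locale dilation_covariant_net = vacuum_representation m \<tau> W \<alpha>\<^sub>W \<omega> \<pi> \<Omega>
  for m \<tau> and W :: "(real \<Rightarrow> complex) \<Rightarrow> 'w::cstar_algebra" and \<alpha>\<^sub>W \<omega>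
    and \<pi> :: "'w \<Rightarrow> 'h::complex_hilbert bdd_op" and \<Omega> +
  fixes \<alpha> :: "(spacetime \<Rightarrow> spacetime) \<Rightarrow> spacetime \<Rightarrow> 'h bdd_op \<Rightarrow> 'h bdd_op"
    and \<phi> :: "real \<Rightarrow> 'h bdd_op \<Rightarrow> 'h bdd_op"
  assumes \<alpha>_extension: "lorentz \<Lambda> \<Longrightarrow> \<exists>U. unitary U \<and>
      (\<forall>a. U \<cdot> (\<pi> a \<cdot> \<Omega>) = \<pi> (\<alpha>\<^sub>W \<Lambda> x a) \<cdot> \<Omega>) \<and>
      (\<forall>A\<in>quasilocal_algebra. \<alpha> \<Lambda> x A = U * A * star U)"
    and \<phi>_automorphism: "l > 0 \<Longrightarrow> star_automorphism quasilocal_algebra (\<phi> l)"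
    and \<phi>_normal: "l > 0 \<Longrightarrow> R \<in> double_cones \<Longrightarrow> normal_on (local_algebra R) (\<phi> l)"
    and \<phi>_W: "l > 0 \<Longrightarrow> f \<in> test_functions \<Longrightarrow> \<phi> l (\<pi> (W f)) = \<pi> (W (dilate l f))"


section \<open>Scaling algebras\<close>

text \<open>Strong integrals over Minkowski space.  The gauge integral needs no separability of the Hilbert
  space; below it is only applied to strongly continuous integrands of compact support.\<close>

definition strong_integral :: "(spacetime \<Rightarrow> 'h::complex_hilbert bdd_op) \<Rightarrow> 'h bdd_op"
  where "strong_integral G = (THE T. \<forall>v. ((\<lambda>y. G y \<cdot> v) has_integral T \<cdot> v) UNIV)"

text \<open>Functions on the scales \<open>(0, \<infinity>)\<close> are represented as functions on the reals vanishing on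
  \<open>(-\<infinity>, 0]\<close>.\<close>

definition on_scales :: "(real \<Rightarrow> 'a::zero) \<Rightarrow> real \<Rightarrow> 'a"
  where "on_scales A = (\<lambda>l. if l > 0 then A l else 0)"

definition mollifiers :: "real \<Rightarrow> (spacetime \<Rightarrow> real) set"
  where "mollifiers r = {h. continuous_on UNIV h \<and> (\<forall>x. 0 \<le> h x) \<and> (h has_integral 1) UNIV \<and>
    supp h \<subseteq> ball 0 r}"

text \<open>The filter of \<open>h \<rightarrow> \<delta>\<close>.\<close>

definition to_delta :: "(spacetime \<Rightarrow> real) filter"
  where "to_delta = (INF r\<in>{0<..}. principal (mollifiers r))"

context dilation_covariant_net
begin

definition bounded_local_families :: "spacetime set \<Rightarrow> (real \<Rightarrow> 'h bdd_op) set"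
  where "bounded_local_families R = {A. bounded (range A) \<and> A = on_scales A \<and>
    (\<forall>l>0. A l \<in> local_algebra (scale_region l R))}"

definition scaling_local_algebra :: "spacetime set \<Rightarrow> (real \<Rightarrow> 'h bdd_op) set"
  where "scaling_local_algebra R = {A \<in> bounded_local_families R.
    ((\<lambda>x. SUP l\<in>{0<..}. norm (\<alpha> id (l *\<^sub>R x) (A l) - A l)) \<longlongrightarrow> 0) (at 0)}"

definition uniform_closure_of :: "(real \<Rightarrow> 'h bdd_op) set \<Rightarrow> (real \<Rightarrow> 'h bdd_op) set"
  where "uniform_closure_of S = {A. \<forall>\<epsilon>>0. \<exists>B\<in>S. \<forall>l. norm (A l - B l) < \<epsilon>}"

definition scaling_algebra :: "(real \<Rightarrow> 'h bdd_op) set"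
  where "scaling_algebra = uniform_closure_of (\<Union>R\<in>double_cones. scaling_local_algebra R)"

definition smear :: "(spacetime \<Rightarrow> real) \<Rightarrow> (real \<Rightarrow> 'h bdd_op) \<Rightarrow> real \<Rightarrow> 'h bdd_op"
  where "smear h A = on_scales (\<lambda>l. strong_integral (\<lambda>x. h x *\<^sub>R \<alpha> id (l *\<^sub>R x) (A l)))"

end

text \<open>The net \<open>\<kappa> \<mapsto> \<lambda>\<^sub>\<kappa>\<close> is a function \<open>s\<close> together with a filter \<open>F\<close> on its index type, for a directed
  index set the filter of its tails.\<close>

locale scaling_limit = dilation_covariant_net m \<tau> W \<alpha>\<^sub>W \<omega> \<pi> \<Omega> \<alpha> \<phi>
  for m \<tau> and W :: "(real \<Rightarrow> complex) \<Rightarrow> 'w::cstar_algebra" and \<alpha>\<^sub>W \<omega>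
    and \<pi> :: "'w \<Rightarrow> 'h::complex_hilbert bdd_op" and \<Omega> \<alpha> \<phi> +
  fixes F :: "'i filter"
    and s :: "'i \<Rightarrow> real"
    and \<omega>\<^sub>0 :: "(real \<Rightarrow> 'h bdd_op) \<Rightarrow> complex"
    and \<pi>\<^sub>0 :: "(real \<Rightarrow> 'h bdd_op) \<Rightarrow> 'k::complex_hilbert bdd_op"
    and \<Omega>\<^sub>0 :: 'k
  assumes F_nontrivial: "F \<noteq> bot"
    and s_to_0: "filterlim s (at_right 0) F"
    and \<omega>\<^sub>0_limit: "A \<in> scaling_algebra \<Longrightarrow> ((\<lambda>\<kappa>. cinner \<Omega> (A (s \<kappa>) \<cdot> \<Omega>)) \<longlongrightarrow> \<omega>\<^sub>0 A) F"
    and limit_gns: "gns_triple scaling_algebra \<omega>\<^sub>0 \<pi>\<^sub>0 \<Omega>\<^sub>0"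
begin

definition limit_local_algebra :: "spacetime set \<Rightarrow> 'k bdd_op set"
  where "limit_local_algebra R = bicommutant (\<pi>\<^sub>0 ` scaling_local_algebra R)"

definition limit_algebra :: "'k bdd_op set"
  where "limit_algebra = closure (\<Union>R\<in>double_cones. limit_local_algebra R)"

definition bullet_local_algebra :: "spacetime set \<Rightarrow> (real \<Rightarrow> 'h bdd_op) set"
  where "bullet_local_algebra R = {A \<in> bounded_local_families R.
    \<forall>R'\<in>double_cones. closure R \<subseteq> R' \<longrightarrow> (\<forall>\<epsilon>>0.
      \<exists>B\<in>scaling_local_algebra R'. \<exists>B'\<in>scaling_local_algebra R'.
        Limsup F (\<lambda>\<kappa>. ereal (norm ((A (s \<kappa>) - B (s \<kappa>)) \<cdot> \<Omega>)
          + norm ((star (A (s \<kappa>)) - B' (s \<kappa>)) \<cdot> \<Omega>))) < ereal \<epsilon>)}"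

definition bullet_algebra :: "(real \<Rightarrow> 'h bdd_op) set"
  where "bullet_algebra = uniform_closure_of (\<Union>R\<in>double_cones. bullet_local_algebra R)"

end

locale extended_scaling_limit = scaling_limit m \<tau> W \<alpha>\<^sub>W \<omega> \<pi> \<Omega> \<alpha> \<phi> F s \<omega>\<^sub>0 \<pi>\<^sub>0 \<Omega>\<^sub>0
  for m \<tau> and W :: "(real \<Rightarrow> complex) \<Rightarrow> 'w::cstar_algebra" and \<alpha>\<^sub>W \<omega>
    and \<pi> :: "'w \<Rightarrow> 'h::complex_hilbert bdd_op" and \<Omega> \<alpha> \<phi>
    and F :: "'i filter" and s \<omega>\<^sub>0
    and \<pi>\<^sub>0 :: "(real \<Rightarrow> 'h bdd_op) \<Rightarrow> 'k::complex_hilbert bdd_op" and \<Omega>\<^sub>0 +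
  fixes \<pi>\<^sub>b :: "(real \<Rightarrow> 'h bdd_op) \<Rightarrow> 'k bdd_op"
  assumes \<pi>\<^sub>b_hom: "star_hom_on bullet_algebra \<pi>\<^sub>b"
    and \<pi>\<^sub>b_range: "\<pi>\<^sub>b ` bullet_algebra \<subseteq> limit_algebra"
    and \<pi>\<^sub>b_extends: "A \<in> scaling_algebra \<Longrightarrow> \<pi>\<^sub>b A = \<pi>\<^sub>0 A"
    and \<pi>\<^sub>b_local: "R \<in> double_cones \<Longrightarrow> A \<in> bullet_local_algebra R \<Longrightarrow>
      ((\<lambda>h. \<pi>\<^sub>0 (smear h A) \<cdot> v) \<longlongrightarrow> \<pi>\<^sub>b A \<cdot> v) to_delta"

end

theory Submission
  imports Defs "HOL-Probability.Sinc_Integral" "HOL-Probability.Characteristic_Functions"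
    "HOL-Complex_Analysis.Complex_Analysis" "HOL-Real_Asymp.Real_Asymp"
begin

text \<open>
  Write \<open>V f\<close> for the Weyl operator \<open>W f\<close> in the vacuum representation, \<open>\<tau>\<^sub>y\<close> for the translations of test
  functions and \<open>\<delta>\<^sub>l\<close> for the dilations.  Vacuum expectation values are invariant under translations, so
  \<open>\<langle>\<Omega>, Wg \<Omega>\<rangle> = exp (- \<parallel>f\<parallel>\<^sup>2 / 2) \<integral> g > 0\<close> and \<open>Wg\<close> is not zero.

  The image under a dilation is the weak integral of \<open>g y V (\<delta>\<^sub>l \<tau>\<^sub>y f)\<close>, by normality (\<open>\<phi>_W_avg\<close>).  The scalar
  product of \<open>V (\<delta>\<^sub>l \<tau>\<^sub>y f) \<Omega>\<close> and \<open>V (\<delta>\<^sub>l \<tau>\<^sub>y\<^sub>' f) \<Omega>\<close> has modulus \<open>exp (- \<parallel>\<delta>\<^sub>l h\<parallel>\<^sup>2 / 2)\<close> with \<open>h = \<tau>\<^sub>y f - \<tau>\<^sub>y\<^sub>' f\<close>.  Time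
  evolution with mass \<open>m\<close> turns \<open>\<integral> Im f\<close> into a zero mode of the real part: the Fourier transform of \<open>Re h\<close> at
  momentum zero is a multiple of \<open>(sin (m t') - sin (m t)) \<integral> Im f\<close>, with \<open>t\<close> and \<open>t'\<close> the times of \<open>y\<close> and \<open>y'\<close>,
  hence non-zero for almost all \<open>y'\<close> (\<open>zero_mode_\<tau>\<close>, \<open>AE_sin_neq\<close>).  If this zero mode does not vanish, then
  \<open>\<parallel>\<delta>\<^sub>l h\<parallel>\<^sup>2\<close> diverges logarithmically as \<open>l \<rightarrow> 0\<close> (\<open>vacuum_norm_dilate_lower\<close>).  The vectors become pairwise
  orthogonal, and their averages \<open>\<phi>\<^sub>l(Wg) \<Omega>\<close> and \<open>\<phi>\<^sub>l(Wg)\<^sup>* \<Omega>\<close> tend to zero (\<open>weak_average_tendsto_zero\<close>).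

  It remains to conclude from \<open>\<parallel>X\<^sub>l \<Omega>\<parallel> \<rightarrow> 0\<close> that \<open>\<pi>\<^sub>0 X = 0\<close>, where \<open>X\<close> is a local element of the scaling algebra
  obtained by smearing \<open>l \<mapsto> \<phi>\<^sub>l(Wg)\<close> over translations; the claim follows as the mollifiers shrink to a point.
  Since \<open>\<Omega>\<^sub>0\<close> is cyclic, it suffices that \<open>\<parallel>X\<^sub>l B\<^sub>l \<Omega>\<parallel> \<rightarrow> 0\<close> for all local elements \<open>B\<close> of the scaling algebra
  (\<open>limit_operator_zero\<close>).  This is a Reeh-Schlieder argument, uniform in the scale
  (\<open>annihilates_vacuum_limit\<close>).  Consider \<open>F\<^sub>l(x) = \<langle>X\<^sub>l\<^sup>* X\<^sub>l B\<^sub>l \<Omega>, U(l x) B\<^sub>l \<Omega>\<rangle>\<close>.  For \<open>x\<close> far spacelike, \<open>X\<^sub>l\<close>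
  commutes with the translated \<open>B\<^sub>l\<close>, whence \<open>F\<^sub>l(x) \<rightarrow> 0\<close>.  Along a causal line \<open>F\<^sub>l\<close> is the boundary value of a
  bounded holomorphic function on the upper half-plane (\<open>spectrum_condition\<close>), and these functions are bounded
  and equicontinuous, uniformly in \<open>l\<close>.  By compactness, convergence to zero on an interval of such a line
  implies convergence on the whole line (\<open>positive_frequency_limit_vanish\<close>).  A time-like and a light-like line
  lead to \<open>x = 0\<close>, where \<open>F\<^sub>l(0) = \<parallel>X\<^sub>l B\<^sub>l \<Omega>\<parallel>\<^sup>2\<close>.

  The properties of the free field that enter are derived from the mass shell transform.  Finite propagation
  speed (\<open>propagation\<close>) follows by shifting the integration over the rapidity by \<open>\<plusminus> i \<pi>\<close>.  The spectrum condition
  follows from the explicit form of \<open>\<langle>V g \<Omega>, U(x) V f \<Omega>\<rangle>\<close>, the exponential of a one-particle scalar product whose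
  imaginary part is half the symplectic form (\<open>one_particle_Im\<close>).
\<close>

section \<open>Test functions\<close>

text \<open>The derivative.  Iterating it describes the smoothness in the definition of test functions.\<close>

definition vd :: "(real \<Rightarrow> complex) \<Rightarrow> real \<Rightarrow> complex"
  where "vd f = (\<lambda>x. vector_derivative f (at x))"

lemma test_functions_iff:
  "f \<in> test_functions \<longleftrightarrow> (\<forall>n. (vd ^^ n) f differentiable_on UNIV) \<and> compact (supp f)"
proof -
  have "(\<lambda>h x. vector_derivative h (at x)) = vd" by (intro ext) (simp add: vd_def)
  then show ?thesis by (simp add: test_functions_def)
qed

lemma eq_0_outside_supp: "x \<notin> supp f \<Longrightarrow> f x = 0"
  using closure_subset[of "{x. f x \<noteq> 0}"] by (auto simp: supp_def)

lemma supp_subsetI: "closed S \<Longrightarrow> (\<And>x. x \<notin> S \<Longrightarrow> f x = 0) \<Longrightarrow> supp f \<subseteq> S"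
  unfolding supp_def by (rule closure_minimal) auto

lemma closed_supp: "closed (supp f)"
  by (simp add: supp_def)

lemma test_has_vd: "f \<in> test_functions \<Longrightarrow> (f has_vector_derivative vd f x) (at x)"
proof -
  assume f: "f \<in> test_functions"
  then have "(vd ^^ 0) f differentiable_on UNIV" unfolding test_functions_iff by blast
  then show ?thesis
    by (simp add: differentiable_on_def vd_def vector_derivative_works[symmetric])
qed

lemma supp_vd: 
  assumes "f \<in> test_functions"
  shows "supp (vd f) \<subseteq> supp f"
proof (rule supp_subsetI[OF closed_supp])
  fix x assume x: "x \<notin> supp f"
  have "((\<lambda>_. 0) has_vector_derivative vd f x) (at x)"
    by (rule has_vector_derivative_transform_within_open[OF test_has_vd[OF assms], of "- supp f"])
      (use x closed_supp eq_0_outside_supp in auto)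
  then show "vd f x = 0"
    by (metis vector_derivative_at vector_derivative_const_at)
qed

lemma test_vd: "f \<in> test_functions \<Longrightarrow> vd f \<in> test_functions"
proof -
  assume f: "f \<in> test_functions"
  have "compact (supp (vd f))"
    using compact_Int_closed[OF _ closed_supp, of "supp f" "vd f"] supp_vd[OF f] f
    by (simp add: test_functions_iff Int_absorb1)
  moreover have "(vd ^^ n) (vd f) differentiable_on UNIV" for n
    using f funpow_swap1[of vd n f] unfolding test_functions_iff
    by (metis comp_apply funpow.simps(2))
  ultimately show ?thesis by (simp add: test_functions_iff)
qed

lemma test_vd_power: "f \<in> test_functions \<Longrightarrow> (vd ^^ n) f \<in> test_functions"
  by (induction n) (auto intro: test_vd)

lemma test_continuous: "f \<in> test_functions \<Longrightarrow> continuous_on S f"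
  by (meson continuous_at_imp_continuous_on has_vector_derivative_continuous test_has_vd)

text \<open>Smoothness by coinduction: a set of differentiable functions that is closed under
  differentiation consists of smooth functions.\<close>

lemma test_functions_coinduct:
  assumes "f \<in> S" "compact (supp f)"
    and step: "\<And>h. h \<in> S \<Longrightarrow> \<exists>h'. h' \<in> S \<and> (\<forall>x. (h has_vector_derivative h' x) (at x))"
  shows "f \<in> test_functions"
proof -
  have vdS: "vd h \<in> S" if "h \<in> S" for h
  proof -
    from step[OF that] obtain h' where h': "h' \<in> S" "\<And>x. (h has_vector_derivative h' x) (at x)"
      by blast
    have "vd h = h'" unfolding vd_def using h'(2) vector_derivative_at by blast
    then show ?thesis using h'(1) by simp
  qed
  have "(vd ^^ n) f \<in> S" for n
    by (induction n) (auto simp: assms(1) vdS)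
  moreover have "h differentiable_on UNIV" if "h \<in> S" for h
    using step[OF that] by (metis differentiableI_vector differentiable_on_def)
  ultimately show ?thesis using assms(2) by (simp add: test_functions_iff)
qed

lemma compact_supp_iff_real:
  fixes f :: "real \<Rightarrow> complex"
  shows "compact (supp f) \<longleftrightarrow> (\<exists>r>0. \<forall>x. f x \<noteq> 0 \<longrightarrow> \<bar>x\<bar> < r)"
proof
  assume "compact (supp f)"
  then obtain r where r: "\<And>x. x \<in> supp f \<Longrightarrow> \<bar>x\<bar> \<le> r"
    using compact_imp_bounded by (metis bounded_iff real_norm_def)
  have "\<bar>x\<bar> < \<bar>r\<bar> + 1" if "f x \<noteq> 0" for x
  proof -
    have "x \<in> supp f" using eq_0_outside_supp[of x f] that by blast
    then show ?thesis using r[of x] by linarith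
  qed
  then show "\<exists>r>0. \<forall>x. f x \<noteq> 0 \<longrightarrow> \<bar>x\<bar> < r"
    by (intro exI[of _ "\<bar>r\<bar> + 1"] conjI allI impI) simp_all
next
  assume "\<exists>r>0. \<forall>x. f x \<noteq> 0 \<longrightarrow> \<bar>x\<bar> < r"
  then obtain r where r: "\<And>x. f x \<noteq> 0 \<Longrightarrow> \<bar>x\<bar> < r" by blast
  have "f x = 0" if "x \<notin> {-r..r}" for x
    using r[of x] that by (cases "f x = 0") auto
  then have "supp f \<subseteq> {-r..r}" by (intro supp_subsetI closed_atLeastAtMost) blast
  then show "compact (supp f)"
    by (metis closed_supp compact_Icc compact_Int_closed inf.absorb2)
qed

lemma test_bounded_supp:
  assumes "f \<in> test_functions"
  obtains r where "r > 0" "\<And>x. f x \<noteq> 0 \<Longrightarrow> \<bar>x\<bar> < r"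
  using assms compact_supp_iff_real[of f] by (auto simp: test_functions_iff)

lemma test_linear_dilate:
  assumes L: "bounded_linear L" and l: "l > 0" and f: "f \<in> test_functions"
  shows "(\<lambda>x. L (f (x / l))) \<in> test_functions"
proof (rule test_functions_coinduct)
  let ?S = "{\<lambda>x. L (f (x / l)) | L f. bounded_linear L \<and> f \<in> test_functions}"
  show "(\<lambda>x. L (f (x / l))) \<in> ?S" using L f by blast
  obtain r where r: "r > 0" "\<And>x. f x \<noteq> 0 \<Longrightarrow> \<bar>x\<bar> < r" using test_bounded_supp[OF f] by blast
  have "L (f (x / l)) \<noteq> 0 \<Longrightarrow> \<bar>x\<bar> < r * l" for x
    using r(2)[of "x / l"] linear_0[OF bounded_linear.linear[OF L]] l by (cases "f (x / l) = 0") (auto simp: field_simps)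
  then show "compact (supp (\<lambda>x. L (f (x / l))))"
    unfolding compact_supp_iff_real using mult_pos_pos[OF r(1) l] by blast
  fix h assume "h \<in> ?S"
  then obtain M k where h: "h = (\<lambda>x. M (k (x / l)))" and M: "bounded_linear M" and k: "k \<in> test_functions"
    by blast
  have "(h has_vector_derivative M ((1/l) *\<^sub>R vd k (x / l))) (at x)" for x
  proof -
    have "((k \<circ> (\<lambda>x. x / l)) has_vector_derivative (1/l) *\<^sub>R vd k (x / l)) (at x)"
      by (rule vector_diff_chain_at) 
        (use l test_has_vd[OF k] in \<open>auto intro!: derivative_eq_intros simp: has_real_derivative_iff_has_vector_derivative[symmetric]\<close>)
    from bounded_linear.has_vector_derivative[OF M this] show ?thesis by (simp add: h o_def)
  qed
  moreover have "(\<lambda>x. M ((1/l) *\<^sub>R vd k (x / l))) \<in> ?S"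
    unfolding mem_Collect_eq
    by (rule exI[of _ "\<lambda>z. M ((1/l) *\<^sub>R z)"], rule exI[of _ "vd k"])
      (use bounded_linear_compose[OF M bounded_linear_scaleR_right[of "1/l"]] test_vd[OF k] in simp)
  ultimately show "\<exists>h'. h' \<in> ?S \<and> (\<forall>x. (h has_vector_derivative h' x) (at x))" by blast
qed

lemma test_linear:
  assumes "bounded_linear L" "f \<in> test_functions"
  shows "(\<lambda>x. L (f x)) \<in> test_functions"
  using test_linear_dilate[of L 1 f] assms by simp

lemma test_add:
  assumes "f \<in> test_functions" "g \<in> test_functions"
  shows "f + g \<in> test_functions"
proof (rule test_functions_coinduct)
  let ?S = "{f + g | f g. f \<in> test_functions \<and> g \<in> test_functions}"
  show "f + g \<in> ?S" using assms by blast
  obtain r where r: "r > 0" "\<And>x. f x \<noteq> 0 \<Longrightarrow> \<bar>x\<bar> < r" using test_bounded_supp[OF assms(1)] by blast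
  obtain r' where r': "r' > 0" "\<And>x. g x \<noteq> 0 \<Longrightarrow> \<bar>x\<bar> < r'" using test_bounded_supp[OF assms(2)] by blast
  have "(f + g) x \<noteq> 0 \<Longrightarrow> \<bar>x\<bar> < max r r'" for x
    using r(2)[of x] r'(2)[of x] by fastforce
  then show "compact (supp (f + g))"
    unfolding compact_supp_iff_real using r(1) by (intro exI[of _ "max r r'"]) auto
  fix h assume "h \<in> ?S"
  then obtain u v where h: "h = u + v" and u: "u \<in> test_functions" and v: "v \<in> test_functions" by blast
  have "(h has_vector_derivative (vd u + vd v) x) (at x)" for x
    using has_vector_derivative_add[OF test_has_vd[OF u] test_has_vd[OF v]] by (simp add: h plus_fun_def)
  then show "\<exists>h'. h' \<in> ?S \<and> (\<forall>x. (h has_vector_derivative h' x) (at x))"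
    using test_vd[OF u] test_vd[OF v] by blast
qed

lemma test_minus: "f \<in> test_functions \<Longrightarrow> - f \<in> test_functions"
  using test_linear[OF bounded_linear_minus[OF bounded_linear_ident]] by (simp add: fun_Compl_def)

lemma test_zero: "0 \<in> test_functions"
  by (rule test_functions_coinduct[of _ "{0}"]) (auto simp: supp_def zero_fun_def)

lemma test_diff: "f \<in> test_functions \<Longrightarrow> g \<in> test_functions \<Longrightarrow> f - g \<in> test_functions"
  using test_add[OF _ test_minus] by (metis diff_conv_add_uminus)

lemma test_re_part: "f \<in> test_functions \<Longrightarrow> re_part f \<in> test_functions"
  unfolding re_part_def
  by (rule test_linear) (auto intro: bounded_linear_compose[OF bounded_linear_of_real bounded_linear_Re])

lemma test_im_part: "f \<in> test_functions \<Longrightarrow> im_part f \<in> test_functions"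
  unfolding im_part_def
  by (rule test_linear) (auto intro: bounded_linear_compose[OF bounded_linear_of_real bounded_linear_Im])

lemma test_dilate: 
  assumes "l > 0" "f \<in> test_functions"
  shows "dilate l f \<in> test_functions"
proof -
  have "bounded_linear (\<lambda>z. complex_of_real (Re z / l) + \<i> * Im z)"
    by (intro bounded_linear_add bounded_linear_compose[OF bounded_linear_of_real]
        bounded_linear_compose[OF bounded_linear_mult_right]
        bounded_linear_compose[OF bounded_linear_divide bounded_linear_Re] bounded_linear_Im)
  from test_linear_dilate[OF this assms] show ?thesis by (simp add: dilate_def[abs_def])
qed

section \<open>Fourier transforms of test functions\<close>

lemma integrable_compact_support:
  fixes h :: "'a::euclidean_space \<Rightarrow> 'b::{banach, second_countable_topology}"
  assumes "continuous_on UNIV h" "compact S" "\<And>x. x \<notin> S \<Longrightarrow> h x = 0"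
  shows "integrable lborel h"
proof -
  have "integrable lborel (\<lambda>x. indicator S x *\<^sub>R h x)"
    by (rule borel_integrable_compact) (use assms continuous_on_subset[of UNIV h S] in auto)
  moreover have "(\<lambda>x. indicator S x *\<^sub>R h x) = h" using assms(3) by (auto simp: indicator_def)
  ultimately show ?thesis by simp
qed

lemma test_integrable: 
  assumes "f \<in> test_functions" "continuous_on UNIV e"
  shows "integrable lborel (\<lambda>x. e x * f x)"
  using assms by (intro integrable_compact_support[of _ "supp f"] continuous_intros)
    (auto simp: test_functions_iff eq_0_outside_supp intro: test_continuous)

text \<open>The integral \<open>\<integral> exp(-iqy) f(y) dy\<close>: the Fourier transform without its normalising factor, at complex
  momenta \<open>q\<close>.\<close>

definition laplace :: "(real \<Rightarrow> complex) \<Rightarrow> complex \<Rightarrow> complex"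
  where "laplace f q = (LINT y|lborel. exp (- (\<i> * q * of_real y)) * f y)"

lemma fourier_laplace: "fourier f p = complex_of_real ((2 * pi) powr (-1/2)) * laplace f (of_real p)"
  by (simp add: fourier_def laplace_def scaleR_conv_of_real)

lemma integral_derivative_zero:
  fixes h :: "real \<Rightarrow> complex"
  assumes "\<And>x. (h has_vector_derivative h' x) (at x)" "compact (supp h)" "integrable lborel h'"
    and h': "\<And>x. x \<notin> supp h \<Longrightarrow> h' x = 0"
  shows "(LINT x|lborel. h' x) = 0"
proof -
  obtain r where r: "r > 0" "\<And>x. h x \<noteq> 0 \<Longrightarrow> \<bar>x\<bar> < r" using assms(2) compact_supp_iff_real by blast
  have "(h' has_integral (h r - h (-r))) {-r..r}"
    by (rule fundamental_theorem_of_calculus)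
      (use r(1) assms(1) in \<open>auto intro: has_vector_derivative_at_within\<close>)
  moreover have "h r = 0" "h (-r) = 0" using r(2)[of r] r(2)[of "-r"] r(1) by auto
  ultimately have int: "(h' has_integral 0) {-r..r}" by simp
  have "h x = 0" if "x \<notin> {-r..r}" for x
  proof (rule ccontr)
    assume "h x \<noteq> 0"
    from r(2)[OF this] that show False by auto
  qed
  then have "supp h \<subseteq> {-r..r}" by (rule supp_subsetI[OF closed_atLeastAtMost])
  then have "h' x = 0" if "x \<notin> {-r..r}" for x using that h' by blast
  then have "(h' has_integral 0) UNIV"
    by (rule has_integral_on_superset[OF int]) auto
  then show ?thesis using has_integral_unique[OF has_integral_integral_lborel[OF assms(3)]] by simp
qed

lemma laplace_vd:
  assumes f: "f \<in> test_functions"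
  shows "laplace (vd f) q = \<i> * q * laplace f q"
proof -
  let ?e = "\<lambda>y::real. exp (- (\<i> * q * of_real y))"
  have cont: "continuous_on UNIV ?e" by (intro continuous_intros)
  have e: "(?e has_vector_derivative - (\<i> * q) * ?e y) (at y)" for y
    by (rule has_vector_derivative_real_field) (auto intro!: derivative_eq_intros)
  have i1: "integrable lborel (\<lambda>y. ?e y * vd f y)"
    by (rule test_integrable[OF test_vd[OF f] cont])
  have i2: "integrable lborel (\<lambda>y. \<i> * q * (?e y * f y))"
    by (intro integrable_mult_right test_integrable[OF f cont])
  have "(LINT y|lborel. ?e y * vd f y - \<i> * q * (?e y * f y)) = 0"
  proof (rule integral_derivative_zero)
    show "((\<lambda>y. ?e y * f y) has_vector_derivative ?e y * vd f y - \<i> * q * (?e y * f y)) (at y)" for y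
      using has_vector_derivative_mult[OF e test_has_vd[OF f], of y] by (simp add: algebra_simps)
    have s: "supp (\<lambda>y. ?e y * f y) = supp f" by (simp add: supp_def)
    then show "compact (supp (\<lambda>y. ?e y * f y))" using f by (simp add: test_functions_iff)
    show "x \<notin> supp (\<lambda>y. ?e y * f y) \<Longrightarrow> ?e x * vd f x - \<i> * q * (?e x * f x) = 0" for x
      unfolding s using supp_vd[OF f] eq_0_outside_supp[of x f] eq_0_outside_supp[of x "vd f"] by auto
  qed (use i1 i2 in simp)
  then show ?thesis using i1 i2 by (simp add: laplace_def)
qed

lemma laplace_vd_power:
  assumes "f \<in> test_functions"
  shows "laplace ((vd ^^ n) f) q = (\<i> * q) ^ n * laplace f q"
  by (induction n) (simp_all add: laplace_vd test_vd_power assms)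

lemma cmod_laplace_real_le:
  assumes "f \<in> test_functions"
  shows "cmod (laplace f (of_real p)) \<le> (LINT y|lborel. cmod (f y))"
proof -
  have "cmod (laplace f (of_real p)) \<le> (LINT y|lborel. cmod (exp (- (\<i> * of_real p * of_real y)) * f y))"
    unfolding laplace_def by (rule integral_norm_bound)
  then show ?thesis by (simp add: norm_mult)
qed

text \<open>By four integrations by parts.  The exponent is chosen such that products with the energy remain
  integrable.\<close>

lemma laplace_decay:
  assumes f: "f \<in> test_functions"
  obtains C where "C \<ge> 0" "\<And>p::real. cmod (laplace f (of_real p)) \<le> C / (1 + p\<^sup>2)\<^sup>2"
proof -
  define C0 where "C0 = (LINT y|lborel. cmod (f y))"
  define C4 where "C4 = (LINT y|lborel. cmod ((vd ^^ 4) f y))"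
  have "cmod (laplace f (of_real p)) \<le> 2 * (C0 + C4) / (1 + p\<^sup>2)\<^sup>2" for p :: real
  proof -
    let ?u = "cmod (laplace f (of_real p))"
    have 0: "?u \<le> C0" unfolding C0_def by (rule cmod_laplace_real_le[OF f])
    have "cmod ((\<i> * of_real p) ^ 4 * laplace f (of_real p)) \<le> C4"
      unfolding laplace_vd_power[OF f, symmetric] C4_def
      by (rule cmod_laplace_real_le) (rule test_vd_power[OF f])
    then have 4: "p ^ 4 * ?u \<le> C4" by (simp add: norm_mult norm_power)
    \<comment> \<open>It suffices to bound the transforms of \<open>f\<close> and of its fourth derivative.\<close>
    have "(1 + p\<^sup>2)\<^sup>2 \<le> 2 * (1 + p ^ 4)"
      using zero_le_power2[of "p\<^sup>2 - 1"] by (simp add: power2_eq_square power4_eq_xxxx algebra_simps)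
    then have "(1 + p\<^sup>2)\<^sup>2 * ?u \<le> 2 * (1 + p ^ 4) * ?u" by (rule mult_right_mono) simp
    also have "\<dots> \<le> 2 * (C0 + C4)" using 0 4 by (simp add: algebra_simps)
    finally have "?u * (1 + p\<^sup>2)\<^sup>2 \<le> 2 * (C0 + C4)" by (simp add: mult.commute)
    moreover have "(1 + p\<^sup>2)\<^sup>2 > 0" by (rule zero_less_power) (simp add: add_pos_nonneg)
    ultimately show ?thesis by (simp only: pos_le_divide_eq)
  qed
  moreover have "0 \<le> 2 * (C0 + C4)" by (simp add: C0_def C4_def)
  ultimately show ?thesis using that by blast
qed

lemma integrable_inverse_1_plus_sq: "integrable lborel (\<lambda>p::real. 1 / (1 + p\<^sup>2))"
  using integrable_inverse_1_plus_square
  by (simp add: set_integrable_def inverse_eq_divide)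

lemma continuous_on_LINT:
  fixes k :: "'a::metric_space \<Rightarrow> 'b \<Rightarrow> 'c::{banach, second_countable_topology}"
  assumes meas: "\<And>x. x \<in> S \<Longrightarrow> k x \<in> borel_measurable M"
    and cont: "\<And>y. continuous_on S (\<lambda>x. k x y)"
    and bound: "\<And>x y. x \<in> S \<Longrightarrow> norm (k x y) \<le> B y" and B: "integrable M B"
  shows "continuous_on S (\<lambda>x. LINT y|M. k x y)"
  unfolding continuous_on_sequentially
proof (intro allI ballI impI, elim conjE)
  fix X a assume a: "a \<in> S" and X: "\<forall>n. X n \<in> S" "X \<longlonglongrightarrow> a"
  show "((\<lambda>x. LINT y|M. k x y) \<circ> X) \<longlonglongrightarrow> (LINT y|M. k a y)"
    unfolding o_def
  proof (rule integral_dominated_convergence[of _ _ _ B])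
    show "AE y in M. (\<lambda>i. k (X i) y) \<longlonglongrightarrow> k a y"
      using cont a X unfolding continuous_on_sequentially by (auto simp: o_def)
  qed (use meas a X bound B in auto)
qed

lemma laplace_continuous:
  assumes f: "f \<in> test_functions"
  shows "continuous_on UNIV (\<lambda>p::real. laplace f (of_real p))"
  unfolding laplace_def
proof (rule continuous_on_LINT[where B = "\<lambda>y. cmod (f y)"])
  show "(\<lambda>y. exp (- (\<i> * of_real p * of_real y)) * f y) \<in> borel_measurable lborel" for p :: real
    by (rule borel_measurable_integrable, rule test_integrable[OF f]) (intro continuous_intros)
  show "integrable lborel (\<lambda>y. cmod (f y))"
    using test_integrable[OF f, of "\<lambda>_. 1"] by simp
qed (auto intro!: continuous_intros simp: norm_mult)

lemma integrable_bound_1_plus_sq: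
  fixes h :: "real \<Rightarrow> complex"
  assumes "continuous_on UNIV h" "\<And>p. cmod (h p) \<le> C / (1 + p\<^sup>2)"
  shows "integrable lborel h"
proof (rule Bochner_Integration.integrable_bound)
  show "integrable lborel (\<lambda>p. C * (1 / (1 + p\<^sup>2)))"
    by (intro integrable_mult_right integrable_inverse_1_plus_sq)
  show "h \<in> borel_measurable lborel" using assms(1) by (simp add: borel_measurable_continuous_onI)
  show "AE p in lborel. norm (h p) \<le> norm (C * (1 / (1 + p\<^sup>2)))"
  proof (rule AE_I2)
    fix p
    have "0 \<le> C / (1 + p\<^sup>2)" by (rule order_trans[OF norm_ge_zero assms(2)])
    then show "norm (h p) \<le> norm (C * (1 / (1 + p\<^sup>2)))"
      using assms(2)[of p] by (metis abs_of_nonneg mult.right_neutral real_norm_def times_divide_eq_right)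
  qed
qed

lemma decay_mono: 
  assumes "0 \<le> (C::real)" shows "C / (1 + p\<^sup>2)\<^sup>2 \<le> C / (1 + p\<^sup>2)"
proof -
  have "1 + p\<^sup>2 \<le> (1 + p\<^sup>2)\<^sup>2" 
    by (rule self_le_power) simp_all
  moreover have "1 + p\<^sup>2 > 0" by (simp add: add_pos_nonneg)
  ultimately show ?thesis using assms by (intro divide_left_mono) auto
qed

lemma laplace_integrable:
  assumes f: "f \<in> test_functions"
  shows "integrable lborel (\<lambda>p::real. laplace f (of_real p))"
proof -
  obtain C where "C \<ge> 0" "\<And>p::real. cmod (laplace f (of_real p)) \<le> C / (1 + p\<^sup>2)\<^sup>2"
    using laplace_decay[OF f] by blast
  then have "\<And>p::real. cmod (laplace f (of_real p)) \<le> C / (1 + p\<^sup>2)"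
    by (meson decay_mono order_trans)
  then show ?thesis using laplace_continuous[OF f] by (intro integrable_bound_1_plus_sq)
qed

text \<open>Integrability for exchanging the order of integration in Fourier integrals.\<close>

lemma integrable_pair_bounded:
  fixes k :: "real \<times> real \<Rightarrow> complex"
  assumes k: "continuous_on UNIV k" "\<And>z. cmod (k z) \<le> 1"
    and f: "integrable lborel f" and g: "integrable lborel g"
  shows "integrable (lborel \<Otimes>\<^sub>M lborel) (\<lambda>(x, y). k (x, y) * (f x * g y))"
proof -
  have [measurable]: "k \<in> borel_measurable (lborel \<Otimes>\<^sub>M lborel)"
    using k(1) by (simp add: lborel_prod borel_measurable_continuous_onI)
  have [measurable]: "f \<in> borel_measurable lborel" "g \<in> borel_measurable lborel" using f g by auto
  have fg: "integrable (lborel \<Otimes>\<^sub>M lborel) (\<lambda>(x, y). f x * g y)"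
    by (rule lborel_pair.Fubini_integrable) (use f g in \<open>auto simp: norm_mult\<close>)
  show ?thesis
  proof (rule Bochner_Integration.integrable_bound[OF fg])
    show "AE z in lborel \<Otimes>\<^sub>M lborel. norm (case z of (x, y) \<Rightarrow> k (x, y) * (f x * g y)) \<le> norm (case z of (x, y) \<Rightarrow> f x * g y)"
      by (rule AE_I2) (use mult_right_mono[OF k(2)] in \<open>auto simp: norm_mult split: prod.split\<close>)
  qed measurable
qed

lemma gaussian_transform:
  "integrable lborel (\<lambda>p::real. exp (- p\<^sup>2 / 2))"
  "(LINT p|lborel. exp (\<i> * of_real (p * z)) * of_real (exp (- p\<^sup>2 / 2))) = of_real (sqrt (2 * pi) * exp (- z\<^sup>2 / 2))"
proof -
  have d: "std_normal_density p = exp (- p\<^sup>2 / 2) / sqrt (2 * pi)" for p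
    by (simp add: std_normal_density_def)
  have "integrable lborel (\<lambda>p. sqrt (2 * pi) * std_normal_density p)"
    by (intro integrable_mult_right integrable_normal_density) simp
  then show "integrable lborel (\<lambda>p::real. exp (- p\<^sup>2 / 2))" by (simp add: d)
  have "of_real (exp (- z\<^sup>2 / 2)) = char std_normal_distribution z"
    by (simp add: char_std_normal_distribution)
  also have "\<dots> = (LINT p|lborel. std_normal_density p *\<^sub>R iexp (z * p))"
    unfolding char_def by (subst integral_density) auto
  also have "\<dots> = (LINT p|lborel. of_real (1 / sqrt (2 * pi)) * (exp (\<i> * of_real (p * z)) * of_real (exp (- p\<^sup>2 / 2))))"
    by (rule Bochner_Integration.integral_cong) (auto simp: d scaleR_conv_of_real mult_ac)
  also have "\<dots> = of_real (1 / sqrt (2 * pi)) * (LINT p|lborel. exp (\<i> * of_real (p * z)) * of_real (exp (- p\<^sup>2 / 2)))"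
    by (rule integral_mult_right_zero)
  finally show "(LINT p|lborel. exp (\<i> * of_real (p * z)) * of_real (exp (- p\<^sup>2 / 2))) = of_real (sqrt (2 * pi) * exp (- z\<^sup>2 / 2))"
    by (simp add: field_simps)
qed

lemma gaussian_transform_scaled:
  assumes e: "e > 0"
  shows "(LINT p|lborel. exp (\<i> * of_real (p * z)) * of_real (exp (- (e * p)\<^sup>2 / 2)))
    = of_real (sqrt (2 * pi) / e * exp (- (z / e)\<^sup>2 / 2))"
proof -
  have "(LINT p|lborel. exp (\<i> * of_real (p * z)) * of_real (exp (- (e * p)\<^sup>2 / 2)))
    = \<bar>1 / e\<bar> *\<^sub>R (LINT q|lborel. exp (\<i> * of_real ((0 + (1 / e) * q) * z)) * of_real (exp (- (e * (0 + (1 / e) * q))\<^sup>2 / 2)))"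
    by (rule lborel_integral_real_affine) (use e in simp)
  also have "\<dots> = (1 / e) *\<^sub>R (LINT q|lborel. exp (\<i> * of_real (q * (z / e))) * of_real (exp (- q\<^sup>2 / 2)))"
    using e by (simp add: mult.commute)
  finally show ?thesis
    unfolding gaussian_transform(2) by (simp add: scaleR_conv_of_real)
qed

text \<open>Gaussian summability: the mollified inverse transform is the average of \<open>f\<close> over a Gaussian of
  width \<open>e\<close>.\<close>

lemma laplace_gaussian_inversion:
  assumes f: "f \<in> test_functions" and e: "e > 0"
  shows "(LINT p|lborel. laplace f (of_real p) * (exp (\<i> * of_real (p * x)) * of_real (exp (- (e * p)\<^sup>2 / 2))))
    = of_real (sqrt (2 * pi)) * (LINT u|lborel. f (x + e * u) * of_real (exp (- u\<^sup>2 / 2)))"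
proof -
  let ?g = "\<lambda>p::real. complex_of_real (exp (- (e * p)\<^sup>2 / 2))"
  let ?k = "\<lambda>(p, y). exp (\<i> * complex_of_real (p * (x - y)))"
  have "integrable lborel (\<lambda>p. exp (- (0 + e * p)\<^sup>2 / 2))"
    by (rule lborel_integrable_real_affine[OF gaussian_transform(1)]) (use e in simp)
  then have g: "integrable lborel ?g" by simp
  have fi: "integrable lborel f" using test_integrable[OF f, of "\<lambda>_. 1"] by simp
  have int: "integrable (lborel \<Otimes>\<^sub>M lborel) (\<lambda>(p, y). ?k (p, y) * (?g p * f y))"
    by (rule integrable_pair_bounded[OF _ _ g fi])
      (auto intro!: continuous_intros simp: case_prod_beta)
  have "(LINT p|lborel. laplace f (of_real p) * (exp (\<i> * of_real (p * x)) * ?g p))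
    = (LINT p|lborel. (LINT y|lborel. ?k (p, y) * (?g p * f y)))"
  proof (rule Bochner_Integration.integral_cong[OF refl])
    fix p :: real
    have "(LINT y|lborel. ?k (p, y) * (?g p * f y))
        = (LINT y|lborel. (exp (- (\<i> * of_real p * of_real y)) * f y) * (exp (\<i> * of_real (p * x)) * ?g p))"
      by (rule Bochner_Integration.integral_cong[OF refl]) (simp add: algebra_simps exp_diff exp_minus field_simps)
    also have "\<dots> = (LINT y|lborel. exp (- (\<i> * of_real p * of_real y)) * f y) * (exp (\<i> * of_real (p * x)) * ?g p)"
      by (rule integral_mult_left_zero)
    finally show "laplace f (of_real p) * (exp (\<i> * of_real (p * x)) * ?g p) = (LINT y|lborel. ?k (p, y) * (?g p * f y))"
      by (simp add: laplace_def)
  qed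
  also have "\<dots> = (LINT y|lborel. (LINT p|lborel. ?k (p, y) * (?g p * f y)))"
    using lborel_pair.Fubini_integral[OF int] by simp
  also have "\<dots> = (LINT y|lborel. of_real (sqrt (2 * pi) / e * exp (- ((x - y) / e)\<^sup>2 / 2)) * f y)"
  proof (rule Bochner_Integration.integral_cong[OF refl])
    fix y :: real
    have "(LINT p|lborel. ?k (p, y) * (?g p * f y)) = (LINT p|lborel. (exp (\<i> * of_real (p * (x - y))) * ?g p) * f y)"
      by (simp add: mult_ac)
    also have "\<dots> = (LINT p|lborel. exp (\<i> * of_real (p * (x - y))) * ?g p) * f y"
      by (rule integral_mult_left_zero)
    finally show "(LINT p|lborel. ?k (p, y) * (?g p * f y)) = of_real (sqrt (2 * pi) / e * exp (- ((x - y) / e)\<^sup>2 / 2)) * f y"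
      using gaussian_transform_scaled[OF e, of "x - y"] by simp
  qed
  also have "\<dots> = \<bar>e\<bar> *\<^sub>R (LINT u|lborel. of_real (sqrt (2 * pi) / e * exp (- ((x - (x + e * u)) / e)\<^sup>2 / 2)) * f (x + e * u))"
    by (rule lborel_integral_real_affine) (use e in simp)
  also have "\<dots> = (LINT u|lborel. of_real (sqrt (2 * pi)) * (f (x + e * u) * of_real (exp (- u\<^sup>2 / 2))))"
    unfolding integral_scaleR_right[symmetric]
    by (rule Bochner_Integration.integral_cong[OF refl]) (use e in \<open>simp add: scaleR_conv_of_real field_simps\<close>)
  also have "\<dots> = of_real (sqrt (2 * pi)) * (LINT u|lborel. f (x + e * u) * of_real (exp (- u\<^sup>2 / 2)))"
    by (rule integral_mult_right_zero)
  finally show ?thesis .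
qed

lemma test_bounded:
  assumes "f \<in> test_functions"
  obtains B where "\<And>x. cmod (f x) \<le> B"
proof -
  have "bounded (f ` supp f)"
    using assms by (intro compact_imp_bounded compact_continuous_image test_continuous)
      (auto simp: test_functions_iff)
  then obtain B where B: "\<And>x. x \<in> supp f \<Longrightarrow> cmod (f x) \<le> B" by (auto simp: bounded_iff)
  have "cmod (f x) \<le> max B 0" for x
    by (cases "x \<in> supp f") (use B eq_0_outside_supp[of x f] in \<open>auto simp: le_max_iff_disj\<close>)
  then show ?thesis using that by blast
qed

lemma of_real_sqrt_2pi_mult:
  "complex_of_real (sqrt (2 * pi)) * (z * of_real (sqrt (2 * pi))) = of_real (2 * pi) * z"
proof -
  have "sqrt (2 * pi) * sqrt (2 * pi) = 2 * pi" by simp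
  then have "complex_of_real (sqrt (2 * pi)) * of_real (sqrt (2 * pi)) = of_real (2 * pi)"
    by (metis of_real_mult)
  then show ?thesis by (metis mult.assoc mult.commute)
qed

text \<open>Fourier inversion, as the limit of Gaussian summability for \<open>e \<rightarrow> 0\<close>, where both sides converge dominatedly.\<close>

lemma laplace_inversion:
  assumes f: "f \<in> test_functions"
  shows "(LINT p|lborel. laplace f (of_real p) * exp (\<i> * of_real (p * x))) = of_real (2 * pi) * f x"
proof -
  define e where "e n = 1 / real (Suc n)" for n
  have e0: "e n > 0" for n by (simp add: e_def)
  have elim: "e \<longlonglongrightarrow> 0" unfolding e_def using LIMSEQ_inverse_real_of_nat by (simp add: inverse_eq_divide)
  have m: "(\<lambda>p::real. laplace f (of_real p)) \<in> borel_measurable borel"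
    using laplace_continuous[OF f] by (rule borel_measurable_continuous_onI)
  have 1: "(\<lambda>n. LINT p|lborel. laplace f (of_real p) * (exp (\<i> * of_real (p * x)) * of_real (exp (- (e n * p)\<^sup>2 / 2))))
     \<longlonglongrightarrow> (LINT p|lborel. laplace f (of_real p) * exp (\<i> * of_real (p * x)))"
  proof (rule integral_dominated_convergence[where w = "\<lambda>p. cmod (laplace f (of_real p))"])
    show "AE p in lborel. (\<lambda>n. laplace f (of_real p) * (exp (\<i> * of_real (p * x)) * of_real (exp (- (e n * p)\<^sup>2 / 2))))
      \<longlonglongrightarrow> laplace f (of_real p) * exp (\<i> * of_real (p * x))"
    proof (rule AE_I2)
      fix p :: real
      have "(\<lambda>n. laplace f (of_real p) * (exp (\<i> * of_real (p * x)) * of_real (exp (- (e n * p)\<^sup>2 / 2))))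
        \<longlonglongrightarrow> laplace f (of_real p) * (exp (\<i> * of_real (p * x)) * of_real (exp (- (0 * p)\<^sup>2 / 2)))"
        by (intro tendsto_intros elim) simp
      then show "(\<lambda>n. laplace f (of_real p) * (exp (\<i> * of_real (p * x)) * of_real (exp (- (e n * p)\<^sup>2 / 2))))
        \<longlonglongrightarrow> laplace f (of_real p) * exp (\<i> * of_real (p * x))" by simp
    qed
  qed (use m laplace_integrable[OF f] in \<open>auto simp: norm_mult mult_left_le\<close>)
  obtain B where B: "\<And>x. cmod (f x) \<le> B" using test_bounded[OF f] by blast
  have B0: "0 \<le> B" using order_trans[OF norm_ge_zero B] .
  have fm: "f \<in> borel_measurable borel"
    using test_continuous[OF f] by (rule borel_measurable_continuous_onI)
  have 2: "(\<lambda>n. LINT u|lborel. f (x + e n * u) * of_real (exp (- u\<^sup>2 / 2)))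
     \<longlonglongrightarrow> (LINT u|lborel. f x * of_real (exp (- u\<^sup>2 / 2)))"
  proof (rule integral_dominated_convergence[where w = "\<lambda>u. B * exp (- u\<^sup>2 / 2)"])
    have "(\<lambda>n. f (x + e n * u)) \<longlonglongrightarrow> f x" for u
    proof -
      have "(\<lambda>n. x + e n * u) \<longlonglongrightarrow> x + 0 * u" by (intro tendsto_intros elim)
      then show ?thesis
        using continuous_on_tendsto_compose[OF test_continuous[OF f, of UNIV]] by simp
    qed
    then show "AE u in lborel. (\<lambda>n. f (x + e n * u) * of_real (exp (- u\<^sup>2 / 2))) \<longlonglongrightarrow> f x * of_real (exp (- u\<^sup>2 / 2))"
      by (auto intro: tendsto_mult_right)
  qed (use B B0 fm gaussian_transform(1) in \<open>auto simp: norm_mult mult_right_mono\<close>)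
  have g1: "(LINT u|lborel. of_real (exp (- u\<^sup>2 / 2))) = complex_of_real (sqrt (2 * pi))"
    using gaussian_transform(2)[of 0] by simp
  have "(LINT u|lborel. f x * of_real (exp (- u\<^sup>2 / 2))) = f x * of_real (sqrt (2 * pi))"
    by (simp only: integral_mult_right_zero g1)
  from 2[unfolded this] have "(\<lambda>n. of_real (sqrt (2 * pi)) * (LINT u|lborel. f (x + e n * u) * of_real (exp (- u\<^sup>2 / 2))))
     \<longlonglongrightarrow> of_real (sqrt (2 * pi)) * (f x * of_real (sqrt (2 * pi)))"
    by (rule tendsto_mult_left)
  moreover have "(\<lambda>n. LINT p|lborel. laplace f (of_real p) * (exp (\<i> * of_real (p * x)) * of_real (exp (- (e n * p)\<^sup>2 / 2))))
     = (\<lambda>n. of_real (sqrt (2 * pi)) * (LINT u|lborel. f (x + e n * u) * of_real (exp (- u\<^sup>2 / 2))))"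
    by (rule ext) (rule laplace_gaussian_inversion[OF f e0])
  ultimately have "(\<lambda>n. LINT p|lborel. laplace f (of_real p) * (exp (\<i> * of_real (p * x)) * of_real (exp (- (e n * p)\<^sup>2 / 2))))
     \<longlonglongrightarrow> of_real (sqrt (2 * pi)) * (f x * of_real (sqrt (2 * pi)))"
    by (simp only:)
  then have "(LINT p|lborel. laplace f (of_real p) * exp (\<i> * of_real (p * x))) 
    = of_real (sqrt (2 * pi)) * (f x * of_real (sqrt (2 * pi)))"
    by (rule LIMSEQ_unique[OF 1])
  then show ?thesis by (simp only: of_real_sqrt_2pi_mult)
qed

lemma laplace_plancherel:
  assumes f: "f \<in> test_functions" and g: "g \<in> test_functions"
  shows "(LINT p|lborel. cnj (laplace f (of_real p)) * laplace g (of_real p)) = of_real (2 * pi) * (LINT x|lborel. cnj (f x) * g x)"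
proof -
  let ?k = "\<lambda>(p, y). exp (\<i> * complex_of_real (p * y))"
  have fi: "integrable lborel (\<lambda>x. cnj (f x))" using test_integrable[OF f, of "\<lambda>_. 1"] by simp
  have int: "integrable (lborel \<Otimes>\<^sub>M lborel) (\<lambda>(p, y). ?k (p, y) * (laplace g (of_real p) * cnj (f y)))"
    by (rule integrable_pair_bounded[OF _ _ laplace_integrable[OF g] fi])
      (auto intro!: continuous_intros simp: case_prod_beta)
  have "of_real (2 * pi) * (LINT x|lborel. cnj (f x) * g x) = (LINT x|lborel. cnj (f x) * (of_real (2 * pi) * g x))"
    by (subst integral_mult_right_zero[symmetric]) (simp add: mult_ac)
  also have "\<dots> = (LINT x|lborel. (LINT p|lborel. ?k (p, x) * (laplace g (of_real p) * cnj (f x))))"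
    unfolding laplace_inversion[OF g, symmetric]
    by (subst integral_mult_right_zero[symmetric]) (simp add: mult_ac)
  also have "\<dots> = (LINT p|lborel. (LINT x|lborel. ?k (p, x) * (laplace g (of_real p) * cnj (f x))))"
    using lborel_pair.Fubini_integral[OF int] by simp
  also have "\<dots> = (LINT p|lborel. cnj (laplace f (of_real p)) * laplace g (of_real p))"
  proof (rule Bochner_Integration.integral_cong[OF refl])
    fix p :: real
    have "(LINT x|lborel. ?k (p, x) * (laplace g (of_real p) * cnj (f x)))
        = (LINT x|lborel. cnj (exp (- (\<i> * of_real p * of_real x)) * f x) * laplace g (of_real p))"
      by (rule Bochner_Integration.integral_cong[OF refl]) (simp add: exp_cnj mult_ac)
    also have "\<dots> = (LINT x|lborel. cnj (exp (- (\<i> * of_real p * of_real x)) * f x)) * laplace g (of_real p)"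
      by (rule integral_mult_left_zero)
    also have "\<dots> = cnj (laplace f (of_real p)) * laplace g (of_real p)"
      unfolding laplace_def by (rule arg_cong[OF Bochner_Integration.integral_cnj])
    finally show "(LINT x|lborel. ?k (p, x) * (laplace g (of_real p) * cnj (f x))) = cnj (laplace f (of_real p)) * laplace g (of_real p)" .
  qed
  finally show ?thesis by (rule sym)
qed

lemma fourier_plancherel:
  assumes f: "f \<in> test_functions" and g: "g \<in> test_functions"
  shows "(LINT p|lborel. cnj (fourier f p) * fourier g p) = (LINT x|lborel. cnj (f x) * g x)"
proof -
  let ?c = "(2 * pi) powr (-1/2)"
  have c: "?c * ?c = 1 / (2 * pi)" 
    using powr_add[of "2 * pi" "-1/2" "-1/2"] powr_minus_divide[of "2 * pi" 1] by simp
  have "(LINT p|lborel. cnj (fourier f p) * fourier g p) 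
    = (LINT p|lborel. of_real (?c * ?c) * (cnj (laplace f (of_real p)) * laplace g (of_real p)))"
    by (simp only: fourier_laplace complex_cnj_mult complex_cnj_complex_of_real of_real_mult mult_ac)
  also have "\<dots> = of_real (?c * ?c) * (LINT p|lborel. cnj (laplace f (of_real p)) * laplace g (of_real p))"
    by (rule integral_mult_right_zero)
  also have "\<dots> = of_real (?c * ?c) * (of_real (2 * pi) * (LINT x|lborel. cnj (f x) * g x))"
    by (simp only: laplace_plancherel[OF f g])
  finally show ?thesis unfolding c by simp
qed

section \<open>Finite propagation speed\<close>

text \<open>In two dimensions the proper orthochronous Lorentz transformations are the boosts.\<close>

lemma lorentz_boost:
  assumes "lorentz \<Lambda>"
  obtains \<beta> where "\<And>t x. \<Lambda> (t, x) = (t * cosh \<beta> + x * sinh \<beta>, t * sinh \<beta> + x * cosh \<beta>)"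
proof -
  obtain A C where AC: "\<Lambda> (1, 0) = (A, C)" by fastforce
  obtain B D where BD: "\<Lambda> (0, 1) = (B, D)" by fastforce
  have lin: "linear \<Lambda>" and form: "\<And>x y. minkowski_form (\<Lambda> x) (\<Lambda> y) = minkowski_form x y"
    and det: "A * D - B * C = 1" and pos: "A > 0"
    using assms AC BD by (auto simp: lorentz_def)
  have \<Lambda>: "\<Lambda> (t, x) = (t * A + x * B, t * C + x * D)" for t x
  proof -
    have "(t, x) = t *\<^sub>R (1, 0) + x *\<^sub>R (0, 1)" by simp
    then have "\<Lambda> (t, x) = t *\<^sub>R \<Lambda> (1, 0) + x *\<^sub>R \<Lambda> (0, 1)"
      using linear_add[OF lin] linear_scale[OF lin] by metis
    then show ?thesis by (simp add: AC BD)
  qed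
  have 1: "A * A - C * C = 1" using form[of "(1, 0)" "(1, 0)"] AC by (simp add: minkowski_form_def)
  have 3: "A * B = C * D" using form[of "(1, 0)" "(0, 1)"] AC BD by (simp add: minkowski_form_def)
  have D: "D = A"
  proof -
    have "D = D * (A * A - C * C)" by (simp add: 1)
    also have "\<dots> = A * (A * D) - C * (C * D)" by (simp add: algebra_simps)
    also have "\<dots> = A * (A * D - B * C)" unfolding 3[symmetric] by (simp add: algebra_simps)
    finally show ?thesis by (simp add: det)
  qed
  have B: "B = C"
  proof -
    have "B = B * (A * A - C * C)" by (simp add: 1)
    also have "\<dots> = A * (A * B) - B * C * C" by (simp add: algebra_simps)
    also have "\<dots> = C * (A * D - B * C)" unfolding 3 by (simp add: algebra_simps)
    finally show ?thesis by (simp add: det)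
  qed
  define \<beta> where "\<beta> = arsinh C"
  have s: "sinh \<beta> = C" by (simp add: \<beta>_def)
  have "(cosh \<beta>)\<^sup>2 = A\<^sup>2" using cosh_square_eq[of \<beta>] 1 s by (simp add: power2_eq_square)
  then have c: "cosh \<beta> = A" using pos cosh_real_pos[of \<beta>] by (simp add: power2_eq_iff_nonneg)
  show ?thesis by (rule that[of \<beta>]) (simp add: \<Lambda> B D c s)
qed

lemma lorentz_id: "lorentz id"
  by (simp add: lorentz_def linear_id)

lemma inv_boost:
  assumes \<Lambda>: "\<And>t x. \<Lambda> (t, x) = (t * cosh \<beta> + x * sinh \<beta>, t * sinh \<beta> + x * cosh (\<beta>::real))"
  shows "inv \<Lambda> (t, x) = (t * cosh \<beta> - x * sinh \<beta>, x * cosh \<beta> - t * sinh \<beta>)"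
proof -
  let ?M = "\<lambda>(t, x). (t * cosh \<beta> - x * sinh \<beta>, x * cosh \<beta> - t * sinh \<beta>)"
  have cs: "cosh \<beta> * cosh \<beta> - sinh \<beta> * sinh \<beta> = 1"
    using cosh_square_eq[of \<beta>] by (simp add: power2_eq_square)
  have e1: "(t * cosh \<beta> + x * sinh \<beta>) * cosh \<beta> - (t * sinh \<beta> + x * cosh \<beta>) * sinh \<beta> = t"
    "(t * sinh \<beta> + x * cosh \<beta>) * cosh \<beta> - (t * cosh \<beta> + x * sinh \<beta>) * sinh \<beta> = x" for t x
  proof -
    have "(t * cosh \<beta> + x * sinh \<beta>) * cosh \<beta> - (t * sinh \<beta> + x * cosh \<beta>) * sinh \<beta>
      = t * (cosh \<beta> * cosh \<beta> - sinh \<beta> * sinh \<beta>)"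
      "(t * sinh \<beta> + x * cosh \<beta>) * cosh \<beta> - (t * cosh \<beta> + x * sinh \<beta>) * sinh \<beta>
      = x * (cosh \<beta> * cosh \<beta> - sinh \<beta> * sinh \<beta>)"
      by (simp_all add: algebra_simps)
    then show "(t * cosh \<beta> + x * sinh \<beta>) * cosh \<beta> - (t * sinh \<beta> + x * cosh \<beta>) * sinh \<beta> = t"
      "(t * sinh \<beta> + x * cosh \<beta>) * cosh \<beta> - (t * cosh \<beta> + x * sinh \<beta>) * sinh \<beta> = x" by (simp_all add: cs)
  qed
  have "?M (\<Lambda> z) = z" for z
    by (cases z) (simp only: \<Lambda> prod.case e1)
  then have inj: "inj \<Lambda>" by (rule inj_on_inverseI)
  have "\<Lambda> (t * cosh \<beta> - x * sinh \<beta>, x * cosh \<beta> - t * sinh \<beta>) = (t, x)"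
  proof -
    have "(t * cosh \<beta> - x * sinh \<beta>) * cosh \<beta> + (x * cosh \<beta> - t * sinh \<beta>) * sinh \<beta>
        = t * (cosh \<beta> * cosh \<beta> - sinh \<beta> * sinh \<beta>)"
      "(t * cosh \<beta> - x * sinh \<beta>) * sinh \<beta> + (x * cosh \<beta> - t * sinh \<beta>) * cosh \<beta>
        = x * (cosh \<beta> * cosh \<beta> - sinh \<beta> * sinh \<beta>)"
      by (simp_all add: algebra_simps)
    then show ?thesis by (simp add: \<Lambda> cs)
  qed
  then show ?thesis by (rule inv_f_eq[OF inj])
qed

lemma energy_sinh: "m > 0 \<Longrightarrow> energy m (m * sinh \<theta>) = m * cosh \<theta>"
proof -
  assume m: "m > 0"
  have "(m * sinh \<theta>)\<^sup>2 + m\<^sup>2 = (m * cosh \<theta>)\<^sup>2"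
    by (simp add: power_mult_distrib cosh_square_eq algebra_simps)
  then show ?thesis using m by (simp add: energy_def cosh_real_pos less_imp_le)
qed

lemma snd_inv_boost:
  assumes \<Lambda>: "\<And>t x. \<Lambda> (t, x) = (t * cosh \<beta> + x * sinh \<beta>, t * sinh \<beta> + x * cosh (\<beta>::real))"
    and m: "m > 0"
  shows "snd (inv \<Lambda> (energy m (m * sinh \<theta>), m * sinh \<theta>)) = m * sinh (\<theta> - \<beta>)"
  by (simp add: inv_boost[OF \<Lambda>] energy_sinh[OF m] sinh_diff algebra_simps)

lemma cmod_cosh_le: "cmod (cosh z) \<le> cosh (Re z)"
proof -
  have "cmod (cosh z) = cmod (exp z + exp (-z)) / 2" by (simp add: cosh_field_def norm_divide)
  also have "\<dots> \<le> (cmod (exp z) + cmod (exp (-z))) / 2"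
    by (intro divide_right_mono norm_triangle_ineq) simp
  also have "\<dots> = cosh (Re z)" by (simp add: cosh_field_def)
  finally show ?thesis .
qed

lemma cmod_sinh_ge: "\<bar>sinh (Re z)\<bar> \<le> cmod (sinh z)"
proof -
  have "cmod (sinh z) = cmod (exp z - exp (-z)) / 2" by (simp add: sinh_field_def norm_divide)
  moreover have "\<bar>cmod (exp z) - cmod (exp (-z))\<bar> / 2 \<le> cmod (exp z - exp (-z)) / 2"
    by (intro divide_right_mono norm_triangle_ineq3) simp
  moreover have "\<bar>sinh (Re z)\<bar> = \<bar>cmod (exp z) - cmod (exp (-z))\<bar> / 2" by (simp add: sinh_field_def)
  ultimately show ?thesis by simp
qed

lemma Im_cosh_sinh: 
  "Im (cosh z) = sinh (Re z) * sin (Im z)" "Im (sinh z) = cosh (Re z) * sin (Im z)"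
  by (auto simp: cosh_field_def sinh_field_def Re_exp Im_exp algebra_simps)

lemma cosh_sinh_plus_pi:
  fixes z :: complex and \<sigma> :: real
  assumes "\<sigma> = 1 \<or> \<sigma> = -1"
  shows "cosh (z + \<i> * of_real (\<sigma> * pi)) = - cosh z" "sinh (z + \<i> * of_real (\<sigma> * pi)) = - sinh z"
proof -
  have "cosh (\<i> * of_real (\<sigma> * pi)) = (-1 :: complex)" "sinh (\<i> * of_real (\<sigma> * pi)) = (0 :: complex)"
    using assms by (auto simp: cosh_field_def sinh_field_def exp_minus mult.commute)
  then show "cosh (z + \<i> * of_real (\<sigma> * pi)) = - cosh z" "sinh (z + \<i> * of_real (\<sigma> * pi)) = - sinh z"
    by (simp_all only: cosh_add sinh_add) simp_all
qed

lemma laplace_holomorphic: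
  assumes f: "f \<in> test_functions"
  shows "laplace f holomorphic_on UNIV"
proof -
  obtain r where r: "r > 0" "\<And>x. f x \<noteq> 0 \<Longrightarrow> \<bar>x\<bar> < r" using test_bounded_supp[OF f] by blast
  have "laplace f = (\<lambda>q. integral (cbox (-r) r) (\<lambda>y. exp (- (\<i> * q * of_real y)) * f y))"
  proof
    fix q
    let ?h = "\<lambda>y::real. exp (- (\<i> * q * of_real y)) * f y"
    have "integrable lborel ?h" by (rule test_integrable[OF f]) (intro continuous_intros)
    then have 1: "(?h has_integral laplace f q) UNIV"
      unfolding laplace_def by (rule has_integral_integral_lborel)
    have "?h y = 0" if "y \<notin> cbox (-r) r" for y
    proof (rule ccontr)
      assume "?h y \<noteq> 0"
      then have "f y \<noteq> 0" by auto
      from r(2)[OF this] that show False by auto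
    qed
    then have "(\<lambda>y. if y \<in> cbox (-r) r then ?h y else 0) = ?h" by auto
    then have "(?h has_integral laplace f q) (cbox (-r) r)"
      using 1 has_integral_restrict_UNIV[of "cbox (-r) r" ?h] by simp
    then show "laplace f q = integral (cbox (-r) r) ?h" by (simp add: integral_unique)
  qed
  moreover have "(\<lambda>q. integral (cbox (-r) r) (\<lambda>y. exp (- (\<i> * q * of_real y)) * f y)) holomorphic_on UNIV"
  proof (rule leibniz_rule_holomorphic)
    show "((\<lambda>q. exp (- (\<i> * q * of_real y)) * f y) has_field_derivative 
        - (\<i> * of_real y) * exp (- (\<i> * q * of_real y)) * f y) (at q within UNIV)" for q and y :: real
      by (auto intro!: derivative_eq_intros)
    show "(\<lambda>y. exp (- (\<i> * q * of_real y)) * f y) integrable_on cbox (- r) r" for q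
      by (intro integrable_continuous continuous_intros test_continuous[OF f])
    show "continuous_on (UNIV \<times> cbox (- r) r) (\<lambda>(q, y). - (\<i> * of_real y) * exp (- (\<i> * q * of_real y)) * f y)"
      unfolding case_prod_beta
      by (intro continuous_intros continuous_on_compose2[OF test_continuous[OF f, of UNIV]]) auto
  qed auto
  ultimately show ?thesis by simp
qed

text \<open>Shift of the line of integration by \<open>\<plusminus> i \<pi>\<close>.  The bound is only needed for large \<open>\<bar>u\<bar>\<close>; a possible
  singularity of \<open>b\<close> at \<open>\<beta>\<close> is harmless.\<close>

lemma rectangle_tendsto:
  fixes G :: "complex \<Rightarrow> complex"
  assumes hol: "G holomorphic_on UNIV" and \<sigma>: "\<sigma> = 1 \<or> \<sigma> = -1"
    and bound: "\<And>u v. 0 \<le> \<sigma> * v \<Longrightarrow> \<sigma> * v \<le> pi \<Longrightarrow> u \<noteq> \<beta> \<Longrightarrow> cmod (G (Complex u v)) \<le> b u"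
    and b: "(b \<longlongrightarrow> 0) at_top" "(b \<longlongrightarrow> 0) at_bot"
  shows "((\<lambda>R. integral {-R..R} (\<lambda>u. G (of_real u)) - integral {-R..R} (\<lambda>u. G (of_real u + \<i> * of_real (\<sigma> * pi)))) \<longlongrightarrow> 0) at_top"
proof -
  obtain P where P: "\<And>z. (P has_field_derivative G z) (at z)"
    using holomorphic_convex_primitive'[OF convex_UNIV open_UNIV hol] by auto
  have FTC: "integral {-R..R} (\<lambda>u. G (of_real u + c)) = P (of_real R + c) - P (of_real (-R) + c)" if "R \<ge> 0" for R c
  proof (rule integral_unique, rule fundamental_theorem_of_calculus)
    show "((\<lambda>u. P (of_real u + c)) has_vector_derivative G (of_real u + c)) (at u within {-R..R})" for u
    proof -
      have "((\<lambda>z. P (z + c)) has_field_derivative G (of_real u + c)) (at (of_real u))"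
        using DERIV_shift[of P "G (of_real u + c)" "of_real u" c] P by blast
      then show ?thesis
        by (rule has_vector_derivative_at_within[OF has_vector_derivative_real_field])
    qed
  qed (use that in simp)
  let ?J = "\<i> * complex_of_real (\<sigma> * pi)"
  have vert: "cmod (P (of_real u + ?J) - P (of_real u)) \<le> b u * pi" if u: "u \<noteq> \<beta>" for u
  proof -
    let ?S = "closed_segment (of_real u) (of_real u + ?J)"
    have "cmod (G z) \<le> b u" if "z \<in> ?S" for z
    proof -
      from that obtain s where s: "0 \<le> s" "s \<le> 1" "z = (1 - s) *\<^sub>R of_real u + s *\<^sub>R (of_real u + ?J)"
        unfolding closed_segment_def by blast
      then have "z = Complex u (s * \<sigma> * pi)" by (auto simp: complex_eq_iff algebra_simps)
      moreover have e: "\<sigma> * (s * \<sigma> * pi) = s * pi" using \<sigma> by auto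
      ultimately show ?thesis using bound[of "s * \<sigma> * pi" u] s(1,2) u unfolding e
        by (simp add: mult_left_le_one_le)
    qed
    then have "cmod (P (of_real u + ?J) - P (of_real u)) \<le> b u * cmod ((of_real u + ?J) - of_real u)"
      by (intro field_differentiable_bound[of ?S P G]) (auto intro: P has_field_derivative_at_within)
    also have "cmod ((of_real u + ?J) - of_real u) = pi" using \<sigma> by (auto simp: norm_mult)
    finally show ?thesis .
  qed
  have lim: "((\<lambda>R. b R * pi + b (-R) * pi) \<longlongrightarrow> 0) at_top"
    using tendsto_add[OF tendsto_mult_left_zero[OF b(1), of pi]
        tendsto_mult_left_zero[OF filterlim_compose[OF b(2) filterlim_uminus_at_bot_at_top], of pi]] by simp
  have bd: "\<forall>\<^sub>F R in at_top. norm (integral {-R..R} (\<lambda>u. G (of_real u)) - integral {-R..R} (\<lambda>u. G (of_real u + ?J)))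
     \<le> b R * pi + b (-R) * pi"
    using eventually_gt_at_top[of "\<bar>\<beta>\<bar>"]
  proof eventually_elim
    case (elim R)
    then have R: "R \<ge> 0" "R \<noteq> \<beta>" "- R \<noteq> \<beta>" by linarith+
    have "integral {-R..R} (\<lambda>u. G (of_real u)) - integral {-R..R} (\<lambda>u. G (of_real u + ?J))
      = (P (of_real (-R) + ?J) - P (of_real (-R))) - (P (of_real R + ?J) - P (of_real R))"
      using FTC[OF R(1), of 0] FTC[OF R(1), of ?J] by simp
    then have "norm (integral {-R..R} (\<lambda>u. G (of_real u)) - integral {-R..R} (\<lambda>u. G (of_real u + ?J)))
      \<le> cmod (P (of_real (-R) + ?J) - P (of_real (-R))) + cmod (P (of_real R + ?J) - P (of_real R))"
      by (simp only: norm_triangle_ineq4)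
    also have "\<dots> \<le> b (-R) * pi + b R * pi" by (intro add_mono vert R)
    finally show ?case by (simp only: add.commute)
  qed
  show ?thesis by (rule Lim_null_comparison[OF bd lim])
qed


text \<open>The mass shell transform in the rapidity variable, up to a constant factor.\<close>

definition rapidity_transform :: "real \<Rightarrow> (real \<Rightarrow> complex) \<Rightarrow> complex \<Rightarrow> complex"
  where "rapidity_transform m f z = laplace (re_part f) (of_real m * sinh z)
    + \<i> * of_real m * cosh z * laplace (im_part f) (of_real m * sinh z)"

lemma of_real_cosh_sinh: "complex_of_real (cosh x) = cosh (of_real x)" "complex_of_real (sinh x) = sinh (of_real x)"
  by (simp_all add: cosh_field_def sinh_field_def flip: exp_of_real)

lemma mass_shell_rapidity:
  assumes "m > 0"
  shows "mass_shell_transform m f (m * sinh \<theta>) = of_real ((2 * pi) powr (-1/2)) * rapidity_transform m f (of_real \<theta>)"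
  by (simp add: mass_shell_transform_def fourier_laplace energy_sinh[OF assms] rapidity_transform_def
      of_real_cosh_sinh algebra_simps)

lemma laplace_cnj:
  assumes "\<And>y. cnj (f y) = f y"
  shows "cnj (laplace f (of_real p)) = laplace f (- of_real p)"
  unfolding laplace_def Bochner_Integration.integral_cnj[symmetric]
  by (rule Bochner_Integration.integral_cong) (simp_all add: exp_cnj assms)

lemma cnj_parts: "cnj (re_part f y) = re_part f y" "cnj (im_part f y) = im_part f y"
  by (simp_all add: re_part_def im_part_def)

text \<open>Crossing: continuation by half a period is complex conjugation.\<close>

lemma rapidity_transform_crossing:
  assumes "\<sigma> = 1 \<or> \<sigma> = -1"
  shows "rapidity_transform m f (of_real \<theta> + \<i> * of_real (\<sigma> * pi)) = cnj (rapidity_transform m f (of_real \<theta>))"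
proof -
  have "laplace k (- (of_real m * sinh (of_real \<theta>))) = cnj (laplace k (of_real m * sinh (of_real \<theta>)))"
    if "\<And>y. cnj (k y) = k y" for k
    using laplace_cnj[OF that, where p = "m * sinh \<theta>"] by (simp add: of_real_cosh_sinh)
  note * = this[OF cnj_parts(1)] this[OF cnj_parts(2)]
  have "cnj (cosh (of_real \<theta>)) = cosh (of_real \<theta>)" by (simp flip: of_real_cosh_sinh)
  then show ?thesis
    unfolding rapidity_transform_def cosh_sinh_plus_pi[OF assms] by (simp add: *)
qed

lemma rapidity_transform_holomorphic:
  assumes "f \<in> test_functions"
  shows "rapidity_transform m f holomorphic_on S"
proof -
  have c: "(\<lambda>z. laplace k (of_real m * sinh z)) holomorphic_on S" if "k \<in> test_functions" for k
  proof -
    have "(\<lambda>z. of_real m * sinh z) holomorphic_on S"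
      unfolding sinh_field_def by (intro holomorphic_intros) auto
    from holomorphic_on_compose_gen[OF this laplace_holomorphic[OF that]]
    show ?thesis by (simp add: o_def)
  qed
  have "cosh holomorphic_on S"
    unfolding cosh_field_def[abs_def] by (intro holomorphic_intros) auto
  then show ?thesis
    unfolding rapidity_transform_def[abs_def]
    by (intro holomorphic_intros c test_re_part test_im_part assms)
qed

text \<open>The factor \<open>exp w\<close> stands for a translation that compensates the exponential growth of the transform at
  complex momenta.\<close>

lemma cmod_exp_laplace_le:
  assumes f: "f \<in> test_functions"
    and le: "\<And>y. y \<in> supp f \<Longrightarrow> Re (w - \<i> * q * of_real y) \<le> 0"
  shows "cmod (exp w * laplace f q) \<le> (LINT y|lborel. cmod (f y))"
proof -
  have "exp w * laplace f q = (LINT y|lborel. exp w * (exp (- (\<i> * q * of_real y)) * f y))"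
    unfolding laplace_def by (rule integral_mult_right_zero[symmetric])
  also have "cmod \<dots> \<le> (LINT y|lborel. cmod (f y))"
  proof (rule Bochner_Integration.integral_norm_bound_integral)
    show "integrable lborel (\<lambda>y. exp w * (exp (- (\<i> * q * of_real y)) * f y))"
      by (intro integrable_mult_right test_integrable[OF f] continuous_intros)
    show "integrable lborel (\<lambda>y. cmod (f y))"
      using test_integrable[OF f, of "\<lambda>_. 1"] by simp
    show "cmod (exp w * (exp (- (\<i> * q * of_real y)) * f y)) \<le> cmod (f y)" for y
    proof (cases "y \<in> supp f")
      case True
      have "cmod (exp w * (exp (- (\<i> * q * of_real y)) * f y)) = exp (Re (w - \<i> * q * of_real y)) * cmod (f y)"
        by (simp add: norm_mult exp_add[symmetric] exp_diff)
      also have "\<dots> \<le> 1 * cmod (f y)" using le[OF True] by (intro mult_right_mono) simp_all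
      finally show ?thesis by simp
    qed (simp add: eq_0_outside_supp)
  qed
  finally show ?thesis .
qed

lemma supp_vd_power: "f \<in> test_functions \<Longrightarrow> supp ((vd ^^ n) f) \<subseteq> supp f"
proof (induction n)
  case (Suc n)
  have "supp ((vd ^^ Suc n) f) \<subseteq> supp ((vd ^^ n) f)"
    using supp_vd[OF test_vd_power[OF Suc.prems]] by simp
  then show ?case using Suc by blast
qed simp

lemma cmod_exp_laplace_decay:
  assumes f: "f \<in> test_functions" and q: "q \<noteq> 0"
    and le: "\<And>y. y \<in> supp f \<Longrightarrow> Re (w - \<i> * q * of_real y) \<le> 0"
  shows "cmod (exp w * laplace f q) \<le> (LINT y|lborel. cmod ((vd ^^ 4) f y)) / cmod q ^ 4"
proof -
  have "cmod (exp w * laplace ((vd ^^ 4) f) q) \<le> (LINT y|lborel. cmod ((vd ^^ 4) f y))"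
    by (rule cmod_exp_laplace_le[OF test_vd_power[OF f]]) (use le supp_vd_power[OF f] in blast)
  moreover have "cmod (exp w * laplace ((vd ^^ 4) f) q) = cmod q ^ 4 * cmod (exp w * laplace f q)"
    by (simp add: laplace_vd_power[OF f] norm_mult norm_power)
  ultimately show ?thesis using q by (simp add: field_simps)
qed

lemma supp_parts: "supp (re_part f) \<subseteq> supp f" "supp (im_part f) \<subseteq> supp f"
  unfolding supp_def re_part_def im_part_def by (auto intro!: closure_mono)

text \<open>In a point outside the causal shadow of the support, the Fourier integrand as a function of the rapidity
  extends to the strip of width \<open>\<pi>\<close> above (\<open>\<sigma> = 1\<close>) or below (\<open>\<sigma> = -1\<close>) the real line with decay in the whole
  strip.\<close>

lemma rapidity_strip_bound:
  fixes m t a x' \<beta> \<sigma> :: real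
  assumes f: "f \<in> test_functions" and m: "m > 0" and \<sigma>: "\<sigma> = 1 \<or> \<sigma> = -1"
    and out: "\<And>y. y \<in> supp f \<Longrightarrow> \<bar>t + y * sinh \<beta>\<bar> \<le> \<sigma> * (x' - (a + y * cosh \<beta>))"
  obtains C where "\<And>u v. 0 \<le> \<sigma> * v \<Longrightarrow> \<sigma> * v \<le> pi \<Longrightarrow> u \<noteq> \<beta> \<Longrightarrow>
    cmod (exp (\<i> * of_real m * (of_real t * cosh (Complex u v) + of_real (x' - a) * sinh (Complex u v)))
      * rapidity_transform m f (Complex u v - of_real \<beta>)) \<le> C * cosh (u - \<beta>) / sinh (u - \<beta>) ^ 4"
proof -
  define C1 where "C1 = (LINT y|lborel. cmod ((vd ^^ 4) (re_part f) y))"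
  define C2 where "C2 = (LINT y|lborel. cmod ((vd ^^ 4) (im_part f) y))"
  have C: "C1 \<ge> 0" "C2 \<ge> 0" by (auto simp: C1_def C2_def)
  have "cmod (exp (\<i> * of_real m * (of_real t * cosh (Complex u v) + of_real (x' - a) * sinh (Complex u v)))
      * rapidity_transform m f (Complex u v - of_real \<beta>)) \<le> (C1 + m * C2) / m ^ 4 * cosh (u - \<beta>) / sinh (u - \<beta>) ^ 4"
    if v: "0 \<le> \<sigma> * v" "\<sigma> * v \<le> pi" and u: "u \<noteq> \<beta>" for u v
  proof -
    define z where "z = Complex u v"
    define q where "q = of_real m * sinh (z - of_real \<beta>)"
    define w where "w = \<i> * of_real m * (of_real t * cosh z + of_real (x' - a) * sinh z)"
    \<comment> \<open>The sign of \<open>sin v\<close> in the strip makes the exponent below have non-positive real part.\<close>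
    have sin: "0 \<le> \<sigma> * sin v" using \<sigma> v sin_ge_zero[of v] sin_ge_zero[of "-v"] by auto
    have le: "Re (w - \<i> * q * of_real y) \<le> 0" if y: "y \<in> supp f" for y
    proof -
      let ?T = "t + y * sinh \<beta>" and ?D = "x' - (a + y * cosh \<beta>)"
      have "w - \<i> * q * of_real y = \<i> * of_real m * (of_real ?T * cosh z + of_real ?D * sinh z)"
        by (simp add: w_def q_def sinh_diff of_real_cosh_sinh algebra_simps)
      then have "Re (w - \<i> * q * of_real y) = - m * (?T * Im (cosh z) + ?D * Im (sinh z))"
        by simp
      also have "\<dots> = - m * sin v * (?T * sinh u + ?D * cosh u)"
        by (simp add: Im_cosh_sinh z_def algebra_simps)
      also have "\<dots> = - m * (\<sigma> * \<sigma> * sin v * (?T * sinh u + ?D * cosh u))"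
        using \<sigma> by auto
      also have "\<dots> = - m * ((\<sigma> * sin v) * (\<sigma> * ?T * sinh u + \<sigma> * ?D * cosh u))"
        by (simp only: algebra_simps)
      also have "\<dots> \<le> 0"
      proof -
        have "\<bar>\<sigma> * ?T * sinh u\<bar> = \<bar>?T\<bar> * \<bar>sinh u\<bar>" using \<sigma> by (auto simp: abs_mult)
        also have "\<dots> \<le> (\<sigma> * ?D) * cosh u"
        proof (intro mult_mono out[OF y])
          show "\<bar>sinh u\<bar> \<le> cosh u" using sinh_le_cosh_real[of u] sinh_le_cosh_real[of "-u"] by simp
          show "0 \<le> \<sigma> * ?D" using out[OF y] by linarith
        qed simp
        finally have "0 \<le> \<sigma> * ?T * sinh u + \<sigma> * ?D * cosh u" by linarith
        with sin m show ?thesis by simp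
      qed
      finally show ?thesis .
    qed
    have sq: "m * \<bar>sinh (u - \<beta>)\<bar> \<le> cmod q"
      using cmod_sinh_ge[of "z - of_real \<beta>"] m by (simp add: q_def z_def norm_mult)
    have s0: "\<bar>sinh (u - \<beta>)\<bar> > 0" using u by simp
    have "cmod q > 0" using mult_pos_pos[OF m s0] sq by linarith
    then have q0: "q \<noteq> 0" by simp
    have q4: "(m * \<bar>sinh (u - \<beta>)\<bar>) ^ 4 \<le> cmod q ^ 4" using sq m by (intro power_mono) auto
    have pos4: "(m * \<bar>sinh (u - \<beta>)\<bar>) ^ 4 > 0" using m s0 by simp
    have 1: "cmod (exp w * laplace (re_part f) q) \<le> C1 / (m * \<bar>sinh (u - \<beta>)\<bar>) ^ 4"
    proof -
      have "cmod (exp w * laplace (re_part f) q) \<le> C1 / cmod q ^ 4"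
        unfolding C1_def by (rule cmod_exp_laplace_decay[OF test_re_part[OF f] q0]) (use le supp_parts in blast)
      also have "\<dots> \<le> C1 / (m * \<bar>sinh (u - \<beta>)\<bar>) ^ 4"
        using q4 pos4 C by (intro divide_left_mono mult_pos_pos) (simp_all add: q0)
      finally show ?thesis .
    qed
    have 2: "cmod (exp w * laplace (im_part f) q) \<le> C2 / (m * \<bar>sinh (u - \<beta>)\<bar>) ^ 4"
    proof -
      have "cmod (exp w * laplace (im_part f) q) \<le> C2 / cmod q ^ 4"
        unfolding C2_def by (rule cmod_exp_laplace_decay[OF test_im_part[OF f] q0]) (use le supp_parts in blast)
      also have "\<dots> \<le> C2 / (m * \<bar>sinh (u - \<beta>)\<bar>) ^ 4"
        using q4 pos4 C by (intro divide_left_mono mult_pos_pos) (simp_all add: q0)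
      finally show ?thesis .
    qed
    have ch: "cmod (cosh (z - of_real \<beta>)) \<le> cosh (u - \<beta>)"
      using cmod_cosh_le[of "z - of_real \<beta>"] by (simp add: z_def)
    have "exp w * rapidity_transform m f (z - of_real \<beta>) = exp w * laplace (re_part f) q 
       + \<i> * of_real m * cosh (z - of_real \<beta>) * (exp w * laplace (im_part f) q)"
      by (simp add: rapidity_transform_def q_def algebra_simps)
    then have "cmod (exp w * rapidity_transform m f (z - of_real \<beta>)) \<le> cmod (exp w * laplace (re_part f) q)
       + m * (cmod (cosh (z - of_real \<beta>)) * cmod (exp w * laplace (im_part f) q))"
      using norm_triangle_ineq[of "exp w * laplace (re_part f) q" "\<i> * of_real m * cosh (z - of_real \<beta>) * (exp w * laplace (im_part f) q)"] m
      by (simp add: norm_mult mult.assoc)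
    also have "\<dots> \<le> C1 / (m * \<bar>sinh (u - \<beta>)\<bar>) ^ 4 + m * (cosh (u - \<beta>) * (C2 / (m * \<bar>sinh (u - \<beta>)\<bar>) ^ 4))"
      using m by (intro add_mono mult_left_mono mult_mono 1 2 ch) auto
    also have "\<dots> \<le> cosh (u - \<beta>) * (C1 / (m * \<bar>sinh (u - \<beta>)\<bar>) ^ 4) + m * (cosh (u - \<beta>) * (C2 / (m * \<bar>sinh (u - \<beta>)\<bar>) ^ 4))"
      using C(1) pos4 mult_right_mono[OF cosh_real_ge_1[of "u - \<beta>"], of "C1 / (m * \<bar>sinh (u - \<beta>)\<bar>) ^ 4"]
      by (intro add_right_mono) simp
    also have "\<dots> = (C1 + m * C2) / m ^ 4 * cosh (u - \<beta>) / sinh (u - \<beta>) ^ 4"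
      using m s0 by (simp add: power_mult_distrib field_simps)
    finally show ?thesis by (simp add: z_def w_def)
  qed
  then show ?thesis using that by blast
qed


text \<open>The substitution \<open>p = m sinh \<theta>\<close>.\<close>

lemma integral_sinh_substitution_tendsto:
  fixes \<phi> :: "real \<Rightarrow> complex"
  assumes m: "m > 0" and cont: "continuous_on UNIV \<phi>" and int: "integrable lborel \<phi>"
  shows "((\<lambda>n. integral {- real n..real n} (\<lambda>\<theta>. (m * cosh \<theta>) *\<^sub>R \<phi> (m * sinh \<theta>))) \<longlongrightarrow> (LINT p|lborel. \<phi> p)) sequentially"
proof -
  define r where "r n = m * sinh (real n)" for n
  have r0: "r n \<ge> 0" for n using m by (simp add: r_def)
  have subst: "integral {- real n..real n} (\<lambda>\<theta>. (m * cosh \<theta>) *\<^sub>R \<phi> (m * sinh \<theta>)) = integral {- r n..r n} \<phi>" for n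
  proof (rule integral_unique)
    have "((\<lambda>\<theta>. (m * cosh \<theta>) *\<^sub>R \<phi> (m * sinh \<theta>)) has_integral
       (integral {m * sinh (- real n)..m * sinh (real n)} \<phi>)) {- real n..real n}"
    proof (rule has_integral_substitution[where c = "- r n" and d = "r n"])
      show "(\<lambda>\<theta>. m * sinh \<theta>) ` {- real n..real n} \<subseteq> {- r n..r n}"
        using m by (auto simp: r_def simp flip: sinh_minus mult_minus_right)
      show "((\<lambda>\<theta>. m * sinh \<theta>) has_field_derivative m * cosh x) (at x within {- real n..real n})" for x
        by (auto intro!: derivative_eq_intros)
    qed (use m cont continuous_on_subset in \<open>auto simp: r_def\<close>)
    then show "((\<lambda>\<theta>. (m * cosh \<theta>) *\<^sub>R \<phi> (m * sinh \<theta>)) has_integral integral {- r n..r n} \<phi>) {- real n..real n}"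
      by (simp add: r_def)
  qed
  have rlim: "filterlim r at_top sequentially"
    unfolding r_def sinh_field_def using m by real_asymp
  have "(\<lambda>n. LINT p|lborel. indicator {- r n..r n} p *\<^sub>R \<phi> p) \<longlonglongrightarrow> (LINT p|lborel. \<phi> p)"
  proof (rule integral_dominated_convergence[where w = "\<lambda>p. norm (\<phi> p)"])
    show "AE p in lborel. (\<lambda>n. indicator {- r n..r n} p *\<^sub>R \<phi> p) \<longlonglongrightarrow> \<phi> p"
    proof (rule AE_I2, rule tendsto_eventually)
      fix p
      from filterlim_at_top_dense[THEN iffD1, OF rlim, rule_format, of "\<bar>p\<bar>"]
      show "\<forall>\<^sub>F n in sequentially. indicator {- r n..r n} p *\<^sub>R \<phi> p = \<phi> p"
        by eventually_elim (auto simp: indicator_def abs_less_iff)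
    qed
    show "\<phi> \<in> borel_measurable lborel" using int by auto
    show "(\<lambda>p. indicator {- r i..r i} p *\<^sub>R \<phi> p) \<in> borel_measurable lborel" for i
      using int by (intro borel_measurable_scaleR borel_measurable_indicator) auto
  qed (use int in \<open>auto simp: indicator_def\<close>)
  moreover have "(LINT p|lborel. indicator {- r n..r n} p *\<^sub>R \<phi> p) = integral {- r n..r n} \<phi>" for n
  proof -
    have "set_integrable lborel {- r n..r n} \<phi>"
      by (rule borel_integrable_atLeastAtMost') (use cont continuous_on_subset in blast)
    from set_borel_integral_eq_integral(2)[OF this] show ?thesis by (simp add: set_lebesgue_integral_def)
  qed
  ultimately show ?thesis by (simp add: subst)
qed

text \<open>The Fourier integral of \<open>k\<close> at \<open>x'\<close>, written in the rapidity, is the difference of the integrals of an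
  entire function over the real line and over the line shifted by \<open>\<plusminus> i \<pi>\<close>, hence zero.\<close>

lemma crossing_vanish:
  fixes m x' \<sigma> \<beta> :: real
  assumes k: "k \<in> test_functions" and m: "m > 0" and \<sigma>: "\<sigma> = 1 \<or> \<sigma> = -1"
    and hol: "G holomorphic_on UNIV"
    and bound: "\<And>u v. 0 \<le> \<sigma> * v \<Longrightarrow> \<sigma> * v \<le> pi \<Longrightarrow> u \<noteq> \<beta> \<Longrightarrow> cmod (G (Complex u v)) \<le> b u"
    and b: "(b \<longlongrightarrow> 0) at_top" "(b \<longlongrightarrow> 0) at_bot"
    and eq: "\<And>\<theta>. of_real (m * cosh \<theta>) * (laplace k (of_real (m * sinh \<theta>)) * exp (\<i> * of_real (m * sinh \<theta> * x')))
      = c * (G (of_real \<theta>) - G (of_real (- \<theta>) + \<i> * of_real (\<sigma> * pi)))"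
  shows "k x' = 0"
proof -
  let ?\<phi> = "\<lambda>p::real. laplace k (of_real p) * exp (\<i> * of_real (p * x'))"
  let ?D = "\<lambda>R. integral {-R..R} (\<lambda>u. G (of_real u)) - integral {-R..R} (\<lambda>u. G (of_real u + \<i> * of_real (\<sigma> * pi)))"
  have Gc: "continuous_on S (\<lambda>u. G (of_real u + w))" for S and w
    by (intro continuous_on_compose2[OF holomorphic_on_imp_continuous_on[OF hol]] continuous_intros) auto
  have cont: "continuous_on UNIV ?\<phi>"
    by (intro continuous_intros laplace_continuous[OF k])
  have int: "integrable lborel ?\<phi>"
  proof (rule Bochner_Integration.integrable_bound[OF laplace_integrable[OF k]])
    show "?\<phi> \<in> borel_measurable lborel" using cont by (simp add: borel_measurable_continuous_onI)
  qed (simp add: norm_mult)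
  have "integral {-R..R} (\<lambda>\<theta>. (m * cosh \<theta>) *\<^sub>R ?\<phi> (m * sinh \<theta>)) = c * ?D R" for R
  proof -
    have "integral {-R..R} (\<lambda>\<theta>. (m * cosh \<theta>) *\<^sub>R ?\<phi> (m * sinh \<theta>)) 
      = integral {-R..R} (\<lambda>\<theta>. c * (G (of_real \<theta>) - G (of_real (- \<theta>) + \<i> * of_real (\<sigma> * pi))))"
      by (simp only: scaleR_conv_of_real eq)
    also have "\<dots> = c * integral {-R..R} (\<lambda>\<theta>. G (of_real \<theta>) - G (of_real (- \<theta>) + \<i> * of_real (\<sigma> * pi)))"
      by (rule integral_mult_right)
    also have "integral {-R..R} (\<lambda>\<theta>. G (of_real \<theta>) - G (of_real (- \<theta>) + \<i> * of_real (\<sigma> * pi)))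
      = integral {-R..R} (\<lambda>\<theta>. G (of_real \<theta>)) - integral {-R..R} (\<lambda>\<theta>. G (of_real (- \<theta>) + \<i> * of_real (\<sigma> * pi)))"
    proof (rule Henstock_Kurzweil_Integration.integral_diff)
      show "(\<lambda>\<theta>. G (of_real \<theta>)) integrable_on {-R..R}"
        using Gc[of "{-R..R}" 0] by (intro integrable_continuous_interval) simp
      have "continuous_on {-R..R} (\<lambda>\<theta>. G (of_real (- \<theta>) + \<i> * of_real (\<sigma> * pi)))"
        by (intro continuous_on_compose2[OF holomorphic_on_imp_continuous_on[OF hol]] continuous_intros) auto
      then show "(\<lambda>\<theta>. G (of_real (- \<theta>) + \<i> * of_real (\<sigma> * pi))) integrable_on {-R..R}"
        by (rule integrable_continuous_interval)
    qed
    also have "integral {-R..R} (\<lambda>\<theta>. G (of_real (- \<theta>) + \<i> * of_real (\<sigma> * pi))) = integral {-R..R} (\<lambda>\<theta>. G (of_real \<theta> + \<i> * of_real (\<sigma> * pi)))"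
      using Henstock_Kurzweil_Integration.integral_reflect_real[of R "-R" "\<lambda>\<theta>. G (of_real \<theta> + \<i> * of_real (\<sigma> * pi))"] by simp
    finally show ?thesis .
  qed
  then have "(\<lambda>n. c * ?D (real n)) \<longlonglongrightarrow> (LINT p|lborel. ?\<phi> p)"
    using integral_sinh_substitution_tendsto[OF m cont int] by simp
  moreover have "(\<lambda>n. c * ?D (real n)) \<longlonglongrightarrow> c * 0"
    by (intro tendsto_mult_left filterlim_compose[OF rectangle_tendsto[OF hol \<sigma> bound b] filterlim_real_sequentially])
  ultimately have "(LINT p|lborel. ?\<phi> p) = 0" using LIMSEQ_unique by fastforce
  then show ?thesis using laplace_inversion[OF k, of x'] by simp
qed

lemma hyperbolic_decay:
  fixes C m \<beta> :: real
  shows "((\<lambda>u. C * cosh (u - \<beta>) / sinh (u - \<beta>) ^ 4 * (m * cosh u)) \<longlongrightarrow> 0) at_top"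
    "((\<lambda>u. C * cosh (u - \<beta>) / sinh (u - \<beta>) ^ 4 * (m * cosh u)) \<longlongrightarrow> 0) at_bot"
    "((\<lambda>u. C * cosh (u - \<beta>) / sinh (u - \<beta>) ^ 4) \<longlongrightarrow> 0) at_top"
    "((\<lambda>u. C * cosh (u - \<beta>) / sinh (u - \<beta>) ^ 4) \<longlongrightarrow> 0) at_bot"
proof -
  have *: "((\<lambda>u. cosh (u - \<beta>) / sinh (u - \<beta>) ^ 4 * cosh u) \<longlongrightarrow> 0) at_top"
    "((\<lambda>u. cosh (u - \<beta>) / sinh (u - \<beta>) ^ 4 * cosh u) \<longlongrightarrow> 0) at_bot"
    "((\<lambda>u. cosh (u - \<beta>) / sinh (u - \<beta>) ^ 4) \<longlongrightarrow> 0) at_top"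
    "((\<lambda>u. cosh (u - \<beta>) / sinh (u - \<beta>) ^ 4) \<longlongrightarrow> 0) at_bot"
    unfolding cosh_field_def sinh_field_def by real_asymp+
  show "((\<lambda>u. C * cosh (u - \<beta>) / sinh (u - \<beta>) ^ 4 * (m * cosh u)) \<longlongrightarrow> 0) at_top"
    "((\<lambda>u. C * cosh (u - \<beta>) / sinh (u - \<beta>) ^ 4 * (m * cosh u)) \<longlongrightarrow> 0) at_bot"
    "((\<lambda>u. C * cosh (u - \<beta>) / sinh (u - \<beta>) ^ 4) \<longlongrightarrow> 0) at_top"
    "((\<lambda>u. C * cosh (u - \<beta>) / sinh (u - \<beta>) ^ 4) \<longlongrightarrow> 0) at_bot"
    using *[THEN tendsto_mult_right_zero, of "C * m"] *[THEN tendsto_mult_right_zero, of C]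
    by (simp_all add: mult_ac)
qed

text \<open>A point \<open>x'\<close> that lies to the right (\<open>\<sigma> = 1\<close>) or to the left (\<open>\<sigma> = -1\<close>) of the causal shadow of the
  transformed support is not in the support of the transformed test function.\<close>

theorem propagation:
  fixes m t a x' \<sigma> :: real
  assumes m: "m > 0" and \<Lambda>: "lorentz \<Lambda>" and f: "f \<in> test_functions" and h: "h \<in> test_functions"
    and transform: "\<And>p. mass_shell_transform m h p = exp (\<i> * (t * energy m p - a * p)) *
      mass_shell_transform m f (snd (inv \<Lambda> (energy m p, p)))"
    and \<sigma>: "\<sigma> = 1 \<or> \<sigma> = -1"
    and out: "\<And>y. y \<in> supp f \<Longrightarrow> \<bar>fst (\<Lambda> (0, y)) + t\<bar> \<le> \<sigma> * (x' - (snd (\<Lambda> (0, y)) + a))"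
  shows "h x' = 0"
proof -
  obtain \<beta> where \<beta>: "\<And>t x. \<Lambda> (t, x) = (t * cosh \<beta> + x * sinh \<beta>, t * sinh \<beta> + x * cosh \<beta>)"
    using lorentz_boost[OF \<Lambda>] by blast
  define K where "K z = exp (\<i> * of_real m * (of_real t * cosh z - of_real a * sinh z)) * rapidity_transform m f (z - of_real \<beta>)" for z
  define E where "E z = exp (\<i> * of_real m * of_real x' * sinh z)" for z :: complex
  let ?J = "\<i> * complex_of_real (\<sigma> * pi)"
  have Kh: "rapidity_transform m h (of_real \<theta>) = K (of_real \<theta>)" for \<theta>
  proof -
    have "of_real ((2 * pi) powr (-1/2)) * rapidity_transform m h (of_real \<theta>)
      = of_real ((2 * pi) powr (-1/2)) * K (of_real \<theta>)"
      using transform[of "m * sinh \<theta>"]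
      unfolding snd_inv_boost[OF \<beta> m] mass_shell_rapidity[OF m]
      unfolding energy_sinh[OF m]
      by (simp add: K_def of_real_cosh_sinh algebra_simps)
    then show ?thesis by simp
  qed
  have cc: "cnj (cosh (of_real \<theta>)) = cosh (of_real \<theta>)" "cnj (sinh (of_real \<theta>)) = sinh (of_real \<theta>)" for \<theta> :: real
    by (simp_all flip: of_real_cosh_sinh)
  have Kc: "K (of_real \<theta> + ?J) = cnj (K (of_real \<theta>))" for \<theta>
  proof -
    have "rapidity_transform m f (of_real \<theta> + ?J - of_real \<beta>) = cnj (rapidity_transform m f (of_real \<theta> - of_real \<beta>))"
      using rapidity_transform_crossing[OF \<sigma>, of m f "\<theta> - \<beta>"] by (simp add: algebra_simps)
    then show ?thesis
      unfolding K_def cosh_sinh_plus_pi[OF \<sigma>] by (simp add: exp_cnj cc algebra_simps)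
  qed
  have Ec: "E (of_real (- \<theta>) + ?J) = E (of_real \<theta>)" for \<theta>
    unfolding E_def cosh_sinh_plus_pi[OF \<sigma>] by simp
  \<comment> \<open>Real and imaginary part of \<open>h\<close> are recovered from \<open>K\<close> by reflection of the rapidity and conjugation, and
    conjugation is the shift by \<open>\<plusminus> i \<pi>\<close>.\<close>
  have refl: "laplace (re_part h) (of_real (m * sinh \<theta>)) = (K (of_real \<theta>) + cnj (K (of_real (- \<theta>)))) / 2"
    "\<i> * of_real (m * cosh \<theta>) * laplace (im_part h) (of_real (m * sinh \<theta>)) = (K (of_real \<theta>) - cnj (K (of_real (- \<theta>)))) / 2" for \<theta>
  proof -
    have 1: "K (of_real \<theta>) = laplace (re_part h) (of_real (m * sinh \<theta>)) + \<i> * of_real (m * cosh \<theta>) * laplace (im_part h) (of_real (m * sinh \<theta>))"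
      unfolding Kh[symmetric] rapidity_transform_def by (simp add: of_real_cosh_sinh)
    have "K (of_real (- \<theta>)) = laplace (re_part h) (- of_real (m * sinh \<theta>)) + \<i> * of_real (m * cosh \<theta>) * laplace (im_part h) (- of_real (m * sinh \<theta>))"
      unfolding Kh[symmetric] rapidity_transform_def by (simp add: of_real_cosh_sinh)
    then have 2: "cnj (K (of_real (- \<theta>))) = laplace (re_part h) (of_real (m * sinh \<theta>)) - \<i> * of_real (m * cosh \<theta>) * laplace (im_part h) (of_real (m * sinh \<theta>))"
      unfolding laplace_cnj[OF cnj_parts(1), symmetric] laplace_cnj[OF cnj_parts(2), symmetric] by simp
    show "laplace (re_part h) (of_real (m * sinh \<theta>)) = (K (of_real \<theta>) + cnj (K (of_real (- \<theta>)))) / 2"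
      "\<i> * of_real (m * cosh \<theta>) * laplace (im_part h) (of_real (m * sinh \<theta>)) = (K (of_real \<theta>) - cnj (K (of_real (- \<theta>)))) / 2"
      unfolding 1 2 by simp_all
  qed
  have hyp: "cosh holomorphic_on (UNIV :: complex set)" "sinh holomorphic_on (UNIV :: complex set)"
    unfolding cosh_field_def[abs_def] sinh_field_def[abs_def] by (intro holomorphic_intros; simp)+
  have Khol: "K holomorphic_on UNIV"
  proof -
    have "(\<lambda>z. rapidity_transform m f (z - of_real \<beta>)) holomorphic_on UNIV"
    proof -
      have "(\<lambda>z. z - of_real \<beta>) holomorphic_on UNIV" by (intro holomorphic_intros)
      from holomorphic_on_compose_gen[OF this rapidity_transform_holomorphic[OF f, of m UNIV]]
      show ?thesis by (simp add: o_def)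
    qed
    then show ?thesis unfolding K_def[abs_def] by (intro holomorphic_intros hyp)
  qed
  have Ehol: "E holomorphic_on UNIV" unfolding E_def[abs_def] by (intro holomorphic_intros hyp)
  have out': "\<bar>t + y * sinh \<beta>\<bar> \<le> \<sigma> * (x' - (a + y * cosh \<beta>))" if "y \<in> supp f" for y
    using out[OF that] by (simp add: \<beta> algebra_simps)
  obtain C where C: "\<And>u v. 0 \<le> \<sigma> * v \<Longrightarrow> \<sigma> * v \<le> pi \<Longrightarrow> u \<noteq> \<beta> \<Longrightarrow>
    cmod (exp (\<i> * of_real m * (of_real t * cosh (Complex u v) + of_real (x' - a) * sinh (Complex u v)))
      * rapidity_transform m f (Complex u v - of_real \<beta>)) \<le> C * cosh (u - \<beta>) / sinh (u - \<beta>) ^ 4"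
    using rapidity_strip_bound[OF f m \<sigma> out'] by blast
  have KE: "K z * E z = exp (\<i> * of_real m * (of_real t * cosh z + of_real (x' - a) * sinh z)) * rapidity_transform m f (z - of_real \<beta>)" for z
    unfolding K_def E_def by (simp add: exp_add[symmetric] algebra_simps)
  have b2: "cmod (K (Complex u v) * E (Complex u v)) \<le> C * cosh (u - \<beta>) / sinh (u - \<beta>) ^ 4"
    if "0 \<le> \<sigma> * v" "\<sigma> * v \<le> pi" "u \<noteq> \<beta>" for u v
    unfolding KE by (rule C[OF that])
  have b1: "cmod (K (Complex u v) * E (Complex u v) * (of_real m * cosh (Complex u v))) \<le> C * cosh (u - \<beta>) / sinh (u - \<beta>) ^ 4 * (m * cosh u)"
    if "0 \<le> \<sigma> * v" "\<sigma> * v \<le> pi" "u \<noteq> \<beta>" for u v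
    unfolding norm_mult[of "K (Complex u v) * E (Complex u v)"]
    by (intro mult_mono b2 that) (use m cmod_cosh_le[of "Complex u v"] order_trans[OF norm_ge_zero b2[OF that]] in \<open>auto simp: norm_mult\<close>)
  have "re_part h x' = 0"
  proof (rule crossing_vanish[where c = "1/2" and G = "\<lambda>z. K z * E z * (of_real m * cosh z)", OF test_re_part[OF h] m \<sigma> _ b1])
    show "((\<lambda>u. C * cosh (u - \<beta>) / sinh (u - \<beta>) ^ 4 * (m * cosh u)) \<longlongrightarrow> 0) at_top"
      "((\<lambda>u. C * cosh (u - \<beta>) / sinh (u - \<beta>) ^ 4 * (m * cosh u)) \<longlongrightarrow> 0) at_bot"
      by (rule hyperbolic_decay)+
    show "of_real (m * cosh \<theta>) * (laplace (re_part h) (of_real (m * sinh \<theta>)) * exp (\<i> * of_real (m * sinh \<theta> * x')))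
      = 1/2 * (K (of_real \<theta>) * E (of_real \<theta>) * (of_real m * cosh (of_real \<theta>))
        - K (of_real (- \<theta>) + ?J) * E (of_real (- \<theta>) + ?J) * (of_real m * cosh (of_real (- \<theta>) + ?J)))" for \<theta>
      unfolding Kc Ec cosh_sinh_plus_pi[OF \<sigma>] refl(1)
      by (simp add: E_def of_real_cosh_sinh algebra_simps)
  qed (intro holomorphic_intros Khol Ehol hyp)
  moreover have "im_part h x' = 0"
  proof (rule crossing_vanish[where c = "1/(2 * \<i>)" and G = "\<lambda>z. K z * E z", OF test_im_part[OF h] m \<sigma> _ b2])
    show "((\<lambda>u. C * cosh (u - \<beta>) / sinh (u - \<beta>) ^ 4) \<longlongrightarrow> 0) at_top"
      "((\<lambda>u. C * cosh (u - \<beta>) / sinh (u - \<beta>) ^ 4) \<longlongrightarrow> 0) at_bot"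
      by (rule hyperbolic_decay)+
    show "of_real (m * cosh \<theta>) * (laplace (im_part h) (of_real (m * sinh \<theta>)) * exp (\<i> * of_real (m * sinh \<theta> * x')))
      = 1/(2 * \<i>) * (K (of_real \<theta>) * E (of_real \<theta>) - K (of_real (- \<theta>) + ?J) * E (of_real (- \<theta>) + ?J))" for \<theta>
    proof -
      have "of_real (m * cosh \<theta>) * laplace (im_part h) (of_real (m * sinh \<theta>)) = - \<i> * ((K (of_real \<theta>) - cnj (K (of_real (- \<theta>)))) / 2)"
        unfolding refl(2)[symmetric] by (simp add: mult.assoc[symmetric])
      moreover have "exp (\<i> * of_real (m * sinh \<theta> * x')) = E (of_real \<theta>)"
        by (simp add: E_def of_real_cosh_sinh mult_ac)
      moreover have "- \<i> * ((x - y) / 2) * e = 1/(2 * \<i>) * (x * e - y * e)" for x y e :: complex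
        by (simp add: field_simps)
      ultimately show ?thesis
        unfolding Kc Ec by (simp only: mult.assoc[symmetric])
    qed
  qed (intro holomorphic_intros Khol Ehol)
  ultimately show ?thesis by (simp add: re_part_def im_part_def complex_eq_iff)
qed

section \<open>Functions of positive frequency\<close>

text \<open>Differentiation under the integral sign with respect to a complex parameter.\<close>

lemma has_field_derivative_LINT:
  fixes f :: "complex \<Rightarrow> 'a \<Rightarrow> complex"
  assumes U: "open U" "convex U" "z \<in> U"
    and int: "\<And>w. w \<in> U \<Longrightarrow> integrable M (f w)"
    and der: "\<And>w s. w \<in> U \<Longrightarrow> ((\<lambda>w. f w s) has_field_derivative f' w s) (at w)"
    and bound: "\<And>w s. w \<in> U \<Longrightarrow> cmod (f' w s) \<le> B s" and B: "integrable M B"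
    and meas: "f' z \<in> borel_measurable M"
  shows "((\<lambda>w. LINT s|M. f w s) has_field_derivative (LINT s|M. f' z s)) (at z)"
proof -
  have "((\<lambda>w. ((LINT s|M. f w s) - (LINT s|M. f z s)) / (w - z)) \<longlongrightarrow> (LINT s|M. f' z s)) (at z within U)"
    unfolding tendsto_at_iff_sequentially
  proof (intro allI impI)
    fix X :: "nat \<Rightarrow> complex" assume X: "\<forall>i. X i \<in> U - {z}" "X \<longlonglongrightarrow> z"
    then have XU: "X i \<in> U" "X i \<noteq> z" for i by auto
    have "(\<lambda>i. LINT s|M. (f (X i) s - f z s) / (X i - z)) \<longlonglongrightarrow> (LINT s|M. f' z s)"
    proof (rule integral_dominated_convergence[where w = B])
      show "AE s in M. (\<lambda>i. (f (X i) s - f z s) / (X i - z)) \<longlonglongrightarrow> f' z s"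
      proof (rule AE_I2)
        fix s
        have "((\<lambda>w. (f w s - f z s) / (w - z)) \<longlongrightarrow> f' z s) (at z)"
          using der[OF U(3)] by (simp add: has_field_derivative_iff)
        moreover have "filterlim X (at z) sequentially"
          using X by (simp add: filterlim_at)
        ultimately show "(\<lambda>i. (f (X i) s - f z s) / (X i - z)) \<longlonglongrightarrow> f' z s"
          by (rule filterlim_compose)
      qed
      show "AE s in M. norm ((f (X i) s - f z s) / (X i - z)) \<le> B s" for i
      proof (rule AE_I2)
        fix s
        have "cmod (f (X i) s - f z s) \<le> B s * cmod (X i - z)"
          by (rule field_differentiable_bound[OF U(2), of "\<lambda>w. f w s" "\<lambda>w. f' w s"])
            (use has_field_derivative_at_within[OF der] bound XU U(3) in auto)
        then show "norm ((f (X i) s - f z s) / (X i - z)) \<le> B s"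
          using XU(2)[of i] by (simp add: norm_divide divide_le_eq)
      qed
      show "(\<lambda>s. (f (X i) s - f z s) / (X i - z)) \<in> borel_measurable M" for i
        using int[OF XU(1)[of i]] int[OF U(3)] by auto
    qed (use meas B in auto)
    moreover have "(LINT s|M. (f (X i) s - f z s) / (X i - z)) = ((LINT s|M. f (X i) s) - (LINT s|M. f z s)) / (X i - z)" for i
      by (simp only: integral_divide_zero Bochner_Integration.integral_diff[OF int[OF XU(1)] int[OF U(3)]])
    ultimately show "((\<lambda>w. ((LINT s|M. f w s) - (LINT s|M. f z s)) / (w - z)) \<circ> X) \<longlonglongrightarrow> (LINT s|M. f' z s)"
      by (simp only: o_def)
  qed
  then show ?thesis
    by (simp only: has_field_derivative_iff at_within_open[OF U(3) U(1)])
qed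

text \<open>Cauchy kernels, regularised by subtracting a fixed one so that they are integrable.\<close>

definition cauchy_kernel :: "complex \<Rightarrow> complex \<Rightarrow> complex \<Rightarrow> complex"
  where "cauchy_kernel w w\<^sub>0 z = 1 / (z - w) - 1 / (z - w\<^sub>0)"

text \<open>On the complement of a disc around \<open>w\<close>, the distance to \<open>w\<close> dominates the size of \<open>z\<close>.\<close>

lemma one_plus_sq_le:
  assumes r: "0 < r" "r \<le> cmod (z - w)" and W: "cmod w \<le> W"
  shows "1 + (cmod z)\<^sup>2 \<le> (2 + (1 + 2 * W\<^sup>2) / r\<^sup>2) * (cmod (z - w))\<^sup>2"
proof -
  let ?d = "cmod (z - w)"
  have "cmod z \<le> ?d + cmod w" using norm_triangle_ineq[of "z - w" w] by simp
  then have "(cmod z)\<^sup>2 \<le> (?d + cmod w)\<^sup>2" by (rule power_mono) simp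
  also have "\<dots> \<le> 2 * ?d\<^sup>2 + 2 * (cmod w)\<^sup>2"
    using zero_le_power2[of "?d - cmod w"] by (simp add: power2_eq_square algebra_simps)
  also have "(cmod w)\<^sup>2 \<le> W\<^sup>2" using W by (rule power_mono) simp
  finally have 1: "1 + (cmod z)\<^sup>2 \<le> 2 * ?d\<^sup>2 + (1 + 2 * W\<^sup>2)" by simp
  have "r\<^sup>2 \<le> ?d\<^sup>2" using r by (intro power_mono) auto
  then have "(1 + 2 * W\<^sup>2) * 1 \<le> (1 + 2 * W\<^sup>2) * (?d\<^sup>2 / r\<^sup>2)"
    using r by (intro mult_left_mono) auto
  with 1 show ?thesis by (simp add: algebra_simps)
qed

lemma cauchy_kernel_bound:
  assumes r: "0 < r" "r \<le> cmod (z - w)" "r \<le> cmod (z - w\<^sub>0)" and W: "cmod w \<le> W" "cmod w\<^sub>0 \<le> W"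
  shows "cmod (cauchy_kernel w w\<^sub>0 z) \<le> 2 * W * (2 + (1 + 2 * W\<^sup>2) / r\<^sup>2) / (1 + (cmod z)\<^sup>2)"
proof -
  let ?C = "2 + (1 + 2 * W\<^sup>2) / r\<^sup>2"
  have pos: "1 + (cmod z)\<^sup>2 > 0" by (simp add: add_pos_nonneg)
  have C: "?C > 0" using r by (intro add_pos_nonneg) auto
  have d: "cmod (z - w) > 0" "cmod (z - w\<^sub>0) > 0" using r by linarith+
  have "cauchy_kernel w w\<^sub>0 z = (w - w\<^sub>0) / ((z - w) * (z - w\<^sub>0))"
    using d by (simp add: cauchy_kernel_def field_simps)
  then have eq: "cmod (cauchy_kernel w w\<^sub>0 z) = cmod (w - w\<^sub>0) / (cmod (z - w) * cmod (z - w\<^sub>0))"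
    by (simp add: norm_divide norm_mult)
  have "(1 + (cmod z)\<^sup>2)\<^sup>2 \<le> (?C * (cmod (z - w))\<^sup>2) * (?C * (cmod (z - w\<^sub>0))\<^sup>2)"
    unfolding power2_eq_square[of "1 + (cmod z)\<^sup>2"]
    by (intro mult_mono one_plus_sq_le r W) (use pos C in auto)
  also have "\<dots> = (?C * (cmod (z - w) * cmod (z - w\<^sub>0)))\<^sup>2" by (simp add: power_mult_distrib power2_eq_square)
  finally have "1 + (cmod z)\<^sup>2 \<le> ?C * (cmod (z - w) * cmod (z - w\<^sub>0))"
    by (rule power2_le_imp_le) (use C in simp)
  then have "1 / (cmod (z - w) * cmod (z - w\<^sub>0)) \<le> ?C / (1 + (cmod z)\<^sup>2)"
    using pos d by (simp add: divide_simps mult.commute)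
  then have "cmod (w - w\<^sub>0) * (1 / (cmod (z - w) * cmod (z - w\<^sub>0))) \<le> (2 * W) * (?C / (1 + (cmod z)\<^sup>2))"
    using W order_trans[OF norm_ge_zero W(1)] norm_triangle_ineq4[of w w\<^sub>0] d by (intro mult_mono) auto
  then show ?thesis unfolding eq by simp
qed

lemma integrable_bound_real_1_plus_sq:
  "integrable lborel (\<lambda>s::real. C / (1 + s\<^sup>2))"
  using integrable_mult_right[OF integrable_inverse_1_plus_sq, of C] by simp

lemma cauchy_kernel_integrable:
  fixes F :: "real \<Rightarrow> complex"
  assumes F: "F \<in> borel_measurable borel" "\<And>s. cmod (F s) \<le> M"
    and r: "0 < r" "\<And>s. F s \<noteq> 0 \<Longrightarrow> r \<le> cmod (of_real s - w) \<and> r \<le> cmod (of_real s - w\<^sub>0)"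
  shows "integrable lborel (\<lambda>s. F s * cauchy_kernel w w\<^sub>0 (of_real s))"
proof -
  define W where "W = max (cmod w) (cmod w\<^sub>0)"
  let ?C = "M * (2 * W * (2 + (1 + 2 * W\<^sup>2) / r\<^sup>2))"
  have W: "cmod w \<le> W" "cmod w\<^sub>0 \<le> W" by (auto simp: W_def)
  have M: "0 \<le> M" using order_trans[OF norm_ge_zero F(2)] .
  have W0: "0 \<le> W" using order_trans[OF norm_ge_zero W(1)] .
  show ?thesis
  proof (rule Bochner_Integration.integrable_bound[OF integrable_bound_real_1_plus_sq[of ?C]])
    show "(\<lambda>s. F s * cauchy_kernel w w\<^sub>0 (of_real s)) \<in> borel_measurable lborel"
      using F(1) unfolding cauchy_kernel_def by measurable
    have "cmod (F s * cauchy_kernel w w\<^sub>0 (of_real s)) \<le> ?C / (1 + s\<^sup>2)" for s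
    proof (cases "F s = 0")
      case True
      have "0 \<le> ?C / (1 + s\<^sup>2)" using M W0 by (intro divide_nonneg_nonneg mult_nonneg_nonneg add_nonneg_nonneg) auto
      with True show ?thesis by simp
    next
      case False
      have "cmod (F s) * cmod (cauchy_kernel w w\<^sub>0 (of_real s)) \<le> M * (2 * W * (2 + (1 + 2 * W\<^sup>2) / r\<^sup>2) / (1 + (cmod (of_real s))\<^sup>2))"
        using r(2)[OF False] by (intro mult_mono F(2) cauchy_kernel_bound[OF r(1) _ _ W] M) auto
      then show ?thesis by (simp add: norm_mult)
    qed
    then show "AE s in lborel. norm (F s * cauchy_kernel w w\<^sub>0 (of_real s)) \<le> norm (?C / (1 + s\<^sup>2))"
      by (intro AE_I2) (metis abs_ge_self order_trans real_norm_def)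
  qed
qed

text \<open>Boundary values of bounded holomorphic functions on the upper half-plane, characterised by
  the vanishing of their Cauchy integrals over the lower half-plane.\<close>

definition positive_frequency :: "(real \<Rightarrow> complex) \<Rightarrow> bool"
  where "positive_frequency F \<longleftrightarrow> (\<forall>w w\<^sub>0. Im w < 0 \<longrightarrow> Im w\<^sub>0 < 0 \<longrightarrow>
    (LINT s|lborel. F s * cauchy_kernel w w\<^sub>0 (of_real s)) = 0)"

lemma cmod_ge_Im: "\<bar>Im w\<bar> \<le> cmod (of_real s - w)"
  using abs_Im_le_cmod[of "of_real s - w"] by simp

lemma cauchy_kernel_integrable_nonreal:
  fixes F :: "real \<Rightarrow> complex"
  assumes F: "F \<in> borel_measurable borel" "\<And>s. cmod (F s) \<le> M"
    and w: "Im w \<noteq> 0" "Im w\<^sub>0 \<noteq> 0"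
  shows "integrable lborel (\<lambda>s. F s * cauchy_kernel w w\<^sub>0 (of_real s))"
  by (rule cauchy_kernel_integrable[OF F, of "min \<bar>Im w\<bar> \<bar>Im w\<^sub>0\<bar>"])
    (use w cmod_ge_Im in \<open>auto simp: min_le_iff_disj\<close>)

text \<open>The kernel has no poles in the upper half-plane, where the contour is closed by large rectangles.\<close>

lemma half_plane_positive_frequency:
  fixes \<Phi> :: "complex \<Rightarrow> complex"
  assumes cont: "continuous_on {z. Im z \<ge> 0} \<Phi>"
    and diff: "\<And>z. Im z > 0 \<Longrightarrow> \<Phi> field_differentiable (at z)"
    and M: "\<And>z. Im z \<ge> 0 \<Longrightarrow> cmod (\<Phi> z) \<le> M"
  shows "positive_frequency (\<lambda>s. \<Phi> (of_real s))"
  unfolding positive_frequency_def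
proof (intro allI impI)
  fix w w\<^sub>0 assume w: "Im w < 0" "Im w\<^sub>0 < 0"
  let ?S = "{z. Im z \<ge> 0}"
  let ?G = "\<lambda>z. \<Phi> z * cauchy_kernel w w\<^sub>0 z"
  have conv: "convex ?S" by (rule convex_halfspace_Im_ge)
  define r where "r = min (- Im w) (- Im w\<^sub>0)"
  define W where "W = max (cmod w) (cmod w\<^sub>0)"
  define C where "C = M * (2 * W * (2 + (1 + 2 * W\<^sup>2) / r\<^sup>2))"
  have M0: "0 \<le> M" using order_trans[OF norm_ge_zero M[of 0]] by simp
  have W: "cmod w \<le> W" "cmod w\<^sub>0 \<le> W" "0 \<le> W" by (auto simp: W_def le_max_iff_disj)
  have r: "r > 0" using w by (simp add: r_def)
  have far: "r \<le> cmod (z - w)" "r \<le> cmod (z - w\<^sub>0)" if "Im z \<ge> 0" for z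
    using abs_Im_le_cmod[of "z - w"] abs_Im_le_cmod[of "z - w\<^sub>0"] that w by (auto simp: r_def)
  have C0: "C \<ge> 0" unfolding C_def using M0 W(3) by (intro mult_nonneg_nonneg add_nonneg_nonneg) auto
  have G: "cmod (?G z) \<le> C / (1 + (cmod z)\<^sup>2)" if z: "Im z \<ge> 0" for z
  proof -
    have "cmod (\<Phi> z) * cmod (cauchy_kernel w w\<^sub>0 z) \<le> M * (2 * W * (2 + (1 + 2 * W\<^sup>2) / r\<^sup>2) / (1 + (cmod z)\<^sup>2))"
      by (intro mult_mono M z cauchy_kernel_bound[OF r far[OF z] W(1,2)] M0) auto
    then show ?thesis by (simp add: norm_mult C_def)
  qed
  have nz: "z - w \<noteq> 0" "z - w\<^sub>0 \<noteq> 0" if "Im z \<ge> 0" for z using far[OF that] r by auto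
  have Gcont: "continuous_on ?S ?G"
    unfolding cauchy_kernel_def by (intro continuous_intros cont) (use nz in auto)
  have Gdiff: "?G field_differentiable (at z)" if "z \<in> interior ?S - {}" for z
  proof -
    have "Im z > 0"
      using that interior_halfspace_ge[of \<i> 0] by (simp add: inner_complex_def)
    then show ?thesis unfolding cauchy_kernel_def
      using nz[of z] by (intro derivative_intros field_differentiable_divide diff field_differentiable_diff
          field_differentiable_mult field_differentiable_const field_differentiable_ident) auto
  qed
  obtain P where P: "\<And>z. z \<in> ?S \<Longrightarrow> (P has_field_derivative ?G z) (at z within ?S)"
    using holomorphic_convex_primitive[OF conv finite.emptyI Gcont Gdiff] by blast
  have FTC: "((\<lambda>s. ?G (of_real s)) has_integral (P (of_real R) - P (of_real (-R)))) {-R..R}" if "R \<ge> 0" for R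
  proof (rule fundamental_theorem_of_calculus)
    show "((\<lambda>s. P (of_real s)) has_vector_derivative ?G (of_real s)) (at s within {-R..R})" for s
    proof -
      have 1: "(of_real has_vector_derivative (1::complex)) (at s within {-R..R})"
        by (rule has_vector_derivative_eq_rhs[OF has_vector_derivative_of_real[OF DERIV_ident]]) simp
      have 2: "(P has_field_derivative ?G (of_real s)) (at (of_real s) within of_real ` {-R..R})"
        by (rule has_field_derivative_subset[OF P]) auto
      from field_vector_diff_chain_within[OF 1 2] show ?thesis by (simp add: o_def)
    qed
  qed (use that in simp)
  have seg: "cmod (P a - P b) \<le> C / (1 + R\<^sup>2) * cmod (a - b)"
    if S: "closed_segment b a \<subseteq> {z. Im z \<ge> 0 \<and> R \<le> cmod z}" and R: "R \<ge> 0" for a b R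
  proof (rule field_differentiable_bound[where S = "closed_segment b a" and f' = ?G])
    show "(P has_field_derivative ?G z) (at z within closed_segment b a)" if "z \<in> closed_segment b a" for z
      by (rule has_field_derivative_subset[OF P]) (use S that in auto)
    show "cmod (?G z) \<le> C / (1 + R\<^sup>2)" if "z \<in> closed_segment b a" for z
    proof -
      have z: "Im z \<ge> 0" "R \<le> cmod z" using S that by auto
      have "C / (1 + (cmod z)\<^sup>2) \<le> C / (1 + R\<^sup>2)"
        using C0 R z by (intro divide_left_mono add_left_mono power_mono mult_pos_pos add_pos_nonneg) auto
      with G[OF z(1)] show ?thesis by linarith
    qed
  qed auto
  \<comment> \<open>The three sides of the rectangle with corners \<open>-R\<close>, \<open>-R + iR\<close>, \<open>R + iR\<close>, \<open>R\<close> that lie off the real line.\<close>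
  have lim: "cmod (P (of_real R) - P (of_real (-R))) \<le> 4 * C * (R / (1 + R\<^sup>2))" if R: "R \<ge> 0" for R
  proof -
    let ?a = "complex_of_real (-R)" and ?b = "Complex (-R) R" and ?c = "Complex R R" and ?d = "complex_of_real R"
    have vert: "closed_segment x y \<subseteq> {z. Im z \<ge> 0 \<and> R \<le> cmod z}"
      if "Re x = u" "Re y = u" "\<bar>u\<bar> = R" "Im x \<ge> 0" "Im y \<ge> 0" for x y u
    proof
      fix z assume "z \<in> closed_segment x y"
      then obtain v where v: "0 \<le> v" "v \<le> 1" "z = (1 - v) *\<^sub>R x + v *\<^sub>R y" unfolding closed_segment_def by blast
      have "Re z = u" unfolding v(3) using that by (simp add: algebra_simps)
      moreover have "Im z \<ge> 0" unfolding v(3) using that v by simp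
      ultimately show "z \<in> {z. Im z \<ge> 0 \<and> R \<le> cmod z}" using abs_Re_le_cmod[of z] that by auto
    qed
    have top: "closed_segment ?b ?c \<subseteq> {z. Im z \<ge> 0 \<and> R \<le> cmod z}"
    proof
      fix z assume "z \<in> closed_segment ?b ?c"
      then obtain v where v: "0 \<le> v" "v \<le> 1" "z = (1 - v) *\<^sub>R ?b + v *\<^sub>R ?c" unfolding closed_segment_def by blast
      have "Im z = R" unfolding v(3) by (simp add: algebra_simps)
      then show "z \<in> {z. Im z \<ge> 0 \<and> R \<le> cmod z}" using abs_Im_le_cmod[of z] R by auto
    qed
    have l: "cmod (?b - ?a) = R" "cmod (?c - ?b) = 2 * R" "cmod (?d - ?c) = R"
      using R by (simp_all add: cmod_def real_sqrt_mult)
    have "cmod (P ?b - P ?a) \<le> C / (1 + R\<^sup>2) * R"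
      using seg[OF vert[of ?a "-R" ?b] R] R unfolding l by simp
    moreover have "cmod (P ?c - P ?b) \<le> C / (1 + R\<^sup>2) * (2 * R)"
      using seg[OF top R] unfolding l .
    moreover have "cmod (P ?d - P ?c) \<le> C / (1 + R\<^sup>2) * R"
      using seg[OF vert[of ?c R ?d] R] R unfolding l by simp
    moreover have "cmod (P ?d - P ?a) \<le> cmod (P ?d - P ?c) + (cmod (P ?c - P ?b) + cmod (P ?b - P ?a))"
      using order_trans[OF norm_triangle_ineq add_left_mono[OF norm_triangle_ineq],
          of "P ?d - P ?c" "P ?c - P ?b" "P ?b - P ?a"] by simp
    ultimately have "cmod (P ?d - P ?a) \<le> C / (1 + R\<^sup>2) * R + (C / (1 + R\<^sup>2) * (2 * R) + C / (1 + R\<^sup>2) * R)"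
      by linarith
    also have "\<dots> = 4 * C * (R / (1 + R\<^sup>2))" by (simp add: field_simps)
    finally show ?thesis .
  qed
  have meas: "(\<lambda>s. \<Phi> (of_real s)) \<in> borel_measurable borel"
    by (intro borel_measurable_continuous_onI continuous_on_compose2[OF cont] continuous_intros) auto
  have Gint: "integrable lborel (\<lambda>s. ?G (of_real s))"
    by (rule cauchy_kernel_integrable_nonreal[OF meas, of M]) (use M w in auto)
  have 1: "(\<lambda>n. LINT s|lborel. indicator {- real n..real n} s *\<^sub>R ?G (of_real s)) \<longlonglongrightarrow> (LINT s|lborel. ?G (of_real s))"
  proof (rule integral_dominated_convergence[where w = "\<lambda>s. norm (?G (of_real s))"])
    show "AE s in lborel. (\<lambda>n. indicator {- real n..real n} s *\<^sub>R ?G (of_real s)) \<longlonglongrightarrow> ?G (of_real s)"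
    proof (rule AE_I2, rule tendsto_eventually)
      fix s :: real
      from filterlim_at_top_dense[THEN iffD1, OF filterlim_real_sequentially, rule_format, of "\<bar>s\<bar>"]
      show "\<forall>\<^sub>F n in sequentially. indicator {- real n..real n} s *\<^sub>R ?G (of_real s) = ?G (of_real s)"
        by eventually_elim (auto simp: indicator_def abs_less_iff)
    qed
    show "(\<lambda>s. ?G (of_real s)) \<in> borel_measurable lborel" using Gint by (rule borel_measurable_integrable)
    show "(\<lambda>s. indicator {- real i..real i} s *\<^sub>R ?G (of_real s)) \<in> borel_measurable lborel" for i
      by (intro borel_measurable_scaleR borel_measurable_indicator borel_measurable_integrable[OF Gint]) auto
    show "integrable lborel (\<lambda>s. norm (?G (of_real s)))" using Gint by (rule integrable_norm)
  qed (auto simp: indicator_def)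
  have 2: "(LINT s|lborel. indicator {- real n..real n} s *\<^sub>R ?G (of_real s)) = P (of_real (real n)) - P (of_real (- real n))" for n
  proof -
    have "set_integrable lborel {- real n..real n} (\<lambda>s. ?G (of_real s))"
      by (intro borel_integrable_atLeastAtMost' continuous_on_compose2[OF Gcont] continuous_intros) auto
    from set_borel_integral_eq_integral(2)[OF this] show ?thesis
      using integral_unique[OF FTC[of "real n"]] by (simp add: set_lebesgue_integral_def)
  qed
  have "(\<lambda>n. P (of_real (real n)) - P (of_real (- real n))) \<longlonglongrightarrow> 0"
  proof (rule Lim_null_comparison)
    show "\<forall>\<^sub>F n in sequentially. norm (P (of_real (real n)) - P (of_real (- real n))) \<le> 4 * C * (real n / (1 + (real n)\<^sup>2))"
      by (intro always_eventually allI lim) simp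
    have "(\<lambda>n. real n / (1 + (real n)\<^sup>2)) \<longlonglongrightarrow> 0" by real_asymp
    then show "(\<lambda>n. 4 * C * (real n / (1 + (real n)\<^sup>2))) \<longlonglongrightarrow> 0" by (rule tendsto_mult_right_zero)
  qed
  with 1 show "(LINT s|lborel. ?G (of_real s)) = 0"
    unfolding 2 using LIMSEQ_unique by blast
qed


lemma positive_frequency_linear:
  assumes F: "positive_frequency F" "continuous_on UNIV F" "\<And>s. cmod (F s) \<le> M"
    and G: "positive_frequency G" "continuous_on UNIV G" "\<And>s. cmod (G s) \<le> N"
  shows "positive_frequency (\<lambda>s. F s + G s)" "positive_frequency (\<lambda>s. c * F s)"
proof -
  have "integrable lborel (\<lambda>s. F s * cauchy_kernel w w\<^sub>0 (of_real s))" 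
    "integrable lborel (\<lambda>s. G s * cauchy_kernel w w\<^sub>0 (of_real s))" if "Im w < 0" "Im w\<^sub>0 < 0" for w w\<^sub>0
    using that F G by (auto intro!: cauchy_kernel_integrable_nonreal borel_measurable_continuous_onI)
  then show "positive_frequency (\<lambda>s. F s + G s)" 
    using F(1) G(1) by (simp add: positive_frequency_def distrib_right)
  show "positive_frequency (\<lambda>s. c * F s)"
    using F(1) by (simp add: positive_frequency_def mult.assoc)
qed

lemma positive_frequency_limit:
  assumes pos: "\<And>n. positive_frequency (F n)" and cont: "\<And>n. continuous_on UNIV (F n)"
    and G: "continuous_on UNIV G" and lim: "\<And>s. (\<lambda>n. F n s) \<longlonglongrightarrow> G s"
    and M: "\<And>n s. cmod (F n s) \<le> M"
  shows "positive_frequency G"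
  unfolding positive_frequency_def
proof (intro allI impI)
  fix w w\<^sub>0 assume w: "Im w < 0" "Im w\<^sub>0 < 0"
  have one: "integrable lborel (\<lambda>s. 1 * cauchy_kernel w w\<^sub>0 (of_real s))"
    by (rule cauchy_kernel_integrable_nonreal[where M = 1]) (use w in auto)
  have "(\<lambda>n. LINT s|lborel. F n s * cauchy_kernel w w\<^sub>0 (of_real s)) \<longlonglongrightarrow> (LINT s|lborel. G s * cauchy_kernel w w\<^sub>0 (of_real s))"
  proof (rule integral_dominated_convergence[where w = "\<lambda>s. M * cmod (1 * cauchy_kernel w w\<^sub>0 (of_real s))"])
    show "AE s in lborel. (\<lambda>n. F n s * cauchy_kernel w w\<^sub>0 (of_real s)) \<longlonglongrightarrow> G s * cauchy_kernel w w\<^sub>0 (of_real s)"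
      by (intro AE_I2 tendsto_mult_right lim)
    show "AE s in lborel. norm (F n s * cauchy_kernel w w\<^sub>0 (of_real s)) \<le> M * cmod (1 * cauchy_kernel w w\<^sub>0 (of_real s))" for n
      by (intro AE_I2) (simp add: norm_mult M mult_right_mono)
    show "integrable lborel (\<lambda>s. M * cmod (1 * cauchy_kernel w w\<^sub>0 (of_real s)))"
      by (intro integrable_mult_right integrable_norm one)
    show "(\<lambda>s. F n s * cauchy_kernel w w\<^sub>0 (of_real s)) \<in> borel_measurable lborel" for n
      using borel_measurable_continuous_onI[OF cont[of n]] unfolding cauchy_kernel_def by measurable
    show "(\<lambda>s. G s * cauchy_kernel w w\<^sub>0 (of_real s)) \<in> borel_measurable lborel"
      using borel_measurable_continuous_onI[OF G] unfolding cauchy_kernel_def by measurable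
  qed
  moreover have "(LINT s|lborel. F n s * cauchy_kernel w w\<^sub>0 (of_real s)) = 0" for n
    using pos w unfolding positive_frequency_def by blast
  ultimately show "(LINT s|lborel. G s * cauchy_kernel w w\<^sub>0 (of_real s)) = 0"
    by (simp add: LIMSEQ_const_iff)
qed

text \<open>The Cauchy integral \<open>P\<close> of \<open>F\<close> is holomorphic off the support of \<open>F\<close>, a domain that is connected through
  the interval \<open>(a, b)\<close>.  It vanishes on the lower half-plane, hence also on the upper one.  The jump of \<open>P\<close>
  across the real line is the Poisson integral of \<open>F\<close>, which tends to \<open>F\<close>.\<close>

lemma positive_frequency_vanish:
  fixes F :: "real \<Rightarrow> complex"
  assumes cont: "continuous_on UNIV F" and M: "\<And>s. cmod (F s) \<le> M"
    and pos: "positive_frequency F" and ab: "a < b" and zero: "\<And>s. a < s \<Longrightarrow> s < b \<Longrightarrow> F s = 0"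
  shows "F x = 0"
proof -
  have meas: "F \<in> borel_measurable borel" using cont by (rule borel_measurable_continuous_onI)
  define D where "D = - (complex_of_real ` (- {a<..<b}))"
  let ?z = "- \<i>"
  define P where "P w = (LINT s|lborel. F s * cauchy_kernel w ?z (of_real s))" for w
  have "closed (complex_of_real ` (- {a<..<b}))"
    by (rule closed_injective_linear_image) (auto simp: inj_def linear_of_real)
  then have openD: "open D" by (simp add: D_def open_Compl)
  define c where "c = complex_of_real ((a + b) / 2)"
  have Dmem: "z \<in> D \<longleftrightarrow> Im z \<noteq> 0 \<or> a < Re z \<and> Re z < b" for z
    unfolding D_def by (auto simp: complex_eq_iff image_iff)
  have connD: "connected D"
  proof -
    have "closed_segment c z \<subseteq> D" if "z \<in> D" for z
    proof
      fix y assume "y \<in> closed_segment c z"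
      then obtain u where u: "0 \<le> u" "u \<le> 1" "y = (1 - u) *\<^sub>R c + u *\<^sub>R z" unfolding closed_segment_def by blast
      have Im: "Im y = u * Im z" and Re: "Re y = (1 - u) * ((a + b) / 2) + u * Re z"
        unfolding u(3) by (simp_all add: c_def)
      show "y \<in> D"
      proof (cases "u * Im z = 0")
        case False then show ?thesis by (simp add: Dmem Im)
      next
        case True
        have "u = 0 \<or> Re z \<in> {a<..<b}" using True that by (auto simp: Dmem)
        then have "Re y \<in> {a<..<b}"
        proof
          assume "u = 0" then show ?thesis using ab by (simp add: Re)
        next
          assume "Re z \<in> {a<..<b}"
          moreover have "(a + b) / 2 \<in> {a<..<b}" using ab by simp
          ultimately show ?thesis
            using convexD_alt[OF convex_real_interval(8)[of a b], of "(a + b) / 2" "Re z" u] u(1,2) unfolding Re by simp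
        qed
        then show ?thesis by (simp add: Dmem)
      qed
    qed
    then have "starlike D" unfolding starlike_def using Dmem[of c] ab by (auto simp: c_def)
    then show ?thesis by (rule starlike_imp_connected)
  qed
  \<comment> \<open>Near a point of the domain, the kernel is bounded away from its pole on the support of \<open>F\<close>.\<close>
  have far: "e \<le> cmod (of_real s - w)" if "cball w1 (2 * e) \<subseteq> D" "w \<in> ball w1 e" "F s \<noteq> 0" for w1 w e s
  proof -
    have "\<not> (a < s \<and> s < b)" using zero that(3) by blast
    then have "complex_of_real s \<notin> D" by (auto simp: Dmem)
    then have "complex_of_real s \<notin> cball w1 (2 * e)" using that(1) by blast
    then have "2 * e < dist w1 (of_real s)" by simp
    moreover have "dist w1 (of_real s) \<le> dist w1 w + dist w (of_real s)" by (rule dist_triangle)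
    ultimately show ?thesis using that(2) by (simp add: dist_norm norm_minus_commute)
  qed
  have far0: "1 \<le> cmod (of_real s - ?z)" for s
    using cmod_ge_Im[of ?z s] by simp
  have M0: "0 \<le> M" using order_trans[OF norm_ge_zero M] .
  have Pdiff: "P field_differentiable at w1" if w1: "w1 \<in> D" for w1
  proof -
    obtain e0 where e0: "e0 > 0" "cball w1 e0 \<subseteq> D" using openD w1 open_contains_cball by blast
    define e where "e = min (e0 / 2) 1"
    have e: "e > 0" "e \<le> 1" "cball w1 (2 * e) \<subseteq> D" using e0 by (auto simp: e_def)
    define W where "W = cmod w1 + e"
    let ?K = "2 + (1 + 2 * W\<^sup>2) / e\<^sup>2"
    have W: "cmod w \<le> W" if "w \<in> ball w1 e" for w
      using that norm_triangle_ineq2[of w w1] by (auto simp: W_def dist_norm norm_minus_commute)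
    have "((\<lambda>w. LINT s|lborel. F s * cauchy_kernel w ?z (of_real s)) has_field_derivative
        (LINT s|lborel. F s / (of_real s - w1)\<^sup>2)) (at w1)"
    proof (rule has_field_derivative_LINT[where U = "ball w1 e" and B = "\<lambda>s. (M * ?K) / (1 + s\<^sup>2)"])
      show "integrable lborel (\<lambda>s. F s * cauchy_kernel w ?z (of_real s))" if "w \<in> ball w1 e" for w
        by (rule cauchy_kernel_integrable[OF meas M e(1)]) 
          (use far[OF e(3) that] far0 e(2) order_trans in blast)
      show "((\<lambda>w. F s * cauchy_kernel w ?z (of_real s)) has_field_derivative F s / (of_real s - w)\<^sup>2) (at w)"
        if w: "w \<in> ball w1 e" for w s
      proof (cases "F s = 0")
        case False
        have "of_real s - w \<noteq> 0" using far[OF e(3) w False] e(1) by auto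
        then show ?thesis unfolding cauchy_kernel_def
          by (auto intro!: derivative_eq_intros simp: power2_eq_square)
      qed simp
      show "cmod (F s / (of_real s - w)\<^sup>2) \<le> (M * ?K) / (1 + s\<^sup>2)" if w: "w \<in> ball w1 e" for w s
      proof (cases "F s = 0")
        case True
        have "0 \<le> (M * ?K) / (1 + s\<^sup>2)" using M0 by (intro divide_nonneg_nonneg mult_nonneg_nonneg add_nonneg_nonneg) auto
        with True show ?thesis by simp
      next
        case False
        have "1 + s\<^sup>2 \<le> ?K * (cmod (of_real s - w))\<^sup>2"
          using one_plus_sq_le[OF e(1) far[OF e(3) w False] W[OF w]] by simp
        moreover have "cmod (of_real s - w) > 0" using far[OF e(3) w False] e(1) by linarith
        moreover have "1 + s\<^sup>2 > 0" by (simp add: add_pos_nonneg)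
        ultimately have "1 / (cmod (of_real s - w))\<^sup>2 \<le> ?K / (1 + s\<^sup>2)" by (simp add: divide_simps mult.commute)
        then have "cmod (F s) * (1 / (cmod (of_real s - w))\<^sup>2) \<le> M * (?K / (1 + s\<^sup>2))"
          by (intro mult_mono M M0) auto
        then show ?thesis by (simp add: norm_divide norm_power)
      qed
      show "integrable lborel (\<lambda>s. (M * ?K) / (1 + s\<^sup>2))" by (rule integrable_bound_real_1_plus_sq)
      show "(\<lambda>s. F s / (of_real s - w1)\<^sup>2) \<in> borel_measurable lborel"
        using meas by measurable
    qed (use e in auto)
    then show ?thesis unfolding P_def[abs_def] field_differentiable_def by blast
  qed
  then have Phol: "P holomorphic_on D"
    by (simp add: holomorphic_on_def field_differentiable_at_within)
  have Plow: "P w = 0" if "Im w < 0" for w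
    using pos that unfolding P_def positive_frequency_def by simp
  have P0: "P w = 0" if "w \<in> D" for w
  proof (rule analytic_continuation[OF Phol openD connD, of "{w. Im w < 0}" "-\<i>"])
    show "- \<i> islimpt {w. Im w < 0}"
      by (rule interior_limit_point) (simp add: interior_open open_halfspace_Im_lt)
  qed (use Plow that in \<open>auto simp: Dmem\<close>)
  have poisson: "(LINT s|lborel. F s * of_real (y / ((s - x)\<^sup>2 + y\<^sup>2))) = 0" if y: "y > 0" for y
  proof -
    let ?w = "Complex x y" and ?w' = "Complex x (-y)"
    have D: "?w \<in> D" "?w' \<in> D" using y by (auto simp: Dmem)
    have int: "integrable lborel (\<lambda>s. F s * cauchy_kernel w ?z (of_real s))" if "Im w \<noteq> 0" for w
      by (rule cauchy_kernel_integrable_nonreal[OF meas M]) (use that in auto)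
    have eq: "F s * cauchy_kernel ?w ?z (of_real s) - F s * cauchy_kernel ?w' ?z (of_real s)
        = 2 * \<i> * (F s * of_real (y / ((s - x)\<^sup>2 + y\<^sup>2)))" for s
    proof -
      have nz: "of_real s - ?w \<noteq> 0" "of_real s - ?w' \<noteq> 0" using y by (auto simp: complex_eq_iff)
      have "1 / (of_real s - ?w) - 1 / (of_real s - ?w') = (?w - ?w') / ((of_real s - ?w) * (of_real s - ?w'))"
        using nz by (simp add: field_simps)
      moreover have "(of_real s - ?w) * (of_real s - ?w') = of_real ((s - x)\<^sup>2 + y\<^sup>2)"
        by (simp add: complex_eq_iff power2_eq_square algebra_simps)
      moreover have "?w - ?w' = 2 * \<i> * of_real y" by (simp add: complex_eq_iff)
      ultimately have "1 / (of_real s - ?w) - 1 / (of_real s - ?w') = 2 * \<i> * of_real (y / ((s - x)\<^sup>2 + y\<^sup>2))"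
        by simp
      then show ?thesis unfolding cauchy_kernel_def by (simp add: algebra_simps)
    qed
    have "0 = P ?w - P ?w'" using P0 D by simp
    also have "\<dots> = (LINT s|lborel. F s * cauchy_kernel ?w ?z (of_real s) - F s * cauchy_kernel ?w' ?z (of_real s))"
      unfolding P_def using y by (intro Bochner_Integration.integral_diff[symmetric] int) auto
    also have "\<dots> = 2 * \<i> * (LINT s|lborel. F s * of_real (y / ((s - x)\<^sup>2 + y\<^sup>2)))"
      unfolding eq by (rule integral_mult_right_zero)
    finally show ?thesis by simp
  qed
  define y where "y n = 1 / real (Suc n)" for n
  have y0: "y n > 0" for n by (simp add: y_def)
  have ylim: "y \<longlonglongrightarrow> 0" unfolding y_def using LIMSEQ_inverse_real_of_nat by (simp add: inverse_eq_divide)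
  have zeroint: "(LINT u|lborel. F (x + y n * u) * of_real (1 / (1 + u\<^sup>2))) = 0" for n
  proof -
    have "0 = (LINT s|lborel. F s * of_real (y n / ((s - x)\<^sup>2 + (y n)\<^sup>2)))" using poisson[OF y0] by simp
    also have "\<dots> = \<bar>y n\<bar> *\<^sub>R (LINT u|lborel. F (x + y n * u) * of_real (y n / ((x + y n * u - x)\<^sup>2 + (y n)\<^sup>2)))"
      by (rule lborel_integral_real_affine) (use y0[of n] in simp)
    also have "(\<lambda>u. F (x + y n * u) * complex_of_real (y n / ((x + y n * u - x)\<^sup>2 + (y n)\<^sup>2)))
      = (\<lambda>u. of_real (1 / y n) * (F (x + y n * u) * complex_of_real (1 / (1 + u\<^sup>2))))"
    proof
      fix u
      have "(y n * u)\<^sup>2 + (y n)\<^sup>2 = (y n)\<^sup>2 * (1 + u\<^sup>2)" by (simp add: power_mult_distrib algebra_simps)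
      then have "y n / ((y n * u)\<^sup>2 + (y n)\<^sup>2) = 1 / y n * (1 / (1 + u\<^sup>2))"
        using y0[of n] by (simp add: power2_eq_square)
      then show "F (x + y n * u) * complex_of_real (y n / ((x + y n * u - x)\<^sup>2 + (y n)\<^sup>2))
        = of_real (1 / y n) * (F (x + y n * u) * complex_of_real (1 / (1 + u\<^sup>2)))"
        by (simp only: add_diff_cancel_left' of_real_mult mult_ac)
    qed
    finally show ?thesis
      unfolding integral_mult_right_zero using y0[of n] by simp
  qed
  have "(\<lambda>n. LINT u|lborel. F (x + y n * u) * of_real (1 / (1 + u\<^sup>2))) \<longlonglongrightarrow> (LINT u|lborel. F x * of_real (1 / (1 + u\<^sup>2)))"
  proof (rule integral_dominated_convergence[where w = "\<lambda>u. M / (1 + u\<^sup>2)"])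
    have "(\<lambda>n. F (x + y n * u)) \<longlonglongrightarrow> F x" for u
    proof -
      have "(\<lambda>n. x + y n * u) \<longlonglongrightarrow> x + 0 * u" by (intro tendsto_intros ylim)
      then show ?thesis using continuous_on_tendsto_compose[OF cont] by simp
    qed
    then show "AE u in lborel. (\<lambda>n. F (x + y n * u) * of_real (1 / (1 + u\<^sup>2))) \<longlonglongrightarrow> F x * of_real (1 / (1 + u\<^sup>2))"
      by (intro AE_I2 tendsto_mult_right)
    have "cmod (F (x + y n * u) * of_real (1 / (1 + u\<^sup>2))) \<le> M / (1 + u\<^sup>2)" for n u
    proof -
      have "cmod (F (x + y n * u)) * (1 / (1 + u\<^sup>2)) \<le> M * (1 / (1 + u\<^sup>2))" by (intro mult_right_mono M) simp
      moreover have "cmod (complex_of_real (1 / (1 + u\<^sup>2))) = 1 / (1 + u\<^sup>2)"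
        unfolding norm_of_real by (rule abs_of_nonneg) simp
      ultimately show ?thesis by (simp only: norm_mult times_divide_eq_right mult_1_right)
    qed
    then show "\<And>n. AE u in lborel. norm (F (x + y n * u) * of_real (1 / (1 + u\<^sup>2))) \<le> M / (1 + u\<^sup>2)"
      by (intro AE_I2)
    show "integrable lborel (\<lambda>u. M / (1 + u\<^sup>2))" by (rule integrable_bound_real_1_plus_sq)
  qed (use meas in measurable)
  then have 0: "(LINT u|lborel. F x * complex_of_real (1 / (1 + u\<^sup>2))) = 0"
    unfolding zeroint using LIMSEQ_unique tendsto_const by blast
  have "(LINT u|lborel. F x * complex_of_real (1 / (1 + u\<^sup>2))) = F x * of_real (LINT u|lborel. 1 / (1 + u\<^sup>2))"
    by (simp only: integral_mult_right_zero integral_complex_of_real)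
  moreover have "(LINT u|lborel. 1 / (1 + u\<^sup>2) :: real) = pi"
    using LBINT_inverse_1_plus_square
    by (simp add: interval_lebesgue_integral_def set_lebesgue_integral_def inverse_eq_divide)
  ultimately show ?thesis using 0 by simp
qed

text \<open>The preceding uniqueness statement for limits: otherwise a diagonal sequence of the bounded, equicontinuous
  family would converge pointwise to a function of positive frequency that vanishes on \<open>(a, b)\<close> but not at
  \<open>x\<close>.\<close>

lemma positive_frequency_limit_vanish:
  fixes F :: "nat \<Rightarrow> real \<Rightarrow> complex"
  assumes M: "\<And>n s. cmod (F n s) \<le> M"
    and equi: "\<And>\<epsilon>. \<epsilon> > 0 \<Longrightarrow> \<exists>\<delta>>0. \<forall>n s t. \<bar>s - t\<bar> < \<delta> \<longrightarrow> cmod (F n s - F n t) < \<epsilon>"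
    and pos: "\<And>n. positive_frequency (F n)"
    and ab: "a < b" and lim: "\<And>s. a < s \<Longrightarrow> s < b \<Longrightarrow> (\<lambda>n. F n s) \<longlonglongrightarrow> 0"
  shows "(\<lambda>n. F n x) \<longlonglongrightarrow> 0"
proof (rule ccontr)
  assume "\<not> (\<lambda>n. F n x) \<longlonglongrightarrow> 0"
  then obtain e where e: "e > 0" and ev: "\<not> (\<forall>\<^sub>F n in sequentially. cmod (F n x) < e)"
    by (auto simp: tendsto_iff)
  from ev have "infinite {n. \<not> cmod (F n x) < e}"
    unfolding eventually_sequentially infinite_nat_iff_unbounded_le by auto
  then obtain r :: "nat \<Rightarrow> nat" where r: "strict_mono r" "\<And>n. r n \<in> {n. \<not> cmod (F n x) < e}"
    using infinite_enumerate by blast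
  obtain k :: "nat \<Rightarrow> nat" where k: "strict_mono k" "\<And>q. q \<in> \<rat> \<Longrightarrow> \<exists>l. (\<lambda>n. F (r (k n)) q) \<longlonglongrightarrow> l"
    by (rule function_convergent_subsequence[of \<rat> "\<lambda>n. F (r n)" M]) (use M countable_rat in auto)
  define H where "H n = F (r (k n))" for n
  have "convergent (\<lambda>n. H n s)" for s
  proof (rule Cauchy_convergent, rule metric_CauchyI)
    fix \<epsilon> :: real assume \<epsilon>: "\<epsilon> > 0"
    obtain d where d: "d > 0" "\<And>n s t. \<bar>s - t\<bar> < d \<Longrightarrow> cmod (F n s - F n t) < \<epsilon> / 3"
      using equi[of "\<epsilon> / 3"] \<epsilon> by auto
    obtain q where q: "q \<in> \<rat>" "s < q" "q < s + d" using Rats_dense_in_real[of s "s + d"] d(1) by auto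
    have "Cauchy (\<lambda>n. H n q)" using k(2)[OF q(1)] unfolding H_def by (auto intro: LIMSEQ_imp_Cauchy)
    then obtain N where N: "\<And>m n. m \<ge> N \<Longrightarrow> n \<ge> N \<Longrightarrow> dist (H m q) (H n q) < \<epsilon> / 3"
      using \<epsilon> metric_CauchyD[of "\<lambda>n. H n q" "\<epsilon> / 3"] by auto
    have "dist (H m s) (H n s) < \<epsilon>" if "m \<ge> N" "n \<ge> N" for m n
    proof -
      have "dist (H m s) (H n s) \<le> dist (H m s) (H m q) + (dist (H m q) (H n q) + dist (H n q) (H n s))"
        by (meson add_left_mono dist_triangle order_trans)
      moreover have "dist (H m s) (H m q) < \<epsilon> / 3" "dist (H n q) (H n s) < \<epsilon> / 3"
        unfolding dist_norm H_def using q by (auto intro!: d(2) simp del: less_divide_eq_numeral1)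
      ultimately show ?thesis using N[OF that] by linarith
    qed
    then show "\<exists>M. \<forall>m\<ge>M. \<forall>n\<ge>M. dist (H m s) (H n s) < \<epsilon>" by blast
  qed
  then obtain G where G: "\<And>s. (\<lambda>n. H n s) \<longlonglongrightarrow> G s" unfolding convergent_def by metis
  have GM: "cmod (G s) \<le> M" for s
    by (rule Lim_bounded[OF tendsto_norm[OF G]]) (simp add: H_def M)
  have Hcont: "continuous_on UNIV (H n)" for n
    unfolding continuous_on_iff
  proof (intro ballI allI impI)
    fix s \<epsilon> :: real assume "\<epsilon> > 0"
    then obtain d where "d > 0" "\<And>n s t. \<bar>s - t\<bar> < d \<Longrightarrow> cmod (F n s - F n t) < \<epsilon>" using equi by blast
    then show "\<exists>d>0. \<forall>t\<in>UNIV. dist t s < d \<longrightarrow> dist (H n t) (H n s) < \<epsilon>"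
      by (intro exI[of _ d]) (auto simp: H_def dist_norm)
  qed
  have Gcont: "continuous_on UNIV G"
    unfolding continuous_on_iff
  proof (intro ballI allI impI)
    fix s \<epsilon> :: real assume \<epsilon>: "\<epsilon> > 0"
    obtain d where d: "d > 0" "\<And>n s t. \<bar>s - t\<bar> < d \<Longrightarrow> cmod (F n s - F n t) < \<epsilon> / 2" 
      using equi[of "\<epsilon> / 2"] \<epsilon> by auto
    have "dist (G t) (G s) < \<epsilon>" if "dist t s < d" for t
    proof -
      have "cmod (G t - G s) \<le> \<epsilon> / 2"
      proof (rule Lim_bounded[OF tendsto_norm[OF tendsto_diff[OF G G]]])
        show "\<forall>n\<ge>0. norm (H n t - H n s) \<le> \<epsilon> / 2"
          unfolding H_def using d(2) that by (auto simp: dist_norm less_imp_le)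
      qed
      then show ?thesis using \<epsilon> by (simp add: dist_norm)
    qed
    then show "\<exists>d>0. \<forall>t\<in>UNIV. dist t s < d \<longrightarrow> dist (G t) (G s) < \<epsilon>" using d(1) by blast
  qed
  have posG: "positive_frequency G"
    by (rule positive_frequency_limit[OF _ Hcont Gcont G, where M = M]) (simp_all add: H_def pos M)
  have "G s = 0" if "a < s" "s < b" for s
  proof -
    have "(\<lambda>n. H n s) \<longlonglongrightarrow> 0"
      using LIMSEQ_subseq_LIMSEQ[OF lim[OF that] strict_mono_o[OF r(1) k(1)]] by (simp add: H_def o_def)
    then show ?thesis by (rule LIMSEQ_unique[OF G])
  qed
  then have "G x = 0" by (rule positive_frequency_vanish[OF Gcont GM posG ab])
  then have "(\<lambda>n. cmod (H n x)) \<longlonglongrightarrow> 0" using tendsto_norm[OF G[of x]] by simp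
  moreover have "\<exists>N. \<forall>n\<ge>N. e \<le> cmod (H n x)" using r(2) unfolding H_def by (auto simp: not_less)
  ultimately have "e \<le> 0" by (rule LIMSEQ_le_const)
  then show False using e by simp
qed

section \<open>Operators on a complex Hilbert space\<close>

lemma bounded_bilinear_cinner: "bounded_bilinear (cinner :: 'a::complex_hilbert \<Rightarrow> 'a \<Rightarrow> complex)"
proof
  show "\<exists>K. \<forall>a b :: 'a. norm (cinner a b) \<le> norm a * norm b * K"
    by (intro exI[of _ 1]) (simp add: cinner_cauchy_schwarz)
qed (auto simp: cinner_add_left cinner_add_right cinner_scaleR scaleR_conv_of_real)

lemma bounded_bilinear_op_app: "bounded_bilinear (op_app :: 'a::complex_hilbert bdd_op \<Rightarrow> 'a \<Rightarrow> 'a)"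
proof
  show "\<exists>K. \<forall>A x. norm ((A :: 'a bdd_op) \<cdot> x) \<le> norm A * norm x * K"
    by (intro exI[of _ 1]) (simp add: norm_op_app)
qed (auto simp: op_app_simps)

lemmas tendsto_cinner = bounded_bilinear.tendsto[OF bounded_bilinear_cinner]
lemmas continuous_on_cinner = bounded_bilinear.continuous_on[OF bounded_bilinear_cinner]
lemmas bounded_linear_cinner_right = bounded_bilinear.bounded_linear_right[OF bounded_bilinear_cinner]
lemmas bounded_linear_op_app = bounded_bilinear.bounded_linear_right[OF bounded_bilinear_op_app]
lemmas tendsto_op_app = bounded_bilinear.tendsto[OF bounded_bilinear_op_app]
lemmas continuous_on_op_app = bounded_bilinear.continuous_on[OF bounded_bilinear_op_app]

lemma cinner_zero: "cinner 0 (x::'a::complex_hilbert) = 0" "cinner (x::'a::complex_hilbert) 0 = 0"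
  using cinner_scaleR[where r = 0] by (metis mult_zero_left of_real_0 scaleR_zero_left)+

lemma norm_sq_cinner: "(norm (x::'a::complex_hilbert))\<^sup>2 = Re (cinner x x)"
  by (simp add: cinner_self)

lemma norm_diff_sq:
  fixes x y :: "'a::complex_hilbert"
  shows "(norm (x - y))\<^sup>2 = (norm x)\<^sup>2 - 2 * Re (cinner x y) + (norm y)\<^sup>2"
  using norm_add_sq[of x "- y"] by (simp add: cinner_minus)

lemma unitary_star: "unitary (u::'a::cstar_algebra) \<Longrightarrow> unitary (star u)"
  by (simp add: unitary_def star_star)

lemma unitary_star_app:
  assumes "unitary (U :: 'a::complex_hilbert bdd_op)"
  shows "star U \<cdot> (U \<cdot> x) = x" "U \<cdot> (star U \<cdot> x) = x"
  using assms by (simp_all add: unitary_def op_app_times[symmetric] op_app_one)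

lemma cinner_unitary:
  assumes "unitary (U :: 'a::complex_hilbert bdd_op)"
  shows "cinner (U \<cdot> x) (U \<cdot> y) = cinner x y"
  by (metis assms star_adjoint unitary_star_app(1))

lemma norm_unitary_app:
  assumes "unitary (U :: 'a::complex_hilbert bdd_op)"
  shows "norm (U \<cdot> x) = norm x"
proof -
  have "(norm (U \<cdot> x))\<^sup>2 = (norm x)\<^sup>2" by (simp add: norm_sq_cinner cinner_unitary[OF assms])
  then show ?thesis by (simp add: power2_eq_iff_nonneg)
qed

lemma norm_star: "norm (star a) = norm (a::'a::cstar_algebra)"
proof -
  have le: "norm a \<le> norm (star a)" for a :: 'a
  proof (cases "norm a = 0")
    case False
    have "norm a * norm a \<le> norm (star a) * norm a"
      using norm_star_mult[of a] norm_mult_ineq[of "star a" a] by (simp add: power2_eq_square)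
    then show ?thesis using False by simp
  qed simp
  show ?thesis using le[of a] le[of "star a"] by (simp add: star_star)
qed

lemma star_zero: "star 0 = (0::'a::cstar_algebra)"
  using star_add[of "0::'a" 0] by simp

lemma star_minus: "star (- a) = - star (a::'a::cstar_algebra)"
  using star_add[of a "- a"] by (simp add: star_zero eq_neg_iff_add_eq_0 add.commute)

lemma star_diff: "star (a - b) = star a - star (b::'a::cstar_algebra)"
  using star_add[of a "- b"] by (simp add: star_minus)

lemma star_one: "star 1 = (1::'a::cstar_algebra)"
  by (metis mult.right_neutral star_mult star_star)

lemma star_scaleR: "star (r *\<^sub>R a) = r *\<^sub>R star (a::'a::cstar_algebra)"
  by (metis complex_cnj_complex_of_real scaleC_of_real star_scaleC)

lemma continuous_star: "continuous_on S (star :: 'a::cstar_algebra \<Rightarrow> 'a)"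
  unfolding continuous_on_iff dist_norm star_diff[symmetric] norm_star by blast

lemma norm_unitary_op:
  assumes "unitary (U :: 'a::complex_hilbert bdd_op)"
  shows "norm U = 1"
proof -
  have "(norm U)\<^sup>2 = 1" using norm_star_mult[of U] assms by (simp add: unitary_def)
  then show ?thesis by (simp add: power2_eq_1_iff) (metis norm_ge_zero not_one_le_zero neg_0_le_iff_le)
qed

section \<open>Bicommutants\<close>

lemma commutant_antimono: "X \<subseteq> Y \<Longrightarrow> commutant Y \<subseteq> commutant X"
  by (auto simp: commutant_def)

lemma bicommutant_mono: "X \<subseteq> Y \<Longrightarrow> bicommutant X \<subseteq> bicommutant Y"
  unfolding bicommutant_def by (intro commutant_antimono)

lemma bicommutant_increasing: "X \<subseteq> bicommutant X"
  by (auto simp: bicommutant_def commutant_def)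

lemma bicommutant_mult:
  fixes A B :: "'a::complex_hilbert bdd_op"
  assumes "A \<in> bicommutant X" "B \<in> bicommutant X"
  shows "A * B \<in> bicommutant X"
  using assms by (auto simp: bicommutant_def commutant_def) (metis mult.assoc)

lemma bicommutant_zero: "0 \<in> bicommutant X"
  by (auto simp: bicommutant_def commutant_def)

lemma bicommutant_star:
  fixes A :: "'a::complex_hilbert bdd_op"
  assumes X: "\<And>B. B \<in> X \<Longrightarrow> star B \<in> X" and A: "A \<in> bicommutant X"
  shows "star A \<in> bicommutant X"
proof -
  have "star T \<in> commutant X" if "T \<in> commutant X" for T
    unfolding commutant_def
  proof (intro CollectI ballI)
    fix B assume "B \<in> X"
    then have "T * star B = star B * T" using that X by (auto simp: commutant_def)
    then have "star (T * star B) = star (star B * T)" by simp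
    then show "star T * B = B * star T" by (simp add: star_mult star_star)
  qed
  note * = this
  show ?thesis
    unfolding bicommutant_def commutant_def[of "commutant X"]
  proof (intro CollectI ballI)
    fix T assume "T \<in> commutant X"
    from *[OF this] A have "A * star T = star T * A" by (auto simp: bicommutant_def commutant_def)
    then have "star (A * star T) = star (star T * A)" by simp
    then show "star A * T = T * star A" by (simp add: star_mult star_star)
  qed
qed

lemma bicommutants_commute:
  assumes "\<And>a b. a \<in> X \<Longrightarrow> b \<in> Y \<Longrightarrow> a * b = b * a" and "A \<in> bicommutant X" "B \<in> bicommutant Y"
  shows "A * B = B * A"
proof -
  have "X \<subseteq> commutant Y" using assms(1) by (auto simp: commutant_def)
  then have "bicommutant Y \<subseteq> commutant X"
    unfolding bicommutant_def by (rule commutant_antimono)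
  then have "B \<in> commutant X" using assms(3) by blast
  then show ?thesis using assms(2) by (auto simp: bicommutant_def commutant_def)
qed

lemma bicommutant_conjugate:
  fixes U :: "'a::complex_hilbert bdd_op"
  assumes U: "unitary U" and A: "A \<in> bicommutant X"
  shows "U * A * star U \<in> bicommutant ((\<lambda>B. U * B * star U) ` X)"
  unfolding bicommutant_def commutant_def[of "commutant _"]
proof (intro CollectI ballI)
  have u: "star U * U = 1" "U * star U = 1" using U by (auto simp: unitary_def)
  have u': "star U * (U * x) = x" "U * (star U * x) = x" for x
    by (simp_all add: u mult.assoc[symmetric])
  fix T assume T: "T \<in> commutant ((\<lambda>B. U * B * star U) ` X)"
  have "star U * T * U \<in> commutant X"
    unfolding commutant_def
  proof (intro CollectI ballI)
    fix B assume "B \<in> X"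
    then have "T * (U * B * star U) = (U * B * star U) * T" using T by (auto simp: commutant_def)
    then have "star U * (T * (U * B * star U)) * U = star U * ((U * B * star U) * T) * U" by simp
    then show "star U * T * U * B = B * (star U * T * U)" by (simp add: mult.assoc u u')
  qed
  then have "A * (star U * T * U) = (star U * T * U) * A" using A by (auto simp: bicommutant_def commutant_def)
  then have "U * (A * (star U * T * U)) * star U = U * ((star U * T * U) * A) * star U" by simp
  then show "U * A * star U * T = T * (U * A * star U)" by (simp add: mult.assoc u u')
qed

text \<open>Bicommutants are closed under weak integrals.\<close>

lemma bicommutant_weakI:
  fixes T :: "'a::complex_hilbert bdd_op" and A :: "'y::euclidean_space \<Rightarrow> 'a bdd_op"
  assumes int: "\<And>u v. ((\<lambda>y. g y *\<^sub>R cinner u (A y \<cdot> v)) has_integral cinner u (T \<cdot> v)) S"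
    and mem: "\<And>y. g y \<noteq> 0 \<Longrightarrow> A y \<in> bicommutant X"
  shows "T \<in> bicommutant X"
  unfolding bicommutant_def commutant_def[of "commutant X"]
proof (intro CollectI ballI op_eqI)
  fix B v assume B: "B \<in> commutant X"
  have com: "g y *\<^sub>R cinner (star B \<cdot> u) (A y \<cdot> v) = g y *\<^sub>R cinner u (A y \<cdot> (B \<cdot> v))" for y u
  proof (cases "g y = 0")
    case False
    then have "A y * B = B * A y" using mem B by (auto simp: bicommutant_def commutant_def)
    then show ?thesis by (simp add: star_adjoint flip: op_app_times)
  qed simp
  have "cinner u (B \<cdot> (T \<cdot> v)) = cinner u (T \<cdot> (B \<cdot> v))" for u
    using has_integral_unique[OF int[of "star B \<cdot> u" v, unfolded com] int[of u "B \<cdot> v"]]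
    by (simp add: star_adjoint)
  then have "cinner (B \<cdot> (T \<cdot> v)) u = cinner (T \<cdot> (B \<cdot> v)) u" for u by (metis cinner_commute)
  then show "(T * B) \<cdot> v = (B * T) \<cdot> v" by (metis cinner_eqI op_app_times)
qed

section \<open>Strong integrals\<close>

text \<open>The pointwise gauge integrals form a bounded linear operator, which is the strong integral.\<close>

lemma strong_integral_ex:
  fixes A :: "spacetime \<Rightarrow> 'a::complex_hilbert bdd_op"
  assumes g: "continuous_on UNIV g" "compact (supp g)"
    and cont: "\<And>v. continuous_on UNIV (\<lambda>y. A y \<cdot> v)" and B: "\<And>y. norm (A y) \<le> B"
  obtains T where "\<And>v. ((\<lambda>y. (g y *\<^sub>R A y) \<cdot> v) has_integral T \<cdot> v) UNIV"
    "norm T \<le> B * (LINT y|lborel. \<bar>g y\<bar>)"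
proof -
  have "integrable lborel (\<lambda>y. \<bar>g y\<bar>)"
    by (rule integrable_compact_support[OF _ g(2)])
      (auto intro!: continuous_intros continuous_on_subset[OF g(1)] simp: eq_0_outside_supp)
  then have gh: "((\<lambda>y. \<bar>g y\<bar>) has_integral (LINT y|lborel. \<bar>g y\<bar>)) UNIV"
    by (rule has_integral_integral_lborel)
  obtain b where b: "supp g \<subseteq> cbox (- b) b"
    using compact_imp_bounded[OF g(2)] bounded_subset_cbox_symmetric by blast
  have int: "(\<lambda>y. (g y *\<^sub>R A y) \<cdot> v) integrable_on UNIV" for v
  proof -
    have "(\<lambda>y. (g y *\<^sub>R A y) \<cdot> v) integrable_on cbox (- b) b"
      unfolding op_app_simps
      by (intro integrable_continuous continuous_intros continuous_on_subset[OF g(1)] continuous_on_subset[OF cont]) auto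
    moreover have "(g y *\<^sub>R A y) \<cdot> v = 0" if "y \<notin> cbox (- b) b" for y
    proof -
      have "g y = 0" using that b closure_subset[of "{y. g y \<noteq> 0}"] by (auto simp: supp_def)
      then show ?thesis by (simp add: op_app_simps)
    qed
    ultimately show ?thesis by (rule integrable_on_superset) auto
  qed
  define t where "t v = integral UNIV (\<lambda>y. (g y *\<^sub>R A y) \<cdot> v)" for v
  have t: "((\<lambda>y. (g y *\<^sub>R A y) \<cdot> v) has_integral t v) UNIV" for v
    unfolding t_def by (rule integrable_integral[OF int])
  have add: "t (u + v) = t u + t v" for u v
    using has_integral_unique[OF t[of "u + v"]] has_integral_add[OF t[of u] t[of v]]
    by (simp add: op_app_simps scaleR_add_right)
  have scale: "t (c *\<^sub>C v) = c *\<^sub>C t v" for c v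
    using has_integral_unique[OF t[of "c *\<^sub>C v"]] has_integral_linear[OF t[of v] bounded_linear_scaleC[of c]]
    by (simp add: o_def op_scaleC_right)
  have norm: "norm (t v) \<le> (B * (LINT y|lborel. \<bar>g y\<bar>)) * norm v" for v
  proof -
    have gh': "((\<lambda>y. \<bar>g y\<bar> * (B * norm v)) has_integral (LINT y|lborel. \<bar>g y\<bar>) * (B * norm v)) UNIV"
      by (rule has_integral_mult_left[OF gh])
    have "norm (t v) \<le> integral UNIV (\<lambda>y. \<bar>g y\<bar> * (B * norm v))"
      unfolding t_def
    proof (rule integral_norm_bound_integral[OF int])
      show "(\<lambda>y. \<bar>g y\<bar> * (B * norm v)) integrable_on UNIV" using gh' by blast
      show "norm ((g y *\<^sub>R A y) \<cdot> v) \<le> \<bar>g y\<bar> * (B * norm v)" for y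
      proof -
        have "norm (A y \<cdot> v) \<le> B * norm v"
          using norm_op_app[of "A y" v] mult_right_mono[OF B[of y] norm_ge_zero[of v]] by linarith
        then show ?thesis by (simp add: op_app_simps mult_left_mono)
      qed
    qed
    then show ?thesis unfolding integral_unique[OF gh'] by (simp add: mult_ac)
  qed
  have B0: "0 \<le> B" using order_trans[OF norm_ge_zero B[of 0]] .
  have "bounded_linear t"
  proof (rule bounded_linear_intro[of t "B * (LINT y|lborel. \<bar>g y\<bar>)"])
    show "t (r *\<^sub>R v) = r *\<^sub>R t v" for r v using scale[of "of_real r" v] by (simp add: scaleC_of_real)
    show "norm (t v) \<le> norm v * (B * (LINT y|lborel. \<bar>g y\<bar>))" for v using norm[of v] by (simp add: mult.commute)
  qed (rule add)
  then have bl: "blinfun_apply (Blinfun t) = t" by (rule bounded_linear_Blinfun_apply)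
  have "bl_of (Bdd_op (Blinfun t)) = Blinfun t"
    by (rule Bdd_op_inverse) (simp add: bl scale)
  then have T: "Bdd_op (Blinfun t) \<cdot> v = t v" for v by (simp add: op_app.rep_eq bl)
  show ?thesis
  proof (rule that[of "Bdd_op (Blinfun t)"])
    show "norm (Bdd_op (Blinfun t)) \<le> B * (LINT y|lborel. \<bar>g y\<bar>)"
      by (rule norm_op_bound) (use B0 norm in \<open>auto simp: T\<close>)
  qed (simp add: T t)
qed

lemma strong_integral_eqI:
  assumes "\<And>v. ((\<lambda>y. G y \<cdot> v) has_integral T \<cdot> v) UNIV"
  shows "strong_integral G = T"
  unfolding strong_integral_def
proof (rule the_equality)
  fix T' assume "\<forall>v. ((\<lambda>y. G y \<cdot> v) has_integral T' \<cdot> v) UNIV"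
  then show "T' = T" using assms by (metis has_integral_unique op_eqI)
qed (use assms in blast)

lemma strong_integral:
  fixes A :: "spacetime \<Rightarrow> 'a::complex_hilbert bdd_op"
  assumes "continuous_on UNIV g" "compact (supp g)"
    and "\<And>v. continuous_on UNIV (\<lambda>y. A y \<cdot> v)" and "\<And>y. norm (A y) \<le> B"
  shows "((\<lambda>y. g y *\<^sub>R (A y \<cdot> v)) has_integral strong_integral (\<lambda>y. g y *\<^sub>R A y) \<cdot> v) UNIV"
    and "norm (strong_integral (\<lambda>y. g y *\<^sub>R A y)) \<le> B * (LINT y|lborel. \<bar>g y\<bar>)"
proof -
  obtain T where T: "\<And>v. ((\<lambda>y. (g y *\<^sub>R A y) \<cdot> v) has_integral T \<cdot> v) UNIV"
    "norm T \<le> B * (LINT y|lborel. \<bar>g y\<bar>)"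
    using strong_integral_ex[OF assms] by blast
  have eq: "strong_integral (\<lambda>y. g y *\<^sub>R A y) = T" by (rule strong_integral_eqI[OF T(1)])
  show "((\<lambda>y. g y *\<^sub>R (A y \<cdot> v)) has_integral strong_integral (\<lambda>y. g y *\<^sub>R A y) \<cdot> v) UNIV"
    using T(1)[of v] by (simp add: eq op_app_simps)
  show "norm (strong_integral (\<lambda>y. g y *\<^sub>R A y)) \<le> B * (LINT y|lborel. \<bar>g y\<bar>)" by (simp add: eq T(2))
qed

lemma has_integral_cinner:
  assumes "((\<lambda>y. g y *\<^sub>R f y) has_integral t) S"
  shows "((\<lambda>y. g y *\<^sub>R cinner u (f y)) has_integral cinner u t) S"
  using has_integral_linear[OF assms bounded_linear_cinner_right[of u]]
  by (simp add: o_def cinner_scaleR scaleR_conv_of_real)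

section \<open>Positive functionals\<close>

text \<open>Square roots near the identity in a C*-algebra.  The fixed point \<open>z\<close> of \<open>z \<mapsto> (x + z\<^sup>2) / 2\<close> satisfies
  \<open>1 - x = (1 - z)\<^sup>2\<close>.\<close>

lemma one_minus_eq_square:
  fixes x :: "'a::cstar_algebra"
  assumes x: "star x = x" "norm x \<le> 3/4"
  obtains b where "star b = b" "1 - x = b * b"
proof -
  define S where "S = {z :: 'a. norm z \<le> 1/2 \<and> star z = z}"
  define T where "T z = (1/2) *\<^sub>R (x + z * z)" for z
  have "closed S"
  proof -
    have "closed {z :: 'a. norm z \<le> 1/2}" by (intro closed_Collect_le continuous_intros)
    moreover have "closed {z :: 'a. star z = z}" by (intro closed_Collect_eq continuous_intros continuous_star)
    ultimately show ?thesis unfolding S_def by (rule closed_Collect_conj)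
  qed
  note complete = complete_eq_closed[THEN iffD2, OF this]
  have "S \<noteq> {}" by (auto simp: S_def star_zero intro!: exI[of _ 0])
  moreover have "T ` S \<subseteq> S"
  proof
    fix y assume "y \<in> T ` S"
    then obtain z where z: "norm z \<le> 1/2" "star z = z" "y = T z" by (auto simp: S_def)
    have "norm (z * z) \<le> norm z * norm z" by (rule norm_mult_ineq)
    also have "\<dots> \<le> 1/2 * (1/2)" using z by (intro mult_mono) auto
    finally have "norm (x + z * z) \<le> 1" using norm_triangle_ineq[of x "z * z"] x by linarith
    moreover have "star y = y" by (simp add: z T_def star_scaleR star_add star_mult x)
    ultimately show "y \<in> S" by (simp add: S_def z T_def)
  qed
  moreover have "dist (T z) (T w) \<le> 1/2 * dist z w" if "z \<in> S" "w \<in> S" for z w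
  proof -
    have "T z - T w = (1/2) *\<^sub>R (z * (z - w) + (z - w) * w)"
      by (simp add: T_def algebra_simps)
    then have "norm (T z - T w) = 1/2 * norm (z * (z - w) + (z - w) * w)" by simp
    also have "norm (z * (z - w) + (z - w) * w) \<le> norm z * norm (z - w) + norm (z - w) * norm w"
      by (rule norm_triangle_le[OF add_mono[OF norm_mult_ineq norm_mult_ineq]])
    also have "\<dots> \<le> 1/2 * norm (z - w) + norm (z - w) * (1/2)"
      using that by (intro add_mono mult_mono) (auto simp: S_def)
    finally show ?thesis by (simp add: dist_norm)
  qed
  ultimately have "\<exists>!z\<in>S. T z = z" by (intro Banach_fix[OF complete, of "1/2" T]) auto
  then obtain z where z: "z \<in> S" "T z = z" by blast
  have "2 *\<^sub>R z = x + z * z"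
  proof -
    have "2 *\<^sub>R T z = x + z * z" by (simp add: T_def)
    then show ?thesis by (simp add: z(2))
  qed
  then have "1 - x = (1 - z) * (1 - z)" by (simp add: algebra_simps scaleR_2)
  moreover have "star (1 - z) = 1 - z" using z(1) by (simp add: S_def star_diff star_one)
  ultimately show ?thesis using that by blast
qed

text \<open>Continuity of states.  The constant is that of the square root above and not optimal.\<close>

lemma state_bound:
  fixes a :: "'a::cstar_algebra"
  assumes \<omega>: "state \<omega>"
  shows "Re (\<omega> (star a * a)) \<le> 4/3 * (norm a)\<^sup>2"
proof (cases "a = 0")
  case True
  have "\<omega> (0 + 0) = \<omega> 0 + \<omega> 0" using \<omega> unfolding state_def by blast
  then show ?thesis using True by simp
next
  case False
  define c where "c = 3 / (4 * (norm a)\<^sup>2)"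
  have c: "c > 0" using False by (simp add: c_def)
  define x where "x = c *\<^sub>R (star a * a)"
  have "star x = x" by (simp add: x_def star_scaleR star_mult star_star)
  moreover have "norm x \<le> 3/4" using False c by (simp add: x_def norm_star_mult c_def)
  ultimately obtain b where b: "star b = b" "1 - x = b * b" using one_minus_eq_square by blast
  have scal: "\<omega> (c *\<^sub>C y) = c * \<omega> y" "\<omega> (y + z) = \<omega> y + \<omega> z" for c y z
    using \<omega> by (auto simp: state_def)
  have "1 = b * b + x" using b(2) by (simp add: algebra_simps)
  then have "\<omega> 1 = \<omega> (star b * b) + \<omega> (complex_of_real c *\<^sub>C (star a * a))"
    by (simp add: b(1) scaleC_of_real x_def flip: scal(2))
  moreover have "\<omega> 1 = 1" "0 \<le> Re (\<omega> (star b * b))" using \<omega> by (auto simp: state_def)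
  ultimately have "1 \<ge> c * Re (\<omega> (star a * a))" unfolding scal(1) by (auto simp: complex_eq_iff)
  then show ?thesis using c False by (simp add: c_def field_simps)
qed

lemma gns_norm_bound:
  assumes \<omega>: "state \<omega>" and gns: "gns_triple UNIV \<omega> \<pi> \<Omega>"
  shows "(norm (\<pi> a \<cdot> \<Omega>))\<^sup>2 \<le> 4/3 * (norm a)\<^sup>2"
proof -
  have hom: "\<pi> (star a) = star (\<pi> a)" "\<pi> (star a * a) = \<pi> (star a) * \<pi> a"
    and exp: "\<omega> (star a * a) = cinner \<Omega> (\<pi> (star a * a) \<cdot> \<Omega>)"
    using gns by (auto simp: gns_triple_def star_hom_on_def)
  have "cinner (\<pi> a \<cdot> \<Omega>) (\<pi> a \<cdot> \<Omega>) = \<omega> (star a * a)"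
    unfolding exp hom by (simp add: op_app_times star_adjoint')
  then show ?thesis using state_bound[OF \<omega>, of a] by (simp add: norm_sq_cinner)
qed

section \<open>The one-particle space\<close>

lemma energy_bounds: 
  assumes "m > 0"
  shows "energy m p \<ge> m" "energy m p > 0" "energy m p \<le> (m + 1) * (1 + p\<^sup>2)" "\<bar>p\<bar> \<le> energy m p"
proof -
  have "sqrt (m\<^sup>2) \<le> energy m p" unfolding energy_def by (intro real_sqrt_le_mono) simp
  then show 1: "energy m p \<ge> m" using assms by simp
  then show "energy m p > 0" using assms by simp
  have "sqrt (p\<^sup>2) \<le> energy m p" unfolding energy_def by (intro real_sqrt_le_mono) simp
  then show "\<bar>p\<bar> \<le> energy m p" by simp
  have "energy m p \<le> \<bar>p\<bar> + m"
    unfolding energy_def using assms by (intro real_le_lsqrt) (simp_all add: power2_eq_square algebra_simps)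
  also have "\<bar>p\<bar> \<le> 1 + p\<^sup>2" using zero_le_power2[of "\<bar>p\<bar> - 1"] by (simp add: power2_eq_square algebra_simps)
  also have "1 + p\<^sup>2 + m \<le> (m + 1) * (1 + p\<^sup>2)" using assms by (simp add: algebra_simps)
  finally show "energy m p \<le> (m + 1) * (1 + p\<^sup>2)" by simp
qed

lemma energy_continuous: "continuous_on S (energy m)"
  unfolding energy_def[abs_def] by (intro continuous_intros)

lemma energy_minus: "energy m (- p) = energy m p"
  by (simp add: energy_def)

lemma fourier_continuous: "f \<in> test_functions \<Longrightarrow> continuous_on UNIV (fourier f)"
  unfolding fourier_laplace[abs_def] by (intro continuous_intros laplace_continuous)

lemma fourier_decay:
  assumes "f \<in> test_functions"
  obtains C where "C \<ge> 0" "\<And>p. cmod (fourier f p) \<le> C / (1 + p\<^sup>2)\<^sup>2"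
proof -
  obtain C where C: "C \<ge> 0" "\<And>p::real. cmod (laplace f (of_real p)) \<le> C / (1 + p\<^sup>2)\<^sup>2"
    using laplace_decay[OF assms] by blast
  let ?c = "(2 * pi) powr (-1/2)"
  have "cmod (fourier f p) \<le> (?c * C) / (1 + p\<^sup>2)\<^sup>2" for p
    using mult_left_mono[OF C(2)[of p], of ?c] by (simp add: fourier_laplace norm_mult)
  then show ?thesis using that[of "?c * C"] C(1) by simp
qed

lemma fourier_add:
  assumes "f \<in> test_functions" "g \<in> test_functions"
  shows "fourier (f + g) p = fourier f p + fourier g p"
proof -
  have "laplace (f + g) q = laplace f q + laplace g q" for q
    unfolding laplace_def plus_fun_def distrib_left
    by (intro Bochner_Integration.integral_add test_integrable assms continuous_intros)
  then show ?thesis by (simp add: fourier_laplace algebra_simps)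
qed

lemma fourier_minus: "fourier (- f) p = - fourier f p"
  by (simp add: fourier_laplace laplace_def)

lemma parts_add: "re_part (f + g) = re_part f + re_part g" "im_part (f + g) = im_part f + im_part g"
  by (auto simp: re_part_def im_part_def)

lemma parts_minus: "re_part (- f) = - re_part f" "im_part (- f) = - im_part f"
  by (auto simp: re_part_def im_part_def)

lemma mass_shell_add:
  assumes "f \<in> test_functions" "g \<in> test_functions"
  shows "mass_shell_transform m (f + g) p = mass_shell_transform m f p + mass_shell_transform m g p"
  using assms by (simp add: mass_shell_transform_def parts_add fourier_add test_re_part test_im_part algebra_simps)

lemma mass_shell_minus: "mass_shell_transform m (- f) p = - mass_shell_transform m f p"
  by (simp add: mass_shell_transform_def parts_minus fourier_minus)

lemma mass_shell_continuous: "f \<in> test_functions \<Longrightarrow> continuous_on UNIV (mass_shell_transform m f)"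
  unfolding mass_shell_transform_def[abs_def]
  by (intro continuous_intros fourier_continuous energy_continuous test_re_part test_im_part)

lemma mass_shell_decay:
  assumes f: "f \<in> test_functions" and m: "m > 0"
  obtains C where "C \<ge> 0" "\<And>p. cmod (mass_shell_transform m f p) \<le> C / (1 + p\<^sup>2)"
proof -
  obtain A where A: "A \<ge> 0" "\<And>p. cmod (fourier (re_part f) p) \<le> A / (1 + p\<^sup>2)\<^sup>2"
    using fourier_decay[OF test_re_part[OF f]] by blast
  obtain B where B: "B \<ge> 0" "\<And>p. cmod (fourier (im_part f) p) \<le> B / (1 + p\<^sup>2)\<^sup>2"
    using fourier_decay[OF test_im_part[OF f]] by blast
  have "cmod (mass_shell_transform m f p) \<le> (A + (m + 1) * B) / (1 + p\<^sup>2)" for p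
  proof -
    have pos: "1 + p\<^sup>2 > 0" by (simp add: add_pos_nonneg)
    have "cmod (mass_shell_transform m f p) \<le> cmod (fourier (re_part f) p) + energy m p * cmod (fourier (im_part f) p)"
      unfolding mass_shell_transform_def using energy_bounds(2)[OF m, of p]
      by (intro norm_triangle_le) (simp add: norm_mult)
    also have "\<dots> \<le> A / (1 + p\<^sup>2) + ((m + 1) * (1 + p\<^sup>2)) * (B / (1 + p\<^sup>2)\<^sup>2)"
      using A B energy_bounds[OF m, of p] order_trans[OF A(2)[of p] decay_mono[OF A(1)]] m
      by (intro add_mono mult_mono) auto
    also have "((m + 1) * (1 + p\<^sup>2)) * (B / (1 + p\<^sup>2)\<^sup>2) = (m + 1) * B / (1 + p\<^sup>2)"
      using pos by (simp add: power2_eq_square)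
    finally show ?thesis by (simp add: add_divide_distrib)
  qed
  moreover have "A + (m + 1) * B \<ge> 0" using A B m by simp
  ultimately show ?thesis using that by blast
qed

text \<open>The integrand of the one-particle scalar product with respect to \<open>dp\<close>, including the density of the
  invariant measure on the mass shell.\<close>

definition shell_density :: "real \<Rightarrow> (real \<Rightarrow> complex) \<Rightarrow> (real \<Rightarrow> complex) \<Rightarrow> real \<Rightarrow> complex"
  where "shell_density m g f p = cnj (mass_shell_transform m g p) * mass_shell_transform m f p / energy m p"

text \<open>The scalar product of the one-particle vectors of \<open>g\<close> and \<open>f\<close>, normalised such that its diagonal is
  the squared vacuum norm.\<close>

definition one_particle :: "real \<Rightarrow> (real \<Rightarrow> complex) \<Rightarrow> (real \<Rightarrow> complex) \<Rightarrow> complex"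
  where "one_particle m g f = 1/2 * (LINT p|lborel. shell_density m g f p)"

lemma shell_density_continuous:
  assumes "f \<in> test_functions" "g \<in> test_functions" "m > 0"
  shows "continuous_on UNIV (shell_density m g f)"
  unfolding shell_density_def[abs_def]
  using energy_bounds(2)[OF assms(3)]
  by (intro continuous_intros mass_shell_continuous energy_continuous assms) (auto simp: less_imp_neq[symmetric])

lemma shell_density_decay:
  assumes f: "f \<in> test_functions" and g: "g \<in> test_functions" and m: "m > 0"
  obtains C where "C \<ge> 0" "\<And>p. cmod (shell_density m g f p) \<le> C / (1 + p\<^sup>2)\<^sup>2"
proof -
  obtain A where A: "A \<ge> 0" "\<And>p. cmod (mass_shell_transform m g p) \<le> A / (1 + p\<^sup>2)"
    using mass_shell_decay[OF g m] by blast
  obtain B where B: "B \<ge> 0" "\<And>p. cmod (mass_shell_transform m f p) \<le> B / (1 + p\<^sup>2)"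
    using mass_shell_decay[OF f m] by blast
  have "cmod (shell_density m g f p) \<le> (A * B / m) / (1 + p\<^sup>2)\<^sup>2" for p
  proof -
    have pos: "1 + p\<^sup>2 > 0" by (simp add: add_pos_nonneg)
    have "cmod (shell_density m g f p) = cmod (mass_shell_transform m g p) * cmod (mass_shell_transform m f p) / energy m p"
      using energy_bounds(2)[OF m, of p] by (simp add: shell_density_def norm_mult norm_divide)
    also have "\<dots> \<le> ((A / (1 + p\<^sup>2)) * (B / (1 + p\<^sup>2))) / m"
      using A B m pos energy_bounds[OF m, of p] by (intro frac_le mult_mono) auto
    finally show ?thesis by (simp add: power2_eq_square mult_ac)
  qed
  moreover have "A * B / m \<ge> 0" using A B m by simp
  ultimately show ?thesis using that by blast
qed

lemma shell_density_integrable: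
  assumes f: "f \<in> test_functions" and g: "g \<in> test_functions" and m: "m > 0"
  shows "integrable lborel (shell_density m g f)"
proof -
  obtain C where C: "C \<ge> 0" "\<And>p. cmod (shell_density m g f p) \<le> C / (1 + p\<^sup>2)\<^sup>2"
    using shell_density_decay[OF assms] by blast
  show ?thesis
    by (rule integrable_bound_1_plus_sq[OF shell_density_continuous[OF assms] order_trans[OF C(2) decay_mono[OF C(1)]]])
qed

lemma shell_density_energy_integrable:
  assumes f: "f \<in> test_functions" and g: "g \<in> test_functions" and m: "m > 0"
  shows "integrable lborel (\<lambda>p. cmod (shell_density m g f p) * energy m p)"
proof -
  obtain C where C: "C \<ge> 0" "\<And>p. cmod (shell_density m g f p) \<le> C / (1 + p\<^sup>2)\<^sup>2"
    using shell_density_decay[OF assms] by blast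
  have "integrable lborel (\<lambda>p. shell_density m g f p * energy m p)"
  proof (rule integrable_bound_1_plus_sq)
    show "continuous_on UNIV (\<lambda>p. shell_density m g f p * energy m p)"
      by (intro continuous_intros shell_density_continuous[OF assms] energy_continuous)
    show "cmod (shell_density m g f p * energy m p) \<le> ((m + 1) * C) / (1 + p\<^sup>2)" for p
    proof -
      have pos: "1 + p\<^sup>2 > 0" by (simp add: add_pos_nonneg)
      have "cmod (shell_density m g f p) * energy m p \<le> C / (1 + p\<^sup>2)\<^sup>2 * ((m + 1) * (1 + p\<^sup>2))"
        using C energy_bounds[OF m, of p] by (intro mult_mono) auto
      also have "\<dots> = ((m + 1) * C) / (1 + p\<^sup>2)" using pos by (simp add: power2_eq_square)
      finally show ?thesis using energy_bounds(2)[OF m, of p] by (simp add: norm_mult)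
    qed
  qed
  then have "integrable lborel (\<lambda>p. cmod (shell_density m g f p * energy m p))" by (rule integrable_norm)
  then show ?thesis using energy_bounds(2)[OF m] by (simp add: norm_mult abs_of_pos)
qed

lemma one_particle_self:
  assumes m: "m > 0"
  shows "one_particle m f f = of_real (vacuum_norm_sq m f)"
proof -
  have "shell_density m f f p = of_real ((cmod (energy m p powr (-1/2) * fourier (re_part f) p
         + \<i> * energy m p powr (1/2) * fourier (im_part f) p))\<^sup>2)" for p
  proof -
    have w: "energy m p > 0" by (rule energy_bounds(2)[OF m])
    let ?r = "energy m p powr (-1/2)"
    have r1: "energy m p powr (1/2) = ?r * energy m p"
      using w powr_mult_base[of "energy m p" "-1/2"] by (simp add: mult.commute)
    have r2: "?r\<^sup>2 = 1 / energy m p"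
      using w by (simp add: power2_eq_square powr_minus_divide flip: powr_add)
    have "energy m p powr (-1/2) * fourier (re_part f) p + \<i> * energy m p powr (1/2) * fourier (im_part f) p
      = of_real ?r * mass_shell_transform m f p"
      unfolding mass_shell_transform_def r1 by (simp add: algebra_simps)
    then have eq: "(cmod (energy m p powr (-1/2) * fourier (re_part f) p
         + \<i> * energy m p powr (1/2) * fourier (im_part f) p))\<^sup>2 = (cmod (mass_shell_transform m f p))\<^sup>2 / energy m p"
      by (simp add: norm_mult power_mult_distrib r2[simplified])
    show ?thesis
      unfolding eq shell_density_def of_real_divide complex_norm_square by (simp add: mult.commute)
  qed
  then have "(LINT p|lborel. shell_density m f f p) = (LINT p|lborel. of_real ((cmod (energy m p powr (-1/2) * fourier (re_part f) p
         + \<i> * energy m p powr (1/2) * fourier (im_part f) p))\<^sup>2))"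
    by (intro Bochner_Integration.integral_cong refl)
  then show ?thesis
    unfolding one_particle_def vacuum_norm_sq_def integral_complex_of_real by simp
qed

lemma real_integral_reflect:
  assumes "\<And>p. h (- p) = cnj (h (p::real))"
  shows "Im (LINT p|lborel. h p) = 0"
proof -
  have "(LINT p|lborel. h p) = \<bar>-1\<bar> *\<^sub>R (LINT p|lborel. h (0 + (-1) * p))"
    by (rule lborel_integral_real_affine) simp
  also have "\<dots> = (LINT p|lborel. cnj (h p))" by (simp add: assms)
  also have "\<dots> = cnj (LINT p|lborel. h p)" by (rule Bochner_Integration.integral_cnj)
  finally show ?thesis by (simp add: complex_eq_iff)
qed

lemma fourier_reflect:
  assumes "\<And>y. cnj (f y) = f y"
  shows "fourier f (- p) = cnj (fourier f p)"
  using laplace_cnj[OF assms, where p = p] by (simp add: fourier_laplace)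

lemma fourier_weighted_integrable:
  assumes k: "k \<in> test_functions" and l: "l \<in> test_functions" 
    and w: "continuous_on UNIV w" "\<And>p. cmod (w p) \<le> D * (1 + p\<^sup>2)"
  shows "integrable lborel (\<lambda>p. w p * (cnj (fourier k p) * fourier l p))"
proof -
  obtain A where A: "A \<ge> 0" "\<And>p. cmod (fourier k p) \<le> A / (1 + p\<^sup>2)\<^sup>2" using fourier_decay[OF k] by blast
  obtain B where B: "B \<ge> 0" "\<And>p. cmod (fourier l p) \<le> B / (1 + p\<^sup>2)\<^sup>2" using fourier_decay[OF l] by blast
  show ?thesis
  proof (rule integrable_bound_1_plus_sq)
    show "continuous_on UNIV (\<lambda>p. w p * (cnj (fourier k p) * fourier l p))"
      by (intro continuous_intros w fourier_continuous k l)
    show "cmod (w p * (cnj (fourier k p) * fourier l p)) \<le> (D * A * B) / (1 + p\<^sup>2)" for p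
    proof -
      have pos: "1 + p\<^sup>2 > 0" by (simp add: add_pos_nonneg)
      have D: "D * (1 + p\<^sup>2) \<ge> 0" using order_trans[OF norm_ge_zero w(2)] .
      have "cmod (w p) * (cmod (fourier k p) * cmod (fourier l p)) \<le> (D * (1 + p\<^sup>2)) * ((A / (1 + p\<^sup>2)) * (B / (1 + p\<^sup>2)))"
        using A B w D order_trans[OF A(2)[of p] decay_mono[OF A(1)]] order_trans[OF B(2)[of p] decay_mono[OF B(1)]] pos
        by (intro mult_mono) auto
      also have "\<dots> = (D * A * B) / (1 + p\<^sup>2)" using pos by simp
      finally show ?thesis by (simp add: norm_mult)
    qed
  qed
qed

text \<open>In the product of the mass shell transforms, the terms that pair real with real and imaginary with
  imaginary parts have real integrals by reflection of the momentum.  In the mixed terms the energies cancel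
  and the Plancherel formula applies.\<close>

lemma one_particle_Im:
  assumes f: "f \<in> test_functions" and g: "g \<in> test_functions" and m: "m > 0"
  shows "Im (one_particle m g f) = symplectic g f / 2"
proof -
  note T = test_re_part[OF f] test_im_part[OF f] test_re_part[OF g] test_im_part[OF g]
  define G1 G2 F1 F2 where "G1 = fourier (re_part g)" "G2 = fourier (im_part g)"
    "F1 = fourier (re_part f)" "F2 = fourier (im_part f)"
  note defs = this
  let ?I = "\<lambda>k l. (LINT x|lborel. cnj (k x) * l x) :: complex"
  define w where "w p = complex_of_real (energy m p)" for p
  have w: "w p \<noteq> 0" "cnj (w p) = w p" "w (- p) = w p" for p
    using energy_bounds(2)[OF m, of p] by (auto simp: w_def energy_minus)
  have wc: "continuous_on UNIV w" unfolding w_def[abs_def] by (intro continuous_intros energy_continuous)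
  have wb: "cmod (w p) \<le> (m + 1) * (1 + p\<^sup>2)" for p
    using energy_bounds[OF m, of p] by (simp add: w_def)
  have wi: "cmod (1 / w p) \<le> (1 / m) * (1 + p\<^sup>2)" for p
  proof -
    have "1 / energy m p \<le> 1 / m" using m energy_bounds[OF m, of p] by (intro divide_left_mono) auto
    also have "\<dots> \<le> (1 / m) * (1 + p\<^sup>2)" using m divide_right_mono[of 1 "1 + p\<^sup>2" m] by simp
    finally show ?thesis using energy_bounds(2)[OF m, of p] by (simp add: w_def norm_divide)
  qed
  have i1: "integrable lborel (\<lambda>p. (1 / w p) * (cnj (G1 p) * F1 p))"
    unfolding defs by (rule fourier_weighted_integrable[OF T(3) T(1) _ wi]) (intro continuous_intros wc, simp add: w)
  have i2: "integrable lborel (\<lambda>p. w p * (cnj (G2 p) * F2 p))"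
    unfolding defs by (rule fourier_weighted_integrable[OF T(4) T(2) wc wb])
  have one: "cmod 1 \<le> 1 * (1 + p\<^sup>2)" for p :: real by simp
  have i3: "integrable lborel (\<lambda>p. 1 * (cnj (G1 p) * F2 p))"
    unfolding defs by (rule fourier_weighted_integrable[OF T(3) T(2) continuous_on_const one])
  have i4: "integrable lborel (\<lambda>p. 1 * (cnj (G2 p) * F1 p))"
    unfolding defs by (rule fourier_weighted_integrable[OF T(4) T(1) continuous_on_const one])
  have "shell_density m g f p = ((1 / w p) * (cnj (G1 p) * F1 p) + w p * (cnj (G2 p) * F2 p))
     + (\<i> * (1 * (cnj (G1 p) * F2 p)) - \<i> * (1 * (cnj (G2 p) * F1 p)))" for p
    using w(1)[of p] unfolding shell_density_def mass_shell_transform_def defs w_def[symmetric]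
    by (simp add: w field_simps power2_eq_square)
  then have "(LINT p|lborel. shell_density m g f p) = 
      ((LINT p|lborel. (1 / w p) * (cnj (G1 p) * F1 p)) + (LINT p|lborel. w p * (cnj (G2 p) * F2 p)))
    + (\<i> * (LINT p|lborel. 1 * (cnj (G1 p) * F2 p)) - \<i> * (LINT p|lborel. 1 * (cnj (G2 p) * F1 p)))"
    using i1 i2 i3 i4 by (simp only: Bochner_Integration.integral_add Bochner_Integration.integral_diff
      Bochner_Integration.integrable_add Bochner_Integration.integrable_diff integrable_mult_right integral_mult_right_zero)
  moreover have "Im (LINT p|lborel. (1 / w p) * (cnj (G1 p) * F1 p)) = 0"
    by (rule real_integral_reflect) (simp add: w defs fourier_reflect[OF cnj_parts(1)])
  moreover have "Im (LINT p|lborel. w p * (cnj (G2 p) * F2 p)) = 0"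
    by (rule real_integral_reflect) (simp add: w defs fourier_reflect[OF cnj_parts(2)])
  moreover have "(LINT p|lborel. 1 * (cnj (G1 p) * F2 p)) = ?I (re_part g) (im_part f)"
    "(LINT p|lborel. 1 * (cnj (G2 p) * F1 p)) = ?I (im_part g) (re_part f)"
    unfolding defs mult_1_left by (rule fourier_plancherel T)+
  ultimately have L: "Im (LINT p|lborel. shell_density m g f p) = Re (?I (re_part g) (im_part f)) - Re (?I (im_part g) (re_part f))"
    by simp
  have int: "integrable lborel (\<lambda>x. cnj (k x) * l x)" if "k \<in> test_functions" "l \<in> test_functions" for k l
    using that by (intro test_integrable continuous_intros test_continuous)
  have real: "Im (?I k l) = 0" if "\<And>x. cnj (k x) = k x" "\<And>x. cnj (l x) = l x" for k l
  proof -
    have "cnj (?I k l) = ?I k l"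
      unfolding Bochner_Integration.integral_cnj[symmetric] by (simp add: that)
    then show ?thesis by (simp add: complex_eq_iff)
  qed
  have "cnj (g x) * f x = (cnj (re_part g x) * re_part f x + cnj (im_part g x) * im_part f x)
     + (\<i> * (cnj (re_part g x) * im_part f x) - \<i> * (cnj (im_part g x) * re_part f x))" for x
    by (simp add: re_part_def im_part_def complex_eq_iff)
  then have "(LINT x|lborel. cnj (g x) * f x) = (?I (re_part g) (re_part f) + ?I (im_part g) (im_part f))
     + (\<i> * ?I (re_part g) (im_part f) - \<i> * ?I (im_part g) (re_part f))"
    using int[OF T(3) T(1)] int[OF T(4) T(2)] int[OF T(3) T(2)] int[OF T(4) T(1)]
    by (simp only: Bochner_Integration.integral_add Bochner_Integration.integral_diff
      Bochner_Integration.integrable_add Bochner_Integration.integrable_diff integrable_mult_right integral_mult_right_zero)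
  then have "symplectic g f = Re (?I (re_part g) (im_part f)) - Re (?I (im_part g) (re_part f))"
    unfolding symplectic_def by (simp add: real[OF cnj_parts(1) cnj_parts(1)] real[OF cnj_parts(2) cnj_parts(2)])
  with L show ?thesis by (simp add: one_particle_def)
qed

lemma vacuum_norm_diff:
  assumes f: "f \<in> test_functions" and g: "g \<in> test_functions" and m: "m > 0"
  shows "vacuum_norm_sq m (f - g) = vacuum_norm_sq m f + vacuum_norm_sq m g - 2 * Re (one_particle m g f)"
proof -
  have "shell_density m (f - g) (f - g) p = (shell_density m f f p + shell_density m g g p) 
    - (shell_density m g f p + cnj (shell_density m g f p))" for p
  proof -
    have "mass_shell_transform m (f - g) p = mass_shell_transform m f p - mass_shell_transform m g p"
      unfolding diff_conv_add_uminus[of f g] mass_shell_add[OF f test_minus[OF g]] mass_shell_minus by simp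
    then show ?thesis
      by (simp only: shell_density_def) (simp add: diff_divide_distrib add_divide_distrib algebra_simps)
  qed
  then have "(LINT p|lborel. shell_density m (f - g) (f - g) p) = (LINT p|lborel. (shell_density m f f p + shell_density m g g p) 
    - (shell_density m g f p + cnj (shell_density m g f p)))"
    by (intro Bochner_Integration.integral_cong refl)
  also have "\<dots> = ((LINT p|lborel. shell_density m f f p) + (LINT p|lborel. shell_density m g g p))
    - ((LINT p|lborel. shell_density m g f p) + cnj (LINT p|lborel. shell_density m g f p))"
    using shell_density_integrable[OF f f m] shell_density_integrable[OF g g m] shell_density_integrable[OF f g m]
    by simp
  finally have eq: "(LINT p|lborel. shell_density m (f - g) (f - g) p)
    = ((LINT p|lborel. shell_density m f f p) + (LINT p|lborel. shell_density m g g p))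
    - ((LINT p|lborel. shell_density m g f p) + cnj (LINT p|lborel. shell_density m g f p))" .
  have "one_particle m (f - g) (f - g) = (one_particle m f f + one_particle m g g) 
    - (one_particle m g f + cnj (one_particle m g f))"
    unfolding one_particle_def eq by (simp add: algebra_simps)
  then have "Re (one_particle m (f - g) (f - g)) = Re (one_particle m f f) + Re (one_particle m g g) - 2 * Re (one_particle m g f)"
    by simp
  then show ?thesis by (simp add: one_particle_self[OF m])
qed

text \<open>Exponentials of translated one-particle scalar products continue to the upper half-plane along a causal
  direction \<open>e\<close>, since \<open>fst e * energy m p - snd e * p\<close> is non-negative.\<close>

lemma one_particle_half_plane:
  fixes e :: spacetime and c :: "real \<Rightarrow> complex"
  assumes m: "m > 0" and e: "\<bar>snd e\<bar> \<le> fst e"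
    and c: "integrable lborel c" "integrable lborel (\<lambda>p. cmod (c p) * energy m p)"
  shows "positive_frequency (\<lambda>s. exp (K + 1/2 * (LINT p|lborel. c p * exp (\<i> * of_real s * of_real (fst e * energy m p - snd e * p)))))"
proof -
  define \<nu> where "\<nu> p = fst e * energy m p - snd e * p" for p
  have \<nu>0: "0 \<le> \<nu> p" for p
  proof -
    have "snd e * p \<le> \<bar>snd e\<bar> * \<bar>p\<bar>" by (metis abs_ge_self abs_mult)
    also have "\<dots> \<le> fst e * energy m p" using e energy_bounds[OF m, of p] by (intro mult_mono) auto
    finally show ?thesis by (simp add: \<nu>_def)
  qed
  have \<nu>b: "\<nu> p \<le> 2 * fst e * energy m p" for p
  proof -
    have "- (snd e * p) \<le> \<bar>snd e\<bar> * \<bar>p\<bar>" by (metis abs_ge_minus_self abs_mult)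
    also have "\<dots> \<le> fst e * energy m p" using e energy_bounds[OF m, of p] by (intro mult_mono) auto
    finally show ?thesis by (simp add: \<nu>_def)
  qed
  have \<nu>m: "\<nu> \<in> borel_measurable borel"
    unfolding \<nu>_def by (intro borel_measurable_continuous_onI continuous_intros energy_continuous)
  define k where "k z p = c p * exp (\<i> * z * of_real (\<nu> p))" for z p
  have km: "k z \<in> borel_measurable lborel" for z
    unfolding k_def using \<nu>m borel_measurable_integrable[OF c(1)] by measurable
  have kb: "cmod (k z p) \<le> cmod (c p)" if "Im z \<ge> 0" for z p
    using that \<nu>0[of p] by (simp add: k_def norm_mult mult_left_le)
  have ki: "integrable lborel (k z)" if "Im z \<ge> 0" for z
    by (rule Bochner_Integration.integrable_bound[OF integrable_norm[OF c(1)] km]) (use kb[OF that] in auto)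
  define \<Phi> where "\<Phi> z = exp (K + 1/2 * (LINT p|lborel. k z p))" for z
  have "positive_frequency (\<lambda>s. \<Phi> (of_real s))"
  proof (rule half_plane_positive_frequency)
    have "continuous_on {z. Im z \<ge> 0} (\<lambda>z. LINT p|lborel. k z p)"
    proof (rule continuous_on_LINT[where B = "\<lambda>p. cmod (c p)"])
      show "continuous_on {z. 0 \<le> Im z} (\<lambda>z. k z p)" for p unfolding k_def by (intro continuous_intros)
    qed (use km kb c in auto)
    then show "continuous_on {z. Im z \<ge> 0} \<Phi>" unfolding \<Phi>_def[abs_def] by (intro continuous_intros)
    show "\<Phi> field_differentiable (at z)" if z: "Im z > 0" for z
    proof -
      have "((\<lambda>z. LINT p|lborel. k z p) has_field_derivative (LINT p|lborel. \<i> * of_real (\<nu> p) * k z p)) (at z)"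
      proof (rule has_field_derivative_LINT[where U = "{z. Im z > 0}" and B = "\<lambda>p. 2 * fst e * (cmod (c p) * energy m p)"])
        show "((\<lambda>z. k z p) has_field_derivative \<i> * of_real (\<nu> p) * k w p) (at w)" for w p
          unfolding k_def by (auto intro!: derivative_eq_intros)
        show "cmod (\<i> * of_real (\<nu> p) * k w p) \<le> 2 * fst e * (cmod (c p) * energy m p)" if "w \<in> {z. Im z > 0}" for w p
        proof -
          have "\<nu> p * cmod (k w p) \<le> (2 * fst e * energy m p) * cmod (c p)"
            using \<nu>b[of p] \<nu>0[of p] kb[of w p] that order_trans[OF \<nu>0 \<nu>b, of p] by (intro mult_mono) auto
          then show ?thesis using \<nu>0[of p] by (simp add: norm_mult mult_ac)
        qed
        show "integrable lborel (\<lambda>p. 2 * fst e * (cmod (c p) * energy m p))" using c(2) by (rule integrable_mult_right)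
        show "(\<lambda>p. \<i> * of_real (\<nu> p) * k z p) \<in> borel_measurable lborel"
          using km[of z] \<nu>m by measurable
      qed (use z ki in \<open>auto intro: open_halfspace_Im_gt convex_halfspace_Im_gt\<close>)
      then have "(\<lambda>z. LINT p|lborel. k z p) field_differentiable (at z)" by (auto simp: field_differentiable_def)
      then show ?thesis unfolding \<Phi>_def[abs_def]
        by (intro derivative_intros field_differentiable_compose[of _ z exp, unfolded o_def]
            field_differentiable_add field_differentiable_mult field_differentiable_const field_differentiable_within_exp)
    qed
    show "cmod (\<Phi> z) \<le> exp (cmod K + 1/2 * (LINT p|lborel. cmod (c p)))" if "Im z \<ge> 0" for z
    proof -
      have "cmod (LINT p|lborel. k z p) \<le> (LINT p|lborel. cmod (c p))"
        by (rule Bochner_Integration.integral_norm_bound_integral) (use ki[OF that] kb[OF that] c in auto)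
      moreover have "Re (K + 1/2 * (LINT p|lborel. k z p)) \<le> cmod K + 1/2 * cmod (LINT p|lborel. k z p)"
        using complex_Re_le_cmod[of K] complex_Re_le_cmod[of "LINT p|lborel. k z p"] by simp
      ultimately show ?thesis by (simp add: \<Phi>_def)
    qed
  qed
  then show ?thesis by (simp add: \<Phi>_def k_def \<nu>_def)
qed

section \<open>The symplectic form\<close>

lemma symplectic_minus_left: "symplectic (- g) f = - symplectic g f"
  by (simp add: symplectic_def)

lemma symplectic_minus_self: "symplectic f (- f) = 0"
proof -
  have "(LINT x|lborel. cnj (f x) * (- f) x) = (LINT x|lborel. complex_of_real (- (cmod (f x))\<^sup>2))"
    by (intro Bochner_Integration.integral_cong refl) (simp add: complex_norm_square mult.commute del: of_real_power)
  then show ?thesis unfolding symplectic_def integral_complex_of_real by simp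
qed

lemma symplectic_disjoint:
  assumes "\<And>x. f x = 0 \<or> g x = 0"
  shows "symplectic f g = 0"
proof -
  have "(\<lambda>x. cnj (f x) * g x) = (\<lambda>_. 0)" using assms by fastforce
  then show ?thesis by (simp add: symplectic_def)
qed

section \<open>Strong continuity\<close>

text \<open>Weak continuity of a family of unitaries with values of constant norm is strong continuity.\<close>

lemma continuous_on_weak_unitary:
  fixes U :: "'x::metric_space \<Rightarrow> 'a::complex_hilbert bdd_op"
  assumes U: "\<And>x. unitary (U x)" and weak: "\<And>y. continuous_on UNIV (\<lambda>x. cinner (U y \<cdot> v) (U x \<cdot> v))"
  shows "continuous_on UNIV (\<lambda>x. U x \<cdot> v)"
proof -
  have "((\<lambda>x. U x \<cdot> v) \<longlongrightarrow> U y \<cdot> v) (at y)" for y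
  proof -
    have "((\<lambda>x. cinner (U y \<cdot> v) (U x \<cdot> v)) \<longlongrightarrow> cinner (U y \<cdot> v) (U y \<cdot> v)) (at y)"
      using weak[of y] by (simp add: continuous_on_def)
    then have "((\<lambda>x. Re (cinner (U y \<cdot> v) (U x \<cdot> v))) \<longlongrightarrow> Re (cinner (U y \<cdot> v) (U y \<cdot> v))) (at y)"
      by (rule tendsto_Re)
    then have "((\<lambda>x. Re (cinner (U y \<cdot> v) (U x \<cdot> v))) \<longlongrightarrow> (norm v)\<^sup>2) (at y)"
      by (simp add: norm_sq_cinner[symmetric] norm_unitary_app[OF U])
    then have "((\<lambda>x. (norm v)\<^sup>2 - 2 * Re (cinner (U y \<cdot> v) (U x \<cdot> v)) + (norm v)\<^sup>2) \<longlongrightarrow> (norm v)\<^sup>2 - 2 * (norm v)\<^sup>2 + (norm v)\<^sup>2) (at y)"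
      by (intro tendsto_intros)
    then have "((\<lambda>x. (norm (U y \<cdot> v - U x \<cdot> v))\<^sup>2) \<longlongrightarrow> 0) (at y)"
      by (simp add: norm_diff_sq norm_unitary_app[OF U])
    then have "((\<lambda>x. sqrt ((norm (U y \<cdot> v - U x \<cdot> v))\<^sup>2)) \<longlongrightarrow> sqrt 0) (at y)"
      by (rule tendsto_real_sqrt)
    then have "((\<lambda>x. norm (U x \<cdot> v - U y \<cdot> v)) \<longlongrightarrow> 0) (at y)"
      by (simp add: norm_minus_commute)
    then show ?thesis by (rule LIM_zero_cancel[OF tendsto_norm_zero_cancel])
  qed
  then show ?thesis by (simp add: continuous_on_def)
qed

lemma continuous_on_star_unitary:
  fixes U :: "'x::metric_space \<Rightarrow> 'a::complex_hilbert bdd_op"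
  assumes U: "\<And>x. unitary (U x)" and cont: "\<And>v. continuous_on UNIV (\<lambda>x. U x \<cdot> v)"
  shows "continuous_on UNIV (\<lambda>x. star (U x) \<cdot> v)"
proof (rule continuous_on_weak_unitary)
  show "continuous_on UNIV (\<lambda>x. cinner (star (U y) \<cdot> v) (star (U x) \<cdot> v))" for y
    unfolding star_adjoint' by (intro continuous_on_cinner continuous_on_const cont)
qed (rule unitary_star[OF U])

lemma continuous_on_app_bounded:
  fixes A :: "'x::metric_space \<Rightarrow> 'a::complex_hilbert bdd_op"
  assumes B: "\<And>x. norm (A x) \<le> B" and cont: "\<And>v. continuous_on UNIV (\<lambda>x. A x \<cdot> v)"
    and u: "continuous_on UNIV u"
  shows "continuous_on UNIV (\<lambda>x. A x \<cdot> u x)"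
proof -
  have "((\<lambda>x. A x \<cdot> u x) \<longlongrightarrow> A y \<cdot> u y) (at y)" for y
  proof -
    have "((\<lambda>x. A x \<cdot> (u x - u y)) \<longlongrightarrow> 0) (at y)"
    proof (rule Lim_null_comparison)
      show "\<forall>\<^sub>F x in at y. norm (A x \<cdot> (u x - u y)) \<le> B * norm (u x - u y)"
        by (intro always_eventually allI order_trans[OF norm_op_app] mult_right_mono B norm_ge_zero)
      have "((\<lambda>x. norm (u x - u y)) \<longlongrightarrow> 0) (at y)"
        using u by (intro tendsto_norm_zero LIM_zero) (simp add: continuous_on_def)
      then show "((\<lambda>x. B * norm (u x - u y)) \<longlongrightarrow> 0) (at y)" by (rule tendsto_mult_right_zero)
    qed
    moreover have "((\<lambda>x. A x \<cdot> u y) \<longlongrightarrow> A y \<cdot> u y) (at y)" using cont by (simp add: continuous_on_def)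
    ultimately have "((\<lambda>x. A x \<cdot> (u x - u y) + A x \<cdot> u y) \<longlongrightarrow> 0 + A y \<cdot> u y) (at y)" by (rule tendsto_add)
    then show ?thesis by (simp add: op_app_simps)
  qed
  then show ?thesis by (simp add: continuous_on_def)
qed

lemma scaleC_one: "1 *\<^sub>C x = (x :: 'a::complex_vector)"
  using scaleC_of_real[of 1 x] by simp

lemma left_inverse_unique:
  fixes a b c :: "'a::monoid_mult"
  assumes "c * a = 1" "a * b = 1"
  shows "c = b"
proof -
  have "c = c * (a * b)" by (simp add: assms)
  also have "\<dots> = (c * a) * b" by (simp only: mult.assoc)
  also have "\<dots> = b" by (simp add: assms)
  finally show ?thesis .
qed

section \<open>Weyl operators in the vacuum representation\<close>

text \<open>The net of positive mass.  Only for \<open>m > 0\<close> is the vacuum norm finite without a condition on zero modes.\<close>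

locale massive_net = dilation_covariant_net m \<tau> W \<alpha>\<^sub>W \<omega> \<pi> \<Omega> \<alpha> \<phi>
  for m \<tau> and W :: "(real \<Rightarrow> complex) \<Rightarrow> 'w::cstar_algebra" and \<alpha>\<^sub>W \<omega>
    and \<pi> :: "'w \<Rightarrow> 'h::complex_hilbert bdd_op" and \<Omega> \<alpha> \<phi> +
  assumes mass_pos: "m > 0"
begin

lemma \<tau>_id_transform:
  assumes "f \<in> test_functions"
  shows "mass_shell_transform m (\<tau> id x f) p =
    exp (\<i> * of_real (fst x * energy m p - snd x * p)) * mass_shell_transform m f p"
  using \<tau>_transform[OF lorentz_id assms, of x p] by (simp add: inv_id[unfolded id_def] id_def)

lemma \<tau>_id_test: "f \<in> test_functions \<Longrightarrow> \<tau> id x f \<in> test_functions"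
  by (rule \<tau>_test[OF lorentz_id])

lemma one_particle_\<tau>:
  assumes "f \<in> test_functions"
  shows "one_particle m g (\<tau> id x f) = 1/2 * (LINT p|lborel. shell_density m g f p * exp (\<i> * of_real (fst x * energy m p - snd x * p)))"
  unfolding one_particle_def shell_density_def \<tau>_id_transform[OF assms] by (simp add: mult_ac)

lemma vacuum_norm_\<tau>:
  assumes "f \<in> test_functions"
  shows "vacuum_norm_sq m (\<tau> id x f) = vacuum_norm_sq m f"
proof -
  have "shell_density m (\<tau> id x f) (\<tau> id x f) p = shell_density m f f p" for p
  proof -
    have "cnj (exp (\<i> * of_real (fst x * energy m p - snd x * p))) * exp (\<i> * of_real (fst x * energy m p - snd x * p)) = 1"
      unfolding exp_cnj exp_add[symmetric] by simp
    then have "cnj (exp (\<i> * of_real (fst x * energy m p - snd x * p))) * exp (\<i> * of_real (fst x * energy m p - snd x * p)) * z = z" for z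
      by simp
    then show ?thesis
      unfolding shell_density_def \<tau>_id_transform[OF assms] complex_cnj_mult by (simp only: mult_ac)
  qed
  then have "shell_density m (\<tau> id x f) (\<tau> id x f) = shell_density m f f" by (rule ext)
  then have "one_particle m (\<tau> id x f) (\<tau> id x f) = one_particle m f f" unfolding one_particle_def by simp
  then show ?thesis unfolding one_particle_self[OF mass_pos] using of_real_eq_iff by blast
qed

lemma \<pi>_hom: "\<pi> (a + b) = \<pi> a + \<pi> b" "\<pi> (a * b) = \<pi> a * \<pi> b" "\<pi> (c *\<^sub>C a) = c *\<^sub>C \<pi> a" "\<pi> (star a) = star (\<pi> a)"
  using vacuum_gns by (auto simp: gns_triple_def star_hom_on_def)

lemma \<omega>_\<pi>: "\<omega> a = cinner \<Omega> (\<pi> a \<cdot> \<Omega>)"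
  using vacuum_gns by (auto simp: gns_triple_def)

lemma gns_induct:
  assumes "\<And>a. P (\<pi> a \<cdot> \<Omega>)" "closed {v. P v}"
  shows "P v"
proof -
  have "closure (range (\<lambda>a. \<pi> a \<cdot> \<Omega>)) \<subseteq> {v. P v}"
    by (rule closure_minimal) (use assms in auto)
  then show ?thesis using vacuum_gns by (auto simp: gns_triple_def)
qed

lemma closed_op_eq: "closed {v. A \<cdot> v = B \<cdot> v}"
  by (intro closed_Collect_eq continuous_on_op_app continuous_on_const continuous_on_id)

lemma \<pi>_one: "\<pi> 1 = 1"
proof (rule op_eqI)
  fix v show "\<pi> 1 \<cdot> v = 1 \<cdot> v"
    by (rule gns_induct[of "\<lambda>v. \<pi> 1 \<cdot> v = 1 \<cdot> v"])
      (simp_all add: closed_op_eq[of "\<pi> 1" 1, unfolded op_app_one] op_app_one flip: op_app_times \<pi>_hom)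
qed

abbreviation V :: "(real \<Rightarrow> complex) \<Rightarrow> 'h bdd_op"
  where "V f \<equiv> \<pi> (W f)"

lemma V_unitary: "f \<in> test_functions \<Longrightarrow> unitary (V f)"
  using W_unitary[of f] by (simp add: unitary_def \<pi>_one flip: \<pi>_hom)

lemma V_mult: "f \<in> test_functions \<Longrightarrow> g \<in> test_functions \<Longrightarrow>
    V f * V g = exp (- (\<i> / 2 * symplectic f g)) *\<^sub>C V (f + g)"
  by (simp add: W_mult flip: \<pi>_hom)

lemma W_zero: "W 0 = 1"
proof -
  have s: "symplectic 0 0 = 0" using symplectic_minus_self[of 0] by simp
  have "W 0 * W 0 = W 0" using W_mult[OF test_zero test_zero] by (simp add: s scaleC_one)
  moreover have "star (W 0) * W 0 = 1" using W_unitary[OF test_zero] by (simp add: unitary_def)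
  ultimately show ?thesis by (metis mult.assoc mult.left_neutral)
qed

lemma W_star: "f \<in> test_functions \<Longrightarrow> star (W f) = W (- f)"
proof -
  assume f: "f \<in> test_functions"
  have "W f * W (- f) = 1"
    using W_mult[OF f test_minus[OF f]] by (simp add: symplectic_minus_self W_zero scaleC_one)
  moreover have "star (W f) * W f = 1" using W_unitary[OF f] by (simp add: unitary_def)
  ultimately show ?thesis by (rule left_inverse_unique[rotated])
qed

lemma V_zero: "V 0 = 1"
  by (simp add: W_zero \<pi>_one)

lemma star_V: "f \<in> test_functions \<Longrightarrow> star (V f) = V (- f)"
  by (simp add: W_star flip: \<pi>_hom)

lemma V_cinner:
  assumes f: "f \<in> test_functions" and g: "g \<in> test_functions"
  shows "cinner (V g \<cdot> \<Omega>) (V f \<cdot> \<Omega>) = 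
    exp (one_particle m g f - of_real (vacuum_norm_sq m g / 2) - of_real (vacuum_norm_sq m f / 2))"
proof -
  have "cinner (V g \<cdot> \<Omega>) (V f \<cdot> \<Omega>) = cinner \<Omega> ((V (- g) * V f) \<cdot> \<Omega>)"
    by (simp add: op_app_times star_adjoint' flip: star_V[OF g])
  also have "\<dots> = exp (- (\<i> / 2 * symplectic (- g) f)) * \<omega> (W (f - g))"
    unfolding V_mult[OF test_minus[OF g] f] \<omega>_\<pi> by (simp add: op_app_scaleC cinner_scaleC_right)
  also have "\<dots> = exp (- (\<i> / 2 * symplectic (- g) f)) * exp (of_real (- vacuum_norm_sq m (f - g) / 2))"
    unfolding exp_of_real using \<omega>_W[OF test_diff[OF f g]] by simp
  also have "\<dots> = exp (one_particle m g f - of_real (vacuum_norm_sq m g / 2) - of_real (vacuum_norm_sq m f / 2))"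
    unfolding exp_add[symmetric] vacuum_norm_diff[OF f g mass_pos] symplectic_minus_left
    using one_particle_Im[OF f g mass_pos]
    by (intro arg_cong[of _ _ exp]) (simp add: complex_eq_iff field_simps)
  finally show ?thesis .
qed

lemma norm_V_vac: "f \<in> test_functions \<Longrightarrow> norm (V f \<cdot> \<Omega>) = 1"
proof -
  assume f: "f \<in> test_functions"
  have "(norm (V f \<cdot> \<Omega>))\<^sup>2 = 1"
    unfolding norm_sq_cinner V_cinner[OF f f] one_particle_self[OF mass_pos] by (simp flip: of_real_diff)
  then show ?thesis by (simp add: power2_eq_1_iff) (metis norm_ge_zero not_one_le_zero neg_0_le_iff_le)
qed

lemma norm_\<Omega>: "norm \<Omega> = 1"
  using norm_V_vac[OF test_zero] by (simp add: V_zero op_app_one)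

text \<open>The vector \<open>V f \<cdot> \<Omega>\<close> depends on \<open>f\<close> only through its mass shell transform.\<close>

lemma V_vac_eqI:
  assumes f: "f \<in> test_functions" and g: "g \<in> test_functions"
    and eq: "\<And>p. mass_shell_transform m f p = mass_shell_transform m g p"
  shows "V f \<cdot> \<Omega> = V g \<cdot> \<Omega>"
proof -
  have "one_particle m g f = one_particle m g g" "one_particle m f f = one_particle m g g"
    by (simp_all add: one_particle_def shell_density_def eq)
  then have "one_particle m g f = of_real (vacuum_norm_sq m g)" "vacuum_norm_sq m f = vacuum_norm_sq m g"
    unfolding one_particle_self[OF mass_pos] using of_real_eq_iff by blast+
  then have "cinner (V g \<cdot> \<Omega>) (V f \<cdot> \<Omega>) = 1" by (simp add: V_cinner[OF f g] flip: of_real_diff)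
  then have "(norm (V g \<cdot> \<Omega> - V f \<cdot> \<Omega>))\<^sup>2 = 0"
    by (simp add: norm_diff_sq norm_V_vac f g)
  then show ?thesis by simp
qed

text \<open>The complex linear span of the Weyl elements, a dense *-subalgebra of the Weyl algebra.\<close>

inductive_set weyl_span :: "'w set" where
  weyl: "f \<in> test_functions \<Longrightarrow> W f \<in> weyl_span"
| add: "a \<in> weyl_span \<Longrightarrow> b \<in> weyl_span \<Longrightarrow> a + b \<in> weyl_span"
| scale: "a \<in> weyl_span \<Longrightarrow> c *\<^sub>C a \<in> weyl_span"

lemma weyl_span_star: "a \<in> weyl_span \<Longrightarrow> star a \<in> weyl_span"
  by (induction rule: weyl_span.induct)
    (auto simp: W_star star_add star_scaleC intro: weyl_span.intros test_minus)

lemma weyl_span_mult: 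
  assumes "a \<in> weyl_span" "b \<in> weyl_span"
  shows "a * b \<in> weyl_span"
  using assms(1)
proof (induction rule: weyl_span.induct)
  case (weyl f)
  note f = weyl
  show ?case using assms(2)
  proof (induction rule: weyl_span.induct)
    case (weyl g)
    show ?case unfolding W_mult[OF f weyl] by (intro weyl_span.scale weyl_span.weyl test_add f weyl)
  next
    case (add a b) then show ?case by (simp add: distrib_left weyl_span.add)
  next
    case (scale a c) then show ?case by (simp add: mult_scaleC_right weyl_span.scale)
  qed
next
  case (add a b) then show ?case by (simp add: distrib_right weyl_span.add)
next
  case (scale a c) then show ?case by (simp add: mult_scaleC_left weyl_span.scale)
qed

lemma weyl_span_dense: "closure weyl_span = UNIV"
proof -
  have "star_subalgebra (closure weyl_span)"
    unfolding star_subalgebra_def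
  proof (intro conjI ballI allI)
    fix a b assume "a \<in> closure weyl_span" "b \<in> closure weyl_span"
    then obtain X Y where X: "\<And>n. X n \<in> weyl_span" "X \<longlonglongrightarrow> a" and Y: "\<And>n. Y n \<in> weyl_span" "Y \<longlonglongrightarrow> b"
      unfolding closure_sequential by blast
    show "a + b \<in> closure weyl_span" unfolding closure_sequential
      by (rule exI[of _ "\<lambda>n. X n + Y n"]) (auto intro: tendsto_add X Y weyl_span.add)
    show "a * b \<in> closure weyl_span" unfolding closure_sequential
      by (rule exI[of _ "\<lambda>n. X n * Y n"]) (auto intro: tendsto_mult X Y weyl_span_mult)
  next
    fix a c assume "a \<in> closure weyl_span"
    then obtain X where X: "\<And>n. X n \<in> weyl_span" "X \<longlonglongrightarrow> a" unfolding closure_sequential by blast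
    have "bounded_linear (\<lambda>a::'w. c *\<^sub>C a)"
      by (rule bounded_linear_intro[of _ "cmod c"])
        (auto simp: scaleC_add_right scaleC_scaleR_commute norm_scaleC mult.commute)
    from bounded_linear.tendsto[OF this X(2)]
    show "c *\<^sub>C a \<in> closure weyl_span" unfolding closure_sequential
      by (intro exI[of _ "\<lambda>n. c *\<^sub>C X n"]) (auto intro: X weyl_span.scale)
  next
    fix a assume "a \<in> closure weyl_span"
    then obtain X where X: "\<And>n. X n \<in> weyl_span" "X \<longlonglongrightarrow> a" unfolding closure_sequential by blast
    have "(\<lambda>n. star (X n)) \<longlonglongrightarrow> star a"
      using continuous_on_tendsto_compose[OF continuous_star[of UNIV] X(2)] by simp
    then show "star a \<in> closure weyl_span" unfolding closure_sequential
      by (intro exI[of _ "\<lambda>n. star (X n)"]) (auto intro: X weyl_span_star)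
  qed
  moreover have "W ` test_functions \<subseteq> closure weyl_span"
    using weyl_span.weyl closure_subset[of weyl_span] by blast
  ultimately have "cstar_generated (W ` test_functions) \<subseteq> closure weyl_span"
    unfolding cstar_generated_def by (intro Inter_lower) simp
  then show ?thesis using W_generate by auto
qed

text \<open>A property stable under linear combinations and limits holds for all vectors if it holds for the
  coherent vectors \<open>V f \<cdot> \<Omega>\<close>.\<close>

lemma weyl_induct:
  assumes weyl: "\<And>f. f \<in> test_functions \<Longrightarrow> P (V f \<cdot> \<Omega>)"
    and add: "\<And>u v. P u \<Longrightarrow> P v \<Longrightarrow> P (u + v)"
    and scale: "\<And>c v. P v \<Longrightarrow> P (c *\<^sub>C v)"
    and closed: "closed {v. P v}"
  shows "P v"
proof -
  have span: "P (\<pi> a \<cdot> \<Omega>)" if "a \<in> weyl_span" for a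
    using that by (induction rule: weyl_span.induct)
      (auto simp: \<pi>_hom op_app_simps op_app_scaleC intro: weyl add scale)
  have "P (\<pi> a \<cdot> \<Omega>)" for a
  proof -
    obtain X where X: "\<And>n. X n \<in> weyl_span" "X \<longlonglongrightarrow> a"
      using weyl_span_dense closure_sequential[of a weyl_span] by auto
    have "(\<lambda>n. \<pi> (X n) \<cdot> \<Omega> - \<pi> a \<cdot> \<Omega>) \<longlonglongrightarrow> 0"
    proof (rule Lim_null_comparison)
      have "norm (\<pi> (X n) \<cdot> \<Omega> - \<pi> a \<cdot> \<Omega>) \<le> 2 * norm (X n - a)" for n
      proof (rule power2_le_imp_le)
        have "\<pi> (X n) = \<pi> (X n - a) + \<pi> a" by (simp flip: \<pi>_hom)
        then have "\<pi> (X n) \<cdot> \<Omega> - \<pi> a \<cdot> \<Omega> = \<pi> (X n - a) \<cdot> \<Omega>" by (simp add: op_app_simps)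
        then show "(norm (\<pi> (X n) \<cdot> \<Omega> - \<pi> a \<cdot> \<Omega>))\<^sup>2 \<le> (2 * norm (X n - a))\<^sup>2"
          using order_trans[OF gns_norm_bound[OF \<omega>_state vacuum_gns, of "X n - a"],
              OF mult_right_mono[of "4/3" 4 "(norm (X n - a))\<^sup>2"]] by (simp add: power_mult_distrib)
      qed simp
      then show "\<forall>\<^sub>F n in sequentially. norm (\<pi> (X n) \<cdot> \<Omega> - \<pi> a \<cdot> \<Omega>) \<le> 2 * norm (X n - a)" by simp
      show "(\<lambda>n. 2 * norm (X n - a)) \<longlonglongrightarrow> 0"
        using X(2) by (intro tendsto_mult_right_zero tendsto_norm_zero LIM_zero)
    qed
    then have "(\<lambda>n. \<pi> (X n) \<cdot> \<Omega>) \<longlonglongrightarrow> \<pi> a \<cdot> \<Omega>" by (rule LIM_zero_cancel)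
    then show ?thesis
      using closed_sequentially[OF closed, of "\<lambda>n. \<pi> (X n) \<cdot> \<Omega>"] span X(1) by blast
  qed
  then show ?thesis by (rule gns_induct[OF _ closed])
qed

section \<open>Translations and the spectrum condition\<close>

text \<open>The unitaries implementing the translations.  They are determined by their values on the dense set of
  vectors \<open>\<pi> a \<cdot> \<Omega>\<close>, so that the choice is unique.\<close>

definition U :: "spacetime \<Rightarrow> 'h bdd_op"
  where "U x = (SOME U. unitary U \<and> (\<forall>a. U \<cdot> (\<pi> a \<cdot> \<Omega>) = \<pi> (\<alpha>\<^sub>W id x a) \<cdot> \<Omega>) \<and>
      (\<forall>A\<in>quasilocal_algebra. \<alpha> id x A = U * A * star U))"

lemma U: "unitary (U x)" "U x \<cdot> (\<pi> a \<cdot> \<Omega>) = \<pi> (\<alpha>\<^sub>W id x a) \<cdot> \<Omega>"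
    "A \<in> quasilocal_algebra \<Longrightarrow> \<alpha> id x A = U x * A * star (U x)"
  using someI_ex[OF \<alpha>_extension[OF lorentz_id, of x]] unfolding U_def[symmetric] by blast+

lemma U_V_vac: "f \<in> test_functions \<Longrightarrow> U x \<cdot> (V f \<cdot> \<Omega>) = V (\<tau> id x f) \<cdot> \<Omega>"
  by (simp add: U(2) \<alpha>\<^sub>W_W[OF lorentz_id])

lemma \<alpha>\<^sub>W_hom: "\<alpha>\<^sub>W id x (a * b) = \<alpha>\<^sub>W id x a * \<alpha>\<^sub>W id x b"
  using \<alpha>\<^sub>W_automorphism[OF lorentz_id, of x] by (simp add: star_automorphism_def star_hom_on_def)

lemma U_\<pi>: "U x * \<pi> a * star (U x) = \<pi> (\<alpha>\<^sub>W id x a)"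
proof -
  have "U x * \<pi> a = \<pi> (\<alpha>\<^sub>W id x a) * U x"
  proof (rule op_eqI)
    fix v show "(U x * \<pi> a) \<cdot> v = (\<pi> (\<alpha>\<^sub>W id x a) * U x) \<cdot> v"
    proof (rule gns_induct[of "\<lambda>v. (U x * \<pi> a) \<cdot> v = (\<pi> (\<alpha>\<^sub>W id x a) * U x) \<cdot> v"])
      fix b
      have "U x \<cdot> (\<pi> a \<cdot> (\<pi> b \<cdot> \<Omega>)) = U x \<cdot> (\<pi> (a * b) \<cdot> \<Omega>)" by (simp only: \<pi>_hom op_app_times)
      also have "\<dots> = (\<pi> (\<alpha>\<^sub>W id x a) * \<pi> (\<alpha>\<^sub>W id x b)) \<cdot> \<Omega>" unfolding U(2) by (simp only: \<alpha>\<^sub>W_hom \<pi>_hom)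
      also have "\<dots> = \<pi> (\<alpha>\<^sub>W id x a) \<cdot> (U x \<cdot> (\<pi> b \<cdot> \<Omega>))" by (simp only: op_app_times U(2))
      finally show "(U x * \<pi> a) \<cdot> (\<pi> b \<cdot> \<Omega>) = (\<pi> (\<alpha>\<^sub>W id x a) * U x) \<cdot> (\<pi> b \<cdot> \<Omega>)" by (simp add: op_app_times)
    qed (rule closed_op_eq)
  qed
  then show ?thesis using U(1)[of x] by (simp add: unitary_def mult.assoc)
qed

lemma U_V: "f \<in> test_functions \<Longrightarrow> U x * V f * star (U x) = V (\<tau> id x f)"
  by (simp add: U_\<pi> \<alpha>\<^sub>W_W[OF lorentz_id])

lemma U_vac: "U x \<cdot> \<Omega> = \<Omega>"
proof -
  obtain b where b: "\<alpha>\<^sub>W id x b = 1"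
    using \<alpha>\<^sub>W_automorphism[OF lorentz_id, of x] by (metis UNIV_I bij_betw_imp_surj_on imageE star_automorphism_def)
  have "\<alpha>\<^sub>W id x 1 * \<alpha>\<^sub>W id x b = \<alpha>\<^sub>W id x b" by (simp flip: \<alpha>\<^sub>W_hom)
  then have "\<alpha>\<^sub>W id x 1 = 1" by (simp add: b)
  then show ?thesis using U(2)[of x 1] by (simp add: \<pi>_one op_app_one)
qed

lemma weyl_op_eqI:
  assumes "\<And>f. f \<in> test_functions \<Longrightarrow> A \<cdot> (V f \<cdot> \<Omega>) = B \<cdot> (V f \<cdot> \<Omega>)"
  shows "A = B"
proof (rule op_eqI)
  fix v show "A \<cdot> v = B \<cdot> v"
    by (rule weyl_induct[of "\<lambda>v. A \<cdot> v = B \<cdot> v"])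
      (auto simp: assms op_app_simps op_scaleC_right closed_op_eq)
qed

lemma U_add: "U x * U y = U (x + y)"
proof (rule weyl_op_eqI)
  fix f assume f: "f \<in> test_functions"
  have "V (\<tau> id x (\<tau> id y f)) \<cdot> \<Omega> = V (\<tau> id (x + y) f) \<cdot> \<Omega>"
  proof (rule V_vac_eqI)
    show "mass_shell_transform m (\<tau> id x (\<tau> id y f)) p = mass_shell_transform m (\<tau> id (x + y) f) p" for p
      unfolding \<tau>_id_transform[OF \<tau>_id_test[OF f]] \<tau>_id_transform[OF f]
      by (simp add: exp_add[symmetric] algebra_simps)
  qed (intro \<tau>_id_test f)+
  then show "(U x * U y) \<cdot> (V f \<cdot> \<Omega>) = U (x + y) \<cdot> (V f \<cdot> \<Omega>)"
    by (simp add: op_app_times U_V_vac f \<tau>_id_test)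
qed

lemma U_zero: "U 0 = 1"
proof -
  have "U 0 * U 0 = U 0" using U_add[of 0 0] by simp
  then have "star (U 0) * (U 0 * U 0) = star (U 0) * U 0" by simp
  then show ?thesis using U(1)[of 0] by (simp add: unitary_def flip: mult.assoc)
qed

lemma star_U: "star (U x) = U (- x)"
proof -
  have "U x * U (- x) = 1" using U_add[of x "- x"] by (simp add: U_zero)
  moreover have "star (U x) * U x = 1" using U(1)[of x] by (simp add: unitary_def)
  ultimately show ?thesis by (rule left_inverse_unique[rotated])
qed

lemma one_particle_\<tau>_continuous:
  assumes f: "f \<in> test_functions" and g: "g \<in> test_functions"
  shows "continuous_on UNIV (\<lambda>x. one_particle m g (\<tau> id x f))"
  unfolding one_particle_\<tau>[OF f]
proof (intro continuous_on_mult continuous_on_const continuous_on_LINT[where B = "\<lambda>p. cmod (shell_density m g f p)"])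
  show "integrable lborel (\<lambda>p. cmod (shell_density m g f p))"
    by (intro integrable_norm shell_density_integrable f g mass_pos)
  show "(\<lambda>p. shell_density m g f p * exp (\<i> * of_real (fst x * energy m p - snd x * p))) \<in> borel_measurable lborel" for x
  proof -
    have "continuous_on UNIV (\<lambda>p. shell_density m g f p * exp (\<i> * of_real (fst x * energy m p - snd x * p)))"
      by (intro continuous_intros shell_density_continuous energy_continuous f g mass_pos)
    then show ?thesis by (simp add: borel_measurable_continuous_onI)
  qed
qed (auto intro!: continuous_intros simp: norm_mult)

lemma U_continuous: "continuous_on UNIV (\<lambda>x. U x \<cdot> v)"
proof (rule weyl_induct[of "\<lambda>v. continuous_on UNIV (\<lambda>x. U x \<cdot> v)"])
  fix f assume f: "f \<in> test_functions"
  show "continuous_on UNIV (\<lambda>x. U x \<cdot> (V f \<cdot> \<Omega>))"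
  proof (rule continuous_on_weak_unitary[OF U(1)])
    show "continuous_on UNIV (\<lambda>x. cinner (U y \<cdot> (V f \<cdot> \<Omega>)) (U x \<cdot> (V f \<cdot> \<Omega>)))" for y
      unfolding U_V_vac[OF f] V_cinner[OF \<tau>_id_test[OF f] \<tau>_id_test[OF f]] vacuum_norm_\<tau>[OF f]
      by (intro continuous_intros one_particle_\<tau>_continuous f \<tau>_id_test)
  qed
next
  fix c v assume "continuous_on UNIV (\<lambda>x. U x \<cdot> v)"
  from bounded_linear.continuous_on[OF bounded_linear_scaleC[of c] this]
  show "continuous_on UNIV (\<lambda>x. U x \<cdot> (c *\<^sub>C v))" by (simp add: op_scaleC_right)
next
  show "closed {v. continuous_on UNIV (\<lambda>x. U x \<cdot> v)}"
    unfolding closed_sequential_limits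
  proof (intro allI impI, elim conjE)
    fix X v assume X: "\<forall>n. X n \<in> {v. continuous_on UNIV (\<lambda>x. U x \<cdot> v)}" "X \<longlonglongrightarrow> v"
    have "continuous_on UNIV (\<lambda>x. U x \<cdot> v)"
    proof (rule uniform_limit_theorem)
      show "uniform_limit UNIV (\<lambda>n x. U x \<cdot> X n) (\<lambda>x. U x \<cdot> v) sequentially"
        unfolding uniform_limit_iff dist_norm
      proof (intro allI impI)
        fix e :: real assume "e > 0"
        then have "\<forall>\<^sub>F n in sequentially. norm (X n - v) < e" using X(2) by (simp add: tendsto_iff dist_norm)
        then show "\<forall>\<^sub>F n in sequentially. \<forall>x\<in>UNIV. norm (U x \<cdot> X n - U x \<cdot> v) < e"
          by (simp add: norm_unitary_app[OF U(1)] flip: op_app_simps)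
      qed
    qed (use X in auto)
    then show "v \<in> {v. continuous_on UNIV (\<lambda>x. U x \<cdot> v)}" by simp
  qed
qed (simp add: op_app_simps continuous_on_add)

lemma V_\<tau>_continuous: 
  assumes f: "f \<in> test_functions"
  shows "continuous_on UNIV (\<lambda>y. V (\<tau> id y f) \<cdot> v)"
proof -
  have "continuous_on UNIV (\<lambda>y. V f \<cdot> (star (U y) \<cdot> v))"
    by (rule bounded_linear.continuous_on[OF bounded_linear_op_app continuous_on_star_unitary[OF U(1) U_continuous]])
  then have "continuous_on UNIV (\<lambda>y. U y \<cdot> (V f \<cdot> (star (U y) \<cdot> v)))"
    by (rule continuous_on_app_bounded[OF _ U_continuous, where B = 1, rotated]) (simp add: norm_unitary_op[OF U(1)])
  then show ?thesis by (simp add: U_V[OF f, symmetric] op_app_times)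
qed

text \<open>Energy and momentum lie in the closed forward light cone, expressed as positive frequency of matrix elements
  along causal directions.  It is verified on the coherent vectors and extended to both arguments by density.\<close>

theorem spectrum_condition:
  assumes e: "\<bar>snd e\<bar> \<le> fst e"
  shows "positive_frequency (\<lambda>s. cinner u (U (a + s *\<^sub>R e) \<cdot> v))"
proof -
  have cont: "continuous_on UNIV (\<lambda>s. cinner u (U (a + s *\<^sub>R e) \<cdot> v))" for u v
    by (intro continuous_on_cinner continuous_on_const continuous_on_compose2[OF U_continuous] continuous_intros) auto
  have bd: "cmod (cinner u (U x \<cdot> v)) \<le> norm u * norm v" for u v x
    using cinner_cauchy_schwarz[of u "U x \<cdot> v"] by (simp add: norm_unitary_app[OF U(1)])
  have base: "positive_frequency (\<lambda>s. cinner (V g \<cdot> \<Omega>) (U (a + s *\<^sub>R e) \<cdot> (V f \<cdot> \<Omega>)))"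
    if f: "f \<in> test_functions" and g: "g \<in> test_functions" for f g
  proof -
    define c where "c p = shell_density m g f p * exp (\<i> * of_real (fst a * energy m p - snd a * p))" for p
    have cb: "cmod (c p) = cmod (shell_density m g f p)" for p by (simp add: c_def norm_mult)
    have "continuous_on UNIV c" unfolding c_def[abs_def]
      by (intro continuous_intros shell_density_continuous energy_continuous f g mass_pos)
    then have "integrable lborel c"
      by (intro Bochner_Integration.integrable_bound[OF shell_density_integrable[OF f g mass_pos]])
        (auto simp: cb borel_measurable_continuous_onI)
    moreover have "integrable lborel (\<lambda>p. cmod (c p) * energy m p)"
      unfolding cb by (rule shell_density_energy_integrable[OF f g mass_pos])
    ultimately have "positive_frequency (\<lambda>s. exp ((- of_real (vacuum_norm_sq m g / 2) - of_real (vacuum_norm_sq m f / 2)) +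
        1/2 * (LINT p|lborel. c p * exp (\<i> * of_real s * of_real (fst e * energy m p - snd e * p)))))"
      by (rule one_particle_half_plane[OF mass_pos e])
    moreover have "cinner (V g \<cdot> \<Omega>) (U (a + s *\<^sub>R e) \<cdot> (V f \<cdot> \<Omega>)) = exp ((- of_real (vacuum_norm_sq m g / 2) - of_real (vacuum_norm_sq m f / 2)) +
        1/2 * (LINT p|lborel. c p * exp (\<i> * of_real s * of_real (fst e * energy m p - snd e * p))))" for s
    proof -
      have "shell_density m g f p * exp (\<i> * of_real (fst (a + s *\<^sub>R e) * energy m p - snd (a + s *\<^sub>R e) * p))
        = c p * exp (\<i> * of_real s * of_real (fst e * energy m p - snd e * p))" for p
        unfolding c_def mult.assoc exp_add[symmetric] by (simp add: algebra_simps)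
      then have "one_particle m g (\<tau> id (a + s *\<^sub>R e) f) = 1/2 * (LINT p|lborel. c p * exp (\<i> * of_real s * of_real (fst e * energy m p - snd e * p)))"
        unfolding one_particle_\<tau>[OF f] by simp
      then show ?thesis
        unfolding U_V_vac[OF f] V_cinner[OF \<tau>_id_test[OF f] g] vacuum_norm_\<tau>[OF f] by (intro arg_cong[of _ _ exp]) simp
    qed
    ultimately show ?thesis by simp
  qed
  have right: "positive_frequency (\<lambda>s. cinner (V g \<cdot> \<Omega>) (U (a + s *\<^sub>R e) \<cdot> v))" if g: "g \<in> test_functions" for g v
  proof (rule weyl_induct[of "\<lambda>v. positive_frequency (\<lambda>s. cinner (V g \<cdot> \<Omega>) (U (a + s *\<^sub>R e) \<cdot> v))"])
    fix u v assume u: "positive_frequency (\<lambda>s. cinner (V g \<cdot> \<Omega>) (U (a + s *\<^sub>R e) \<cdot> u))"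
      and v: "positive_frequency (\<lambda>s. cinner (V g \<cdot> \<Omega>) (U (a + s *\<^sub>R e) \<cdot> v))"
    show "positive_frequency (\<lambda>s. cinner (V g \<cdot> \<Omega>) (U (a + s *\<^sub>R e) \<cdot> (u + v)))"
      unfolding op_app_simps cinner_add_right by (rule positive_frequency_linear(1)[OF u cont bd v cont bd])
  next
    fix c v assume v: "positive_frequency (\<lambda>s. cinner (V g \<cdot> \<Omega>) (U (a + s *\<^sub>R e) \<cdot> v))"
    show "positive_frequency (\<lambda>s. cinner (V g \<cdot> \<Omega>) (U (a + s *\<^sub>R e) \<cdot> (c *\<^sub>C v)))"
      unfolding op_scaleC_right cinner_scaleC_right by (rule positive_frequency_linear(2)[OF v cont bd v cont bd])
  next
    show "closed {v. positive_frequency (\<lambda>s. cinner (V g \<cdot> \<Omega>) (U (a + s *\<^sub>R e) \<cdot> v))}"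
      unfolding closed_sequential_limits
    proof (intro allI impI, elim conjE)
      fix X v assume X: "\<forall>n. X n \<in> {v. positive_frequency (\<lambda>s. cinner (V g \<cdot> \<Omega>) (U (a + s *\<^sub>R e) \<cdot> v))}" "X \<longlonglongrightarrow> v"
      obtain B where B: "\<And>n. norm (X n) \<le> B" using convergent_imp_Bseq[OF convergentI[OF X(2)]] by (auto simp: Bseq_def)
      have "positive_frequency (\<lambda>s. cinner (V g \<cdot> \<Omega>) (U (a + s *\<^sub>R e) \<cdot> v))"
      proof (rule positive_frequency_limit[where F = "\<lambda>n s. cinner (V g \<cdot> \<Omega>) (U (a + s *\<^sub>R e) \<cdot> X n)" and M = "norm (V g \<cdot> \<Omega>) * B"])
        show "cmod (cinner (V g \<cdot> \<Omega>) (U (a + s *\<^sub>R e) \<cdot> X n)) \<le> norm (V g \<cdot> \<Omega>) * B" for n s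
          using bd[of "V g \<cdot> \<Omega>" "a + s *\<^sub>R e" "X n"] mult_left_mono[OF B[of n] norm_ge_zero[of "V g \<cdot> \<Omega>"]] by linarith
        show "(\<lambda>n. cinner (V g \<cdot> \<Omega>) (U (a + s *\<^sub>R e) \<cdot> X n)) \<longlonglongrightarrow> cinner (V g \<cdot> \<Omega>) (U (a + s *\<^sub>R e) \<cdot> v)" for s
          by (intro tendsto_cinner tendsto_op_app tendsto_const X(2))
      qed (use X cont in auto)
      then show "v \<in> {v. positive_frequency (\<lambda>s. cinner (V g \<cdot> \<Omega>) (U (a + s *\<^sub>R e) \<cdot> v))}" by simp
    qed
  qed (rule base[OF _ g])
  show ?thesis
  proof (rule weyl_induct[of "\<lambda>u. positive_frequency (\<lambda>s. cinner u (U (a + s *\<^sub>R e) \<cdot> v))"])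
    fix u w assume u: "positive_frequency (\<lambda>s. cinner u (U (a + s *\<^sub>R e) \<cdot> v))"
      and w: "positive_frequency (\<lambda>s. cinner w (U (a + s *\<^sub>R e) \<cdot> v))"
    show "positive_frequency (\<lambda>s. cinner (u + w) (U (a + s *\<^sub>R e) \<cdot> v))"
      unfolding cinner_add_left by (rule positive_frequency_linear(1)[OF u cont bd w cont bd])
  next
    fix c u assume u: "positive_frequency (\<lambda>s. cinner u (U (a + s *\<^sub>R e) \<cdot> v))"
    show "positive_frequency (\<lambda>s. cinner (c *\<^sub>C u) (U (a + s *\<^sub>R e) \<cdot> v))"
      unfolding cinner_scaleC_left by (rule positive_frequency_linear(2)[OF u cont bd u cont bd])
  next
    show "closed {u. positive_frequency (\<lambda>s. cinner u (U (a + s *\<^sub>R e) \<cdot> v))}"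
      unfolding closed_sequential_limits
    proof (intro allI impI, elim conjE)
      fix X u assume X: "\<forall>n. X n \<in> {u. positive_frequency (\<lambda>s. cinner u (U (a + s *\<^sub>R e) \<cdot> v))}" "X \<longlonglongrightarrow> u"
      obtain B where B: "\<And>n. norm (X n) \<le> B" using convergent_imp_Bseq[OF convergentI[OF X(2)]] by (auto simp: Bseq_def)
      have "positive_frequency (\<lambda>s. cinner u (U (a + s *\<^sub>R e) \<cdot> v))"
      proof (rule positive_frequency_limit[where F = "\<lambda>n s. cinner (X n) (U (a + s *\<^sub>R e) \<cdot> v)" and M = "B * norm v"])
        show "cmod (cinner (X n) (U (a + s *\<^sub>R e) \<cdot> v)) \<le> B * norm v" for n s
          using bd[of "X n" "a + s *\<^sub>R e" v] mult_right_mono[OF B[of n] norm_ge_zero[of v]] by linarith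
        show "(\<lambda>n. cinner (X n) (U (a + s *\<^sub>R e) \<cdot> v)) \<longlonglongrightarrow> cinner u (U (a + s *\<^sub>R e) \<cdot> v)" for s
          by (intro tendsto_cinner tendsto_const X(2))
      qed (use X cont in auto)
      then show "u \<in> {u. positive_frequency (\<lambda>s. cinner u (U (a + s *\<^sub>R e) \<cdot> v))}" by simp
    qed
  qed (rule right)
qed

end

section \<open>Locality\<close>

lemma norm_spacetime_ge: "\<bar>fst x\<bar> \<le> norm x" "\<bar>snd x\<bar> \<le> norm (x :: spacetime)"
  by (metis norm_fst_le prod.collapse real_norm_def, metis norm_snd_le prod.collapse real_norm_def)

lemma double_cone_bound:
  assumes "R \<in> double_cones"
  obtains C where "C > 0" "R \<subseteq> double_cone_over (- C) C"
proof -
  obtain \<Lambda> x a b where R: "R = poincare_image \<Lambda> x (double_cone_over a b)" "lorentz \<Lambda>"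
    using assms by (auto simp: double_cones_def)
  have "double_cone_over a b \<subseteq> cbox (- (\<bar>a\<bar> + \<bar>b\<bar>), - (\<bar>a\<bar> + \<bar>b\<bar>)) (\<bar>a\<bar> + \<bar>b\<bar>, \<bar>a\<bar> + \<bar>b\<bar>)"
    by (auto simp: double_cone_over_def cbox_Pair_eq)
  then have "bounded (double_cone_over a b)" using bounded_cbox bounded_subset by blast
  moreover have "bounded_linear \<Lambda>"
    using R(2) by (simp add: lorentz_def linear_conv_bounded_linear)
  ultimately have "bounded (\<Lambda> ` double_cone_over a b)" by (rule bounded_linear_image)
  then have "bounded ((+) x ` \<Lambda> ` double_cone_over a b)" by (rule bounded_translation)
  moreover have "(+) x ` \<Lambda> ` double_cone_over a b = R"
    by (auto simp: R poincare_image_def image_image add.commute)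
  ultimately obtain B where B: "\<And>z. z \<in> R \<Longrightarrow> norm z \<le> B" by (auto simp: bounded_iff)
  have "R \<subseteq> double_cone_over (- (2 * \<bar>B\<bar> + 1)) (2 * \<bar>B\<bar> + 1)"
  proof
    fix z assume "z \<in> R"
    then have "norm z \<le> B" by (rule B)
    then show "z \<in> double_cone_over (- (2 * \<bar>B\<bar> + 1)) (2 * \<bar>B\<bar> + 1)"
      using norm_spacetime_ge[of z] by (cases z) (auto simp: double_cone_over_def)
  qed
  then show ?thesis using that[of "2 * \<bar>B\<bar> + 1"] by simp
qed

lemma scale_double_cone:
  assumes "l > 0"
  shows "scale_region l (double_cone_over a b) = double_cone_over (l * a) (l * b)"
proof -
  have 1: "l *\<^sub>R z \<in> double_cone_over (l * a) (l * b) \<longleftrightarrow> z \<in> double_cone_over a b" for z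
  proof -
    have "l * a + \<bar>l * t\<bar> < l * x \<longleftrightarrow> a + \<bar>t\<bar> < x" "l * x < l * b - \<bar>l * t\<bar> \<longleftrightarrow> x < b - \<bar>t\<bar>" for t x
      using mult_less_cancel_left_pos[OF assms, of "a + \<bar>t\<bar>" x] mult_less_cancel_left_pos[OF assms, of x "b - \<bar>t\<bar>"] assms
      by (simp_all add: abs_mult algebra_simps)
    then show ?thesis by (cases z) (simp add: double_cone_over_def)
  qed
  have "z = l *\<^sub>R ((1 / l) *\<^sub>R z)" for z :: spacetime using assms by simp
  then show ?thesis unfolding scale_region_def using 1 by (metis (no_types, lifting) equalityI image_iff subsetI)
qed

lemma double_cone_over_mem: "a < b \<Longrightarrow> double_cone_over a b \<in> double_cones"
  unfolding double_cones_def mem_Collect_eq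
  by (intro exI[of _ id] exI[of _ 0] exI[of _ a] exI[of _ b]) (simp add: poincare_image_def lorentz_id)

context massive_net
begin

text \<open>The von Neumann algebra generated by the time-zero Weyl operators over \<open>[-C, C]\<close>.  By finite propagation
  speed, local algebras of double cones can be replaced by these.\<close>

definition time_zero_algebra :: "real \<Rightarrow> 'h bdd_op set"
  where "time_zero_algebra C = bicommutant {V f | f. f \<in> test_functions \<and> supp f \<subseteq> {-C..C}}"

lemma supp_\<tau>:
  assumes \<Lambda>: "lorentz \<Lambda>" and f: "f \<in> test_functions"
    and left: "\<And>y. y \<in> supp f \<Longrightarrow> \<bar>fst (\<Lambda> (0, y) + x)\<bar> \<le> snd (\<Lambda> (0, y) + x) - a"
    and right: "\<And>y. y \<in> supp f \<Longrightarrow> \<bar>fst (\<Lambda> (0, y) + x)\<bar> \<le> b - snd (\<Lambda> (0, y) + x)"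
  shows "supp (\<tau> \<Lambda> x f) \<subseteq> {a..b}"
proof (rule supp_subsetI[OF closed_atLeastAtMost])
  fix z assume z: "z \<notin> {a..b}"
  have tr: "mass_shell_transform m (\<tau> \<Lambda> x f) p = exp (\<i> * (fst x * energy m p - snd x * p)) *
      mass_shell_transform m f (snd (inv \<Lambda> (energy m p, p)))" for p
    using \<tau>_transform[OF \<Lambda> f, of x p] by simp
  show "\<tau> \<Lambda> x f z = 0"
  proof (cases "z < a")
    case True
    show ?thesis
    proof (rule propagation[OF mass_pos \<Lambda> f \<tau>_test[OF \<Lambda> f] tr, of "-1"])
      show "\<bar>fst (\<Lambda> (0, y)) + fst x\<bar> \<le> - 1 * (z - (snd (\<Lambda> (0, y)) + snd x))" if "y \<in> supp f" for y
        using left[OF that] True by simp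
    qed simp
  next
    case False
    then have "z > b" using z by auto
    show ?thesis
    proof (rule propagation[OF mass_pos \<Lambda> f \<tau>_test[OF \<Lambda> f] tr, of 1])
      show "\<bar>fst (\<Lambda> (0, y)) + fst x\<bar> \<le> 1 * (z - (snd (\<Lambda> (0, y)) + snd x))" if "y \<in> supp f" for y
        using right[OF that] \<open>z > b\<close> by simp
    qed simp
  qed
qed

lemma supp_\<tau>_id:
  assumes f: "f \<in> test_functions" and supp: "supp f \<subseteq> {a..b}"
  shows "supp (\<tau> id x f) \<subseteq> {a + snd x - \<bar>fst x\<bar>..b + snd x + \<bar>fst x\<bar>}"
  by (rule supp_\<tau>[OF lorentz_id f]) (use supp in auto)

text \<open>A Weyl operator of a double cone, on whatever space-like line its test function lives, is a time-zero
  Weyl operator.\<close>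

lemma local_algebra_le:
  assumes "R \<subseteq> double_cone_over (- C) C"
  shows "local_algebra R \<subseteq> time_zero_algebra C"
  unfolding local_algebra_def time_zero_algebra_def
proof (rule bicommutant_mono, rule subsetI)
  fix A assume "A \<in> {\<pi> (\<alpha>\<^sub>W \<Lambda> x (W f)) | \<Lambda> x a b f. lorentz \<Lambda> \<and> a < b \<and>
    R = poincare_image \<Lambda> x (double_cone_over a b) \<and> f \<in> test_functions \<and> supp f \<subseteq> {a<..<b}}"
  then obtain \<Lambda> x a b f where A: "A = \<pi> (\<alpha>\<^sub>W \<Lambda> x (W f))" and \<Lambda>: "lorentz \<Lambda>"
    and R: "R = poincare_image \<Lambda> x (double_cone_over a b)" and f: "f \<in> test_functions" "supp f \<subseteq> {a<..<b}"
    by blast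
  have "\<Lambda> (0, y) + x \<in> double_cone_over (- C) C" if "y \<in> supp f" for y
  proof -
    have "(0, y) \<in> double_cone_over a b" using that f(2) by (auto simp: double_cone_over_def)
    then show ?thesis using assms unfolding R poincare_image_def by blast
  qed
  then have in_cone: "- C + \<bar>fst (\<Lambda> (0, y) + x)\<bar> < snd (\<Lambda> (0, y) + x)" "snd (\<Lambda> (0, y) + x) < C - \<bar>fst (\<Lambda> (0, y) + x)\<bar>"
    if "y \<in> supp f" for y
    using that by (auto simp: double_cone_over_def case_prod_beta)
  have "supp (\<tau> \<Lambda> x f) \<subseteq> {-C..C}"
  proof (rule supp_\<tau>[OF \<Lambda> f(1)])
    fix y assume "y \<in> supp f"
    from in_cone[OF this] show "\<bar>fst (\<Lambda> (0, y) + x)\<bar> \<le> snd (\<Lambda> (0, y) + x) - - C"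
      "\<bar>fst (\<Lambda> (0, y) + x)\<bar> \<le> C - snd (\<Lambda> (0, y) + x)" by linarith+
  qed
  moreover have "A = V (\<tau> \<Lambda> x f)" by (simp add: A \<alpha>\<^sub>W_W[OF \<Lambda> f(1)])
  ultimately show "A \<in> {V f | f. f \<in> test_functions \<and> supp f \<subseteq> {-C..C}}"
    using \<tau>_test[OF \<Lambda> f(1)] by blast
qed

lemma time_zero_le_local:
  assumes "C < D" "0 < D"
  shows "time_zero_algebra C \<subseteq> local_algebra (double_cone_over (- D) D)"
  unfolding local_algebra_def time_zero_algebra_def
proof (rule bicommutant_mono, rule subsetI)
  fix A assume "A \<in> {V f | f. f \<in> test_functions \<and> supp f \<subseteq> {-C..C}}"
  then obtain f where f: "f \<in> test_functions" "supp f \<subseteq> {-C..C}" "A = V f" by blast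
  have "\<pi> (\<alpha>\<^sub>W id 0 (W f)) = A" using U_\<pi>[of 0 "W f"] by (simp add: U_zero star_one f)
  moreover have "double_cone_over (- D) D = poincare_image id 0 (double_cone_over (- D) D)"
    by (simp add: poincare_image_def)
  moreover have "supp f \<subseteq> {- D<..<D}" using f(2) assms by auto
  moreover have "- D < D" using assms by simp
  ultimately show "A \<in> {\<pi> (\<alpha>\<^sub>W \<Lambda> x (W f)) | \<Lambda> x a b f. lorentz \<Lambda> \<and> a < b \<and>
      double_cone_over (- D) D = poincare_image \<Lambda> x (double_cone_over a b) \<and> f \<in> test_functions \<and> supp f \<subseteq> {a<..<b}}"
    unfolding mem_Collect_eq using f(1) lorentz_id by metis
qed

lemma time_zero_mono: "C \<le> D \<Longrightarrow> time_zero_algebra C \<subseteq> time_zero_algebra D"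
  unfolding time_zero_algebra_def by (rule bicommutant_mono) fastforce

lemma time_zero_quasilocal: "A \<in> time_zero_algebra C \<Longrightarrow> A \<in> quasilocal_algebra"
proof -
  assume A: "A \<in> time_zero_algebra C"
  have "C < \<bar>C\<bar> + 1" "0 < \<bar>C\<bar> + 1" by linarith+
  from time_zero_le_local[OF this] A have "A \<in> local_algebra (double_cone_over (- (\<bar>C\<bar> + 1)) (\<bar>C\<bar> + 1))" by blast
  moreover have "double_cone_over (- (\<bar>C\<bar> + 1)) (\<bar>C\<bar> + 1) \<in> double_cones"
    by (rule double_cone_over_mem) simp
  ultimately show ?thesis unfolding quasilocal_algebra_def
    by (intro subsetD[OF closure_subset] UN_I)
qed

lemma \<alpha>_time_zero: "A \<in> time_zero_algebra C \<Longrightarrow> \<alpha> id x A = U x * A * star (U x)"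
  by (rule U(3)[OF time_zero_quasilocal])

lemma V_time_zero: "f \<in> test_functions \<Longrightarrow> supp f \<subseteq> {-C..C} \<Longrightarrow> V f \<in> time_zero_algebra C"
  unfolding time_zero_algebra_def by (rule subsetD[OF bicommutant_increasing]) blast

lemma time_zero_star: "A \<in> time_zero_algebra C \<Longrightarrow> star A \<in> time_zero_algebra C"
  unfolding time_zero_algebra_def
proof (erule bicommutant_star[rotated])
  fix B assume "B \<in> {V f | f. f \<in> test_functions \<and> supp f \<subseteq> {-C..C}}"
  then obtain f where f: "f \<in> test_functions" "supp f \<subseteq> {-C..C}" "B = V f" by blast
  have "supp (- f) = supp f" by (simp add: supp_def)
  then show "star B \<in> {V f | f. f \<in> test_functions \<and> supp f \<subseteq> {-C..C}}"
    using f test_minus[OF f(1)] star_V[OF f(1)] by (intro CollectI exI[of _ "- f"]) auto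
qed

lemma time_zero_mult: "A \<in> time_zero_algebra C \<Longrightarrow> B \<in> time_zero_algebra C \<Longrightarrow> A * B \<in> time_zero_algebra C"
  unfolding time_zero_algebra_def by (rule bicommutant_mult)

lemma time_zero_translate:
  assumes A: "A \<in> time_zero_algebra C" and D: "C + \<bar>fst x\<bar> + \<bar>snd x\<bar> \<le> D"
  shows "U x * A * star (U x) \<in> time_zero_algebra D"
proof -
  have "(\<lambda>B. U x * B * star (U x)) ` {V f | f. f \<in> test_functions \<and> supp f \<subseteq> {-C..C}}
     \<subseteq> {V f | f. f \<in> test_functions \<and> supp f \<subseteq> {-D..D}}"
  proof
    fix B assume "B \<in> (\<lambda>B. U x * B * star (U x)) ` {V f | f. f \<in> test_functions \<and> supp f \<subseteq> {-C..C}}"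
    then obtain f where f: "f \<in> test_functions" "supp f \<subseteq> {-C..C}" "B = U x * V f * star (U x)" by blast
    have "supp (\<tau> id x f) \<subseteq> {-D..D}"
      using supp_\<tau>_id[OF f(1,2), of x] D by (force simp: abs_le_iff)
    then show "B \<in> {V f | f. f \<in> test_functions \<and> supp f \<subseteq> {-D..D}}"
      using f U_V[OF f(1)] \<tau>_id_test[OF f(1)] by blast
  qed
  then show ?thesis
    using bicommutant_conjugate[OF U(1)] A bicommutant_mono unfolding time_zero_algebra_def by blast
qed

text \<open>Einstein causality for a translation to the far right.\<close>

lemma time_zero_locality:
  assumes A: "A \<in> time_zero_algebra C" and B: "B \<in> time_zero_algebra D" and x: "C + D + \<bar>fst x\<bar> < snd x"
  shows "A * (U x * B * star (U x)) = (U x * B * star (U x)) * A"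
proof (rule bicommutants_commute)
  show "A \<in> bicommutant {V f | f. f \<in> test_functions \<and> supp f \<subseteq> {-C..C}}"
    using A by (simp add: time_zero_algebra_def)
  show "U x * B * star (U x) \<in> bicommutant ((\<lambda>B. U x * B * star (U x)) ` {V f | f. f \<in> test_functions \<and> supp f \<subseteq> {-D..D}})"
    using B by (intro bicommutant_conjugate U(1)) (simp add: time_zero_algebra_def)
  fix a b assume "a \<in> {V f | f. f \<in> test_functions \<and> supp f \<subseteq> {-C..C}}"
    and "b \<in> (\<lambda>B. U x * B * star (U x)) ` {V f | f. f \<in> test_functions \<and> supp f \<subseteq> {-D..D}}"
  then obtain f g where f: "f \<in> test_functions" "supp f \<subseteq> {-C..C}" "a = V f"
    and g: "g \<in> test_functions" "supp g \<subseteq> {-D..D}" "b = U x * V g * star (U x)"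
    by blast
  note g(3)[unfolded U_V[OF g(1)]]
  note g = g(1,2) this
  let ?k = "\<tau> id x g"
  have k: "?k \<in> test_functions" by (rule \<tau>_id_test[OF g(1)])
  have ks: "supp ?k \<subseteq> {- D + snd x - \<bar>fst x\<bar>..D + snd x + \<bar>fst x\<bar>}" by (rule supp_\<tau>_id[OF g(1,2)])
  have disj: "f y = 0 \<or> ?k y = 0" for y
  proof (rule ccontr)
    assume "\<not> (f y = 0 \<or> ?k y = 0)"
    then have "y \<in> supp f" "y \<in> supp ?k" using eq_0_outside_supp by blast+
    then have "y \<le> C" "- D + snd x - \<bar>fst x\<bar> \<le> y" using f(2) ks by auto
    then show False using x by linarith
  qed
  have "symplectic f ?k = 0" "symplectic ?k f = 0" using disj by (auto intro!: symplectic_disjoint)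
  then show "a * b = b * a"
    unfolding f(3) g(3) V_mult[OF f(1) k] V_mult[OF k f(1)] by (simp add: add.commute)
qed

section \<open>Scaling functions\<close>

text \<open>Local elements of the scaling algebra, described through the time-zero algebras: at scale \<open>l\<close> they are
  localised in \<open>[-l C, l C]\<close>, and the action of translations by \<open>l x\<close> is norm continuous uniformly in \<open>l\<close>.\<close>

definition scaling_function :: "real \<Rightarrow> (real \<Rightarrow> 'h bdd_op) \<Rightarrow> bool"
  where "scaling_function C A \<longleftrightarrow> bounded (range A) \<and> A = on_scales A \<and>
    (\<forall>l>0. A l \<in> time_zero_algebra (l * C)) \<and>
    (\<forall>\<epsilon>>0. \<exists>\<delta>>0. \<forall>x l. norm x < \<delta> \<longrightarrow> l > 0 \<longrightarrow> norm (U (l *\<^sub>R x) * A l * star (U (l *\<^sub>R x)) - A l) < \<epsilon>)"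

lemma norm_conjugate_U: "norm (U x * A * star (U x)) \<le> norm A"
proof -
  have "norm (U x * A * star (U x)) \<le> norm (U x * A) * norm (star (U x))" by (rule norm_mult_ineq)
  also have "\<dots> \<le> (norm (U x) * norm A) * norm (star (U x))"
    by (intro mult_right_mono norm_mult_ineq) simp
  finally show ?thesis by (simp add: norm_unitary_op[OF U(1)] norm_star)
qed

text \<open>Every local element is of this form, since a double cone is contained in one centred at the origin.\<close>

lemma scaling_functionI:
  assumes R: "R \<in> double_cones" and B: "B \<in> scaling_local_algebra R"
  obtains C where "C > 0" "scaling_function C B"
proof -
  obtain C where C: "C > 0" "R \<subseteq> double_cone_over (- C) C" using double_cone_bound[OF R] by blast
  have bd: "bounded (range B)" and on: "B = on_scales B"
    and loc: "\<And>l. l > 0 \<Longrightarrow> B l \<in> local_algebra (scale_region l R)"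
    and lim: "((\<lambda>x. SUP l\<in>{0<..}. norm (\<alpha> id (l *\<^sub>R x) (B l) - B l)) \<longlongrightarrow> 0) (at 0)"
    using B by (auto simp: scaling_local_algebra_def bounded_local_families_def)
  have tz: "B l \<in> time_zero_algebra (l * C)" if "l > 0" for l
  proof -
    have "scale_region l R \<subseteq> scale_region l (double_cone_over (- C) C)"
      unfolding scale_region_def using C(2) by blast
    then have "scale_region l R \<subseteq> double_cone_over (- (l * C)) (l * C)" by (simp add: scale_double_cone[OF that])
    then show ?thesis using local_algebra_le loc[OF that] by blast
  qed
  obtain M where M: "\<And>l. norm (B l) \<le> M" using bd by (auto simp: bounded_iff)
  have "\<exists>\<delta>>0. \<forall>x l. norm x < \<delta> \<longrightarrow> l > 0 \<longrightarrow> norm (U (l *\<^sub>R x) * B l * star (U (l *\<^sub>R x)) - B l) < \<epsilon>" if \<epsilon>: "\<epsilon> > 0" for \<epsilon>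
  proof -
    obtain \<delta> where \<delta>: "\<delta> > 0" "\<And>x. x \<noteq> 0 \<Longrightarrow> norm x < \<delta> \<Longrightarrow> \<bar>SUP l\<in>{0<..}. norm (\<alpha> id (l *\<^sub>R x) (B l) - B l)\<bar> < \<epsilon>"
      using LIM_D[OF lim \<epsilon>] by auto
    have "norm (U (l *\<^sub>R x) * B l * star (U (l *\<^sub>R x)) - B l) < \<epsilon>" if x: "norm x < \<delta>" and l: "l > 0" for x l
    proof (cases "x = 0")
      case True then show ?thesis using \<epsilon> by (simp add: U_zero star_one)
    next
      case False
      have "bdd_above ((\<lambda>l. norm (\<alpha> id (l *\<^sub>R x) (B l) - B l)) ` {0<..})"
      proof (rule bdd_aboveI2)
        fix k :: real assume "k \<in> {0<..}"
        then have "\<alpha> id (k *\<^sub>R x) (B k) = U (k *\<^sub>R x) * B k * star (U (k *\<^sub>R x))" using \<alpha>_time_zero[OF tz] by simp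
        then show "norm (\<alpha> id (k *\<^sub>R x) (B k) - B k) \<le> M + M"
          using norm_triangle_ineq4[of "U (k *\<^sub>R x) * B k * star (U (k *\<^sub>R x))" "B k"] norm_conjugate_U[of "k *\<^sub>R x" "B k"] M[of k]
          by simp
      qed
      from cSUP_upper[OF _ this, of l] l
      have "norm (\<alpha> id (l *\<^sub>R x) (B l) - B l) \<le> (SUP l\<in>{0<..}. norm (\<alpha> id (l *\<^sub>R x) (B l) - B l))" by simp
      also have "\<dots> < \<epsilon>" using \<delta>(2)[OF False x] by simp
      finally show ?thesis using \<alpha>_time_zero[OF tz[OF l]] by simp
    qed
    then show ?thesis using \<delta>(1) by blast
  qed
  then show ?thesis using that[OF C(1)] bd on tz unfolding scaling_function_def by blast
qed

lemma bounded_local_familyI: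
  assumes C: "0 \<le> C" "C < D" and A: "bounded (range A)" "A = on_scales A" "\<And>l. l > 0 \<Longrightarrow> A l \<in> time_zero_algebra (l * C)"
  shows "A \<in> bounded_local_families (double_cone_over (- D) D)"
  unfolding bounded_local_families_def
proof (intro CollectI conjI allI impI A)
  fix l :: real assume l: "l > 0"
  have "l * C < l * D" "0 < l * D" using C l by auto
  then have "time_zero_algebra (l * C) \<subseteq> local_algebra (double_cone_over (- (l * D)) (l * D))" by (rule time_zero_le_local)
  then show "A l \<in> local_algebra (scale_region l (double_cone_over (- D) D))"
    using A(3)[OF l] by (auto simp: scale_double_cone[OF l])
qed

lemma scaling_functionD:
  assumes "scaling_function C A" and C: "0 \<le> C" "C < D"
  shows "A \<in> scaling_local_algebra (double_cone_over (- D) D)"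
  unfolding scaling_local_algebra_def
proof (intro CollectI conjI)
  have A: "bounded (range A)" "A = on_scales A" "\<And>l. l > 0 \<Longrightarrow> A l \<in> time_zero_algebra (l * C)"
    and cont: "\<And>\<epsilon>. \<epsilon> > 0 \<Longrightarrow> \<exists>\<delta>>0. \<forall>x l. norm x < \<delta> \<longrightarrow> l > 0 \<longrightarrow> norm (U (l *\<^sub>R x) * A l * star (U (l *\<^sub>R x)) - A l) < \<epsilon>"
    using assms(1) by (auto simp: scaling_function_def)
  show "A \<in> bounded_local_families (double_cone_over (- D) D)" by (rule bounded_local_familyI[OF C A])
  show "((\<lambda>x. SUP l\<in>{0<..}. norm (\<alpha> id (l *\<^sub>R x) (A l) - A l)) \<longlongrightarrow> 0) (at 0)"
  proof (rule LIM_I)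
    fix r :: real assume r: "r > 0"
    obtain \<delta> where \<delta>: "\<delta> > 0" "\<And>x l. norm x < \<delta> \<Longrightarrow> l > 0 \<Longrightarrow> norm (U (l *\<^sub>R x) * A l * star (U (l *\<^sub>R x)) - A l) < r / 2"
      using cont[of "r / 2"] r by auto
    have "norm ((SUP l\<in>{0<..}. norm (\<alpha> id (l *\<^sub>R x) (A l) - A l)) - 0) < r" if x: "norm x < \<delta>" for x
    proof -
      let ?h = "\<lambda>l. norm (\<alpha> id (l *\<^sub>R x) (A l) - A l)"
      have le: "?h l \<le> r / 2" if "l \<in> {0<..}" for l
        using \<delta>(2)[OF x, of l] that \<alpha>_time_zero[OF A(3), of l] by (simp add: less_imp_le)
      have "(SUP l\<in>{0<..}. ?h l) \<le> r / 2" by (rule cSUP_least) (use le in auto)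
      moreover have "0 \<le> (SUP l\<in>{0<..}. ?h l)"
      proof -
        have "?h 1 \<le> (SUP l\<in>{0<..}. ?h l)" by (rule cSUP_upper) (use le in \<open>auto intro!: bdd_aboveI2[where M = "r / 2"]\<close>)
        then show ?thesis using norm_ge_zero order_trans by blast
      qed
      ultimately show ?thesis using r by simp
    qed
    then show "\<exists>s>0. \<forall>x. x \<noteq> 0 \<and> norm (x - 0) < s \<longrightarrow> norm ((SUP l\<in>{0<..}. norm (\<alpha> id (l *\<^sub>R x) (A l) - A l)) - 0) < r"
      using \<delta>(1) by (intro exI[of _ \<delta>]) auto
  qed
qed

lemma scaling_function_mono: 
  assumes "scaling_function C A" "C \<le> D" shows "scaling_function D A"
proof -
  have "A l \<in> time_zero_algebra (l * D)" if "l > 0" "A l \<in> time_zero_algebra (l * C)" for l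
    using time_zero_mono[of "l * C" "l * D"] that assms(2) by auto
  then show ?thesis using assms(1) unfolding scaling_function_def by blast
qed

lemma scaling_function_algebra: 
  assumes "scaling_function C A" "0 \<le> C" shows "A \<in> scaling_algebra"
proof -
  have "A \<in> scaling_local_algebra (double_cone_over (- (C + 1)) (C + 1))"
    by (rule scaling_functionD[OF assms]) simp
  moreover have "double_cone_over (- (C + 1)) (C + 1) \<in> double_cones" using assms(2) by (intro double_cone_over_mem) simp
  ultimately have "A \<in> (\<Union>R\<in>double_cones. scaling_local_algebra R)" by blast
  then show ?thesis unfolding scaling_algebra_def uniform_closure_of_def
    by (intro CollectI allI impI bexI[of _ A]) auto
qed

lemma scaling_function_star: 
  assumes "scaling_function C A" shows "scaling_function C (star A)"
proof -
  have A: "bounded (range A)" "A = on_scales A" "\<And>l. l > 0 \<Longrightarrow> A l \<in> time_zero_algebra (l * C)"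
    and cont: "\<And>\<epsilon>. \<epsilon> > 0 \<Longrightarrow> \<exists>\<delta>>0. \<forall>x l. norm x < \<delta> \<longrightarrow> l > 0 \<longrightarrow> norm (U (l *\<^sub>R x) * A l * star (U (l *\<^sub>R x)) - A l) < \<epsilon>"
    using assms by (auto simp: scaling_function_def)
  have "bounded (range (star A))" using A(1) by (auto simp: bounded_iff star_fun_def norm_star)
  moreover have "star A = on_scales (star A)"
  proof
    fix l have "A l = on_scales A l" using A(2) by (rule fun_cong)
    then show "star A l = on_scales (star A) l" by (auto simp: star_fun_def on_scales_def star_zero)
  qed
  moreover have "U x * star B * star (U x) - star B = star (U x * B * star (U x) - B)" for x B
    by (simp add: star_diff star_mult star_star mult.assoc)
  ultimately show ?thesis
    unfolding scaling_function_def using time_zero_star[OF A(3)] cont by (simp add: star_fun_def norm_star)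
qed

lemma scaling_function_mult: 
  assumes "scaling_function C A" "scaling_function C B" shows "scaling_function C (A * B)"
proof -
  have A: "bounded (range A)" "A = on_scales A" "\<And>l. l > 0 \<Longrightarrow> A l \<in> time_zero_algebra (l * C)"
    and contA: "\<And>\<epsilon>. \<epsilon> > 0 \<Longrightarrow> \<exists>\<delta>>0. \<forall>x l. norm x < \<delta> \<longrightarrow> l > 0 \<longrightarrow> norm (U (l *\<^sub>R x) * A l * star (U (l *\<^sub>R x)) - A l) < \<epsilon>"
    using assms(1) by (auto simp: scaling_function_def)
  have B: "bounded (range B)" "B = on_scales B" "\<And>l. l > 0 \<Longrightarrow> B l \<in> time_zero_algebra (l * C)"
    and contB: "\<And>\<epsilon>. \<epsilon> > 0 \<Longrightarrow> \<exists>\<delta>>0. \<forall>x l. norm x < \<delta> \<longrightarrow> l > 0 \<longrightarrow> norm (U (l *\<^sub>R x) * B l * star (U (l *\<^sub>R x)) - B l) < \<epsilon>"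
    using assms(2) by (auto simp: scaling_function_def)
  obtain M where M: "M > 0" "\<And>l. norm (A l) \<le> M" using A(1) by (auto simp: bounded_pos)
  obtain N where N: "N > 0" "\<And>l. norm (B l) \<le> N" using B(1) by (auto simp: bounded_pos)
  have "norm (A l * B l) \<le> M * N" for l
    by (rule order_trans[OF norm_mult_ineq mult_mono]) (use M N in \<open>auto simp: less_imp_le\<close>)
  then have "bounded (range (A * B))" by (auto simp: bounded_iff times_fun_def)
  moreover have "A * B = on_scales (A * B)"
  proof
    fix l have "A l = on_scales A l" using A(2) by (rule fun_cong)
    then show "(A * B) l = on_scales (A * B) l" by (auto simp: times_fun_def on_scales_def)
  qed
  moreover have "(A * B) l \<in> time_zero_algebra (l * C)" if "l > 0" for l
    using time_zero_mult[OF A(3)[OF that] B(3)[OF that]] by (simp add: times_fun_def)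
  moreover have "\<exists>\<delta>>0. \<forall>x l. norm x < \<delta> \<longrightarrow> l > 0 \<longrightarrow> norm (U (l *\<^sub>R x) * (A * B) l * star (U (l *\<^sub>R x)) - (A * B) l) < \<epsilon>"
    if \<epsilon>: "\<epsilon> > 0" for \<epsilon>
  proof -
    obtain \<delta> where \<delta>: "\<delta> > 0" "\<And>x l. norm x < \<delta> \<Longrightarrow> l > 0 \<Longrightarrow> norm (U (l *\<^sub>R x) * A l * star (U (l *\<^sub>R x)) - A l) < \<epsilon> / (2 * N)"
      using contA[of "\<epsilon> / (2 * N)"] \<epsilon> N(1) by auto
    obtain \<delta>' where \<delta>': "\<delta>' > 0" "\<And>x l. norm x < \<delta>' \<Longrightarrow> l > 0 \<Longrightarrow> norm (U (l *\<^sub>R x) * B l * star (U (l *\<^sub>R x)) - B l) < \<epsilon> / (2 * M)"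
      using contB[of "\<epsilon> / (2 * M)"] \<epsilon> M(1) by auto
    have "norm (U (l *\<^sub>R x) * (A * B) l * star (U (l *\<^sub>R x)) - (A * B) l) < \<epsilon>"
      if x: "norm x < min \<delta> \<delta>'" and l: "l > 0" for x l
    proof -
      let ?c = "\<lambda>X. U (l *\<^sub>R x) * X * star (U (l *\<^sub>R x))"
      have u: "star (U (l *\<^sub>R x)) * (U (l *\<^sub>R x) * Y) = Y" for Y
        using U(1)[of "l *\<^sub>R x"] by (simp add: unitary_def flip: mult.assoc)
      have "?c (A l * B l) = ?c (A l) * ?c (B l)" by (simp add: mult.assoc u)
      then have "?c (A l * B l) - A l * B l = (?c (A l) - A l) * ?c (B l) + A l * (?c (B l) - B l)"
        by (simp add: algebra_simps)
      then have "norm (?c (A l * B l) - A l * B l) \<le> norm (?c (A l) - A l) * norm (?c (B l)) + norm (A l) * norm (?c (B l) - B l)"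
        by (simp add: norm_triangle_le[OF add_mono[OF norm_mult_ineq norm_mult_ineq]])
      also have "\<dots> \<le> norm (?c (A l) - A l) * N + M * norm (?c (B l) - B l)"
        by (intro add_mono mult_mono order_trans[OF norm_conjugate_U N(2)] M) (use M(1) in auto)
      also have "\<dots> < \<epsilon> / (2 * N) * N + M * (\<epsilon> / (2 * M))"
        using \<delta>(2)[of x l] \<delta>'(2)[of x l] x l M(1) N(1) by (intro add_strict_mono mult_strict_right_mono mult_strict_left_mono) auto
      also have "\<dots> = \<epsilon>" using M(1) N(1) by simp
      finally show ?thesis by (simp add: times_fun_def)
    qed
    then show ?thesis using \<delta>(1) \<delta>'(1) by (intro exI[of _ "min \<delta> \<delta>'"]) auto
  qed
  ultimately show ?thesis unfolding scaling_function_def by blast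
qed

end

section \<open>Smearing over translations\<close>

lemma has_integral_shift_UNIV:
  fixes f :: "'a::euclidean_space \<Rightarrow> 'b::banach"
  assumes f: "(f has_integral I) UNIV" and S: "bounded S" "\<And>x. x \<notin> S \<Longrightarrow> f x = 0"
  shows "((\<lambda>x. f (x + c)) has_integral I) UNIV"
proof -
  obtain b where b: "S \<subseteq> cbox (- b) b" using bounded_subset_cbox_symmetric[OF S(1)] by blast
  then have z: "f x = 0" if "x \<notin> cbox (- b) b" for x using S(2) that by blast
  then have "(\<lambda>x. if x \<in> cbox (- b) b then f x else 0) = f" by auto
  then have "(f has_integral I) (cbox (- b) b)"
    using f has_integral_restrict_UNIV[of "cbox (- b) b" f I] by simp
  from has_integral_affinity[OF this, of 1 c]
  have "((\<lambda>x. f (x + c)) has_integral I) ((\<lambda>x. x - c) ` cbox (- b) b)" by simp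
  then show ?thesis
  proof (rule has_integral_on_superset)
    fix x assume "x \<notin> (\<lambda>x. x - c) ` cbox (- b) b"
    then have "x + c \<notin> cbox (- b) b" by (metis add_diff_cancel image_eqI)
    then show "f (x + c) = 0" by (rule z)
  qed simp
qed

lemma mollifierD:
  assumes "h \<in> mollifiers r"
  shows "continuous_on UNIV h" "h x \<ge> 0" "(h has_integral 1) UNIV" "compact (supp h)" "h x \<noteq> 0 \<Longrightarrow> norm x < r"
    "(LINT y|lborel. \<bar>h y\<bar>) = 1"
proof -
  show 1: "continuous_on UNIV h" "h x \<ge> 0" "(h has_integral 1) UNIV" for x
    using assms unfolding mollifiers_def by blast+
  have s: "supp h \<subseteq> ball 0 r" using assms by (simp add: mollifiers_def)
  show c: "compact (supp h)"
    using bounded_subset[OF bounded_ball s] closed_supp by (simp add: compact_eq_bounded_closed supp_def)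
  show "norm x < r" if "h x \<noteq> 0"
  proof -
    have "x \<in> supp h" using eq_0_outside_supp[of x h] that by blast
    then show ?thesis using s by auto
  qed
  have "integrable lborel h"
    by (rule integrable_compact_support[OF 1(1) c]) (rule eq_0_outside_supp)
  then have "(LINT y|lborel. h y) = 1"
    using has_integral_unique[OF has_integral_integral_lborel 1(3)] by blast
  then show "(LINT y|lborel. \<bar>h y\<bar>) = 1" using 1(2) by simp
qed

text \<open>Translations are continuous in the mean.\<close>

lemma translation_L1_continuous:
  fixes h :: "spacetime \<Rightarrow> real"
  assumes h: "continuous_on UNIV h" and r: "\<And>x. h x \<noteq> 0 \<Longrightarrow> norm x < r" and \<epsilon>: "\<epsilon> > 0"
  obtains \<delta> where "\<delta> > 0" "\<And>y. norm y < \<delta> \<Longrightarrow> (LINT x|lborel. \<bar>h (x - y) - h x\<bar>) < \<epsilon>"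
proof -
  let ?K = "cball (0 :: spacetime) (r + 2)" and ?L = "cball (0 :: spacetime) (r + 1)"
  define v where "v = measure lborel ?L"
  have v: "v \<ge> 0" by (simp add: v_def)
  define \<eta> where "\<eta> = \<epsilon> / (v + 1)"
  have \<eta>: "\<eta> > 0" using \<epsilon> v by (simp add: \<eta>_def)
  have "uniformly_continuous_on ?K h"
    by (rule compact_uniformly_continuous) (auto intro: continuous_on_subset[OF h])
  then obtain d where d: "d > 0" "\<And>x x'. x \<in> ?K \<Longrightarrow> x' \<in> ?K \<Longrightarrow> dist x' x < d \<Longrightarrow> dist (h x') (h x) < \<eta>"
    using \<eta> unfolding uniformly_continuous_on_def by meson
  have "(LINT x|lborel. \<bar>h (x - y) - h x\<bar>) < \<epsilon>" if y: "norm y < min d 1" for y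
  proof -
    have le: "\<bar>h (x - y) - h x\<bar> \<le> indicator ?L x *\<^sub>R \<eta>" for x
    proof (cases "norm x \<le> r + 1")
      case True
      have "norm (x - y) \<le> r + 2" using norm_triangle_ineq4[of x y] True y by simp
      then have "dist (h (x - y)) (h x) < \<eta>" using d(2)[of x "x - y"] True y by (simp add: dist_norm norm_minus_commute)
      then show ?thesis using True by (simp add: dist_real_def)
    next
      case False
      have "h x = 0" using r[of x] False by force
      moreover have "h (x - y) = 0"
      proof (rule ccontr)
        assume "h (x - y) \<noteq> 0"
        from r[OF this] have "norm (x - y) < r" .
        then have "norm x < r + 1" using norm_triangle_ineq[of "x - y" y] y by simp
        then show False using False by simp
      qed
      ultimately show ?thesis using \<eta> by simp
    qed
    have int: "integrable lborel (\<lambda>x. \<bar>h (x - y) - h x\<bar>)"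
    proof (rule integrable_compact_support[of _ ?L])
      show "continuous_on UNIV (\<lambda>x. \<bar>h (x - y) - h x\<bar>)"
        by (intro continuous_intros continuous_on_compose2[OF h] h) auto
      show "x \<notin> ?L \<Longrightarrow> \<bar>h (x - y) - h x\<bar> = 0" for x using le[of x] by (simp add: indicator_def)
    qed simp
    have "(LINT x|lborel. \<bar>h (x - y) - h x\<bar>) \<le> (LINT x|lborel. indicator ?L x *\<^sub>R \<eta>)"
    proof (rule integral_mono[OF int _ le])
      show "integrable lborel (\<lambda>x. indicator ?L x *\<^sub>R \<eta>)"
        by (rule borel_integrable_compact) (auto intro: continuous_intros)
    qed
    also have "\<dots> = v * \<eta>" by (simp add: v_def)
    also have "\<dots> < (v + 1) * \<eta>" using \<eta> by simp
    also have "\<dots> = \<epsilon>" using v by (simp add: \<eta>_def)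
    finally show ?thesis .
  qed
  then show ?thesis using that[of "min d 1"] d(1) by simp
qed

context massive_net
begin

lemma orbit_continuous: "continuous_on UNIV (\<lambda>x. (U (l *\<^sub>R x) * A * star (U (l *\<^sub>R x))) \<cdot> v)"
proof -
  have Uc: "continuous_on UNIV (\<lambda>x. U (l *\<^sub>R x) \<cdot> w)" for w
    by (rule continuous_on_compose2[OF U_continuous]) (auto intro: continuous_intros)
  have "continuous_on UNIV (\<lambda>x. A \<cdot> (star (U (l *\<^sub>R x)) \<cdot> v))"
    by (rule bounded_linear.continuous_on[OF bounded_linear_op_app continuous_on_star_unitary[OF U(1) Uc]])
  then have "continuous_on UNIV (\<lambda>x. U (l *\<^sub>R x) \<cdot> (A \<cdot> (star (U (l *\<^sub>R x)) \<cdot> v)))"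
    by (rule continuous_on_app_bounded[OF _ Uc, where B = 1, rotated]) (simp add: norm_unitary_op[OF U(1)])
  then show ?thesis by (simp add: op_app_times)
qed

text \<open>Smearing enlarges the localisation region by the size of the mollifier, and it makes translations norm
  continuous because they then only shift the mollifier.\<close>

lemma smear_scaling_function:
  assumes A: "bounded (range A)" "A = on_scales A" "\<And>l. l > 0 \<Longrightarrow> A l \<in> time_zero_algebra (l * C)"
    and h: "h \<in> mollifiers r"
  shows "scaling_function (C + 2 * r) (smear h A)" "l > 0 \<Longrightarrow> norm (smear h A l \<cdot> \<Omega>) \<le> norm (A l \<cdot> \<Omega>)"
proof -
  note hD = mollifierD[OF h]
  obtain M where M: "M > 0" "\<And>l. norm (A l) \<le> M" using A(1) by (auto simp: bounded_pos)
  let ?c = "\<lambda>l x. U (l *\<^sub>R x) * A l * star (U (l *\<^sub>R x))"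
  have nc: "norm (?c l x) \<le> M" for l x using norm_conjugate_U M(2) order_trans by blast
  have eq: "smear h A l = strong_integral (\<lambda>x. h x *\<^sub>R ?c l x)" if "l > 0" for l
    using that \<alpha>_time_zero[OF A(3)[OF that]] by (simp add: smear_def on_scales_def)
  have int: "((\<lambda>x. h x *\<^sub>R (?c l x \<cdot> v)) has_integral smear h A l \<cdot> v) UNIV" if "l > 0" for l v
    unfolding eq[OF that] by (rule strong_integral(1)[OF hD(1,4) orbit_continuous nc])
  have bound: "norm (smear h A l) \<le> M" for l
  proof (cases "l > 0")
    case True
    show ?thesis unfolding eq[OF True]
      using strong_integral(2)[OF hD(1,4) orbit_continuous nc, of l] by (simp add: hD(6))
  qed (use M in \<open>simp add: smear_def on_scales_def\<close>)
  have mem: "smear h A l \<in> time_zero_algebra (l * (C + 2 * r))" if l: "l > 0" for l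
    unfolding time_zero_algebra_def
  proof (rule bicommutant_weakI[where g = h and A = "?c l" and S = UNIV])
    show "((\<lambda>x. h x *\<^sub>R cinner u (?c l x \<cdot> v)) has_integral cinner u (smear h A l \<cdot> v)) UNIV" for u v
      by (rule has_integral_cinner[OF int[OF l]])
    show "?c l x \<in> bicommutant {V f | f. f \<in> test_functions \<and> supp f \<subseteq> {- (l * (C + 2 * r))..l * (C + 2 * r)}}"
      if "h x \<noteq> 0" for x
      unfolding time_zero_algebra_def[symmetric]
    proof (rule time_zero_translate[OF A(3)[OF l]])
      have "norm x < r" by (rule hD(5)[OF that])
      then have "\<bar>fst x\<bar> \<le> r" "\<bar>snd x\<bar> \<le> r" using norm_spacetime_ge[of x] by linarith+
      then have "l * (\<bar>fst x\<bar> + \<bar>snd x\<bar>) \<le> l * (2 * r)" using l by (intro mult_left_mono) auto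
      then show "l * C + \<bar>fst (l *\<^sub>R x)\<bar> + \<bar>snd (l *\<^sub>R x)\<bar> \<le> l * (C + 2 * r)"
        using l by (simp add: abs_mult algebra_simps)
    qed
  qed
  have cont: "\<exists>\<delta>>0. \<forall>y l. norm y < \<delta> \<longrightarrow> l > 0 \<longrightarrow> norm (U (l *\<^sub>R y) * smear h A l * star (U (l *\<^sub>R y)) - smear h A l) < \<epsilon>"
    if \<epsilon>: "\<epsilon> > 0" for \<epsilon>
  proof -
    obtain \<delta> where \<delta>: "\<delta> > 0" "\<And>y. norm y < \<delta> \<Longrightarrow> (LINT x|lborel. \<bar>h (x - y) - h x\<bar>) < \<epsilon> / M"
      using translation_L1_continuous[OF hD(1) hD(5), of "\<epsilon> / M"] \<epsilon> M(1) by auto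
    have "norm (U (l *\<^sub>R y) * smear h A l * star (U (l *\<^sub>R y)) - smear h A l) < \<epsilon>"
      if y: "norm y < \<delta>" and l: "l > 0" for y l
    proof -
      let ?g = "\<lambda>x. h (x - y) - h x"
      let ?T = "U (l *\<^sub>R y) * smear h A l * star (U (l *\<^sub>R y)) - smear h A l"
      have gc: "continuous_on UNIV ?g" by (intro continuous_intros continuous_on_compose2[OF hD(1)] hD(1)) auto
      have gz: "?g x = 0" if "norm x > r + norm y" for x
      proof -
        have "norm x \<le> norm (x - y) + norm y" using norm_triangle_ineq[of "x - y" y] by simp
        then have "\<not> norm (x - y) < r" "\<not> norm x < r" using that norm_ge_zero[of y] by linarith+
        then have "h (x - y) = 0" "h x = 0" using hD(5) by blast+
        then show ?thesis by simp
      qed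
      have "supp ?g \<subseteq> cball 0 (r + norm y)"
        by (rule supp_subsetI) (use gz in auto)
      then have gs: "compact (supp ?g)"
        using bounded_subset[OF bounded_cball] by (auto simp: compact_eq_bounded_closed supp_def)
      have shift: "((\<lambda>x. h (x - y) *\<^sub>R (?c l x \<cdot> v)) has_integral (U (l *\<^sub>R y) * smear h A l * star (U (l *\<^sub>R y))) \<cdot> v) UNIV" for v
      proof -
        have "((\<lambda>x. U (l *\<^sub>R y) \<cdot> (h x *\<^sub>R (?c l x \<cdot> (star (U (l *\<^sub>R y)) \<cdot> v)))) has_integral
            U (l *\<^sub>R y) \<cdot> (smear h A l \<cdot> (star (U (l *\<^sub>R y)) \<cdot> v))) UNIV"
          using has_integral_linear[OF int[OF l] bounded_linear_op_app] by (simp add: o_def)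
        moreover have "U (l *\<^sub>R y) \<cdot> (h x *\<^sub>R (?c l x \<cdot> (star (U (l *\<^sub>R y)) \<cdot> v))) = h x *\<^sub>R (?c l (x + y) \<cdot> v)" for x
        proof -
          have "U (l *\<^sub>R y) * U (l *\<^sub>R x) = U (l *\<^sub>R (x + y))" by (simp add: U_add scaleR_add_right add.commute)
          moreover from this have "star (U (l *\<^sub>R x)) * star (U (l *\<^sub>R y)) = star (U (l *\<^sub>R (x + y)))"
            by (simp flip: star_mult)
          ultimately show ?thesis by (simp add: op_app_simps flip: op_app_times) (simp add: mult.assoc flip: mult.assoc[of "U (l *\<^sub>R y)" "U (l *\<^sub>R x)"])
        qed
        ultimately have s: "((\<lambda>x. h x *\<^sub>R (?c l (x + y) \<cdot> v)) has_integral
            (U (l *\<^sub>R y) * smear h A l * star (U (l *\<^sub>R y))) \<cdot> v) UNIV" by (simp add: op_app_times)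
        have "((\<lambda>x. h (x + - y) *\<^sub>R (?c l (x + - y + y) \<cdot> v)) has_integral
            (U (l *\<^sub>R y) * smear h A l * star (U (l *\<^sub>R y))) \<cdot> v) UNIV"
          by (rule has_integral_shift_UNIV[OF s, of "ball 0 r"]) (use hD(5) in auto)
        then show ?thesis by simp
      qed
      have "((\<lambda>x. (?g x *\<^sub>R ?c l x) \<cdot> v) has_integral ?T \<cdot> v) UNIV" for v
        using has_integral_diff[OF shift[of v] int[OF l, of v]]
        by (simp add: op_app_simps scaleR_diff_left)
      then have T: "strong_integral (\<lambda>x. ?g x *\<^sub>R ?c l x) = ?T" by (rule strong_integral_eqI)
      have "norm ?T \<le> M * (LINT x|lborel. \<bar>?g x\<bar>)"
        using strong_integral(2)[OF gc gs orbit_continuous nc, of l] unfolding T .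
      also have "\<dots> < M * (\<epsilon> / M)" using \<delta>(2)[OF y] M(1) by (rule mult_strict_left_mono)
      finally show ?thesis using M(1) by simp
    qed
    then show ?thesis using \<delta>(1) by blast
  qed
  show "scaling_function (C + 2 * r) (smear h A)"
    unfolding scaling_function_def
  proof (intro conjI allI impI mem cont)
    show "bounded (range (smear h A))" using bound by (auto simp: bounded_iff)
    show "smear h A = on_scales (smear h A)" by (auto simp: smear_def on_scales_def)
  qed auto
  show "norm (smear h A l \<cdot> \<Omega>) \<le> norm (A l \<cdot> \<Omega>)" if l: "l > 0"
  proof -
    have hi: "((\<lambda>x. h x * norm (A l \<cdot> \<Omega>)) has_integral 1 * norm (A l \<cdot> \<Omega>)) UNIV"
      by (rule has_integral_mult_left[OF hD(3)])
    have "norm (integral UNIV (\<lambda>x. h x *\<^sub>R (?c l x \<cdot> \<Omega>))) \<le> integral UNIV (\<lambda>x. h x * norm (A l \<cdot> \<Omega>))"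
    proof (rule integral_norm_bound_integral)
      show "(\<lambda>x. h x *\<^sub>R (?c l x \<cdot> \<Omega>)) integrable_on UNIV" using int[OF l] by blast
      show "(\<lambda>x. h x * norm (A l \<cdot> \<Omega>)) integrable_on UNIV" using hi by blast
      show "norm (h x *\<^sub>R (?c l x \<cdot> \<Omega>)) \<le> h x * norm (A l \<cdot> \<Omega>)" for x
        using hD(2)[of x] by (simp add: op_app_times star_U U_vac norm_unitary_app[OF U(1)])
    qed
    then show ?thesis unfolding integral_unique[OF int[OF l]] integral_unique[OF hi] by simp
  qed
qed

section \<open>A Reeh-Schlieder argument uniform in the scale\<close>

text \<open>An element of the scaling algebra that asymptotically annihilates the vacuum asymptotically annihilates
  all vectors obtained from the vacuum by other such elements.\<close>

theorem annihilates_vacuum_limit: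
  assumes A: "scaling_function C A" and B: "scaling_function D B" and CD: "C \<ge> 0" "D \<ge> 0"
    and lim: "((\<lambda>l. norm (A l \<cdot> \<Omega>)) \<longlongrightarrow> 0) (at_right 0)"
  shows "((\<lambda>l. norm (A l \<cdot> (B l \<cdot> \<Omega>))) \<longlongrightarrow> 0) (at_right 0)"
  unfolding tendsto_at_iff_sequentially
proof (intro allI impI)
  fix l :: "nat \<Rightarrow> real" assume l: "\<forall>n. l n \<in> {0<..} - {0}" "l \<longlonglongrightarrow> 0"
  then have l0: "l n > 0" for n by auto
  have limn: "(\<lambda>n. norm (A (l n) \<cdot> \<Omega>)) \<longlonglongrightarrow> 0"
    using lim[unfolded tendsto_at_iff_sequentially] l by (auto simp: o_def)
  obtain M where M: "M > 0" "\<And>l. norm (A l) \<le> M" using A by (auto simp: scaling_function_def bounded_pos)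
  obtain N where N: "N > 0" "\<And>l. norm (B l) \<le> N" using B by (auto simp: scaling_function_def bounded_pos)
  have Am: "A l \<in> time_zero_algebra (l * C)" and Bm: "B l \<in> time_zero_algebra (l * D)" if "l > 0" for l
    using A B that by (auto simp: scaling_function_def)
  have Bcont: "\<exists>\<delta>>0. \<forall>x l. norm x < \<delta> \<longrightarrow> l > 0 \<longrightarrow> norm (U (l *\<^sub>R x) * B l * star (U (l *\<^sub>R x)) - B l) < \<epsilon>"
    if "\<epsilon> > 0" for \<epsilon> using B that by (auto simp: scaling_function_def)
  define w where "w n = A (l n) \<cdot> (B (l n) \<cdot> \<Omega>)" for n
  have BN: "norm (B l \<cdot> \<Omega>) \<le> N" for l using norm_op_app[of "B l" \<Omega>] N(2)[of l] by (simp add: norm_\<Omega>)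
  have wb: "norm (w n) \<le> M * N" for n
    unfolding w_def by (rule order_trans[OF norm_op_app mult_mono]) (use M BN in \<open>auto simp: less_imp_le\<close>)
  have sb: "norm (star (A (l n)) \<cdot> w n) \<le> M * (M * N)" for n
    by (rule order_trans[OF norm_op_app mult_mono]) (use M wb in \<open>auto simp: norm_star less_imp_le\<close>)
  define F where "F n x = cinner (star (A (l n)) \<cdot> w n) (U (l n *\<^sub>R x) \<cdot> (B (l n) \<cdot> \<Omega>))" for n x
  have far: "(\<lambda>n. F n x) \<longlonglongrightarrow> 0" if x: "C + D + \<bar>fst x\<bar> < snd x" for x
  proof (rule Lim_null_comparison)
    have "norm (F n x) \<le> (M * N) * (N * norm (A (l n) \<cdot> \<Omega>))" for n
    proof -
      let ?b = "U (l n *\<^sub>R x) * B (l n) * star (U (l n *\<^sub>R x))"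
      have "l n * (C + D + \<bar>fst x\<bar>) < l n * snd x" using l0[of n] x by simp
      then have "l n * C + l n * D + \<bar>fst (l n *\<^sub>R x)\<bar> < snd (l n *\<^sub>R x)"
        using l0[of n] by (simp add: abs_mult algebra_simps)
      from time_zero_locality[OF Am[OF l0] Bm[OF l0] this]
      have com: "A (l n) * ?b = ?b * A (l n)" .
      have "F n x = cinner (w n) (A (l n) \<cdot> (U (l n *\<^sub>R x) \<cdot> (B (l n) \<cdot> \<Omega>)))"
        by (simp add: F_def star_adjoint)
      also have "A (l n) \<cdot> (U (l n *\<^sub>R x) \<cdot> (B (l n) \<cdot> \<Omega>)) = (A (l n) * ?b) \<cdot> \<Omega>"
        by (simp add: op_app_times star_U U_vac)
      also have "\<dots> = ?b \<cdot> (A (l n) \<cdot> \<Omega>)" unfolding com by (simp add: op_app_times)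
      finally have "norm (F n x) \<le> norm (w n) * norm (?b \<cdot> (A (l n) \<cdot> \<Omega>))"
        using cinner_cauchy_schwarz by simp
      moreover have "norm (?b \<cdot> (A (l n) \<cdot> \<Omega>)) \<le> N * norm (A (l n) \<cdot> \<Omega>)"
        by (rule order_trans[OF norm_op_app mult_right_mono[OF order_trans[OF norm_conjugate_U N(2)] norm_ge_zero]])
      then have "norm (w n) * norm (?b \<cdot> (A (l n) \<cdot> \<Omega>)) \<le> (M * N) * (N * norm (A (l n) \<cdot> \<Omega>))"
        using wb[of n] M N by (intro mult_mono) auto
      ultimately show ?thesis by linarith
    qed
    then show "\<forall>\<^sub>F n in sequentially. norm (F n x) \<le> (M * N) * (N * norm (A (l n) \<cdot> \<Omega>))" by simp
    show "(\<lambda>n. (M * N) * (N * norm (A (l n) \<cdot> \<Omega>))) \<longlonglongrightarrow> 0" by (intro tendsto_mult_right_zero limn)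
  qed
  \<comment> \<open>Convergence on a segment of a causal line extends to the line.  Equicontinuity comes from the continuity of
    translations on the scaling algebra.\<close>
  have line: "(\<lambda>n. F n (a + s *\<^sub>R e)) \<longlonglongrightarrow> 0"
    if e: "\<bar>snd e\<bar> \<le> fst e" and b: "b1 < b2" "\<And>s. b1 < s \<Longrightarrow> s < b2 \<Longrightarrow> (\<lambda>n. F n (a + s *\<^sub>R e)) \<longlonglongrightarrow> 0"
    for a e b1 b2 s
  proof (rule positive_frequency_limit_vanish[where F = "\<lambda>n s. F n (a + s *\<^sub>R e)" and a = b1 and b = b2, OF _ _ _ b])
    show "cmod (F n (a + s *\<^sub>R e)) \<le> M * (M * N) * N" for n s
    proof -
      have "cmod (F n (a + s *\<^sub>R e)) \<le> norm (star (A (l n)) \<cdot> w n) * norm (B (l n) \<cdot> \<Omega>)"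
        unfolding F_def using cinner_cauchy_schwarz[of "star (A (l n)) \<cdot> w n" "U (l n *\<^sub>R (a + s *\<^sub>R e)) \<cdot> (B (l n) \<cdot> \<Omega>)"]
        by (simp add: norm_unitary_app[OF U(1)])
      also have "\<dots> \<le> M * (M * N) * N" using sb BN M N by (intro mult_mono) auto
      finally show ?thesis .
    qed
    show "positive_frequency (\<lambda>s. F n (a + s *\<^sub>R e))" for n
    proof -
      have "\<bar>snd (l n *\<^sub>R e)\<bar> \<le> fst (l n *\<^sub>R e)" using e l0[of n] by (simp add: abs_mult)
      from spectrum_condition[OF this, of "star (A (l n)) \<cdot> w n" "l n *\<^sub>R a" "B (l n) \<cdot> \<Omega>"]
      show ?thesis by (simp add: F_def scaleR_add_right mult.commute)
    qed
    fix \<epsilon> :: real assume \<epsilon>: "\<epsilon> > 0"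
    define K where "K = M * (M * N)"
    have K: "K > 0" using M N by (simp add: K_def)
    obtain \<delta> where \<delta>: "\<delta> > 0" "\<And>x l. norm x < \<delta> \<Longrightarrow> l > 0 \<Longrightarrow> norm (U (l *\<^sub>R x) * B l * star (U (l *\<^sub>R x)) - B l) < \<epsilon> / K"
      using Bcont[of "\<epsilon> / K"] \<epsilon> K by auto
    have "cmod (F n (a + s *\<^sub>R e) - F n (a + t *\<^sub>R e)) < \<epsilon>" if st: "\<bar>s - t\<bar> < \<delta> / (norm e + 1)" for n s t
    proof -
      let ?y = "(s - t) *\<^sub>R e" and ?x = "a + t *\<^sub>R e"
      have "\<bar>s - t\<bar> * (norm e + 1) < \<delta>" using st by (simp add: pos_less_divide_eq add_nonneg_pos)
      moreover have "norm ?y \<le> \<bar>s - t\<bar> * (norm e + 1)" by (simp add: mult_left_mono)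
      ultimately have y: "norm ?y < \<delta>" by linarith
      have "U (l n *\<^sub>R (a + s *\<^sub>R e)) = U (l n *\<^sub>R ?x) * U (l n *\<^sub>R ?y)"
        unfolding U_add by (simp add: algebra_simps)
      then have "F n (a + s *\<^sub>R e) - F n ?x = cinner (star (A (l n)) \<cdot> w n)
          (U (l n *\<^sub>R ?x) \<cdot> ((U (l n *\<^sub>R ?y) * B (l n) * star (U (l n *\<^sub>R ?y)) - B (l n)) \<cdot> \<Omega>))"
        by (simp add: F_def op_app_times op_app_simps star_U U_vac flip: cinner_diff)
      then have "cmod (F n (a + s *\<^sub>R e) - F n ?x) \<le> norm (star (A (l n)) \<cdot> w n)
          * norm ((U (l n *\<^sub>R ?y) * B (l n) * star (U (l n *\<^sub>R ?y)) - B (l n)) \<cdot> \<Omega>)"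
        using cinner_cauchy_schwarz norm_unitary_app[OF U(1)] by metis
      also have "\<dots> \<le> K * norm (U (l n *\<^sub>R ?y) * B (l n) * star (U (l n *\<^sub>R ?y)) - B (l n))"
        using sb[of n] K norm_op_app[of "U (l n *\<^sub>R ?y) * B (l n) * star (U (l n *\<^sub>R ?y)) - B (l n)" \<Omega>]
        unfolding K_def norm_\<Omega> by (intro mult_mono) auto
      also have "\<dots> < K * (\<epsilon> / K)" using \<delta>(2)[OF y l0] K by (rule mult_strict_left_mono)
      finally show ?thesis using K by simp
    qed
    moreover have "\<delta> / (norm e + 1) > 0" using \<delta>(1) by (simp add: add_nonneg_pos)
    ultimately show "\<exists>\<delta>>0. \<forall>n s t. \<bar>s - t\<bar> < \<delta> \<longrightarrow> cmod (F n (a + s *\<^sub>R e) - F n (a + t *\<^sub>R e)) < \<epsilon>" by blast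
  qed
  \<comment> \<open>From the space-like complement in time direction to all points \<open>(s, X)\<close> with \<open>X > C + D\<close>, and from there
    along the light-like line through the origin.\<close>
  have step1: "(\<lambda>n. F n (s, X)) \<longlonglongrightarrow> 0" if X: "X > C + D" for s X
  proof -
    have "(\<lambda>n. F n ((0, X) + s *\<^sub>R (1, 0))) \<longlonglongrightarrow> 0"
      by (rule line[of "(1, 0)" "- (X - C - D)" "X - C - D"]) (use X in \<open>auto intro!: far\<close>)
    then show ?thesis by simp
  qed
  have "(\<lambda>n. F n (0 + 0 *\<^sub>R (1, -1))) \<longlonglongrightarrow> 0"
    by (rule line[of "(1, -1)" "- (C + D) - 1" "- (C + D)"]) (auto intro!: step1)
  then have "(\<lambda>n. F n 0) \<longlonglongrightarrow> 0" unfolding scaleR_zero_left add_0_right .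
  moreover have "F n 0 = of_real ((norm (w n))\<^sup>2)" for n
  proof -
    have "F n 0 = cinner (w n) (w n)" by (simp add: F_def star_adjoint U_zero op_app_one w_def)
    then show ?thesis by (simp only: cinner_self)
  qed
  ultimately have "(\<lambda>n. complex_of_real ((norm (w n))\<^sup>2)) \<longlonglongrightarrow> of_real 0" by (simp only: of_real_0)
  then have "(\<lambda>n. (norm (w n))\<^sup>2) \<longlonglongrightarrow> 0" unfolding tendsto_of_real_iff .
  then have "(\<lambda>n. sqrt ((norm (w n))\<^sup>2)) \<longlonglongrightarrow> sqrt 0" by (rule tendsto_real_sqrt)
  then show "((\<lambda>l. norm (A l \<cdot> (B l \<cdot> \<Omega>))) \<circ> l) \<longlonglongrightarrow> 0" by (simp add: o_def w_def)
qed

end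

section \<open>Logarithmic divergence of the vacuum norm\<close>

lemma dilate_parts:
  "re_part (dilate l f) = (\<lambda>x. re_part f (x / l) / of_real l)" "im_part (dilate l f) = (\<lambda>x. im_part f (x / l))"
  by (auto simp: re_part_def im_part_def dilate_def)

lemma laplace_dilate:
  assumes "l > 0"
  shows "laplace (\<lambda>x. f (x / l)) (of_real p) = of_real l * laplace f (of_real (l * p))"
proof -
  have "laplace (\<lambda>x. f (x / l)) (of_real p)
    = \<bar>l\<bar> *\<^sub>R (LINT x|lborel. exp (- (\<i> * of_real p * of_real (0 + l * x))) * f ((0 + l * x) / l))"
    unfolding laplace_def by (rule lborel_integral_real_affine) (use assms in simp)
  then show ?thesis using assms by (simp add: laplace_def scaleR_conv_of_real mult_ac)
qed

lemma laplace_divide: "laplace (\<lambda>x. f x / c) q = laplace f q / c"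
  by (simp add: laplace_def)

lemma mass_shell_dilate:
  assumes l: "l > 0"
  shows "mass_shell_transform m (dilate l f) p = fourier (re_part f) (l * p) + \<i> * of_real (l * energy m p) * fourier (im_part f) (l * p)"
  using l laplace_dilate[OF l, of "re_part f"] laplace_dilate[OF l, of "im_part f"]
  by (simp add: mass_shell_transform_def fourier_laplace dilate_parts laplace_divide[of "\<lambda>x. re_part f (x / l)"])

lemma vacuum_norm_shell:
  assumes f: "f \<in> test_functions" and m: "m > 0"
  shows "integrable lborel (\<lambda>p. (cmod (mass_shell_transform m f p))\<^sup>2 / energy m p)"
    "vacuum_norm_sq m f = 1/2 * (LINT p|lborel. (cmod (mass_shell_transform m f p))\<^sup>2 / energy m p)"
proof -
  have eq: "Re (shell_density m f f p) = (cmod (mass_shell_transform m f p))\<^sup>2 / energy m p" for p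
  proof -
    have "shell_density m f f p = of_real ((cmod (mass_shell_transform m f p))\<^sup>2 / energy m p)"
      unfolding shell_density_def of_real_divide complex_norm_square by (simp add: mult.commute)
    then show ?thesis by simp
  qed
  have int: "integrable lborel (shell_density m f f)" by (rule shell_density_integrable[OF f f m])
  from integrable_Re[OF int] show "integrable lborel (\<lambda>p. (cmod (mass_shell_transform m f p))\<^sup>2 / energy m p)"
    by (simp add: eq)
  have "vacuum_norm_sq m f = Re (one_particle m f f)" by (simp add: one_particle_self[OF m])
  also have "\<dots> = 1/2 * (LINT p|lborel. Re (shell_density m f f p))"
    using int by (simp add: one_particle_def)
  finally show "vacuum_norm_sq m f = 1/2 * (LINT p|lborel. (cmod (mass_shell_transform m f p))\<^sup>2 / energy m p)"
    by (simp add: eq)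
qed

text \<open>Between the mass and the inverse scale, the integrand of the vacuum norm of \<open>dilate l f\<close> is bounded below
  by a multiple of \<open>1 / (p + m)\<close>, which integrates to a logarithm.\<close>

lemma vacuum_norm_dilate_lower:
  assumes f: "f \<in> test_functions" and m: "m > 0" and nz: "fourier (re_part f) 0 \<noteq> 0"
  obtains c \<rho> where "c > 0" "\<rho> > 0"
    "\<And>l. l > 0 \<Longrightarrow> l * m \<le> \<rho> \<Longrightarrow> c * ln (1 + \<rho> / (l * m)) \<le> vacuum_norm_sq m (dilate l f)"
proof -
  define a where "a = cmod (fourier (re_part f) 0)"
  have a: "a > 0" using nz by (simp add: a_def)
  obtain B where B: "B \<ge> 0" "\<And>p. cmod (fourier (im_part f) p) \<le> B / (1 + p\<^sup>2)\<^sup>2"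
    using fourier_decay[OF test_im_part[OF f]] by blast
  have B': "cmod (fourier (im_part f) p) \<le> B" for p
  proof -
    have "B / (1 + p\<^sup>2)\<^sup>2 \<le> B / (1 + p\<^sup>2)" by (rule decay_mono[OF B(1)])
    also have "\<dots> \<le> B / 1" using B(1) by (intro divide_left_mono) (auto simp: add_pos_nonneg)
    finally show ?thesis using B(2)[of p] by simp
  qed
  obtain d where d: "d > 0" "\<And>q. \<bar>q\<bar> < d \<Longrightarrow> cmod (fourier (re_part f) q - fourier (re_part f) 0) < a / 2"
    using fourier_continuous[OF test_re_part[OF f]] a
    unfolding continuous_on_iff dist_norm by (metis UNIV_I diff_zero half_gt_zero real_norm_def)
  define \<rho> where "\<rho> = min (d / 2) (a / (8 * (B + 1)))"
  have \<rho>: "\<rho> > 0" "\<rho> < d" using d a B by (auto simp: \<rho>_def)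
  have \<rho>B: "2 * \<rho> * B \<le> a / 4"
  proof -
    have "2 * \<rho> * B \<le> 2 * (a / (8 * (B + 1))) * B" using B(1) by (intro mult_right_mono mult_left_mono) (auto simp: \<rho>_def)
    also have "\<dots> \<le> a / 4" using a B(1) by (simp add: field_simps)
    finally show ?thesis .
  qed
  \<comment> \<open>For scaled momenta up to \<open>\<rho>\<close> the real part is close to its zero mode, and the contribution of the imaginary
    part is suppressed by \<open>l * energy m p\<close>.\<close>
  have low: "a / 4 \<le> cmod (mass_shell_transform m (dilate l f) p)"
    if l: "l > 0" "l * m \<le> \<rho>" and p: "0 \<le> p" "l * p \<le> \<rho>" for l p
  proof -
    have "\<bar>l * p\<bar> < d" using l p \<rho> by (simp add: abs_mult)
    from d(2)[OF this] have "a / 2 \<le> cmod (fourier (re_part f) (l * p))"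
      using norm_triangle_ineq3[of "fourier (re_part f) (l * p)" "fourier (re_part f) 0"] a_def by linarith
    moreover have "cmod (\<i> * of_real (l * energy m p) * fourier (im_part f) (l * p)) \<le> a / 4"
    proof -
      have "energy m p \<le> p + m"
        unfolding energy_def using m p by (intro real_le_lsqrt) (simp_all add: power2_eq_square algebra_simps)
      then have "l * energy m p \<le> l * (p + m)" using l by (intro mult_left_mono) auto
      then have "l * energy m p \<le> 2 * \<rho>" using l p by (simp add: algebra_simps)
      then have "(l * energy m p) * cmod (fourier (im_part f) (l * p)) \<le> (2 * \<rho>) * B"
        using \<rho> by (intro mult_mono[OF _ B']) auto
      then show ?thesis using \<rho>B l energy_bounds[OF m, of p] by (simp add: norm_mult)
    qed
    ultimately show ?thesis
      unfolding mass_shell_dilate[OF l(1)]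
      using norm_diff_ineq[of "fourier (re_part f) (l * p)" "\<i> * of_real (l * energy m p) * fourier (im_part f) (l * p)"]
      by linarith
  qed
  define c where "c = (a / 4)\<^sup>2 / 2"
  have c: "c > 0" using a by (simp add: c_def)
  have "c * ln (1 + \<rho> / (l * m)) \<le> vacuum_norm_sq m (dilate l f)" if l: "l > 0" "l * m \<le> \<rho>" for l
  proof -
    let ?k = "dilate l f"
    have k: "?k \<in> test_functions" by (rule test_dilate[OF l(1) f])
    define R where "R = \<rho> / l"
    have R: "R > 0" using \<rho> l by (simp add: R_def)
    let ?h = "\<lambda>p. (a / 4)\<^sup>2 / (p + m)"
    have hc: "continuous_on {0..R} ?h" using m by (intro continuous_intros) auto
    have FTC: "((\<lambda>p. (a / 4)\<^sup>2 / (p + m)) has_integral ((a / 4)\<^sup>2 * ln (R + m) - (a / 4)\<^sup>2 * ln (0 + m))) {0..R}"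
      by (rule fundamental_theorem_of_calculus)
        (use R m in \<open>auto intro!: derivative_eq_intros simp: has_real_derivative_iff_has_vector_derivative[symmetric]\<close>)
    have I: "integral {0..R} ?h = (a / 4)\<^sup>2 * ln (1 + \<rho> / (l * m))"
    proof -
      have "integral {0..R} ?h = (a / 4)\<^sup>2 * (ln (R + m) - ln m)"
        using FTC by (simp add: integral_unique right_diff_distrib)
      also have "ln (R + m) - ln m = ln ((R + m) / m)" using R m by (simp add: ln_div)
      also have "(R + m) / m = 1 + \<rho> / (l * m)" using m l by (simp add: R_def field_simps)
      finally show ?thesis .
    qed
    have seth: "set_integrable lborel {0..R} ?h" by (rule borel_integrable_atLeastAtMost'[OF hc])
    have "integral {0..R} ?h = (LINT p|lborel. indicator {0..R} p *\<^sub>R ?h p)"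
      using set_borel_integral_eq_integral(2)[OF seth] by (simp add: set_lebesgue_integral_def)
    also have "\<dots> \<le> (LINT p|lborel. (cmod (mass_shell_transform m ?k p))\<^sup>2 / energy m p)"
    proof (rule integral_mono)
      show "integrable lborel (\<lambda>p. indicator {0..R} p *\<^sub>R ?h p)" using seth by (simp add: set_integrable_def)
      show "integrable lborel (\<lambda>p. (cmod (mass_shell_transform m ?k p))\<^sup>2 / energy m p)" by (rule vacuum_norm_shell[OF k m])
      show "indicator {0..R} p *\<^sub>R ?h p \<le> (cmod (mass_shell_transform m ?k p))\<^sup>2 / energy m p" for p
      proof (cases "p \<in> {0..R}")
        case True
        then have p: "0 \<le> p" "l * p \<le> \<rho>" using l by (auto simp: R_def field_simps)
        have e: "energy m p \<le> p + m"
          unfolding energy_def using m p by (intro real_le_lsqrt) (simp_all add: power2_eq_square algebra_simps)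
        have "(a / 4)\<^sup>2 / (p + m) \<le> (cmod (mass_shell_transform m ?k p))\<^sup>2 / energy m p"
          using low[OF l p] a e energy_bounds(2)[OF m, of p] by (intro frac_le power_mono) auto
        then show ?thesis using True by simp
      next
        case False
        then show ?thesis using energy_bounds(2)[OF m, of p] by simp
      qed
    qed
    finally show ?thesis unfolding vacuum_norm_shell(2)[OF k m] I c_def by simp
  qed
  then show ?thesis using that c \<rho>(1) by blast
qed

lemma vacuum_norm_dilate_tendsto:
  assumes f: "f \<in> test_functions" and m: "m > 0" and nz: "fourier (re_part f) 0 \<noteq> 0"
  shows "((\<lambda>l. exp (- vacuum_norm_sq m (dilate l f) / 2)) \<longlongrightarrow> 0) (at_right 0)"
proof -
  obtain c \<rho> where c: "c > 0" "\<rho> > 0"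
    "\<And>l. l > 0 \<Longrightarrow> l * m \<le> \<rho> \<Longrightarrow> c * ln (1 + \<rho> / (l * m)) \<le> vacuum_norm_sq m (dilate l f)"
    using vacuum_norm_dilate_lower[OF assms] by blast
  show ?thesis
  proof (rule Lim_null_comparison)
    have "\<forall>\<^sub>F l in at_right 0. l < \<rho> / m" "\<forall>\<^sub>F l in at_right 0. (l::real) > 0"
      using order_tendstoD(2)[OF tendsto_ident_at, of 0 "\<rho> / m" "{0<..}"] eventually_at_right_less[of 0] c(2) m by auto
    then show "\<forall>\<^sub>F l in at_right 0. norm (exp (- vacuum_norm_sq m (dilate l f) / 2)) \<le> exp (- (c * ln (1 + \<rho> / (l * m))) / 2)"
    proof eventually_elim
      case (elim l)
      then have "l * m \<le> \<rho>" using m by (simp add: field_simps)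
      from c(3)[OF elim(2) this] show ?case by simp
    qed
    show "((\<lambda>l. exp (- (c * ln (1 + \<rho> / (l * m))) / 2)) \<longlongrightarrow> 0) (at_right 0)"
      using c m by real_asymp
  qed
qed

lemma countable_sin_eq:
  assumes "m > 0"
  shows "countable {s::real. sin (m * s) = sin (m * t)}"
proof -
  have "{s. sin (m * s) = sin (m * t)} \<subseteq>
     range (\<lambda>i::int. t + 2 * of_int i * pi / m) \<union> range (\<lambda>i::int. - t + of_int i * pi / m)"
  proof
    fix s assume "s \<in> {s. sin (m * s) = sin (m * t)}"
    then have "2 * sin ((m * s - m * t) / 2) * cos ((m * s + m * t) / 2) = 0"
      using sin_diff_sin[of "m * s" "m * t"] by simp
    then consider "sin ((m * s - m * t) / 2) = 0" | "cos ((m * s + m * t) / 2) = 0" by auto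
    then show "s \<in> range (\<lambda>i::int. t + 2 * of_int i * pi / m) \<union> range (\<lambda>i::int. - t + of_int i * pi / m)"
    proof cases
      case 1
      then obtain i :: int where "(m * s - m * t) / 2 = of_int i * pi" using sin_zero_iff_int2 by blast
      then have "s = t + 2 * of_int i * pi / m" using assms by (simp add: field_simps)
      then show ?thesis by blast
    next
      case 2
      then obtain i :: int where "(m * s + m * t) / 2 = of_int i * (pi / 2)" using cos_zero_iff_int by blast
      then have "s = - t + of_int i * pi / m" using assms by (simp add: field_simps)
      then show ?thesis by blast
    qed
  qed
  moreover have "countable (range (\<lambda>i::int. t + 2 * of_int i * pi / m) \<union> range (\<lambda>i::int. - t + of_int i * pi / m))"
    by (intro countable_Un countable_image) auto
  ultimately show ?thesis by (rule countable_subset)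
qed

text \<open>The exceptional times are countable.\<close>

lemma AE_sin_neq:
  assumes "m > 0"
  shows "AE y in (lborel :: spacetime measure). sin (m * fst y) \<noteq> sin (m * t)"
proof -
  have "AE s in lborel. s \<notin> {s. sin (m * s) = sin (m * t)}"
    by (intro AE_not_in countable_imp_null_set_lborel countable_sin_eq assms)
  then have "AE s in lborel. AE x in (lborel :: real measure). sin (m * fst (s, x)) \<noteq> sin (m * t)"
    by eventually_elim simp
  note ae = this
  have "AE y in lborel \<Otimes>\<^sub>M (lborel :: real measure). sin (m * fst y) \<noteq> sin (m * t)"
  proof (rule lborel_pair.AE_pair_measure)
    show "{y \<in> space (lborel \<Otimes>\<^sub>M lborel). sin (m * fst y) \<noteq> sin (m * t)} \<in> sets (lborel \<Otimes>\<^sub>M (lborel :: real measure))"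
      by measurable
  qed (rule ae)
  then show ?thesis unfolding lborel_prod .
qed

section \<open>Averages of asymptotically orthogonal unitaries\<close>

text \<open>If the unitaries \<open>V l y\<close> map \<open>w\<close> to vectors that become orthogonal for almost all pairs of parameters, then
  the scalar product of \<open>A l \<cdot> w\<close> with each \<open>V l y \<cdot> w\<close> tends to zero, hence also with its own average.\<close>

lemma weak_average_tendsto_zero:
  fixes V :: "real \<Rightarrow> spacetime \<Rightarrow> 'h::complex_hilbert bdd_op" and A :: "real \<Rightarrow> 'h bdd_op"
  assumes g: "integrable lborel g" "\<And>y. g y \<ge> 0"
    and V: "\<And>l y. l > 0 \<Longrightarrow> unitary (V l y)"
    and int: "\<And>l u v. l > 0 \<Longrightarrow> integrable lborel (\<lambda>y. of_real (g y) * cinner u (V l y \<cdot> v))"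
    and A: "\<And>l u v. l > 0 \<Longrightarrow> (LINT y|lborel. of_real (g y) * cinner u (V l y \<cdot> v)) = cinner u (A l \<cdot> v)"
    and orth: "\<And>y. AE y' in lborel. ((\<lambda>l. cinner (V l y \<cdot> w) (V l y' \<cdot> w)) \<longlongrightarrow> 0) (at_right 0)"
  shows "((\<lambda>l. norm (A l \<cdot> w)) \<longlongrightarrow> 0) (at_right 0)"
  unfolding tendsto_at_iff_sequentially
proof (intro allI impI)
  fix l :: "nat \<Rightarrow> real" assume l: "\<forall>n. l n \<in> {0<..} - {0}" "l \<longlonglongrightarrow> 0"
  then have l0: "l n > 0" for n by auto
  have "l n \<noteq> 0" for n using l0[of n] by simp
  then have filt: "filterlim l (at_right 0) sequentially" using l by (auto simp: filterlim_at)
  have norm_V: "norm (V (l n) y \<cdot> v) = norm v" for n y v by (rule norm_unitary_app[OF V[OF l0]])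
  have wi: "integrable lborel (\<lambda>y. g y * C)" for C using g(1) by (rule integrable_mult_left)
  have inner: "(\<lambda>n. cinner (A (l n) \<cdot> w) (V (l n) y \<cdot> w)) \<longlonglongrightarrow> 0" for y
  proof -
    have "(\<lambda>n. LINT y'|lborel. of_real (g y') * cinner (V (l n) y \<cdot> w) (V (l n) y' \<cdot> w)) \<longlonglongrightarrow> (LINT y'|(lborel :: spacetime measure). 0)"
    proof (rule integral_dominated_convergence[where w = "\<lambda>y. g y * (norm w * norm w)"])
      show "AE y' in lborel. (\<lambda>n. of_real (g y') * cinner (V (l n) y \<cdot> w) (V (l n) y' \<cdot> w)) \<longlonglongrightarrow> 0"
        using orth[of y]
      proof eventually_elim
        case (elim y')
        show ?case by (rule tendsto_mult_right_zero[OF filterlim_compose[OF elim filt]])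
      qed
      show "AE y' in lborel. norm (of_real (g y') * cinner (V (l n) y \<cdot> w) (V (l n) y' \<cdot> w)) \<le> g y' * (norm w * norm w)" for n
      proof (rule AE_I2)
        fix y'
        have "cmod (cinner (V (l n) y \<cdot> w) (V (l n) y' \<cdot> w)) \<le> norm w * norm w"
          using cinner_cauchy_schwarz[of "V (l n) y \<cdot> w" "V (l n) y' \<cdot> w"] by (simp add: norm_V)
        then show "norm (of_real (g y') * cinner (V (l n) y \<cdot> w) (V (l n) y' \<cdot> w)) \<le> g y' * (norm w * norm w)"
          using g(2)[of y'] by (simp add: norm_mult mult_left_mono)
      qed
    qed (use borel_measurable_integrable[OF int[OF l0]] wi in auto)
    then have "(\<lambda>n. cinner (V (l n) y \<cdot> w) (A (l n) \<cdot> w)) \<longlonglongrightarrow> 0" by (simp add: A[OF l0])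
    then have "(\<lambda>n. cnj (cinner (V (l n) y \<cdot> w) (A (l n) \<cdot> w))) \<longlonglongrightarrow> cnj 0" by (rule tendsto_cnj)
    then show ?thesis by (simp flip: cinner_commute)
  qed
  define G where "G = (LINT y|lborel. g y)"
  have Ab: "norm (A (l n) \<cdot> w) \<le> G * norm w" for n
  proof (cases "A (l n) \<cdot> w = 0")
    case True
    then show ?thesis using g by (simp add: G_def)
  next
    case False
    have "(norm (A (l n) \<cdot> w))\<^sup>2 = cmod (cinner (A (l n) \<cdot> w) (A (l n) \<cdot> w))"
      unfolding cinner_self norm_of_real by simp
    also have "\<dots> = cmod (LINT y|lborel. of_real (g y) * cinner (A (l n) \<cdot> w) (V (l n) y \<cdot> w))" by (simp add: A[OF l0])
    also have "\<dots> \<le> (LINT y|lborel. g y * (norm (A (l n) \<cdot> w) * norm w))"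
    proof (rule Bochner_Integration.integral_norm_bound_integral[OF int[OF l0] wi])
      show "norm (of_real (g y) * cinner (A (l n) \<cdot> w) (V (l n) y \<cdot> w)) \<le> g y * (norm (A (l n) \<cdot> w) * norm w)" for y
        using g(2)[of y] cinner_cauchy_schwarz[of "A (l n) \<cdot> w" "V (l n) y \<cdot> w"] by (simp add: norm_V norm_mult mult_left_mono)
    qed
    also have "\<dots> = (G * norm w) * norm (A (l n) \<cdot> w)" by (simp add: G_def)
    finally show ?thesis using False by (simp add: power2_eq_square)
  qed
  have "(\<lambda>n. LINT y|lborel. of_real (g y) * cinner (A (l n) \<cdot> w) (V (l n) y \<cdot> w)) \<longlonglongrightarrow> (LINT y|(lborel :: spacetime measure). 0)"
  proof (rule integral_dominated_convergence[where w = "\<lambda>y. g y * (G * norm w * norm w)"])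
    show "AE y in lborel. (\<lambda>n. of_real (g y) * cinner (A (l n) \<cdot> w) (V (l n) y \<cdot> w)) \<longlonglongrightarrow> 0"
      by (intro AE_I2 tendsto_mult_right_zero inner)
    show "AE y in lborel. norm (of_real (g y) * cinner (A (l n) \<cdot> w) (V (l n) y \<cdot> w)) \<le> g y * (G * norm w * norm w)" for n
    proof (rule AE_I2)
      fix y
      have "cmod (cinner (A (l n) \<cdot> w) (V (l n) y \<cdot> w)) \<le> norm (A (l n) \<cdot> w) * norm w"
        using cinner_cauchy_schwarz[of "A (l n) \<cdot> w" "V (l n) y \<cdot> w"] by (simp add: norm_V)
      also have "\<dots> \<le> G * norm w * norm w" by (intro mult_right_mono Ab) simp
      finally show "norm (of_real (g y) * cinner (A (l n) \<cdot> w) (V (l n) y \<cdot> w)) \<le> g y * (G * norm w * norm w)"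
        using g(2)[of y] by (simp add: norm_mult mult_left_mono)
    qed
  qed (use borel_measurable_integrable[OF int[OF l0]] wi in auto)
  then have "(\<lambda>n. complex_of_real ((norm (A (l n) \<cdot> w))\<^sup>2)) \<longlonglongrightarrow> of_real 0"
    unfolding A[OF l0] cinner_self by simp
  then have "(\<lambda>n. (norm (A (l n) \<cdot> w))\<^sup>2) \<longlonglongrightarrow> 0" unfolding tendsto_of_real_iff .
  then have "(\<lambda>n. sqrt ((norm (A (l n) \<cdot> w))\<^sup>2)) \<longlonglongrightarrow> sqrt 0" by (rule tendsto_real_sqrt)
  then show "((\<lambda>l. norm (A l \<cdot> w)) \<circ> l) \<longlonglongrightarrow> 0" by (simp add: o_def)
qed

section \<open>Elements annihilating the vacuum in the scaling limit\<close>

context massive_net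
begin

lemma scaling_algebraD:
  assumes "A \<in> scaling_algebra" "\<epsilon> > 0"
  obtains C B where "C > 0" "scaling_function C B" "\<And>l. norm (A l - B l) < \<epsilon>"
proof -
  obtain R B where R: "R \<in> double_cones" "B \<in> scaling_local_algebra R" and B: "\<And>l. norm (A l - B l) < \<epsilon>"
    using assms unfolding scaling_algebra_def uniform_closure_of_def by blast
  obtain C where "C > 0" "scaling_function C B" using scaling_functionI[OF R] by blast
  then show ?thesis using that B by blast
qed

lemma scaling_algebraI:
  assumes "\<And>\<epsilon>. \<epsilon> > 0 \<Longrightarrow> \<exists>C B. C > 0 \<and> scaling_function C B \<and> (\<forall>l. norm (A l - B l) < \<epsilon>)"
  shows "A \<in> scaling_algebra"
  unfolding scaling_algebra_def uniform_closure_of_def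
proof (intro CollectI allI impI)
  fix \<epsilon> :: real assume "\<epsilon> > 0"
  then obtain C B where B: "C > 0" "scaling_function C B" "\<forall>l. norm (A l - B l) < \<epsilon>" using assms by blast
  then have "B \<in> scaling_local_algebra (double_cone_over (- (C + 1)) (C + 1))" by (intro scaling_functionD) auto
  moreover have "double_cone_over (- (C + 1)) (C + 1) \<in> double_cones" using B(1) by (intro double_cone_over_mem) simp
  ultimately show "\<exists>B\<in>\<Union>R\<in>double_cones. scaling_local_algebra R. \<forall>l. norm (A l - B l) < \<epsilon>" using B(3) by blast
qed

lemma scaling_algebra_bounded:
  assumes "A \<in> scaling_algebra"
  obtains M where "M > 0" "\<And>l. norm (A l) \<le> M"
proof -
  obtain C B where B: "scaling_function C B" "\<And>l. norm (A l - B l) < 1" using scaling_algebraD[OF assms zero_less_one] by blast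
  obtain N where N: "N > 0" "\<And>l. norm (B l) \<le> N" using B(1) by (auto simp: scaling_function_def bounded_pos)
  have "norm (A l) \<le> N + 1" for l
    using norm_triangle_ineq[of "A l - B l" "B l"] B(2)[of l] N(2)[of l] by simp
  then show ?thesis using that[of "N + 1"] N(1) by simp
qed

lemma scaling_algebra_star: 
  assumes "A \<in> scaling_algebra" shows "star A \<in> scaling_algebra"
proof (rule scaling_algebraI)
  fix \<epsilon> :: real assume "\<epsilon> > 0"
  then obtain C B where B: "C > 0" "scaling_function C B" "\<And>l. norm (A l - B l) < \<epsilon>" using scaling_algebraD[OF assms] by blast
  have "norm (star A l - star B l) < \<epsilon>" for l
    using B(3)[of l] by (simp add: star_fun_def norm_star flip: star_diff)
  then show "\<exists>C B. C > 0 \<and> scaling_function C B \<and> (\<forall>l. norm (star A l - B l) < \<epsilon>)"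
    using B(1) scaling_function_star[OF B(2)] by blast
qed

lemma scaling_algebra_mult: 
  assumes A: "A \<in> scaling_algebra" and B: "B \<in> scaling_algebra" shows "A * B \<in> scaling_algebra"
proof (rule scaling_algebraI)
  fix \<epsilon> :: real assume \<epsilon>: "\<epsilon> > 0"
  obtain M where M: "M > 0" "\<And>l. norm (A l) \<le> M" using scaling_algebra_bounded[OF A] by blast
  obtain N where N: "N > 0" "\<And>l. norm (B l) \<le> N" using scaling_algebra_bounded[OF B] by blast
  define d where "d = min 1 (\<epsilon> / (M + N + 1))"
  have d: "d > 0" "d \<le> 1" using \<epsilon> M N by (auto simp: d_def)
  have "d * (M + N + 1) \<le> \<epsilon> / (M + N + 1) * (M + N + 1)" using M N by (intro mult_right_mono) (auto simp: d_def)
  then have d3: "d * (M + N + 1) \<le> \<epsilon>" using M(1) N(1) by simp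
  obtain C A' where A': "C > 0" "scaling_function C A'" "\<And>l. norm (A l - A' l) < d" using scaling_algebraD[OF A d(1)] by blast
  obtain D B' where B': "D > 0" "scaling_function D B'" "\<And>l. norm (B l - B' l) < d" using scaling_algebraD[OF B d(1)] by blast
  have "norm ((A * B) l - (A' * B') l) < \<epsilon>" for l
  proof -
    have "A l * B l - A' l * B' l = A l * (B l - B' l) + (A l - A' l) * B' l" by (simp add: algebra_simps)
    then have "norm (A l * B l - A' l * B' l) \<le> norm (A l) * norm (B l - B' l) + norm (A l - A' l) * norm (B' l)"
      by (simp add: norm_triangle_le[OF add_mono[OF norm_mult_ineq norm_mult_ineq]])
    also have "\<dots> \<le> M * norm (B l - B' l) + norm (A l - A' l) * (N + 1)"
    proof (intro add_mono mult_mono M)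
      show "norm (B' l) \<le> N + 1"
        using norm_triangle_ineq4[of "B l" "B l - B' l"] B'(3)[of l] N(2)[of l] d(2) by simp
    qed (use M in auto)
    also have "\<dots> < M * d + d * (N + 1)"
      using A'(3)[of l] B'(3)[of l] M(1) N(1) by (intro add_strict_mono mult_strict_left_mono mult_strict_right_mono) auto
    also have "\<dots> \<le> \<epsilon>" using d3 by (simp add: algebra_simps)
    finally show ?thesis by (simp add: times_fun_def)
  qed
  moreover have "scaling_function (max C D) (A' * B')"
    by (intro scaling_function_mult scaling_function_mono[OF A'(2)] scaling_function_mono[OF B'(2)]) auto
  ultimately show "\<exists>C B''. C > 0 \<and> scaling_function C B'' \<and> (\<forall>l. norm ((A * B) l - B'' l) < \<epsilon>)"
    using A'(1) by (intro exI[of _ "max C D"] exI[of _ "A' * B'"]) auto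
qed

end

text \<open>A scaling limit of the net of positive mass.\<close>

locale massive_scaling_limit =
  massive_net m \<tau> W \<alpha>\<^sub>W \<omega> \<pi> \<Omega> \<alpha> \<phi> + scaling_limit m \<tau> W \<alpha>\<^sub>W \<omega> \<pi> \<Omega> \<alpha> \<phi> F s \<omega>\<^sub>0 \<pi>\<^sub>0 \<Omega>\<^sub>0
  for m \<tau> and W :: "(real \<Rightarrow> complex) \<Rightarrow> 'w::cstar_algebra" and \<alpha>\<^sub>W \<omega>
    and \<pi> :: "'w \<Rightarrow> 'h::complex_hilbert bdd_op" and \<Omega> \<alpha> \<phi>
    and F :: "'i filter" and s \<omega>\<^sub>0
    and \<pi>\<^sub>0 :: "(real \<Rightarrow> 'h bdd_op) \<Rightarrow> 'k::complex_hilbert bdd_op" and \<Omega>\<^sub>0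
begin

text \<open>Along the net \<open>s\<close>, the squared norms converge to the squared norm of \<open>\<pi>\<^sub>0 X \<cdot> \<Omega>\<^sub>0\<close>.\<close>

lemma limit_vector_zero:
  assumes X: "X \<in> scaling_algebra" and lim: "((\<lambda>l. norm (X l \<cdot> \<Omega>)) \<longlongrightarrow> 0) (at_right 0)"
  shows "\<pi>\<^sub>0 X \<cdot> \<Omega>\<^sub>0 = 0"
proof -
  have sX: "star X \<in> scaling_algebra" by (rule scaling_algebra_star[OF X])
  have XX: "star X * X \<in> scaling_algebra" by (rule scaling_algebra_mult[OF sX X])
  have hom: "\<pi>\<^sub>0 (star X * X) = \<pi>\<^sub>0 (star X) * \<pi>\<^sub>0 X" "\<pi>\<^sub>0 (star X) = star (\<pi>\<^sub>0 X)"
    and \<omega>0: "\<omega>\<^sub>0 (star X * X) = cinner \<Omega>\<^sub>0 (\<pi>\<^sub>0 (star X * X) \<cdot> \<Omega>\<^sub>0)"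
    using limit_gns X sX XX unfolding gns_triple_def star_hom_on_def by blast+
  have "((\<lambda>\<kappa>. cinner \<Omega> ((star X * X) (s \<kappa>) \<cdot> \<Omega>)) \<longlongrightarrow> \<omega>\<^sub>0 (star X * X)) F" by (rule \<omega>\<^sub>0_limit[OF XX])
  moreover have "cinner \<Omega> ((star X * X) l \<cdot> \<Omega>) = of_real ((norm (X l \<cdot> \<Omega>))\<^sup>2)" for l
    by (simp only: times_fun_def star_fun_def op_app_times star_adjoint' cinner_self)
  ultimately have "((\<lambda>\<kappa>. complex_of_real ((norm (X (s \<kappa>) \<cdot> \<Omega>))\<^sup>2)) \<longlongrightarrow> \<omega>\<^sub>0 (star X * X)) F" by simp
  moreover have "((\<lambda>\<kappa>. complex_of_real ((norm (X (s \<kappa>) \<cdot> \<Omega>))\<^sup>2)) \<longlongrightarrow> of_real (0\<^sup>2)) F"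
    by (intro tendsto_of_real tendsto_power filterlim_compose[OF lim s_to_0])
  ultimately have "\<omega>\<^sub>0 (star X * X) = 0" using tendsto_unique[OF F_nontrivial] by fastforce
  then have "cinner (\<pi>\<^sub>0 X \<cdot> \<Omega>\<^sub>0) (\<pi>\<^sub>0 X \<cdot> \<Omega>\<^sub>0) = 0"
    unfolding \<omega>0 hom by (simp add: op_app_times star_adjoint')
  then show ?thesis by (simp add: cinner_self)
qed

theorem limit_operator_zero:
  assumes A: "scaling_function C A" and C: "C \<ge> 0"
    and lim: "((\<lambda>l. norm (A l \<cdot> \<Omega>)) \<longlongrightarrow> 0) (at_right 0)"
  shows "\<pi>\<^sub>0 A = 0"
proof (rule op_eqI)
  have AS: "A \<in> scaling_algebra" by (rule scaling_function_algebra[OF A C])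
  obtain M where M: "M > 0" "\<And>l. norm (A l) \<le> M" using scaling_algebra_bounded[OF AS] by blast
  have zero: "\<pi>\<^sub>0 A \<cdot> (\<pi>\<^sub>0 B \<cdot> \<Omega>\<^sub>0) = 0" if B: "B \<in> scaling_algebra" for B
  proof -
    have "((\<lambda>l. norm ((A * B) l \<cdot> \<Omega>)) \<longlongrightarrow> 0) (at_right 0)"
    proof (rule tendstoI)
      fix e :: real assume e: "e > 0"
      obtain D B' where B': "D > 0" "scaling_function D B'" "\<And>l. norm (B l - B' l) < e / (2 * M)"
        using scaling_algebraD[OF B, of "e / (2 * M)"] e M(1) by auto
      have "((\<lambda>l. norm (A l \<cdot> (B' l \<cdot> \<Omega>))) \<longlongrightarrow> 0) (at_right 0)"
        by (rule annihilates_vacuum_limit[OF A B'(2) C _ lim]) (use B'(1) in simp)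
      then have "\<forall>\<^sub>F l in at_right 0. dist (norm (A l \<cdot> (B' l \<cdot> \<Omega>))) 0 < e / 2" using e by (intro tendstoD) auto
      then show "\<forall>\<^sub>F l in at_right 0. dist (norm ((A * B) l \<cdot> \<Omega>)) 0 < e"
      proof eventually_elim
        case (elim l)
        have "(A * B) l \<cdot> \<Omega> = A l \<cdot> ((B l - B' l) \<cdot> \<Omega>) + A l \<cdot> (B' l \<cdot> \<Omega>)"
          by (simp add: times_fun_def op_app_times op_app_simps)
        moreover have "norm (A l \<cdot> ((B l - B' l) \<cdot> \<Omega>)) \<le> M * (e / (2 * M))"
        proof (rule order_trans[OF norm_op_app mult_mono[OF M(2)]])
          show "norm ((B l - B' l) \<cdot> \<Omega>) \<le> e / (2 * M)"
            using norm_op_app[of "B l - B' l" \<Omega>] B'(3)[of l] by (simp add: norm_\<Omega>)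
        qed (use M in auto)
        moreover have "M * (e / (2 * M)) = e / 2" using M(1) by simp
        ultimately show ?case
          using elim norm_triangle_ineq[of "A l \<cdot> ((B l - B' l) \<cdot> \<Omega>)" "A l \<cdot> (B' l \<cdot> \<Omega>)"] by simp
      qed
    qed
    then have "\<pi>\<^sub>0 (A * B) \<cdot> \<Omega>\<^sub>0 = 0" by (rule limit_vector_zero[OF scaling_algebra_mult[OF AS B]])
    moreover have "\<pi>\<^sub>0 (A * B) = \<pi>\<^sub>0 A * \<pi>\<^sub>0 B"
      using limit_gns AS B unfolding gns_triple_def star_hom_on_def by blast
    ultimately show ?thesis by (simp add: op_app_times)
  qed
  fix v
  have "closed {v. \<pi>\<^sub>0 A \<cdot> v = 0}"
    by (intro closed_Collect_eq continuous_on_op_app continuous_on_const continuous_on_id)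
  then have "closure ((\<lambda>a. \<pi>\<^sub>0 a \<cdot> \<Omega>\<^sub>0) ` scaling_algebra) \<subseteq> {v. \<pi>\<^sub>0 A \<cdot> v = 0}"
    by (intro closure_minimal) (use zero in auto)
  then show "\<pi>\<^sub>0 A \<cdot> v = 0 \<cdot> v" using limit_gns by (auto simp: gns_triple_def op_app_simps)
qed

end

section \<open>Approximate identities\<close>

lemma integral_pos_continuous:
  fixes g :: "'a::euclidean_space \<Rightarrow> real"
  assumes g: "continuous_on UNIV g" "integrable lborel g" "\<And>y. g y \<ge> 0" and y: "g y \<noteq> 0"
  shows "(LINT y|lborel. g y) > 0"
proof -
  have gy: "g y > 0" using g(3)[of y] y by simp
  obtain d where d: "d > 0" "\<And>x. dist x y < d \<Longrightarrow> dist (g x) (g y) < g y / 2"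
    using g(1) gy unfolding continuous_on_iff by (meson UNIV_I half_gt_zero)
  have le: "indicator (ball y d) x *\<^sub>R (g y / 2) \<le> g x" for x
  proof (cases "x \<in> ball y d")
    case True
    then have "\<bar>g x - g y\<bar> < g y / 2" using d(2)[of x] by (simp add: dist_commute dist_real_def)
    then have "g y / 2 \<le> g x" by linarith
    then show ?thesis using True by simp
  qed (simp add: g(3))
  have fin: "emeasure lborel (ball y d) < \<infinity>" by (rule emeasure_lborel_ball_finite)
  have "0 < measure lborel (ball y d) * (g y / 2)"
    using content_ball_pos[OF d(1), of y] gy by simp
  also have "\<dots> = (LINT x|lborel. indicator (ball y d) x *\<^sub>R (g y / 2))" by simp
  also have "\<dots> \<le> (LINT x|lborel. g x)"
    by (rule integral_mono[OF _ g(2) le]) (use fin in simp)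
  finally show ?thesis .
qed

lemma mollifiers_nonempty:
  assumes "r > 0" shows "mollifiers r \<noteq> {}"
proof -
  define k where "k x = max 0 (r / 2 - norm x)" for x :: spacetime
  have kc: "continuous_on UNIV k" unfolding k_def by (intro continuous_intros)
  have kz: "k x = 0" if "x \<notin> cball 0 (r / 2)" for x using that by (simp add: k_def)
  have ki: "integrable lborel k" by (rule integrable_compact_support[OF kc compact_cball kz])
  define c where "c = (LINT x|lborel. k x)"
  have c: "c > 0" unfolding c_def
    by (rule integral_pos_continuous[OF kc ki, of 0]) (use assms in \<open>auto simp: k_def\<close>)
  have "(\<lambda>x. k x / c) \<in> mollifiers r"
    unfolding mollifiers_def
  proof (intro CollectI conjI allI)
    show "continuous_on UNIV (\<lambda>x. k x / c)" using c by (intro continuous_intros kc) auto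
    show "0 \<le> k x / c" for x using c by (simp add: k_def)
    have "(k has_integral c) UNIV" unfolding c_def by (rule has_integral_integral_lborel[OF ki])
    from has_integral_divide[OF this, of c] show "((\<lambda>x. k x / c) has_integral 1) UNIV" using c by simp
    have "supp (\<lambda>x. k x / c) \<subseteq> cball 0 (r / 2)" by (rule supp_subsetI) (use kz in auto)
    also have "\<dots> \<subseteq> ball 0 r" using assms by auto
    finally show "supp (\<lambda>x. k x / c) \<subseteq> ball 0 r" .
  qed
  then show ?thesis by blast
qed

text \<open>The sets of mollifiers decrease with their radius and so form a basis of the filter.\<close>

lemma eventually_to_delta:
  "eventually P to_delta \<longleftrightarrow> (\<exists>r>0. \<forall>h\<in>mollifiers r. P h)"
proof -
  have "\<exists>x\<in>{0<..}. principal (mollifiers x) \<le> inf (principal (mollifiers a)) (principal (mollifiers b))"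
    if "a \<in> {0<..}" "b \<in> {0<..}" for a b :: real
  proof (rule bexI[of _ "min a b"])
    have "ball (0 :: spacetime) (min a b) \<subseteq> ball 0 a" "ball (0 :: spacetime) (min a b) \<subseteq> ball 0 b" by auto
    then have "mollifiers (min a b) \<subseteq> mollifiers a" "mollifiers (min a b) \<subseteq> mollifiers b"
      unfolding mollifiers_def by blast+
    then show "principal (mollifiers (min a b)) \<le> inf (principal (mollifiers a)) (principal (mollifiers b))" by simp
  qed (use that in simp)
  then have "eventually P to_delta \<longleftrightarrow> (\<exists>r\<in>{0<..}. eventually P (principal (mollifiers r)))"
    unfolding to_delta_def by (intro eventually_INF_base) auto
  then show ?thesis by (auto simp: eventually_principal)
qed

lemma to_delta_nontrivial: "to_delta \<noteq> bot"
  using mollifiers_nonempty by (auto simp: trivial_limit_def eventually_to_delta)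

section \<open>Dilated averages of Weyl operators\<close>

lemma ultraweak_vector_functional: "ultraweak_functional (\<lambda>A. cinner u (A \<cdot> v))"
  unfolding ultraweak_functional_def
proof (intro exI conjI allI)
  let ?u = "\<lambda>n::nat. if n = 0 then u else 0" and ?v = "\<lambda>n::nat. if n = 0 then v else 0"
  show "summable (\<lambda>n. (norm (?u n))\<^sup>2)" "summable (\<lambda>n. (norm (?v n))\<^sup>2)"
    by (rule summable_finite[of "{0}"]; simp)+
  fix A
  have "(\<Sum>n. cinner (?u n) (A \<cdot> ?v n)) = (\<Sum>n\<in>{0}. cinner (?u n) (A \<cdot> ?v n))"
    by (rule suminf_finite) (auto simp: cinner_zero)
  then show "cinner u (A \<cdot> v) = (\<Sum>n. cinner (?u n) (A \<cdot> ?v n))" by simp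
qed

lemma dilate_diff: "dilate l f - dilate l g = dilate l (f - g)"
  by (auto simp: dilate_def diff_divide_distrib algebra_simps)

lemma supp_dilate:
  assumes l: "l > 0" and f: "supp f \<subseteq> {-C..C}"
  shows "supp (dilate l f) \<subseteq> {- (l * C)..l * C}"
proof (rule supp_subsetI[OF closed_atLeastAtMost])
  fix x assume x: "x \<notin> {- (l * C)..l * C}"
  have "x / l \<notin> {-C..C}" using x l by (auto simp: field_simps)
  then have "f (x / l) = 0" using f eq_0_outside_supp by blast
  then show "dilate l f x = 0" by (simp add: dilate_def)
qed

context massive_net
begin

text \<open>The imaginary part of the one-particle scalar product only contributes a phase.\<close>

lemma V_cinner_norm:
  assumes f: "f \<in> test_functions" and g: "g \<in> test_functions"
  shows "cmod (cinner (V g \<cdot> \<Omega>) (V f \<cdot> \<Omega>)) = exp (- vacuum_norm_sq m (f - g) / 2)"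
  unfolding V_cinner[OF f g] vacuum_norm_diff[OF f g mass_pos] by (simp add: field_simps)

lemma V_orthogonal_limit:
  assumes f: "f \<in> test_functions" and g: "g \<in> test_functions"
    and nz: "fourier (re_part (f - g)) 0 \<noteq> 0"
  shows "((\<lambda>l. cinner (V (dilate l g) \<cdot> \<Omega>) (V (dilate l f) \<cdot> \<Omega>)) \<longlongrightarrow> 0) (at_right 0)"
proof (rule Lim_null_comparison[OF _ vacuum_norm_dilate_tendsto[OF test_diff[OF f g] mass_pos nz]])
  show "\<forall>\<^sub>F l in at_right 0. norm (cinner (V (dilate l g) \<cdot> \<Omega>) (V (dilate l f) \<cdot> \<Omega>))
      \<le> exp (- vacuum_norm_sq m (dilate l (f - g)) / 2)"
    using eventually_at_right_less[of 0]
  proof eventually_elim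
    case (elim l)
    show ?case
      using V_cinner_norm[OF test_dilate[OF elim f] test_dilate[OF elim g]] by (simp add: dilate_diff)
  qed
qed

text \<open>Time evolution turns the charge \<open>\<integral> Im f\<close> into a zero mode of the real part.\<close>

lemma zero_mode_\<tau>:
  assumes f: "f \<in> test_functions" and re: "(LINT x|lborel. Re (f x)) = 0"
  shows "fourier (re_part (\<tau> id y f - \<tau> id y' f)) 0
    = of_real (m * ((2 * pi) powr (-1/2) * (LINT x|lborel. Im (f x))) * (sin (m * fst y') - sin (m * fst y)))"
proof -
  define c where "c = (2 * pi) powr (-1/2) * (LINT x|lborel. Im (f x))"
  have real: "fourier (re_part k) 0 = of_real ((2 * pi) powr (-1/2) * (LINT x|lborel. Re (k x)))"
    "fourier (im_part k) 0 = of_real ((2 * pi) powr (-1/2) * (LINT x|lborel. Im (k x)))" for k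
    by (simp_all add: fourier_def re_part_def im_part_def scaleR_conv_of_real integral_complex_of_real)
  have e: "energy m 0 = m" using mass_pos by (simp add: energy_def)
  have Re: "fourier (re_part k) 0 = of_real (Re (mass_shell_transform m k 0))" for k
    unfolding mass_shell_transform_def real by simp
  have "mass_shell_transform m f 0 = \<i> * of_real (m * c)"
    unfolding mass_shell_transform_def real re e by (simp add: c_def)
  then have "Re (mass_shell_transform m (\<tau> id z f) 0) = - m * c * sin (m * fst z)" for z
    unfolding \<tau>_id_transform[OF f] e by (simp add: Re_exp Im_exp mult_ac)
  moreover have "Re (mass_shell_transform m (\<tau> id y f - \<tau> id y' f) 0)
    = Re (mass_shell_transform m (\<tau> id y f) 0) - Re (mass_shell_transform m (\<tau> id y' f) 0)"
    unfolding diff_conv_add_uminus[of "\<tau> id y f"] 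
      mass_shell_add[OF \<tau>_id_test[OF f] test_minus[OF \<tau>_id_test[OF f]]] mass_shell_minus by simp
  ultimately have "Re (mass_shell_transform m (\<tau> id y f - \<tau> id y' f) 0)
    = m * c * (sin (m * fst y') - sin (m * fst y))" by (simp add: algebra_simps)
  then show ?thesis unfolding Re c_def[symmetric] by (rule arg_cong)
qed

end

text \<open>A Weyl operator averaged over translations with a non-negative weight.\<close>

locale averaged_weyl_operator = massive_net m \<tau> W \<alpha>\<^sub>W \<omega> \<pi> \<Omega> \<alpha> \<phi>
  for m \<tau> and W :: "(real \<Rightarrow> complex) \<Rightarrow> 'w::cstar_algebra" and \<alpha>\<^sub>W \<omega>
    and \<pi> :: "'w \<Rightarrow> 'h::complex_hilbert bdd_op" and \<Omega> \<alpha> \<phi> +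
  fixes f :: "real \<Rightarrow> complex" and g :: "spacetime \<Rightarrow> real"
  assumes f: "f \<in> test_functions"
    and g_cont: "continuous_on UNIV g" and g_supp: "compact (supp g)" and g_nonneg: "g y \<ge> 0"
begin

text \<open>The average, as a strong integral.\<close>

definition W_avg :: "'h bdd_op"
  where "W_avg = strong_integral (\<lambda>y. g y *\<^sub>R \<alpha> id y (V f))"

lemma g_integrable: "integrable lborel g"
  by (rule integrable_compact_support[OF g_cont g_supp]) (rule eq_0_outside_supp)

lemma \<alpha>_V: "\<alpha> id y (V f) = V (\<tau> id y f)"
proof -
  obtain r where r: "\<And>x. f x \<noteq> 0 \<Longrightarrow> \<bar>x\<bar> < r" using test_bounded_supp[OF f] by blast
  have "f x = 0" if "x \<notin> {-r..r}" for x
  proof (rule ccontr)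
    assume "f x \<noteq> 0"
    from r[OF this] that show False by auto
  qed
  then have "supp f \<subseteq> {-r..r}" by (rule supp_subsetI[OF closed_atLeastAtMost])
  from \<alpha>_time_zero[OF V_time_zero[OF f this]] show ?thesis by (simp add: U_V[OF f])
qed

lemma W_avg_integral: "((\<lambda>y. g y *\<^sub>R (V (\<tau> id y f) \<cdot> v)) has_integral W_avg \<cdot> v) UNIV"
  unfolding W_avg_def \<alpha>_V
proof (rule strong_integral(1)[OF g_cont g_supp V_\<tau>_continuous[OF f]])
  show "norm (V (\<tau> id y f)) \<le> 1" for y using norm_unitary_op[OF V_unitary[OF \<tau>_id_test[OF f]], of y] by simp
qed

lemma W_avg_nonzero:
  assumes "g y \<noteq> 0" shows "W_avg \<noteq> 0"
proof
  assume "W_avg = 0"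
  have "cinner \<Omega> (V (\<tau> id y f) \<cdot> \<Omega>) = of_real (exp (- vacuum_norm_sq m f / 2))" for y
    using \<omega>_W[OF \<tau>_id_test[OF f]] vacuum_norm_\<tau>[OF f] by (simp flip: \<omega>_\<pi>)
  then have "((\<lambda>y. g y *\<^sub>R complex_of_real (exp (- vacuum_norm_sq m f / 2))) has_integral 0) UNIV"
    using has_integral_cinner[OF W_avg_integral, of \<Omega> \<Omega>] \<open>W_avg = 0\<close> by (simp add: op_app_simps cinner_zero)
  moreover have "((\<lambda>y. g y *\<^sub>R complex_of_real (exp (- vacuum_norm_sq m f / 2))) has_integral
      (LINT y|lborel. g y) *\<^sub>R complex_of_real (exp (- vacuum_norm_sq m f / 2))) UNIV"
    by (rule has_integral_scaleR_left[OF has_integral_integral_lborel[OF g_integrable]])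
  ultimately have "(LINT y|lborel. g y) *\<^sub>R complex_of_real (exp (- vacuum_norm_sq m f / 2)) = 0"
    by (rule has_integral_unique[rotated])
  then have "(LINT y|lborel. g y) = 0" by simp
  then show False using integral_pos_continuous[OF g_cont g_integrable g_nonneg assms] by simp
qed

text \<open>All translates in the average are supported in a common interval.\<close>

lemma common_support:
  obtains C where "C > 0" "\<And>y. g y \<noteq> 0 \<Longrightarrow> supp (\<tau> id y f) \<subseteq> {-C..C}"
proof -
  obtain B where B: "\<And>y. y \<in> supp g \<Longrightarrow> norm y \<le> B" using compact_imp_bounded[OF g_supp] by (auto simp: bounded_iff)
  have "bounded (supp f)" using f by (intro compact_imp_bounded) (simp add: test_functions_iff)
  then obtain r where r: "\<And>x. x \<in> supp f \<Longrightarrow> \<bar>x\<bar> \<le> r" by (auto simp: bounded_iff)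
  have "supp (\<tau> id y f) \<subseteq> {- (\<bar>r\<bar> + 2 * \<bar>B\<bar> + 1)..\<bar>r\<bar> + 2 * \<bar>B\<bar> + 1}" if "g y \<noteq> 0" for y
  proof -
    have "y \<in> supp g" using eq_0_outside_supp[of y g] that by blast
    then have "norm y \<le> B" by (rule B)
    then have y: "\<bar>fst y\<bar> \<le> \<bar>B\<bar>" "\<bar>snd y\<bar> \<le> \<bar>B\<bar>" using norm_spacetime_ge[of y] by linarith+
    have fr: "supp f \<subseteq> {-\<bar>r\<bar>..\<bar>r\<bar>}"
    proof
      fix x assume "x \<in> supp f"
      from r[OF this] show "x \<in> {-\<bar>r\<bar>..\<bar>r\<bar>}" by auto
    qed
    have sub: "supp (\<tau> id y f) \<subseteq> {- \<bar>r\<bar> + snd y - \<bar>fst y\<bar>..\<bar>r\<bar> + snd y + \<bar>fst y\<bar>}" by (rule supp_\<tau>_id[OF f fr])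
    show ?thesis
    proof
      fix t assume "t \<in> supp (\<tau> id y f)"
      with sub have "- \<bar>r\<bar> + snd y - \<bar>fst y\<bar> \<le> t" "t \<le> \<bar>r\<bar> + snd y + \<bar>fst y\<bar>" by auto
      with y have "- (\<bar>r\<bar> + 2 * \<bar>B\<bar> + 1) \<le> t" "t \<le> \<bar>r\<bar> + 2 * \<bar>B\<bar> + 1" by linarith+
      then show "t \<in> {- (\<bar>r\<bar> + 2 * \<bar>B\<bar> + 1)..\<bar>r\<bar> + 2 * \<bar>B\<bar> + 1}" by simp
    qed
  qed
  then show ?thesis using that[of "\<bar>r\<bar> + 2 * \<bar>B\<bar> + 1"] by simp
qed

text \<open>Normality of the dilations moves them under the integral: it turns a matrix element of \<open>\<phi> l A\<close> into an
  absolutely convergent sum of matrix elements of \<open>A\<close>, which can be integrated termwise.\<close>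

lemma \<phi>_W_avg:
  assumes l: "l > 0"
  shows "integrable lborel (\<lambda>y. of_real (g y) * cinner u (V (dilate l (\<tau> id y f)) \<cdot> v))"
    "(LINT y|lborel. of_real (g y) * cinner u (V (dilate l (\<tau> id y f)) \<cdot> v)) = cinner u (\<phi> l W_avg \<cdot> v)"
proof -
  obtain C where C: "C > 0" "\<And>y. g y \<noteq> 0 \<Longrightarrow> supp (\<tau> id y f) \<subseteq> {-C..C}" using common_support by blast
  let ?R = "double_cone_over (- (C + 1)) (C + 1)"
  have le: "time_zero_algebra C \<subseteq> local_algebra ?R" using C(1) by (intro time_zero_le_local) auto
  have Vm: "V (\<tau> id y f) \<in> time_zero_algebra C" if "g y \<noteq> 0" for y
    by (rule V_time_zero[OF \<tau>_id_test[OF f] C(2)[OF that]])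
  have Wm: "W_avg \<in> time_zero_algebra C"
    unfolding time_zero_algebra_def
    by (rule bicommutant_weakI[where g = g and A = "\<lambda>y. V (\<tau> id y f)" and S = UNIV])
      (use has_integral_cinner[OF W_avg_integral] Vm in \<open>auto simp: time_zero_algebra_def\<close>)
  have "normal_on (local_algebra ?R) (\<phi> l)"
    using C(1) by (intro \<phi>_normal l double_cone_over_mem) simp
  then obtain \<psi> where \<psi>: "ultraweak_functional \<psi>" "\<And>A. A \<in> local_algebra ?R \<Longrightarrow> \<psi> A = cinner u (\<phi> l A \<cdot> v)"
    unfolding normal_on_def using ultraweak_vector_functional[of u v] by meson
  obtain a b :: "nat \<Rightarrow> 'h" where ab: "summable (\<lambda>n. (norm (a n))\<^sup>2)" "summable (\<lambda>n. (norm (b n))\<^sup>2)"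
    and \<psi>ab: "\<And>A. \<psi> A = (\<Sum>n. cinner (a n) (A \<cdot> b n))"
    using \<psi>(1) unfolding ultraweak_functional_def by blast
  have sab: "summable (\<lambda>n. norm (a n) * norm (b n))"
  proof (rule summable_comparison_test')
    show "summable (\<lambda>n. (norm (a n))\<^sup>2 + (norm (b n))\<^sup>2)" by (rule summable_add[OF ab])
    show "norm (norm (a n) * norm (b n)) \<le> (norm (a n))\<^sup>2 + (norm (b n))\<^sup>2" for n
    proof -
      have "0 \<le> (norm (a n) - norm (b n))\<^sup>2" by simp
      then have "2 * (norm (a n) * norm (b n)) \<le> (norm (a n))\<^sup>2 + (norm (b n))\<^sup>2"
        by (simp add: power2_eq_square algebra_simps)
      moreover have "0 \<le> norm (a n) * norm (b n)" by simp
      ultimately show ?thesis unfolding real_norm_def by linarith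
    qed
  qed
  let ?V = "\<lambda>y. V (\<tau> id y f)"
  have cb: "cmod (cinner (a n) (?V y \<cdot> b n)) \<le> norm (a n) * norm (b n)" for n y
    using cinner_cauchy_schwarz[of "a n" "?V y \<cdot> b n"] by (simp add: norm_unitary_app[OF V_unitary[OF \<tau>_id_test[OF f]]])
  define q where "q n y = of_real (g y) * cinner (a n) (?V y \<cdot> b n)" for n y
  have qc: "continuous_on UNIV (q n)" for n
    unfolding q_def by (intro continuous_intros g_cont continuous_on_cinner continuous_on_const V_\<tau>_continuous f)
  have qi: "integrable lborel (q n)" for n
    by (rule integrable_compact_support[OF qc g_supp]) (simp add: q_def eq_0_outside_supp)
  have qb: "cmod (q n y) \<le> g y * (norm (a n) * norm (b n))" for n y
    using cb[of n y] g_nonneg[of y] by (simp add: q_def norm_mult mult_left_mono)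
  have qI: "(LINT y|lborel. q n y) = cinner (a n) (W_avg \<cdot> b n)" for n
  proof (rule has_integral_unique[OF has_integral_integral_lborel[OF qi]])
    show "(q n has_integral cinner (a n) (W_avg \<cdot> b n)) UNIV"
      using has_integral_cinner[OF W_avg_integral, of "a n" "b n"] by (simp add: q_def[abs_def] scaleR_conv_of_real)
  qed
  have qs: "summable (\<lambda>n. norm (q n y))" for y
    by (rule summable_comparison_test'[OF summable_mult[OF sab, of "g y"]]) (use qb in simp)
  have qn: "summable (\<lambda>n. LINT y|lborel. norm (q n y))"
  proof (rule summable_comparison_test'[OF summable_mult[OF sab, of "LINT y|lborel. g y"]])
    fix n
    have "(LINT y|lborel. norm (q n y)) \<le> (LINT y|lborel. g y * (norm (a n) * norm (b n)))"
      by (rule integral_mono[OF integrable_norm[OF qi] integrable_mult_left[OF g_integrable] qb])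
    then show "norm (LINT y|lborel. norm (q n y)) \<le> (LINT y|lborel. g y) * (norm (a n) * norm (b n))" by simp
  qed
  have sum: "(\<Sum>n. q n y) = of_real (g y) * cinner u (V (dilate l (\<tau> id y f)) \<cdot> v)" for y
  proof (cases "g y = 0")
    case False
    have "summable (\<lambda>n. cinner (a n) (?V y \<cdot> b n))"
      by (rule summable_norm_cancel, rule summable_comparison_test'[OF sab]) (use cb in simp)
    then have "(\<Sum>n. q n y) = of_real (g y) * \<psi> (?V y)" unfolding q_def \<psi>ab by (rule suminf_mult)
    also have "\<psi> (?V y) = cinner u (\<phi> l (?V y) \<cdot> v)" using \<psi>(2) le Vm[OF False] by blast
    finally show ?thesis by (simp add: \<phi>_W[OF l \<tau>_id_test[OF f]])
  qed (simp add: q_def)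
  show "integrable lborel (\<lambda>y. of_real (g y) * cinner u (V (dilate l (\<tau> id y f)) \<cdot> v))"
    using integrable_suminf[OF qi _ qn] qs by (simp add: sum)
  have "(LINT y|lborel. (\<Sum>n. q n y)) = (\<Sum>n. LINT y|lborel. q n y)"
    by (rule integral_suminf[OF qi _ qn]) (use qs in simp)
  also have "\<dots> = \<psi> W_avg" by (simp add: qI \<psi>ab)
  also have "\<psi> W_avg = cinner u (\<phi> l W_avg \<cdot> v)" using \<psi>(2) le Wm by blast
  finally show "(LINT y|lborel. of_real (g y) * cinner u (V (dilate l (\<tau> id y f)) \<cdot> v)) = cinner u (\<phi> l W_avg \<cdot> v)"
    by (simp add: sum)
qed

lemma norm_\<phi>_W_avg:
  assumes l: "l > 0" shows "norm (\<phi> l W_avg) \<le> (LINT y|lborel. g y)"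
proof (rule norm_op_bound)
  show G: "0 \<le> (LINT y|lborel. g y)" using g_nonneg by simp
  fix v
  let ?A = "\<phi> l W_avg"
  show "norm (?A \<cdot> v) \<le> (LINT y|lborel. g y) * norm v"
  proof (cases "?A \<cdot> v = 0")
    case False
    have "(norm (?A \<cdot> v))\<^sup>2 = cmod (cinner (?A \<cdot> v) (?A \<cdot> v))" unfolding cinner_self norm_of_real by simp
    also have "\<dots> = cmod (LINT y|lborel. of_real (g y) * cinner (?A \<cdot> v) (V (dilate l (\<tau> id y f)) \<cdot> v))"
      unfolding \<phi>_W_avg(2)[OF l] ..
    also have "\<dots> \<le> (LINT y|lborel. g y * (norm (?A \<cdot> v) * norm v))"
    proof (rule Bochner_Integration.integral_norm_bound_integral[OF \<phi>_W_avg(1)[OF l] integrable_mult_left[OF g_integrable]])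
      show "norm (of_real (g y) * cinner (?A \<cdot> v) (V (dilate l (\<tau> id y f)) \<cdot> v)) \<le> g y * (norm (?A \<cdot> v) * norm v)" for y
        using g_nonneg[of y] cinner_cauchy_schwarz[of "?A \<cdot> v" "V (dilate l (\<tau> id y f)) \<cdot> v"]
        by (simp add: norm_mult mult_left_mono norm_unitary_app[OF V_unitary[OF test_dilate[OF l \<tau>_id_test[OF f]]]])
    qed
    also have "\<dots> = ((LINT y|lborel. g y) * norm v) * norm (?A \<cdot> v)" by simp
    finally show ?thesis using False by (simp add: power2_eq_square)
  qed (use G in simp)
qed

lemma \<phi>_W_avg_time_zero:
  assumes l: "l > 0" and C: "\<And>y. g y \<noteq> 0 \<Longrightarrow> supp (\<tau> id y f) \<subseteq> {-C..C}"
  shows "\<phi> l W_avg \<in> time_zero_algebra (l * C)"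
  unfolding time_zero_algebra_def
proof (rule bicommutant_weakI[where g = g and A = "\<lambda>y. V (dilate l (\<tau> id y f))" and S = UNIV])
  show "((\<lambda>y. g y *\<^sub>R cinner u (V (dilate l (\<tau> id y f)) \<cdot> v)) has_integral cinner u (\<phi> l W_avg \<cdot> v)) UNIV" for u v
    using has_integral_integral_lborel[OF \<phi>_W_avg(1)[OF l, of u v]] by (simp add: \<phi>_W_avg(2)[OF l] scaleR_conv_of_real)
  show "V (dilate l (\<tau> id y f)) \<in> bicommutant {V f | f. f \<in> test_functions \<and> supp f \<subseteq> {- (l * C)..l * C}}"
    if "g y \<noteq> 0" for y
    unfolding time_zero_algebra_def[symmetric]
    by (intro V_time_zero test_dilate[OF l] \<tau>_id_test f supp_dilate[OF l] C that)
qed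

text \<open>The second part treats the adjoints, which are the Weyl operators of the negative test functions.\<close>

lemma orthogonality:
  assumes re: "(LINT x|lborel. Re (f x)) = 0" and im: "(LINT x|lborel. Im (f x)) \<noteq> 0"
  shows "AE y' in lborel. ((\<lambda>l. cinner (V (dilate l (\<tau> id y f)) \<cdot> \<Omega>) (V (dilate l (\<tau> id y' f)) \<cdot> \<Omega>)) \<longlongrightarrow> 0) (at_right 0)"
    "AE y' in lborel. ((\<lambda>l. cinner (star (V (dilate l (\<tau> id y f))) \<cdot> \<Omega>) (star (V (dilate l (\<tau> id y' f))) \<cdot> \<Omega>)) \<longlongrightarrow> 0) (at_right 0)"
proof -
  have nz: "fourier (re_part (\<tau> id y f - \<tau> id y' f)) 0 \<noteq> 0" if "sin (m * fst y') \<noteq> sin (m * fst y)" for y y'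
    unfolding zero_mode_\<tau>[OF f re] using that mass_pos im by simp
  show "AE y' in lborel. ((\<lambda>l. cinner (V (dilate l (\<tau> id y f)) \<cdot> \<Omega>) (V (dilate l (\<tau> id y' f)) \<cdot> \<Omega>)) \<longlongrightarrow> 0) (at_right 0)"
    using AE_sin_neq[OF mass_pos, of "fst y"]
  proof eventually_elim
    case (elim y')
    show ?case by (rule V_orthogonal_limit[OF \<tau>_id_test[OF f] \<tau>_id_test[OF f] nz]) (use elim in simp)
  qed
  show "AE y' in lborel. ((\<lambda>l. cinner (star (V (dilate l (\<tau> id y f))) \<cdot> \<Omega>) (star (V (dilate l (\<tau> id y' f))) \<cdot> \<Omega>)) \<longlongrightarrow> 0) (at_right 0)"
    using AE_sin_neq[OF mass_pos, of "fst y"]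
  proof eventually_elim
    case (elim y')
    have d: "dilate l (- k) = - dilate l k" for l and k :: "real \<Rightarrow> complex" by (auto simp: dilate_def)
    have t: "- \<tau> id z f \<in> test_functions" for z by (rule test_minus[OF \<tau>_id_test[OF f]])
    have "- \<tau> id y' f - - \<tau> id y f = \<tau> id y f - \<tau> id y' f" by simp
    then have nz': "fourier (re_part (- \<tau> id y' f - - \<tau> id y f)) 0 \<noteq> 0" using nz[OF elim] by simp
    have "\<forall>\<^sub>F l in at_right 0. cinner (star (V (dilate l (\<tau> id y f))) \<cdot> \<Omega>) (star (V (dilate l (\<tau> id y' f))) \<cdot> \<Omega>)
        = cinner (V (dilate l (- \<tau> id y f)) \<cdot> \<Omega>) (V (dilate l (- \<tau> id y' f)) \<cdot> \<Omega>)"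
      using eventually_at_right_less[of 0]
      by eventually_elim (simp add: star_V test_dilate \<tau>_id_test f d)
    from tendsto_cong[OF this] V_orthogonal_limit[OF t t nz'] show ?case by simp
  qed
qed

text \<open>The dilated averages and their adjoints asymptotically annihilate the vacuum.\<close>

theorem \<phi>_W_avg_vacuum_limit:
  assumes re: "(LINT x|lborel. Re (f x)) = 0" and im: "(LINT x|lborel. Im (f x)) \<noteq> 0"
  shows "((\<lambda>l. norm (\<phi> l W_avg \<cdot> \<Omega>)) \<longlongrightarrow> 0) (at_right 0)"
    "((\<lambda>l. norm (star (\<phi> l W_avg) \<cdot> \<Omega>)) \<longlongrightarrow> 0) (at_right 0)"
proof -
  have un: "unitary (V (dilate l (\<tau> id y f)))" if "l > 0" for l y
    by (intro V_unitary test_dilate \<tau>_id_test f that)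
  show "((\<lambda>l. norm (\<phi> l W_avg \<cdot> \<Omega>)) \<longlongrightarrow> 0) (at_right 0)"
    by (rule weak_average_tendsto_zero[OF g_integrable g_nonneg un \<phi>_W_avg(1) \<phi>_W_avg(2) orthogonality(1)[OF re im]])
  have flip: "of_real (g y) * cinner u (star B \<cdot> v) = cnj (of_real (g y) * cinner v (B \<cdot> u))" for y u v and B :: "'h bdd_op"
    using cinner_commute[of u "star B \<cdot> v"] by (simp add: star_adjoint)
  show "((\<lambda>l. norm (star (\<phi> l W_avg) \<cdot> \<Omega>)) \<longlongrightarrow> 0) (at_right 0)"
  proof (rule weak_average_tendsto_zero[OF g_integrable g_nonneg _ _ _ orthogonality(2)[OF re im]])
    show "unitary (star (V (dilate l (\<tau> id y f))))" if "l > 0" for l y by (rule unitary_star[OF un[OF that]])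
    show "integrable lborel (\<lambda>y. of_real (g y) * cinner u (star (V (dilate l (\<tau> id y f))) \<cdot> v))" if "l > 0" for l u v
      unfolding flip by (intro Bochner_Integration.integrable_cnj \<phi>_W_avg(1) that)
    show "(LINT y|lborel. of_real (g y) * cinner u (star (V (dilate l (\<tau> id y f))) \<cdot> v)) = cinner u (star (\<phi> l W_avg) \<cdot> v)"
      if "l > 0" for l u v
      unfolding flip Bochner_Integration.integral_cnj \<phi>_W_avg(2)[OF that]
      using cinner_commute[of u "star (\<phi> l W_avg) \<cdot> v"] by (simp add: star_adjoint)
  qed
qed

end

section \<open>The averaged Weyl operator in the scaling limit\<close>

context massive_scaling_limit
begin

lemma zero_scaling_local: "0 \<in> scaling_local_algebra R"
proof -
  have z: "0 \<in> local_algebra R'" for R' unfolding local_algebra_def by (rule bicommutant_zero)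
  have "0 \<in> time_zero_algebra 0" unfolding time_zero_algebra_def by (rule bicommutant_zero)
  from \<alpha>_time_zero[OF this] have \<alpha>0: "\<alpha> id x 0 = 0" for x by simp
  have "range (0 :: real \<Rightarrow> 'h bdd_op) = {0}" by (auto simp: zero_fun_def)
  then show ?thesis
    using z \<alpha>0 by (auto simp: scaling_local_algebra_def bounded_local_families_def on_scales_def zero_fun_def)
qed

text \<open>Bounded local families that, together with their adjoints, asymptotically annihilate the vacuum belong to
  the enlarged scaling algebra, with zero as approximant.\<close>

lemma bullet_localI:
  assumes fam: "A \<in> bounded_local_families R"
    and lim: "((\<lambda>l. norm (A l \<cdot> \<Omega>)) \<longlongrightarrow> 0) (at_right 0)" "((\<lambda>l. norm (star (A l) \<cdot> \<Omega>)) \<longlongrightarrow> 0) (at_right 0)"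
  shows "A \<in> bullet_local_algebra R"
  unfolding bullet_local_algebra_def
proof (intro CollectI conjI ballI impI allI fam bexI[OF _ zero_scaling_local])
  fix \<epsilon> :: real assume \<epsilon>: "\<epsilon> > 0"
  have "((\<lambda>\<kappa>. norm (A (s \<kappa>) \<cdot> \<Omega>) + norm (star (A (s \<kappa>)) \<cdot> \<Omega>)) \<longlongrightarrow> 0 + 0) F"
    by (intro tendsto_add filterlim_compose[OF lim(1) s_to_0] filterlim_compose[OF lim(2) s_to_0])
  then have "((\<lambda>\<kappa>. ereal (norm ((A (s \<kappa>) - 0 (s \<kappa>)) \<cdot> \<Omega>) + norm ((star (A (s \<kappa>)) - 0 (s \<kappa>)) \<cdot> \<Omega>))) \<longlongrightarrow> ereal 0) F"
    by (simp add: zero_fun_def)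
  from lim_imp_Limsup[OF F_nontrivial this]
  show "Limsup F (\<lambda>\<kappa>. ereal (norm ((A (s \<kappa>) - 0 (s \<kappa>)) \<cdot> \<Omega>) + norm ((star (A (s \<kappa>)) - 0 (s \<kappa>)) \<cdot> \<Omega>))) < ereal \<epsilon>"
    using \<epsilon> by simp
qed

end

theorem proposition4p2:
  fixes m :: real
    and \<tau> :: "(spacetime \<Rightarrow> spacetime) \<Rightarrow> spacetime \<Rightarrow> (real \<Rightarrow> complex) \<Rightarrow> real \<Rightarrow> complex"
    and W :: "(real \<Rightarrow> complex) \<Rightarrow> 'w::cstar_algebra"
    and \<alpha>\<^sub>W :: "(spacetime \<Rightarrow> spacetime) \<Rightarrow> spacetime \<Rightarrow> 'w \<Rightarrow> 'w"
    and \<omega> :: "'w \<Rightarrow> complex"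
    and \<pi> :: "'w \<Rightarrow> 'h::complex_hilbert bdd_op"
    and \<Omega> :: 'h
    and \<alpha> :: "(spacetime \<Rightarrow> spacetime) \<Rightarrow> spacetime \<Rightarrow> 'h bdd_op \<Rightarrow> 'h bdd_op"
    and \<phi> :: "real \<Rightarrow> 'h bdd_op \<Rightarrow> 'h bdd_op"
    and F :: "'i filter"
    and s :: "'i \<Rightarrow> real"
    and \<omega>\<^sub>0 :: "(real \<Rightarrow> 'h bdd_op) \<Rightarrow> complex"
    and \<pi>\<^sub>0 :: "(real \<Rightarrow> 'h bdd_op) \<Rightarrow> 'k::complex_hilbert bdd_op"
    and \<Omega>\<^sub>0 :: 'k
    and \<pi>\<^sub>b :: "(real \<Rightarrow> 'h bdd_op) \<Rightarrow> 'k bdd_op"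
    and f :: "real \<Rightarrow> complex"
    and g :: "spacetime \<Rightarrow> real"
    and Wg :: "'h bdd_op"
  assumes "m > 0"
    and "extended_scaling_limit m \<tau> W \<alpha>\<^sub>W \<omega> \<pi> \<Omega> \<alpha> \<phi> F s \<omega>\<^sub>0 \<pi>\<^sub>0 \<Omega>\<^sub>0 \<pi>\<^sub>b"
    and "f \<in> test_functions"
    and "(LINT x|lborel. Re (f x)) = 0"
    and "(LINT x|lborel. Im (f x)) \<noteq> 0"
    and "continuous_on UNIV g"
    and "compact (supp g)"
    and "\<And>y. g y \<ge> 0" and "\<exists>y. g y \<noteq> 0"
    and "Wg = strong_integral (\<lambda>y. g y *\<^sub>R \<alpha> id y (\<pi> (W f)))"
  shows "Wg \<noteq> 0 \<and> \<pi>\<^sub>b (on_scales (\<lambda>l. \<phi> l Wg)) = 0"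
proof -
  interpret extended_scaling_limit m \<tau> W \<alpha>\<^sub>W \<omega> \<pi> \<Omega> \<alpha> \<phi> F s \<omega>\<^sub>0 \<pi>\<^sub>0 \<Omega>\<^sub>0 \<pi>\<^sub>b
    by (rule assms(2))
  interpret massive_scaling_limit m \<tau> W \<alpha>\<^sub>W \<omega> \<pi> \<Omega> \<alpha> \<phi> F s \<omega>\<^sub>0 \<pi>\<^sub>0 \<Omega>\<^sub>0
    by unfold_locales (rule assms(1))
  interpret averaged_weyl_operator m \<tau> W \<alpha>\<^sub>W \<omega> \<pi> \<Omega> \<alpha> \<phi> f g
    by unfold_locales (use assms in auto)
  have Wg: "Wg = W_avg" by (simp add: assms(10) W_avg_def)
  define A where "A = on_scales (\<lambda>l. \<phi> l W_avg)"
  have A: "A l = \<phi> l W_avg" if "l > 0" for l using that by (simp add: A_def on_scales_def)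
  obtain C where C: "C > 0" "\<And>y. g y \<noteq> 0 \<Longrightarrow> supp (\<tau> id y f) \<subseteq> {-C..C}" using common_support by blast
  have "norm (A l) \<le> (LINT y|lborel. g y)" for l
    using norm_\<phi>_W_avg[of l] g_nonneg by (simp add: A_def on_scales_def)
  then have bounded: "bounded (range A)" by (auto simp: bounded_iff)
  have on: "A = on_scales A" by (auto simp: A_def on_scales_def)
  have tz: "A l \<in> time_zero_algebra (l * C)" if "l > 0" for l
    unfolding A[OF that] by (rule \<phi>_W_avg_time_zero[OF that C(2)])
  have ev: "\<forall>\<^sub>F l in at_right 0. A l = \<phi> l W_avg"
    using eventually_at_right_less[of 0] by eventually_elim (rule A)
  have lim: "((\<lambda>l. norm (A l \<cdot> \<Omega>)) \<longlongrightarrow> 0) (at_right 0)"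
    by (rule Lim_transform_eventually[OF \<phi>_W_avg_vacuum_limit(1)[OF assms(4,5)]])
      (use ev in eventually_elim, simp)
  have lim': "((\<lambda>l. norm (star (A l) \<cdot> \<Omega>)) \<longlongrightarrow> 0) (at_right 0)"
    by (rule Lim_transform_eventually[OF \<phi>_W_avg_vacuum_limit(2)[OF assms(4,5)]])
      (use ev in eventually_elim, simp)
  let ?R = "double_cone_over (- (C + 1)) (C + 1)"
  have "A \<in> bounded_local_families ?R"
    by (rule bounded_local_familyI[OF _ _ bounded on tz]) (use C(1) in auto)
  then have bullet: "A \<in> bullet_local_algebra ?R" by (rule bullet_localI[OF _ lim lim'])
  have R: "?R \<in> double_cones" using C(1) by (intro double_cone_over_mem) simp
  \<comment> \<open>The smeared family lies in the scaling algebra and still annihilates the vacuum asymptotically.\<close>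
  have smear0: "\<pi>\<^sub>0 (smear h A) = 0" if h: "h \<in> mollifiers 1" for h
  proof (rule limit_operator_zero[OF smear_scaling_function(1)[OF bounded on tz h]])
    show "((\<lambda>l. norm (smear h A l \<cdot> \<Omega>)) \<longlongrightarrow> 0) (at_right 0)"
    proof (rule Lim_null_comparison[OF _ lim])
      show "\<forall>\<^sub>F l in at_right 0. norm (norm (smear h A l \<cdot> \<Omega>)) \<le> norm (A l \<cdot> \<Omega>)"
        using eventually_at_right_less[of 0]
        by eventually_elim (use smear_scaling_function(2)[OF bounded on tz h] in simp)
    qed
  qed (use C(1) in auto)
  have "\<pi>\<^sub>b A \<cdot> v = 0" for v
  proof -
    have "\<forall>\<^sub>F h in to_delta. \<pi>\<^sub>0 (smear h A) \<cdot> v = 0"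
      unfolding eventually_to_delta by (rule exI[of _ 1]) (simp add: smear0 op_app_simps)
    then have "((\<lambda>h. \<pi>\<^sub>0 (smear h A) \<cdot> v) \<longlongrightarrow> 0) to_delta" by (rule tendsto_eventually)
    from tendsto_unique[OF to_delta_nontrivial \<pi>\<^sub>b_local[OF R bullet] this] show ?thesis .
  qed
  then have "\<pi>\<^sub>b A = 0" by (intro op_eqI) (simp add: op_app_simps)
  moreover have "W_avg \<noteq> 0" using assms(9) W_avg_nonzero by blast
  ultimately show ?thesis by (simp add: Wg A_def)
qed

end
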